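(* Let $\rho:L^\infty_{\mathcal F}(\mathcal E)\to L^0(\mathcal F)$ be a convex risk measure such that $\rho_0:=\rho|_{L^\infty(\mathcal E)}$ has the Fatou property, and put $$\rho_0^*(y):=\operatorname{ess\,sup}\{\mathbb E_{\mathbb P}[xy|\mathcal F]-\rho_0(x): x\in L^\infty(\mathcal E)\}\quad\text{for } y\in L^1(\mathcal E).$$ The following statements are equivalent: (1) the conditional set $\mathbf V_{\boldsymbol\rho^*}(\mathbf c):=[\mathbf y\in\mathbf L^1:\boldsymbol\rho^*(\mathbf y)\le\mathbf c]$ is conditionally $\sigma(\mathbf L^1,\mathbf L^\infty)$-compact for all $\mathbf c\in\mathbf R$; (2) $\rho_0$ has the Lebesgue property; (3) $\boldsymbol\rho$ has the conditional Lebesgue property; (4) for every $x\in L^\infty(\mathcal E)$ there is $y\in L^1(\mathcal E)$ with $y\le 0$ and $\mathbb E_{\mathbb P}[y|\mathcal F]=-1$ such that $\rho(x)=\mathbb E_{\mathbb P}[xy|\mathcal F]-\rho_0^*(y)$; (5) for every $x\in L^\infty_{\mathcal F}(\mathcal E)$ there is $y\in L^1_{\mathcal F}(\mathcal E)$ with $y\le 0$ and $\mathbb E_{\mathbb P}[y|\mathcal F]=-1$ such that $\rho(x)=\mathbb E_{\mathbb P}[xy|\mathcal F]-\rho^*(y)$.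
   Context: Basic setting. $(\Omega,\mathcal E,\mathbb P)$ is a probability space, $\mathcal F\subset\mathcal E$ a sub-$\sigma$-algebra. $L^0(\mathcal F)$ is the ring of classes of real $\mathcal F$-measurable random variables with the a.s. order; $\bar L^0(\mathcal F)$ the analogue with values in $[-\infty,\infty]$. $L^p_{\mathcal F}(\mathcal E):=L^0(\mathcal F)L^p(\mathcal E)=\{\xi z:\xi\in L^0(\mathcal F),z\in L^p(\mathcal E)\}$ for $p\in[1,\infty]$, with $\mathbb E_{\mathbb P}[\xi z|\mathcal F]=\xi\,\mathbb E_{\mathbb P}[z|\mathcal F]$ and $\|x|\mathcal F\|_\infty=\operatorname{ess\,inf}\{y\in\bar L^0(\mathcal F):y\ge|x|\}$. Risk measures. $\rho:L^\infty_{\mathcal F}(\mathcal E)\to L^0(\mathcal F)$ is a convex risk measure if it is monotone ($x\le y\Rightarrow\rho(x)\ge\rho(y)$), $L^0(\mathcal F)$-cash invariant ($\rho(x+\eta)=\rho(x)-\eta$ for $\eta\in L^0(\mathcal F)$), and convex ($\rho(rx+(1-r)y)\le r\rho(x)+(1-r)\rho(y)$ for real $r\in[0,1]$). $\rho^*(y)=\operatorname{ess\,sup}\{\mathbb E_{\mathbb P}[xy|\mathcal F]-\rho(x):x\in L^\infty_{\mathcal F}(\mathcal E)\}\in\bar L^0(\mathcal F)$, $y\in L^1_{\mathcal F}(\mathcal E)$. $\rho_0$ has the Fatou (resp. Lebesgue) property if for every norm-bounded sequence $\{x_n\}\subset L^\infty(\mathcal E)$ with $x_n\to x$ a.s. one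 has $\rho(x)\le\operatorname{ess\,lim\,inf}_n\rho(x_n)$ (resp. $\rho(x)=\lim_n\rho(x_n)$ a.s.). Conditional sets. $\mathcal A$ is the measure algebra of $(\Omega,\mathcal F,\mathbb P)$ ($\mathcal F$ modulo null sets; bottom $0$, top $1$); $p(a)$ is the set of countable families $\{a_k\}\subset\mathcal A$, pairwise disjoint, with $\bigvee a_k=a$. A conditional set $\mathbf X$ of a non-empty set $X$ is a collection of objects $x|a$ ($x\in X,a\in\mathcal A$) with: $x|a=y|b\Rightarrow a=b$; if $a\le b$ and $x|b=y|b$ then $x|a=y|a$; for $\{a_k\}\in p(1)$ and $\{x_k\}\subset X$ there is exactly one $x=\sum x_k|a_k\in X$ with $x|a_k=x_k|a_k$ for all $k$. Conditional elements are $\mathbf x=x|1$. A non-empty $Y\subset X$ is stable if it contains all concatenations of its elements; the conditional subsets of $\mathbf X$ are the sets $\mathbf Y|a=\{x|b:x\in Y,b\le a\}$ ($Y$ stable, $a\in\mathcal A$), said to be on $a$; under inclusion $\sqsubset$ they form a complete Boolean algebra with join $\sqcup$. $[\cdots]$ denotes the conditional subset generated by the stable hull of the indicated collection. A stable function ($f(\sum x_k|a_k)=\sum f(x_k)|a_k$) generates a conditional function $\mathbf f$, $x|a\mapsto f(x)|a$. $\mathbf L^p$, $\mathbf R$, $\overline{\mathbf R}$ are the conditional sets of $L^p_{\mathcal F}(\mathcal E)$, $L^0(\mathcal F)$, $\bar L^0(\mathcal F)$ with $x|a=y|b$ iff $a=b$ and $1_ax=1_by$ ($0\cdot\infty=0$),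 with a.s. order; $\mathbf R^{++}=[\mathbf r:\mathbf r>\mathbf 0]$; $\mathbf N$ is generated by $L^0(\mathcal F;\mathbb N)$ (the $\mathbb N$-valued elements). The functions $\rho$ and $\rho^*$ are stable and generate $\boldsymbol\rho:\mathbf L^\infty\to\mathbf R$, $\boldsymbol\rho^*:\mathbf L^1\to\overline{\mathbf R}$. $\mathbf V_{\boldsymbol\rho^*}(\mathbf c)$ consists of all $y|b$ with $\rho^*(y)\le c$ a.s. on $b$ (a conditional subset on some $a\in\mathcal A$). A conditional subset is conditionally finite if it is the image of $[\mathbf k:\mathbf 1\le\mathbf k\le\mathbf n]$ for some $\mathbf n\in\mathbf N$ under a conditional function generated by an injective stable function. Conditional Lebesgue property. A conditional sequence $\{\mathbf x_{\mathbf n}\}$ is a conditional function on $\mathbf N$. In $\mathbf L^\infty$ (ordered a.s.), $\liminf_{\mathbf n}\mathbf x_{\mathbf n}=\sup_{\mathbf m}\inf_{\mathbf n\ge\mathbf m}\mathbf x_{\mathbf n}$ and $\limsup_{\mathbf n}\mathbf x_{\mathbf n}=\inf_{\mathbf m}\sup_{\mathbf n\ge\mathbf m}\mathbf x_{\mathbf n}$ (conditional suprema and infima are generated by essential ones); $\{\mathbf x_{\mathbf n}\}$ conditionally converges a.s. to $\mathbf x$ if both equal $\mathbf x$ (for conditionally bounded sequences: iff $\{x_n\}_{n\in\mathbb N}$ converges a.s. to $x$). It is conditionally bounded if for some $\mathbf r\in\mathbf R^{++}$, $\|x_n|\mathcal F\|_\infty\le r$ for all $n$. In $\mathbf R$,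 $\lim_{\mathbf n}\mathbf r_{\mathbf n}=\mathbf r$ means that for every $\boldsymbol\varepsilon\in\mathbf R^{++}$ there is $\mathbf m\in\mathbf N$ with $|\mathbf r_{\mathbf n}-\mathbf r|\le\boldsymbol\varepsilon$ for $\mathbf n\ge\mathbf m$. $\boldsymbol\rho$ has the conditional Lebesgue property if $\lim_{\mathbf n}\boldsymbol\rho(\mathbf x_{\mathbf n})=\boldsymbol\rho(\mathbf x)$ for every conditionally bounded $\{\mathbf x_{\mathbf n}\}$ in $\mathbf L^\infty$ conditionally converging a.s. to $\mathbf x$. Conditional weak compactness. In $\sigma(\mathbf L^1,\mathbf L^\infty)$ a conditional subset $\mathbf O$ of $\mathbf L^1$ is open iff for every $y|b\in\mathbf O$ there are $\mathbf r\in\mathbf R^{++}$ and a conditionally finite $\mathbf G\sqsubset\mathbf L^\infty$ on $1$ with $[\mathbf z\in\mathbf L^1:|\mathbb E_{\mathbb P}[\mathbf x(\mathbf z-\mathbf y)|\mathcal F]|\le\mathbf r\ \forall\mathbf x\in\mathbf G]|b\sqsubset\mathbf O$. A conditional subset $\mathbf K$ on $a$ is conditionally compact if for every family $\mathcal U$ of open conditional subsets closed under concatenations $\sqcup_k\mathbf O_k|a_k$ ($\{a_k\}\in p(1)$) with $\mathbf K\sqsubset\bigsqcup\mathcal U$ there are $\{a_k\}\in p(a)$ and finite $\mathcal U_k\subset\mathcal U$ with $\mathbf K|a_k\sqsubset\bigsqcup\mathcal U_k$ for all $k$ (every conditional open covering has a conditionally finite subcovering). *)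

theory Defs
  imports "HOL-Probability.Probability"
begin

(* Conventions.  M is the probability space (Omega, E, P) and F a sub-sigma-algebra, given as a
   measure with "subalgebra M F" (only its measurable sets matter).  Elements of spaces of
   random variables are handled through representatives: functions on Omega, where equality and
   order of classes become almost sure equality and order.  Likewise an element of the measure
   algebra of F is represented by a set in "sets F", up to P-null sets.  Maps between such spaces
   act on representatives. *)

section \<open>Modules of random variables\<close>

abbreviation L0 :: "'w measure \<Rightarrow> ('w \<Rightarrow> real) set" where
  "L0 F \<equiv> borel_measurable F"

abbreviation L0bar :: "'w measure \<Rightarrow> ('w \<Rightarrow> ereal) set" where
  "L0bar F \<equiv> borel_measurable F"

definition L0pos :: "'w measure \<Rightarrow> 'w measure \<Rightarrow> ('w \<Rightarrow> real) set" where
  "L0pos M F = {r \<in> L0 F. AE w in M. r w > 0}"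

(* The natural numbers indexing conditional sequences start at 1. *)
definition L0N :: "'w measure \<Rightarrow> ('w \<Rightarrow> nat) set" where
  "L0N F = measurable F (count_space {1..})"

definition L1 :: "'w measure \<Rightarrow> ('w \<Rightarrow> real) set" where
  "L1 M = {z. integrable M z}"

definition Linf :: "'w measure \<Rightarrow> ('w \<Rightarrow> real) set" where
  "Linf M = {z \<in> borel_measurable M. \<exists>C. AE w in M. \<bar>z w\<bar> \<le> C}"

definition L0_span :: "'w measure \<Rightarrow> 'w measure \<Rightarrow> ('w \<Rightarrow> real) set \<Rightarrow> ('w \<Rightarrow> real) set" where
  "L0_span M F Z = {x \<in> borel_measurable M. \<exists>\<xi>\<in>L0 F. \<exists>z\<in>Z. AE w in M. x w = \<xi> w * z w}"

abbreviation L1_cond :: "'w measure \<Rightarrow> 'w measure \<Rightarrow> ('w \<Rightarrow> real) set" where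
  "L1_cond M F \<equiv> L0_span M F (L1 M)"

abbreviation Linf_cond :: "'w measure \<Rightarrow> 'w measure \<Rightarrow> ('w \<Rightarrow> real) set" where
  "Linf_cond M F \<equiv> L0_span M F (Linf M)"

(* E[xi z | F] = xi E[z | F] for xi in L0(F) and integrable z; well defined up to null sets. *)
definition cexp :: "'w measure \<Rightarrow> 'w measure \<Rightarrow> ('w \<Rightarrow> real) \<Rightarrow> 'w \<Rightarrow> real" where
  "cexp M F x = (SOME h. \<exists>\<xi>\<in>L0 F. \<exists>z\<in>L1 M.
     (AE w in M. x w = \<xi> w * z w) \<and> h = (\<lambda>w. \<xi> w * real_cond_exp M F z w))"

section \<open>Essential suprema and infima\<close>

(* Least upper bound (greatest lower bound) of S within the space X for the a.s. order. *)
definition is_esssup ::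
  "'w measure \<Rightarrow> ('w \<Rightarrow> 'b::order) set \<Rightarrow> ('w \<Rightarrow> 'b) set \<Rightarrow> ('w \<Rightarrow> 'b) \<Rightarrow> bool" where
  "is_esssup M X S h \<longleftrightarrow> h \<in> X \<and> (\<forall>s\<in>S. AE w in M. s w \<le> h w) \<and>
     (\<forall>g\<in>X. (\<forall>s\<in>S. AE w in M. s w \<le> g w) \<longrightarrow> (AE w in M. h w \<le> g w))"

definition is_essinf ::
  "'w measure \<Rightarrow> ('w \<Rightarrow> 'b::order) set \<Rightarrow> ('w \<Rightarrow> 'b) set \<Rightarrow> ('w \<Rightarrow> 'b) \<Rightarrow> bool" where
  "is_essinf M X S h \<longleftrightarrow> h \<in> X \<and> (\<forall>s\<in>S. AE w in M. h w \<le> s w) \<and>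
     (\<forall>g\<in>X. (\<forall>s\<in>S. AE w in M. g w \<le> s w) \<longrightarrow> (AE w in M. g w \<le> h w))"

definition ess_sup :: "'w measure \<Rightarrow> 'w measure \<Rightarrow> ('w \<Rightarrow> ereal) set \<Rightarrow> 'w \<Rightarrow> ereal" where
  "ess_sup M F S = (SOME h. is_esssup M (L0bar F) S h)"

definition ess_inf :: "'w measure \<Rightarrow> 'w measure \<Rightarrow> ('w \<Rightarrow> ereal) set \<Rightarrow> 'w \<Rightarrow> ereal" where
  "ess_inf M F S = (SOME h. is_essinf M (L0bar F) S h)"

definition cnorm_inf :: "'w measure \<Rightarrow> 'w measure \<Rightarrow> ('w \<Rightarrow> real) \<Rightarrow> 'w \<Rightarrow> ereal" where
  "cnorm_inf M F x = ess_inf M F {y \<in> L0bar F. AE w in M. ereal \<bar>x w\<bar> \<le> y w}"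

section \<open>Risk measures\<close>

definition convex_risk_measure ::
  "'w measure \<Rightarrow> 'w measure \<Rightarrow> (('w \<Rightarrow> real) \<Rightarrow> 'w \<Rightarrow> real) \<Rightarrow> bool" where
  "convex_risk_measure M F \<rho> \<longleftrightarrow>
     (\<forall>x\<in>Linf_cond M F. \<rho> x \<in> L0 F) \<and>
     (\<forall>x\<in>Linf_cond M F. \<forall>y\<in>Linf_cond M F.
        (AE w in M. x w \<le> y w) \<longrightarrow> (AE w in M. \<rho> x w \<ge> \<rho> y w)) \<and>
     (\<forall>x\<in>Linf_cond M F. \<forall>\<eta>\<in>L0 F. AE w in M. \<rho> (\<lambda>w. x w + \<eta> w) w = \<rho> x w - \<eta> w) \<and>
     (\<forall>x\<in>Linf_cond M F. \<forall>y\<in>Linf_cond M F. \<forall>r. 0 \<le> r \<and> r \<le> 1 \<longrightarrow>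
        (AE w in M. \<rho> (\<lambda>w. r * x w + (1 - r) * y w) w \<le> r * \<rho> x w + (1 - r) * \<rho> y w))"

(* X is the space over which the supremum is taken: X = Linf_cond M F yields the conjugate of
   rho, and X = Linf M the conjugate of the restriction of rho to Linf M. *)
definition conj_fun :: "'w measure \<Rightarrow> 'w measure \<Rightarrow> ('w \<Rightarrow> real) set \<Rightarrow>
    (('w \<Rightarrow> real) \<Rightarrow> 'w \<Rightarrow> real) \<Rightarrow> ('w \<Rightarrow> real) \<Rightarrow> 'w \<Rightarrow> ereal" where
  "conj_fun M F X \<rho> y =
     ess_sup M F ((\<lambda>x w. ereal (cexp M F (\<lambda>v. x v * y v) w - \<rho> x w)) ` X)"

definition bounded_as_conv ::
  "'w measure \<Rightarrow> (nat \<Rightarrow> 'w \<Rightarrow> real) \<Rightarrow> ('w \<Rightarrow> real) \<Rightarrow> bool" where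
  "bounded_as_conv M x x0 \<longleftrightarrow> (\<forall>n. x n \<in> Linf M) \<and> x0 \<in> Linf M \<and>
     (\<exists>C. \<forall>n. AE w in M. \<bar>x n w\<bar> \<le> C) \<and> (AE w in M. (\<lambda>n. x n w) \<longlonglongrightarrow> x0 w)"

(* These two only involve the values of rho on Linf M. *)
definition fatou_property :: "'w measure \<Rightarrow> (('w \<Rightarrow> real) \<Rightarrow> 'w \<Rightarrow> real) \<Rightarrow> bool" where
  "fatou_property M \<rho> \<longleftrightarrow> (\<forall>x x0. bounded_as_conv M x x0 \<longrightarrow>
     (AE w in M. ereal (\<rho> x0 w) \<le> liminf (\<lambda>n. ereal (\<rho> (x n) w))))"

definition lebesgue_property :: "'w measure \<Rightarrow> (('w \<Rightarrow> real) \<Rightarrow> 'w \<Rightarrow> real) \<Rightarrow> bool" where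
  "lebesgue_property M \<rho> \<longleftrightarrow> (\<forall>x x0. bounded_as_conv M x x0 \<longrightarrow>
     (AE w in M. (\<lambda>n. \<rho> (x n) w) \<longlonglongrightarrow> \<rho> x0 w))"

section \<open>Conditional sets\<close>

definition le_alg :: "'w measure \<Rightarrow> 'w set \<Rightarrow> 'w set \<Rightarrow> bool" where
  "le_alg M a b \<longleftrightarrow> (AE w in M. w \<in> a \<longrightarrow> w \<in> b)"

(* The set p(a).  Members of a family may be null, so finite families are included. *)
definition partitions :: "'w measure \<Rightarrow> 'w measure \<Rightarrow> 'w set \<Rightarrow> (nat \<Rightarrow> 'w set) set" where
  "partitions M F a = {A. (\<forall>k. A k \<in> sets F) \<and>
     (\<forall>i j. i \<noteq> j \<longrightarrow> (AE w in M. w \<notin> A i \<inter> A j)) \<and>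
     (AE w in M. w \<in> a \<longleftrightarrow> w \<in> (\<Union>k. A k))}"

(* The object x|a, as the class of the pair (x, a): see cobj_eq_iff below. *)
definition cobj :: "'w measure \<Rightarrow> ('w \<Rightarrow> 'b) \<Rightarrow> 'w set \<Rightarrow> (('w \<Rightarrow> 'b) \<times> 'w set) set" where
  "cobj M x a = {(y, b). AE w in M. (w \<in> a \<longleftrightarrow> w \<in> b) \<and> (w \<in> a \<longrightarrow> x w = y w)}"

lemma cobj_eq_iff:
  "cobj M x a = cobj M y b \<longleftrightarrow>
     (AE w in M. w \<in> a \<longleftrightarrow> w \<in> b) \<and> (AE w in M. w \<in> a \<longrightarrow> x w = y w)"
proof
  assume "cobj M x a = cobj M y b"
  moreover have "(y, b) \<in> cobj M y b" by (simp add: cobj_def)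
  ultimately have "(y, b) \<in> cobj M x a" by simp
  then show "(AE w in M. w \<in> a \<longleftrightarrow> w \<in> b) \<and> (AE w in M. w \<in> a \<longrightarrow> x w = y w)"
    by (simp add: cobj_def)
next
  assume "(AE w in M. w \<in> a \<longleftrightarrow> w \<in> b) \<and> (AE w in M. w \<in> a \<longrightarrow> x w = y w)"
  then have h: "AE w in M. (w \<in> a \<longleftrightarrow> w \<in> b) \<and> (w \<in> a \<longrightarrow> x w = y w)" by simp
  have "(AE w in M. (w \<in> a \<longleftrightarrow> w \<in> c) \<and> (w \<in> a \<longrightarrow> x w = z w)) \<longleftrightarrow>
        (AE w in M. (w \<in> b \<longleftrightarrow> w \<in> c) \<and> (w \<in> b \<longrightarrow> y w = z w))" for z c
    by (rule eventually_cong[OF h]) auto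
  then show "cobj M x a = cobj M y b" unfolding cobj_def by auto
qed

(* z is the concatenation of the x k along the partition A. *)
definition is_concat :: "'w measure \<Rightarrow> (nat \<Rightarrow> 'w set) \<Rightarrow> (nat \<Rightarrow> 'w \<Rightarrow> 'b) \<Rightarrow> ('w \<Rightarrow> 'b) \<Rightarrow> bool"
  where "is_concat M A x z \<longleftrightarrow> (\<forall>k. cobj M z (A k) = cobj M (x k) (A k))"

definition stable_hull ::
  "'w measure \<Rightarrow> 'w measure \<Rightarrow> ('w \<Rightarrow> 'b) set \<Rightarrow> ('w \<Rightarrow> 'b) set \<Rightarrow> ('w \<Rightarrow> 'b) set" where
  "stable_hull M F X Y = {z \<in> X. \<exists>A\<in>partitions M F (space M). \<exists>y. (\<forall>k. y k \<in> Y) \<and> is_concat M A y z}"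

definition stable ::
  "'w measure \<Rightarrow> 'w measure \<Rightarrow> ('w \<Rightarrow> 'b) set \<Rightarrow> ('w \<Rightarrow> 'b) set \<Rightarrow> bool" where
  "stable M F X Y \<longleftrightarrow> Y \<noteq> {} \<and> Y \<subseteq> X \<and> stable_hull M F X Y \<subseteq> Y"

(* The set of objects Y|a. *)
definition csub ::
  "'w measure \<Rightarrow> 'w measure \<Rightarrow> ('w \<Rightarrow> 'b) set \<Rightarrow> 'w set \<Rightarrow> (('w \<Rightarrow> 'b) \<times> 'w set) set set" where
  "csub M F Y a = {cobj M x b | x b. x \<in> Y \<and> b \<in> sets F \<and> le_alg M b a}"

(* In the following, X is the space generating the ambient conditional set. *)
definition csubset_on :: "'w measure \<Rightarrow> 'w measure \<Rightarrow> ('w \<Rightarrow> 'b) set \<Rightarrow> 'w set \<Rightarrow>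
    (('w \<Rightarrow> 'b) \<times> 'w set) set set \<Rightarrow> bool" where
  "csubset_on M F X a S \<longleftrightarrow> a \<in> sets F \<and> (\<exists>Y. stable M F X Y \<and> S = csub M F Y a)"

definition csubset :: "'w measure \<Rightarrow> 'w measure \<Rightarrow> ('w \<Rightarrow> 'b) set \<Rightarrow>
    (('w \<Rightarrow> 'b) \<times> 'w set) set set \<Rightarrow> bool" where
  "csubset M F X S \<longleftrightarrow> (\<exists>a. csubset_on M F X a S)"

(* The join of a family in the Boolean algebra of conditional subsets, i.e. the least conditional
   subset containing all members (conditional subsets are closed under intersections). *)
definition cjoin :: "'w measure \<Rightarrow> 'w measure \<Rightarrow> ('w \<Rightarrow> 'b) set \<Rightarrow>
    (('w \<Rightarrow> 'b) \<times> 'w set) set set set \<Rightarrow> (('w \<Rightarrow> 'b) \<times> 'w set) set set" where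
  "cjoin M F X \<U> = \<Inter>{S. csubset M F X S \<and> (\<forall>T\<in>\<U>. T \<subseteq> S)}"

(* S|a for a conditional subset S. *)
definition crestrict :: "'w measure \<Rightarrow> 'w measure \<Rightarrow> (('w \<Rightarrow> 'b) \<times> 'w set) set set \<Rightarrow>
    'w set \<Rightarrow> (('w \<Rightarrow> 'b) \<times> 'w set) set set" where
  "crestrict M F S a = {s \<in> S. \<exists>x b. s = cobj M x b \<and> b \<in> sets F \<and> le_alg M b a}"

definition stable_fun :: "'w measure \<Rightarrow> 'w measure \<Rightarrow> ('w \<Rightarrow> 'b) set \<Rightarrow> ('w \<Rightarrow> 'c) set \<Rightarrow>
    (('w \<Rightarrow> 'b) \<Rightarrow> ('w \<Rightarrow> 'c)) \<Rightarrow> bool" where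
  "stable_fun M F X Z f \<longleftrightarrow> (\<forall>x\<in>X. f x \<in> Z) \<and>
     (\<forall>A\<in>partitions M F (space M). \<forall>x z. (\<forall>k. x k \<in> X) \<and> z \<in> X \<and> is_concat M A x z \<longrightarrow>
        is_concat M A (\<lambda>k. f (x k)) (f z))"

definition cfinite :: "'w measure \<Rightarrow> 'w measure \<Rightarrow> ('w \<Rightarrow> 'b) set \<Rightarrow>
    (('w \<Rightarrow> 'b) \<times> 'w set) set set \<Rightarrow> bool" where
  "cfinite M F X S \<longleftrightarrow> (\<exists>n\<in>L0N F. \<exists>f.
     let I = {k \<in> L0N F. AE w in M. 1 \<le> k w \<and> k w \<le> n w} in
       stable_fun M F I X f \<and>
       (\<forall>k\<in>I. \<forall>l\<in>I. (AE w in M. f k w = f l w) \<longrightarrow> (AE w in M. k w = l w)) \<and>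
       S = {cobj M (f k) b | k b. k \<in> I \<and> b \<in> sets F})"

section \<open>The conditional Lebesgue property\<close>

(* liminf and limsup are formed in the a.s. ordered space Linf_cond M F: u m is the infimum and
   v m the supremum of the x n with n \<ge> m. *)
definition cond_conv_as :: "'w measure \<Rightarrow> 'w measure \<Rightarrow> (('w \<Rightarrow> nat) \<Rightarrow> 'w \<Rightarrow> real) \<Rightarrow>
    ('w \<Rightarrow> real) \<Rightarrow> bool" where
  "cond_conv_as M F x x0 \<longleftrightarrow> (\<exists>u v.
     (\<forall>m\<in>L0N F. is_essinf M (Linf_cond M F) (x ` {n \<in> L0N F. AE w in M. m w \<le> n w}) (u m)) \<and>
     (\<forall>m\<in>L0N F. is_esssup M (Linf_cond M F) (x ` {n \<in> L0N F. AE w in M. m w \<le> n w}) (v m)) \<and>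
     is_esssup M (Linf_cond M F) (u ` L0N F) x0 \<and>
     is_essinf M (Linf_cond M F) (v ` L0N F) x0)"

definition cond_bounded :: "'w measure \<Rightarrow> 'w measure \<Rightarrow> (('w \<Rightarrow> nat) \<Rightarrow> 'w \<Rightarrow> real) \<Rightarrow> bool" where
  "cond_bounded M F x \<longleftrightarrow>
     (\<exists>r\<in>L0pos M F. \<forall>n\<in>L0N F. AE w in M. cnorm_inf M F (x n) w \<le> ereal (r w))"

definition cond_lim :: "'w measure \<Rightarrow> 'w measure \<Rightarrow> (('w \<Rightarrow> nat) \<Rightarrow> 'w \<Rightarrow> real) \<Rightarrow>
    ('w \<Rightarrow> real) \<Rightarrow> bool" where
  "cond_lim M F r r0 \<longleftrightarrow> (\<forall>\<epsilon>\<in>L0pos M F. \<exists>m\<in>L0N F. \<forall>n\<in>L0N F.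
     (AE w in M. m w \<le> n w) \<longrightarrow> (AE w in M. \<bar>r n w - r0 w\<bar> \<le> \<epsilon> w))"

definition cond_lebesgue_property ::
  "'w measure \<Rightarrow> 'w measure \<Rightarrow> (('w \<Rightarrow> real) \<Rightarrow> 'w \<Rightarrow> real) \<Rightarrow> bool" where
  "cond_lebesgue_property M F \<rho> \<longleftrightarrow> (\<forall>x. \<forall>x0\<in>Linf_cond M F.
     stable_fun M F (L0N F) (Linf_cond M F) x \<and> cond_bounded M F x \<and> cond_conv_as M F x x0 \<longrightarrow>
       cond_lim M F (\<lambda>n. \<rho> (x n)) (\<rho> x0))"

section \<open>Conditional weak compactness\<close>

definition weak_nbhd :: "'w measure \<Rightarrow> 'w measure \<Rightarrow> (('w \<Rightarrow> real) \<times> 'w set) set set \<Rightarrow>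
    ('w \<Rightarrow> real) \<Rightarrow> ('w \<Rightarrow> real) \<Rightarrow> (('w \<Rightarrow> real) \<times> 'w set) set set" where
  "weak_nbhd M F G r y = csub M F (stable_hull M F (L1_cond M F)
     {z \<in> L1_cond M F. \<forall>x\<in>Linf_cond M F. cobj M x (space M) \<in> G \<longrightarrow>
        (AE w in M. \<bar>cexp M F (\<lambda>v. x v * (z v - y v)) w\<bar> \<le> r w)}) (space M)"

definition weak_open ::
  "'w measure \<Rightarrow> 'w measure \<Rightarrow> (('w \<Rightarrow> real) \<times> 'w set) set set \<Rightarrow> bool" where
  "weak_open M F U \<longleftrightarrow> csubset M F (L1_cond M F) U \<and>
     (\<forall>y\<in>L1_cond M F. \<forall>b\<in>sets F. cobj M y b \<in> U \<longrightarrow>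
        (\<exists>r\<in>L0pos M F. \<exists>G. csubset_on M F (Linf_cond M F) (space M) G \<and>
           cfinite M F (Linf_cond M F) G \<and> crestrict M F (weak_nbhd M F G r y) b \<subseteq> U))"

definition concat_closed :: "'w measure \<Rightarrow> 'w measure \<Rightarrow> ('w \<Rightarrow> 'b) set \<Rightarrow>
    (('w \<Rightarrow> 'b) \<times> 'w set) set set set \<Rightarrow> bool" where
  "concat_closed M F X \<U> \<longleftrightarrow> (\<forall>A\<in>partitions M F (space M). \<forall>U. (\<forall>k. U k \<in> \<U>) \<longrightarrow>
     cjoin M F X (range (\<lambda>k. crestrict M F (U k) (A k))) \<in> \<U>)"

definition cond_weakly_compact ::
  "'w measure \<Rightarrow> 'w measure \<Rightarrow> (('w \<Rightarrow> real) \<times> 'w set) set set \<Rightarrow> bool" where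
  "cond_weakly_compact M F K \<longleftrightarrow> (\<exists>a. csubset_on M F (L1_cond M F) a K \<and>
     (\<forall>\<U>. (\<forall>U\<in>\<U>. weak_open M F U) \<and> concat_closed M F (L1_cond M F) \<U> \<and>
           K \<subseteq> cjoin M F (L1_cond M F) \<U> \<longrightarrow>
        (\<exists>A\<in>partitions M F a. \<exists>\<V>. \<forall>k. finite (\<V> k) \<and> \<V> k \<subseteq> \<U> \<and>
           crestrict M F K (A k) \<subseteq> cjoin M F (L1_cond M F) (\<V> k))))"

definition sublevel :: "'w measure \<Rightarrow> 'w measure \<Rightarrow> (('w \<Rightarrow> real) \<Rightarrow> 'w \<Rightarrow> real) \<Rightarrow>
    ('w \<Rightarrow> real) \<Rightarrow> (('w \<Rightarrow> real) \<times> 'w set) set set" where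
  "sublevel M F \<rho> c = {cobj M y b | y b. y \<in> L1_cond M F \<and> b \<in> sets F \<and>
     (AE w in M. w \<in> b \<longrightarrow> conj_fun M F (Linf_cond M F) \<rho> y w \<le> ereal (c w))}"

end

theory Submission
  imports Defs
begin

text \<open>
Every statement is compared with the Lebesgue property. The bridge to convex analysis on a
single space is scalarisation: for a conditionally bounded position \<open>x1\<close> the number
\<open>r x = E[\<rho> (x1 + x) - \<rho> x1]\<close> is a convex monetary functional on the bounded random
variables. Locality of \<open>\<rho>\<close> makes the scalar and the conditional notions agree: testing
\<open>r\<close> on \<open>indicator A * x\<close> with \<open>A\<close> in the small algebra turns one integral inequality
into an almost sure inequality between conditional expectations
(\<open>scal_subgradient_conditional\<close>), and countable gluing passes from bounded to
conditionally bounded positions.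

\<^bold>\<open>Attainment.\<close> Under the Lebesgue property the directional derivative of \<open>r\<close> is
continuous along bounded almost surely convergent sequences, so a linear functional below it, which
exists by Hahn and Banach, has an integrable density (\<open>upper_lebesgue_imp_subgradient\<close>).
This is the maximiser of the conditional dual problem. Conversely, if every bounded position
has a maximiser, an argument in the manner of James and Simons applies: for a bounded
sequence decreasing to zero along which \<open>r\<close> does not converge, a fast converging series
of its members is almost extremal, and the expectations of the maximiser at its sum against
the members of the sequence would stay away from zero, against dominated convergence
(\<open>subgradients_imp_upper_lebesgue\<close>).

\<^bold>\<open>The conditional Lebesgue property.\<close> A random index takes countably many constant
values, so a conditional sequence is determined, piece by piece, by its members with constant index.
The conditional limit is squeezed between the tail infima and suprema at constant indices.

\<^bold>\<open>Compactness.\<close> A conditional subset is a set of objects closed under restriction and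
countable gluing (\<open>csubset_iff_gluable\<close>), and a join consists of what is countably covered.
If sublevel sets are compact, a conditional form of Dini's theorem (\<open>compact_uniform\<close>)
makes expectations against a sequence decreasing to zero small uniformly over a sublevel set.
The Fatou property supplies approximate subgradients that are integrable functions
(\<open>lower_fatou_imp_approx_subgradient\<close>, through a penalty in place of the
Krein--Smulian theorem), and these lie in a sublevel set on most of the space.
Together this gives the Lebesgue property. Conversely, take a maximal filter base
among the subsets of a sublevel set that are closed under countable gluing. It forces every
expectation to converge, and the Lebesgue property gives the limit functional a density, hence
a cluster point (\<open>stable_ultrafilter_cluster_point\<close>). If a covering had no finite
subcovering on some set of positive measure, the elements that avoid finitely many of its members
would generate such a filter base with a cluster point outside every member.
\<close>

section \<open>Modules of conditionally bounded and conditionally integrable functions\<close>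

locale cond_space = finite_measure_subalgebra M F + prob_space M
 for M F :: "'w measure"
begin

abbreviation X1 :: "('w \<Rightarrow> real) set" where "X1 \<equiv> L1_cond M F"
abbreviation Xinf :: "('w \<Rightarrow> real) set" where "Xinf \<equiv> Linf_cond M F"
abbreviation rnat :: "('w \<Rightarrow> nat) set" where "rnat \<equiv> measurable F (count_space UNIV)"
abbreviation cpair :: "('w \<Rightarrow> real) \<Rightarrow> ('w \<Rightarrow> real) \<Rightarrow> 'w \<Rightarrow> real" where
 "cpair x y \<equiv> cexp M F (\<lambda>v. x v * y v)"

lemma L0_M: "f \<in> borel_measurable F \<Longrightarrow> f \<in> L0 M"
 by (rule measurable_from_subalg[OF subalg])

lemma sets_M: "A \<in> sets F \<Longrightarrow> A \<in> sets M"
 using subalg by (auto simp: subalgebra_def)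

lemma space_F: "space F = space M"
 using subalg by (auto simp: subalgebra_def)

lemma measurable_F_M: "f \<in> measurable F N \<Longrightarrow> f \<in> measurable M N"
 by (rule measurable_from_subalg[OF subalg])

lemma Linf_borel: "x \<in> Linf M \<Longrightarrow> x \<in> L0 M"
 by (simp add: Linf_def)

lemma X1_borel: "x \<in> X1 \<Longrightarrow> x \<in> L0 M"
 by (simp add: L0_span_def)

lemma Xinf_borel: "x \<in> Xinf \<Longrightarrow> x \<in> L0 M"
 by (simp add: L0_span_def)

lemma LinfE:
 assumes "x \<in> Linf M"
 obtains C where "C \<ge> 1" "AE w in M. \<bar>x w\<bar> \<le> C" proof -
 obtain C where "AE w in M. \<bar>x w\<bar> \<le> C" using assms by (auto simp: Linf_def)
 then have "AE w in M. \<bar>x w\<bar> \<le> max 1 C" by auto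
 then show ?thesis using that[of "max 1 C"] by auto
qed

lemma LinfI: "x \<in> L0 M \<Longrightarrow> (AE w in M. \<bar>x w\<bar> \<le> C) \<Longrightarrow> x \<in> Linf M"
 by (auto simp: Linf_def)

lemma XinfI:
 assumes x: "x \<in> L0 M" and e: "\<eta> \<in> L0 F" and b: "AE w in M. \<bar>x w\<bar> \<le> \<eta> w"
 shows "x \<in> Xinf" proof -
 let ?e = "\<lambda>w. max 1 (\<eta> w)" and ?z = "\<lambda>w. x w / max 1 (\<eta> w)"
 have e1: "?e \<in> L0 F" using e by measurable
 have z: "?z \<in> L0 M" using x L0_M[OF e] by measurable
 have "AE w in M. \<bar>?z w\<bar> \<le> 1" using b proof eventually_elim
  case (elim w)
  have "0 < max 1 (\<eta> w)" by simp
  then have "\<bar>?z w\<bar> = \<bar>x w\<bar> / max 1 (\<eta> w)" by simp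
  also have "\<dots> \<le> 1" using elim by (simp add: pos_divide_le_eq)
  finally show ?case .
 qed
 then have zL: "?z \<in> Linf M" using z by (rule LinfI[rotated])
 have "AE w in M. x w = ?e w * ?z w" proof (rule AE_I2)
  fix w
  have "max 1 (\<eta> w) \<noteq> 0" by (metis max.cobounded1 not_one_le_zero)
  then show "x w = ?e w * ?z w" by simp
 qed
 with zL e1 have "\<exists>\<xi>\<in>L0 F. \<exists>z\<in>Linf M. AE w in M. x w = \<xi> w * z w" by (intro bexI[of _ ?e] bexI[of _ ?z])
 then show ?thesis using x by (simp add: L0_span_def)
qed

lemma XinfE:
 assumes "x \<in> Xinf"
 obtains \<eta> where "\<eta> \<in> L0 F" "\<And>w. \<eta> w \<ge> 1" "AE w in M. \<bar>x w\<bar> \<le> \<eta> w" proof -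
 obtain \<xi> z where h: "\<xi> \<in> L0 F" "z \<in> Linf M" "AE w in M. x w = \<xi> w * z w"
  using assms by (auto simp: L0_span_def)
 obtain C where C: "C \<ge> 1" "AE w in M. \<bar>z w\<bar> \<le> C" using LinfE[OF h(2)] by blast
 let ?e = "\<lambda>w. max 1 (\<bar>\<xi> w\<bar> * C)"
 have "AE w in M. \<bar>x w\<bar> \<le> ?e w" using h(3) C(2) proof eventually_elim
  case (elim w)
  have "\<bar>\<xi> w\<bar> * \<bar>z w\<bar> \<le> \<bar>\<xi> w\<bar> * C" using elim(2) by (rule mult_left_mono) simp
  then show ?case using elim(1) by (simp add: abs_mult)
 qed
 moreover have "?e \<in> L0 F" using h(1) by measurable
 ultimately show ?thesis using that[of ?e] by auto
qed

lemma X1I: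
 assumes x: "x \<in> L0 M" and e: "\<eta> \<in> L0 F" "\<And>w. \<eta> w > 0" and i: "integrable M (\<lambda>w. x w / \<eta> w)"
 shows "x \<in> X1" proof -
 have "AE w in M. x w = \<eta> w * (x w / \<eta> w)" proof (rule AE_I2)
  fix w show "x w = \<eta> w * (x w / \<eta> w)" using e(2)[of w] by auto
 qed
 then show ?thesis using x e(1) i
  by (auto simp: L0_span_def L1_def intro!: bexI[of _ \<eta>] exI[of _ "\<lambda>w. x w / \<eta> w"])
qed

text \<open>A conditionally integrable function becomes integrable after division by an
 \<open>F\<close>-measurable function bounded below by one, which may be enlarged at will. So finitely many of
 them have a common denominator.\<close>

lemma integrable_divide_larger:
 assumes x: "x \<in> L0 M" and e: "\<eta> \<in> L0 F" "\<And>w. \<eta> w \<ge> (1::real)"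
  and i: "integrable M (\<lambda>w. x w / \<eta> w)" and e': "\<eta>' \<in> L0 F" "\<And>w. \<eta> w \<le> \<eta>' w"
 shows "integrable M (\<lambda>w. x w / \<eta>' w)" proof (rule Bochner_Integration.integrable_bound[OF i])
 show "(\<lambda>w. x w / \<eta>' w) \<in> L0 M" using x L0_M[OF e'(1)] by measurable
 show "AE w in M. norm (x w / \<eta>' w) \<le> norm (x w / \<eta> w)" proof (rule AE_I2)
  fix w
  have "0 < \<eta> w" "\<eta> w \<le> \<eta>' w" using e(2)[of w] e'(2)[of w] by auto
  then show "norm (x w / \<eta>' w) \<le> norm (x w / \<eta> w)" by (simp add: frac_le)
 qed
qed

lemma X1E:
 assumes "x \<in> X1"
 obtains \<eta> where "\<eta> \<in> L0 F" "\<And>w. \<eta> w \<ge> 1" "integrable M (\<lambda>w. x w / \<eta> w)" proof -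
 obtain \<xi> z where h: "x \<in> L0 M" "\<xi> \<in> L0 F" "integrable M z" "AE w in M. x w = \<xi> w * z w"
  using assms by (auto simp: L0_span_def L1_def)
 let ?e = "\<lambda>w. max 1 \<bar>\<xi> w\<bar>"
 have e: "?e \<in> L0 F" using h(2) by measurable
 have "integrable M (\<lambda>w. x w / ?e w)" proof (rule Bochner_Integration.integrable_bound[OF h(3)])
  show "(\<lambda>w. x w / ?e w) \<in> L0 M" using h(1) L0_M[OF e] by measurable
  show "AE w in M. norm (x w / ?e w) \<le> norm (z w)" using h(4) proof eventually_elim
   case (elim w)
   have "\<bar>\<xi> w\<bar> * \<bar>z w\<bar> \<le> ?e w * \<bar>z w\<bar>" by (intro mult_right_mono) auto
   moreover have "0 < ?e w" by simp
   ultimately show ?case using elim by (simp add: abs_mult pos_divide_le_eq mult.commute)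
  qed
 qed
 then show ?thesis using that[of ?e] e by auto
qed

lemma X1E2:
 assumes "x \<in> X1" "y \<in> X1"
 obtains \<eta> where "\<eta> \<in> L0 F" "\<And>w. \<eta> w \<ge> 1" "integrable M (\<lambda>w. x w / \<eta> w)"
  "integrable M (\<lambda>w. y w / \<eta> w)" proof -
 obtain a where a: "a \<in> L0 F" "\<And>w. a w \<ge> 1" "integrable M (\<lambda>w. x w / a w)" using X1E[OF assms(1)] by blast
 obtain b where b: "b \<in> L0 F" "\<And>w. b w \<ge> 1" "integrable M (\<lambda>w. y w / b w)" using X1E[OF assms(2)] by blast
 let ?c = "\<lambda>w. max (a w) (b w)"
 have c: "?c \<in> L0 F" using a(1) b(1) by measurable
 have "integrable M (\<lambda>w. x w / ?c w)" by (rule integrable_divide_larger[OF X1_borel[OF assms(1)] a c]) auto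
 moreover have "integrable M (\<lambda>w. y w / ?c w)"
  by (rule integrable_divide_larger[OF X1_borel[OF assms(2)] b c]) auto
 moreover have "\<And>w. ?c w \<ge> 1" using a(2) by (meson max.coboundedI1)
 ultimately show ?thesis using that[OF c] by blast
qed

lemma L0_in_Xinf: "\<eta> \<in> L0 F \<Longrightarrow> \<eta> \<in> Xinf"
 by (rule XinfI[of _ "\<lambda>w. \<bar>\<eta> w\<bar>"]) (auto simp: L0_M)

lemma Linf_in_Xinf: "x \<in> Linf M \<Longrightarrow> x \<in> Xinf"
 by (rule LinfE, assumption, rule XinfI[OF Linf_borel]) auto

lemma L1_in_X1: "y \<in> L1 M \<Longrightarrow> y \<in> X1"
 by (rule X1I[of _ "\<lambda>_. 1"]) (auto simp: L1_def)

lemma Xinf_in_X1: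
 assumes "x \<in> Xinf" shows "x \<in> X1" proof -
 obtain e where e: "e \<in> L0 F" "\<And>w. e w \<ge> 1" "AE w in M. \<bar>x w\<bar> \<le> e w" using XinfE[OF assms] by blast
 have "integrable M (\<lambda>w. x w / e w)" proof (rule integrable_const_bound[of _ 1])
  show "AE w in M. norm (x w / e w) \<le> 1" using e(3) proof eventually_elim
   case (elim w) then show ?case using e(2)[of w] by (simp add: pos_divide_le_eq)
  qed
  show "(\<lambda>w. x w / e w) \<in> L0 M" using Xinf_borel[OF assms] L0_M[OF e(1)] by measurable
 qed
 moreover have "\<And>w. e w > 0" using e(2) by (metis less_le_trans zero_less_one)
 ultimately show ?thesis by (intro X1I[OF Xinf_borel[OF assms] e(1)])
qed

lemma Xinf_add:
 assumes "x \<in> Xinf" "y \<in> Xinf"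
 shows "(\<lambda>w. x w + y w) \<in> Xinf" proof -
 obtain a where a: "a \<in> L0 F" "AE w in M. \<bar>x w\<bar> \<le> a w" using XinfE[OF assms(1)] by blast
 obtain b where b: "b \<in> L0 F" "AE w in M. \<bar>y w\<bar> \<le> b w" using XinfE[OF assms(2)] by blast
 show ?thesis proof (rule XinfI[of _ "\<lambda>w. a w + b w"])
  show "(\<lambda>w. x w + y w) \<in> L0 M" using assms[THEN Xinf_borel] by measurable
  show "(\<lambda>w. a w + b w) \<in> L0 F" using a(1) b(1) by measurable
  show "AE w in M. \<bar>x w + y w\<bar> \<le> a w + b w" using a(2) b(2) by eventually_elim auto
 qed
qed

lemma Xinf_mult:
 assumes "x \<in> Xinf" "y \<in> Xinf"
 shows "(\<lambda>w. x w * y w) \<in> Xinf" proof -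
 obtain a where a: "a \<in> L0 F" "AE w in M. \<bar>x w\<bar> \<le> a w" "\<And>w. a w \<ge> 1" using XinfE[OF assms(1)] by blast
 obtain b where b: "b \<in> L0 F" "AE w in M. \<bar>y w\<bar> \<le> b w" using XinfE[OF assms(2)] by blast
 show ?thesis proof (rule XinfI[of _ "\<lambda>w. a w * b w"])
  show "(\<lambda>w. x w * y w) \<in> L0 M" using assms[THEN Xinf_borel] by measurable
  show "(\<lambda>w. a w * b w) \<in> L0 F" using a(1) b(1) by measurable
  show "AE w in M. \<bar>x w * y w\<bar> \<le> a w * b w" using a(2) b(2) proof eventually_elim
   case (elim w) then show ?case using a(3)[of w] by (auto simp: abs_mult intro!: mult_mono)
  qed
 qed
qed

lemma Xinf_const: "(\<lambda>_. c) \<in> Xinf"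
 by (rule L0_in_Xinf) simp


lemma L0_mult_Xinf: "\<eta> \<in> L0 F \<Longrightarrow> x \<in> Xinf \<Longrightarrow> (\<lambda>w. \<eta> w * x w) \<in> Xinf"
 by (rule Xinf_mult[OF L0_in_Xinf])

lemma Xinf_diff:
 assumes "x \<in> Xinf" "y \<in> Xinf"
 shows "(\<lambda>w. x w - y w) \<in> Xinf" using Xinf_add[OF assms(1) L0_mult_Xinf[of "\<lambda>_. -1", OF _ assms(2)]] by simp

lemma Xinf_uminus: "x \<in> Xinf \<Longrightarrow> (\<lambda>w. - x w) \<in> Xinf"
 using Xinf_diff[OF Xinf_const[of 0]] by simp

lemma Linf_add: assumes "x \<in> Linf M" "y \<in> Linf M" shows "(\<lambda>w. x w + y w) \<in> Linf M"
proof -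
 obtain a where a: "AE w in M. \<bar>x w\<bar> \<le> a" using LinfE[OF assms(1)] by blast
 obtain b where b: "AE w in M. \<bar>y w\<bar> \<le> b" using LinfE[OF assms(2)] by blast
 have "AE w in M. \<bar>x w + y w\<bar> \<le> a + b" using a b by eventually_elim auto
 moreover have "(\<lambda>w. x w + y w) \<in> L0 M" using assms[THEN Linf_borel] by measurable
 ultimately show ?thesis by (rule LinfI[rotated])
qed

lemma Linf_mult: assumes "x \<in> Linf M" "y \<in> Linf M" shows "(\<lambda>w. x w * y w) \<in> Linf M"
proof -
 obtain a where a: "a \<ge> 1" "AE w in M. \<bar>x w\<bar> \<le> a" using LinfE[OF assms(1)] by blast
 obtain b where b: "AE w in M. \<bar>y w\<bar> \<le> b" using LinfE[OF assms(2)] by blast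
 have "AE w in M. \<bar>x w * y w\<bar> \<le> a * b" using a(2) b
  by eventually_elim (use a(1) in \<open>auto simp: abs_mult intro!: mult_mono\<close>)
 moreover have "(\<lambda>w. x w * y w) \<in> L0 M" using assms[THEN Linf_borel] by measurable
 ultimately show ?thesis by (rule LinfI[rotated])
qed

lemma Linf_const: "(\<lambda>_. c) \<in> Linf M"
 by (rule LinfI[of _ "\<bar>c\<bar>"]) auto

lemma Linf_cmult: "x \<in> Linf M \<Longrightarrow> (\<lambda>w. c * x w) \<in> Linf M"
 by (rule Linf_mult[OF Linf_const])

lemma Linf_ind: "A \<in> sets M \<Longrightarrow> indicator A \<in> Linf M"
 by (rule LinfI[of _ 1]) (auto simp: indicator_def)

lemma Linf_diff: "x \<in> Linf M \<Longrightarrow> y \<in> Linf M \<Longrightarrow> (\<lambda>w. x w - y w) \<in> Linf M"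
 using Linf_add[of x "\<lambda>w. -1 * y w"] Linf_cmult[of y "-1"] by simp

lemma Linf_uminus: "x \<in> Linf M \<Longrightarrow> (\<lambda>w. - x w) \<in> Linf M"
 using Linf_cmult[of x "-1"] by simp

lemma Linf_max: assumes "x \<in> Linf M" "y \<in> Linf M" shows "(\<lambda>w. max (x w) (y w)) \<in> Linf M"
proof -
 obtain a where a: "AE w in M. \<bar>x w\<bar> \<le> a" using LinfE[OF assms(1)] by blast
 obtain b where b: "AE w in M. \<bar>y w\<bar> \<le> b" using LinfE[OF assms(2)] by blast
 have "AE w in M. \<bar>max (x w) (y w)\<bar> \<le> max a b" using a b by eventually_elim auto
 moreover have "(\<lambda>w. max (x w) (y w)) \<in> L0 M" using assms[THEN Linf_borel] by measurable
 ultimately show ?thesis by (rule LinfI[rotated])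
qed

lemma integrable_Linf_L1: assumes "x \<in> Linf M" "integrable M y" shows "integrable M (\<lambda>w. x w * y w)"
proof -
 obtain a where a: "a \<ge> 1" "AE w in M. \<bar>x w\<bar> \<le> a" using LinfE[OF assms(1)] by blast
 show ?thesis proof (rule Bochner_Integration.integrable_bound[of M "\<lambda>w. a * y w"])
  show "integrable M (\<lambda>w. a * y w)" using assms(2) by auto
  show "(\<lambda>w. x w * y w) \<in> L0 M" using Linf_borel[OF assms(1)] assms(2) by measurable
  show "AE w in M. norm (x w * y w) \<le> norm (a * y w)" using a(2)
   by eventually_elim (use a(1) in \<open>auto simp: abs_mult intro!: mult_right_mono\<close>)
 qed
qed

lemma X1_mult:
 assumes x: "x \<in> Xinf" and y: "y \<in> X1"
 shows "(\<lambda>w. x w * y w) \<in> X1" proof -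
 obtain a where a: "a \<in> L0 F" "AE w in M. \<bar>x w\<bar> \<le> a w" "\<And>w. a w \<ge> 1" using XinfE[OF x] by blast
 obtain b where b: "b \<in> L0 F" "\<And>w. b w \<ge> 1" "integrable M (\<lambda>w. y w / b w)" using X1E[OF y] by blast
 have pos: "a w * b w > 0" for w using a(3)[of w] b(2)[of w] by simp
 have "integrable M (\<lambda>w. x w * y w / (a w * b w))" proof (rule Bochner_Integration.integrable_bound[OF b(3)])
  show "(\<lambda>w. x w * y w / (a w * b w)) \<in> L0 M"
   using Xinf_borel[OF x] X1_borel[OF y] L0_M[OF a(1)] L0_M[OF b(1)] by measurable
  show "AE w in M. norm (x w * y w / (a w * b w)) \<le> norm (y w / b w)" using a(2) proof eventually_elim
   case (elim w)
   have "\<bar>x w / a w\<bar> \<le> 1" using elim a(3)[of w] by (simp add: pos_divide_le_eq)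
   then have "\<bar>x w / a w\<bar> * \<bar>y w / b w\<bar> \<le> 1 * \<bar>y w / b w\<bar>" by (intro mult_right_mono) auto
   then show ?case by (simp add: abs_mult)
  qed
 qed
 moreover have "(\<lambda>w. x w * y w) \<in> L0 M" using Xinf_borel[OF x] X1_borel[OF y] by measurable
 moreover have "(\<lambda>w. a w * b w) \<in> L0 F" using a(1) b(1) by measurable
 ultimately show ?thesis using pos by (intro X1I[where \<eta> = "\<lambda>w. a w * b w"]) auto
qed

lemma X1_add:
 assumes "x \<in> X1" "y \<in> X1"
 shows "(\<lambda>w. x w + y w) \<in> X1" proof -
 obtain e where e: "e \<in> L0 F" "\<And>w. e w \<ge> 1" "integrable M (\<lambda>w. x w / e w)" "integrable M (\<lambda>w. y w / e w)"
  using X1E2[OF assms] by blast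
 have pos: "e w > 0" for w using e(2)[of w] by simp
 have "integrable M (\<lambda>w. (x w + y w) / e w)"
  using Bochner_Integration.integrable_add[OF e(3,4)] by (simp add: add_divide_distrib)
 moreover have "(\<lambda>w. x w + y w) \<in> L0 M" using assms[THEN X1_borel] by measurable
 ultimately show ?thesis by (intro X1I[OF _ e(1) pos])
qed

lemma X1_diff:
 assumes "x \<in> X1" "y \<in> X1"
 shows "(\<lambda>w. x w - y w) \<in> X1" using X1_add[OF assms(1) X1_mult[OF Xinf_const[of "-1"] assms(2)]] by simp


lemma cexp_props:
 assumes x: "x \<in> X1"
 shows cexp_L0: "cexp M F x \<in> L0 F"
  and cexp_unique: "\<eta> \<in> L0 F \<Longrightarrow> (\<And>w. \<eta> w > 0) \<Longrightarrow> integrable M (\<lambda>w. x w / \<eta> w) \<Longrightarrow>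
   AE w in M. cexp M F x w = \<eta> w * real_cond_exp M F (\<lambda>w. x w / \<eta> w) w" proof -
 let ?P = "\<lambda>h. \<exists>\<xi>\<in>L0 F. \<exists>z\<in>L1 M. (AE w in M. x w = \<xi> w * z w) \<and> h = (\<lambda>w. \<xi> w * real_cond_exp M F z w)"
 have "\<exists>h. ?P h" using x by (auto simp: L0_span_def)
 then have "?P (cexp M F x)" unfolding cexp_def by (rule someI_ex)
 then obtain \<xi> z where h: "\<xi> \<in> L0 F" "integrable M z" "AE w in M. x w = \<xi> w * z w"
  and c: "cexp M F x = (\<lambda>w. \<xi> w * real_cond_exp M F z w)" by (auto simp: L1_def)
 have rF: "real_cond_exp M F z \<in> L0 F" by simp
 show "cexp M F x \<in> L0 F" unfolding c using h(1) rF by measurable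
 assume e: "\<eta> \<in> L0 F" "\<And>w. \<eta> w > 0" "integrable M (\<lambda>w. x w / \<eta> w)"
 have xm: "x \<in> L0 M" using X1_borel[OF x] .
 have eq: "AE w in M. x w / \<eta> w = \<xi> w / \<eta> w * z w" using h(3) by eventually_elim simp
 have zm: "z \<in> L0 M" using h(2) by simp
 have m: "(\<lambda>w. x w / \<eta> w) \<in> L0 M" "(\<lambda>w. \<xi> w / \<eta> w * z w) \<in> L0 M"
  using xm zm L0_M[OF e(1)] L0_M[OF h(1)] by measurable
 have i: "integrable M (\<lambda>w. \<xi> w / \<eta> w * z w)" by (rule integrable_cong_AE_imp[OF e(3) m(2)]) (use eq in auto)
 have q: "(\<lambda>w. \<xi> w / \<eta> w) \<in> L0 F" using h(1) e(1) by measurable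
 have "AE w in M. real_cond_exp M F (\<lambda>w. \<xi> w / \<eta> w * z w) w = \<xi> w / \<eta> w * real_cond_exp M F z w"
  by (rule real_cond_exp_mult[OF q zm i])
 moreover have "AE w in M. real_cond_exp M F (\<lambda>w. x w / \<eta> w) w = real_cond_exp M F (\<lambda>w. \<xi> w / \<eta> w * z w) w"
  by (rule real_cond_exp_cong[OF eq m])
 ultimately show "AE w in M. cexp M F x w = \<eta> w * real_cond_exp M F (\<lambda>w. x w / \<eta> w) w" proof eventually_elim
  case (elim w) then show ?case using e(2)[of w] by (simp add: c)
 qed
qed

lemma cexp_L1: "y \<in> L1 M \<Longrightarrow> AE w in M. cexp M F y w = real_cond_exp M F y w"
 using cexp_unique[OF L1_in_X1, of y "\<lambda>_. 1"] by (auto simp: L1_def)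

lemma cexp_integral:
 assumes "integrable M y" shows "integrable M (cexp M F y)" "(\<integral>w. cexp M F y w \<partial>M) = (\<integral>w. y w \<partial>M)" proof -
 have L: "y \<in> L1 M" using assms by (simp add: L1_def)
 have m: "cexp M F y \<in> L0 M" using L0_M[OF cexp_L0[OF L1_in_X1[OF L]]] .
 have ae: "AE w in M. cexp M F y w = real_cond_exp M F y w" using cexp_L1[OF L] .
 have m2: "real_cond_exp M F y \<in> L0 M" by simp
 show "integrable M (cexp M F y)"
  using Bochner_Integration.integrable_cong_AE[OF m m2 ae] real_cond_exp_int(1)[OF assms] by simp
 show "(\<integral>w. cexp M F y w \<partial>M) = (\<integral>w. y w \<partial>M)"
  using integral_cong_AE[OF m m2 ae] real_cond_exp_int(2)[OF assms] by simp
qed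

lemma cexp_add:
 assumes x: "x \<in> X1" and y: "y \<in> X1"
 shows "AE w in M. cexp M F (\<lambda>w. x w + y w) w = cexp M F x w + cexp M F y w" proof -
 obtain e where e: "e \<in> L0 F" "\<And>w. e w \<ge> 1" "integrable M (\<lambda>w. x w / e w)" "integrable M (\<lambda>w. y w / e w)"
  using X1E2[OF assms] by blast
 have pos: "e w > 0" for w using e(2)[of w] by simp
 have i: "integrable M (\<lambda>w. (x w + y w) / e w)"
  using Bochner_Integration.integrable_add[OF e(3,4)] by (simp add: add_divide_distrib)
 show ?thesis using cexp_unique[OF X1_add[OF x y] e(1) pos i] cexp_unique[OF x e(1) pos e(3)]
   cexp_unique[OF y e(1) pos e(4)] real_cond_exp_add[OF e(3,4)]
  by eventually_elim (simp add: add_divide_distrib distrib_left)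
qed

lemma cexp_mult:
 assumes \<xi>: "\<xi> \<in> L0 F" and x: "x \<in> X1"
 shows "AE w in M. cpair \<xi> x w = \<xi> w * cexp M F x w" proof -
 obtain e where e: "e \<in> L0 F" "\<And>w. e w \<ge> 1" "integrable M (\<lambda>w. x w / e w)" using X1E[OF x] by blast
 have pos: "e w > 0" for w using e(2)[of w] by simp
 let ?e = "\<lambda>w. e w * max 1 \<bar>\<xi> w\<bar>"
 have e': "?e \<in> L0 F" using e(1) \<xi> by measurable
 have p': "?e w > 0" for w using pos[of w] by simp
 have q: "(\<lambda>w. \<xi> w / max 1 \<bar>\<xi> w\<bar>) \<in> L0 F" using \<xi> by measurable
 have xm: "x \<in> L0 M" "e \<in> L0 M" "\<xi> \<in> L0 M" using X1_borel[OF x] L0_M[OF e(1)] L0_M[OF \<xi>] by auto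
 have m1: "(\<lambda>w. x w / e w) \<in> L0 M" using xm by measurable
 have i: "integrable M (\<lambda>w. (\<xi> w / max 1 \<bar>\<xi> w\<bar>) * (x w / e w))"
 proof (rule Bochner_Integration.integrable_bound[OF e(3)])
  show "(\<lambda>w. \<xi> w / max 1 \<bar>\<xi> w\<bar> * (x w / e w)) \<in> L0 M" using xm by measurable
  show "AE w in M. norm (\<xi> w / max 1 \<bar>\<xi> w\<bar> * (x w / e w)) \<le> norm (x w / e w)" proof (rule AE_I2)
   fix w
   have "0 < max 1 \<bar>\<xi> w\<bar>" by simp
   then have "\<bar>\<xi> w / max 1 \<bar>\<xi> w\<bar>\<bar> \<le> 1" by (simp add: pos_divide_le_eq)
   then have "\<bar>\<xi> w / max 1 \<bar>\<xi> w\<bar>\<bar> * \<bar>x w / e w\<bar> \<le> 1 * \<bar>x w / e w\<bar>" by (intro mult_right_mono) auto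
   then show "norm (\<xi> w / max 1 \<bar>\<xi> w\<bar> * (x w / e w)) \<le> norm (x w / e w)" by (simp add: abs_mult)
  qed
 qed
 have eq: "(\<lambda>w. \<xi> w * x w / ?e w) = (\<lambda>w. (\<xi> w / max 1 \<bar>\<xi> w\<bar>) * (x w / e w))" by (auto simp: mult.commute)
 have \<xi>x: "(\<lambda>w. \<xi> w * x w) \<in> X1" by (rule X1_mult[OF L0_in_Xinf[OF \<xi>] x])
 have "AE w in M. cpair \<xi> x w = ?e w * real_cond_exp M F (\<lambda>w. \<xi> w * x w / ?e w) w"
  by (rule cexp_unique[OF \<xi>x e' p']) (use i eq in simp)
 moreover have "AE w in M. real_cond_exp M F (\<lambda>w. (\<xi> w / max 1 \<bar>\<xi> w\<bar>) * (x w / e w)) w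
   = (\<xi> w / max 1 \<bar>\<xi> w\<bar>) * real_cond_exp M F (\<lambda>w. x w / e w) w" by (rule real_cond_exp_mult[OF q m1 i])
 ultimately show ?thesis using cexp_unique[OF x e(1) pos e(3)] proof eventually_elim
  case (elim w)
  have "max 1 \<bar>\<xi> w\<bar> \<noteq> 0" by auto
  then show ?case using elim by (simp only: eq) (simp add: field_simps)
 qed
qed

lemma cexp_cong:
 assumes x: "x \<in> X1" and y: "y \<in> X1" and eq: "AE w in M. x w = y w"
 shows "AE w in M. cexp M F x w = cexp M F y w" proof -
 obtain e where e: "e \<in> L0 F" "\<And>w. e w \<ge> 1" "integrable M (\<lambda>w. x w / e w)" "integrable M (\<lambda>w. y w / e w)"
  using X1E2[OF x y] by blast
 have pos: "e w > 0" for w using e(2)[of w] by simp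
 have "AE w in M. real_cond_exp M F (\<lambda>w. x w / e w) w = real_cond_exp M F (\<lambda>w. y w / e w) w"
  by (rule real_cond_exp_cong) (use eq e(3,4) in auto)
 then show ?thesis using cexp_unique[OF x e(1) pos e(3)] cexp_unique[OF y e(1) pos e(4)] by eventually_elim simp
qed

lemma cexp_nonneg:
 assumes x: "x \<in> X1" and p: "AE w in M. x w \<ge> 0"
 shows "AE w in M. cexp M F x w \<ge> 0" proof -
 obtain e where e: "e \<in> L0 F" "\<And>w. e w \<ge> 1" "integrable M (\<lambda>w. x w / e w)" using X1E[OF x] by blast
 have pos: "e w > 0" for w using e(2)[of w] by simp
 have "AE w in M. real_cond_exp M F (\<lambda>w. x w / e w) w \<ge> 0" proof (rule real_cond_exp_pos)
  show "AE w in M. x w / e w \<ge> 0" using p proof eventually_elim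
   case (elim w) then show ?case using pos[of w] by simp
  qed
  show "(\<lambda>w. x w / e w) \<in> L0 M" using e(3) by simp
 qed
 then show ?thesis using cexp_unique[OF x e(1) pos e(3)] proof eventually_elim
  case (elim w) then show ?case using pos[of w] by simp
 qed
qed

lemma cexp_diff:
 assumes x: "x \<in> X1" and y: "y \<in> X1"
 shows "AE w in M. cexp M F (\<lambda>w. x w - y w) w = cexp M F x w - cexp M F y w" proof -
 have "(\<lambda>w. -1 * y w) \<in> X1" by (rule X1_mult[OF Xinf_const y])
 from cexp_add[OF x this] cexp_mult[OF borel_measurable_const y, of "-1"]
 show ?thesis by eventually_elim simp
qed

lemma cexp_local:
 assumes x: "x \<in> X1" and y: "y \<in> X1" and A: "A \<in> sets F" and eq: "AE w\<in>A in M. x w = y w"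
 shows "AE w\<in>A in M. cexp M F x w = cexp M F y w" proof -
 let ?i = "indicator A :: 'w \<Rightarrow> real"
 have i: "?i \<in> L0 F" using A by simp
 have "AE w in M. cexp M F (\<lambda>w. ?i w * x w) w = cexp M F (\<lambda>w. ?i w * y w) w"
  using eq by (intro cexp_cong X1_mult[OF L0_in_Xinf[OF i]] x y)
   (auto elim!: eventually_mono simp: indicator_def)
 with cexp_mult[OF i x] cexp_mult[OF i y] show ?thesis by eventually_elim (auto simp: indicator_def)
qed

lemma cexp_mono_on:
 assumes x: "x \<in> X1" and y: "y \<in> X1" and A: "A \<in> sets F" and le: "AE w\<in>A in M. x w \<le> y w"
 shows "AE w\<in>A in M. cexp M F x w \<le> cexp M F y w" proof -
 let ?i = "indicator A :: 'w \<Rightarrow> real"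
 have i: "?i \<in> L0 F" using A by simp
 have d: "(\<lambda>w. y w - x w) \<in> X1" by (rule X1_diff[OF y x])
 have "AE w in M. cexp M F (\<lambda>w. ?i w * (y w - x w)) w \<ge> 0"
  using le by (intro cexp_nonneg X1_mult[OF L0_in_Xinf[OF i]] d)
   (auto elim!: eventually_mono simp: indicator_def)
 with cexp_mult[OF i d] cexp_diff[OF y x] show ?thesis by eventually_elim (auto simp: indicator_def)
qed

lemma cexp_F:
 assumes "\<eta> \<in> L0 F" shows "AE w in M. cexp M F \<eta> w = \<eta> w" proof -
 have c1: "(\<lambda>_. 1::real) \<in> L1 M" by (simp add: L1_def)
 have "AE w in M. real_cond_exp M F (\<lambda>_. 1) w = 1" by (rule real_cond_exp_F_meas) auto
 with cexp_mult[OF assms L1_in_X1[OF c1]] cexp_L1[OF c1] show ?thesis by eventually_elim simp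
qed

subsection \<open>Gluing along countable partitions\<close>

definition cat :: "('w \<Rightarrow> nat) \<Rightarrow> (nat \<Rightarrow> 'w \<Rightarrow> 'b) \<Rightarrow> 'w \<Rightarrow> 'b" where
 "cat N s w = s (N w) w"

lemma cat_measurable:
 assumes "N \<in> measurable K (count_space UNIV)" "\<And>k::nat. s k \<in> measurable K L"
 shows "cat N s \<in> measurable K L" unfolding cat_def by (rule measurable_compose_countable[OF assms(2,1)])

lemma cat_L0: "N \<in> rnat \<Longrightarrow> (\<And>k. s k \<in> L0 F) \<Longrightarrow> cat N s \<in> L0 F"
 by (rule cat_measurable)

lemma N_level: "N \<in> rnat \<Longrightarrow> {w \<in> space M. N w = (k::nat)} \<in> sets F"
 using measurable_sets[of N F "count_space UNIV" "{k}"] by (simp add: space_F vimage_def Int_def conj_commute)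

lemma cat_X1:
 assumes N: "N \<in> rnat" and s: "\<And>k. s k \<in> X1"
 shows "cat N s \<in> X1" proof -
 have "\<forall>k. \<exists>e. e \<in> L0 F \<and> (\<forall>w. e w \<ge> 1) \<and> integrable M (\<lambda>w. s k w / e w)" using X1E[OF s] by metis
 then obtain e where e: "\<And>k. e k \<in> L0 F" "\<And>k w. e k w \<ge> (1::real)" "\<And>k. integrable M (\<lambda>w. s k w / e k w)"
  by metis
 define I where "I k = (\<integral>w. \<bar>s k w / e k w\<bar> \<partial>M)" for k
 have I0: "I k \<ge> 0" for k unfolding I_def by simp
 \<comment> \<open>the denominator of the \<open>k\<close>-th piece makes its integral at most \<open>2 ^ -k\<close>\<close>
 define f where "f k w = e k w * (2 ^ k * (I k + 1))" for k w
 have f: "f k \<in> L0 F" for k unfolding f_def using e(1)[of k] by measurable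
 have ep: "e k w > 0" for k w using e(2)[of k w] by simp
 have fp: "f k w > 0" for k w unfolding f_def using ep[of k w] I0[of k] by simp
 have nn: "(\<integral>\<^sup>+w. ennreal \<bar>s k w / f k w\<bar> \<partial>M) \<le> ennreal ((1/2)^k)" for k proof -
  have eq: "\<bar>s k w / f k w\<bar> = \<bar>s k w / e k w\<bar> * (1 / (2^k * (I k + 1)))" for w
   unfolding f_def using I0[of k] ep[of k w] by (simp add: abs_mult)
  have "(\<integral>\<^sup>+w. ennreal \<bar>s k w / f k w\<bar> \<partial>M) = ennreal (\<integral>w. \<bar>s k w / f k w\<bar> \<partial>M)" unfolding eq using I0[of k]
   by (intro nn_integral_eq_integral integrable_mult_left integrable_abs e(3)) auto
  also have "(\<integral>w. \<bar>s k w / f k w\<bar> \<partial>M) = I k / (2^k * (I k + 1))"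
   by (simp only: eq integral_mult_left_zero times_divide_eq_right mult_1_right I_def
     integral_divide_zero)
  also have "I k / (2^k * (I k + 1)) \<le> (1/2)^k" using I0[of k] by (simp add: power_divide pos_divide_le_eq)
  finally show ?thesis using ennreal_leI by simp
 qed
 have cm: "cat N s \<in> L0 M" by (rule cat_measurable[OF measurable_F_M[OF N] X1_borel[OF s]])
 have fm: "cat N f \<in> L0 F" by (rule cat_L0[OF N f])
 have im: "(\<lambda>w. cat N s w / cat N f w) \<in> L0 M" using cm L0_M[OF fm] by measurable
 have sm: "(\<lambda>w. ennreal \<bar>s k w / f k w\<bar>) \<in> borel_measurable M" for k
  using X1_borel[OF s[of k]] L0_M[OF f[of k]] by measurable
 have "(\<integral>\<^sup>+w. ennreal \<bar>cat N s w / cat N f w\<bar> \<partial>M) \<le> (\<integral>\<^sup>+w. (\<Sum>k. ennreal \<bar>s k w / f k w\<bar>) \<partial>M)"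
 proof (rule nn_integral_mono)
  fix w
  have "sum (\<lambda>k. ennreal \<bar>s k w / f k w\<bar>) {N w} \<le> (\<Sum>k. ennreal \<bar>s k w / f k w\<bar>)" by (rule sum_le_suminf) auto
  then show "ennreal \<bar>cat N s w / cat N f w\<bar> \<le> (\<Sum>k. ennreal \<bar>s k w / f k w\<bar>)" by (simp add: cat_def)
 qed
 also have "\<dots> = (\<Sum>k. \<integral>\<^sup>+w. ennreal \<bar>s k w / f k w\<bar> \<partial>M)" by (rule nn_integral_suminf[OF sm])
 also have "\<dots> \<le> (\<Sum>k. ennreal ((1/2)^k))" by (intro suminf_le nn) auto
 also have "\<dots> = ennreal (\<Sum>k. (1/2)^k)" by (rule suminf_ennreal2) (auto intro: summable_geometric)
 also have "\<dots> < \<infinity>" by simp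
 finally have "integrable M (\<lambda>w. cat N s w / cat N f w)" using im by (intro integrableI_bounded) auto
 moreover have "\<And>w. cat N f w > 0" using fp by (simp add: cat_def)
 ultimately show ?thesis by (intro X1I[OF cm fm])
qed

lemma AE_levels:
 fixes N :: "'w \<Rightarrow> nat"
 shows "(\<And>k. AE w in M. N w = k \<longrightarrow> P w) \<Longrightarrow> AE w in M. P w" proof -
 assume "\<And>k. AE w in M. N w = k \<longrightarrow> P w"
 then have "AE w in M. \<forall>k. N w = k \<longrightarrow> P w" by (subst AE_all_countable) blast
 then show ?thesis by eventually_elim simp
qed

lemma cexp_cat:
 assumes N: "N \<in> rnat" and s: "\<And>k. s k \<in> X1"
 shows "AE w in M. cexp M F (cat N s) w = cexp M F (s (N w)) w" proof (rule AE_levels[of N])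
 fix k
 have "AE w in M. w \<in> {w \<in> space M. N w = k} \<longrightarrow> cexp M F (cat N s) w = cexp M F (s k) w"
  by (rule cexp_local[OF cat_X1[OF N s] s N_level[OF N]]) (auto simp: cat_def)
 then show "AE w in M. N w = k \<longrightarrow> cexp M F (cat N s) w = cexp M F (s (N w)) w"
  using AE_space by eventually_elim auto
qed

lemma cat_Xinf:
 assumes N: "N \<in> rnat" and s: "\<And>k. s k \<in> Xinf"
 shows "cat N s \<in> Xinf" proof -
 have "\<forall>k. \<exists>e. e \<in> L0 F \<and> (AE w in M. \<bar>s k w\<bar> \<le> e w)" using XinfE[OF s] by metis
 then obtain e where e: "\<And>k. e k \<in> L0 F" "\<And>k. AE w in M. \<bar>s k w\<bar> \<le> e k w" by metis
 have "AE w in M. \<forall>k. \<bar>s k w\<bar> \<le> e k w" using e(2) by (simp add: AE_all_countable)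
 then have "AE w in M. \<bar>cat N s w\<bar> \<le> cat N e w" by eventually_elim (simp add: cat_def)
 then show ?thesis
  by (rule XinfI[OF cat_measurable[OF measurable_F_M[OF N] Xinf_borel[OF s]] cat_L0[OF N e(1)]])
qed

end

section \<open>Scalar monetary functionals\<close>

text \<open>Hahn and Banach by minimality: Zorn's lemma gives a minimal sublinear functional below \<open>p\<close>,
  and minimality forces linearity.\<close>

lemma linear_functional_below_sublinear:
 fixes V :: "('w \<Rightarrow> real) set" and p :: "('w \<Rightarrow> real) \<Rightarrow> real"
 assumes V0: "(\<lambda>_. 0) \<in> V" and Vadd: "\<And>x y. x \<in> V \<Longrightarrow> y \<in> V \<Longrightarrow> (\<lambda>w. x w + y w) \<in> V"
  and Vmul: "\<And>c x. x \<in> V \<Longrightarrow> (\<lambda>w. c * x w) \<in> V"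
  and sub: "\<And>x y. x \<in> V \<Longrightarrow> y \<in> V \<Longrightarrow> p (\<lambda>w. x w + y w) \<le> p x + p y"
  and hom: "\<And>c x. x \<in> V \<Longrightarrow> 0 \<le> c \<Longrightarrow> p (\<lambda>w. c * x w) \<le> c * p x"
 shows "\<exists>l. (\<forall>x\<in>V. \<forall>y\<in>V. l (\<lambda>w. x w + y w) = l x + l y) \<and>
       (\<forall>x\<in>V. \<forall>c. l (\<lambda>w. c * x w) = c * l x) \<and> (\<forall>x\<in>V. l x \<le> p x)" proof -
 define A where "A = {q :: ('w \<Rightarrow> real) \<Rightarrow> real. (\<forall>x. x \<notin> V \<longrightarrow> q x = 0) \<and> (\<forall>x\<in>V. q x \<le> p x) \<and>
  (\<forall>x\<in>V. \<forall>y\<in>V. q (\<lambda>w. x w + y w) \<le> q x + q y) \<and>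
  (\<forall>x\<in>V. \<forall>c\<ge>0. q (\<lambda>w. c * x w) \<le> c * q x)}"
 define P where "P = (\<lambda>q q' :: ('w \<Rightarrow> real) \<Rightarrow> real. \<forall>x\<in>V. q' x \<le> q x)"
 have As: "q (\<lambda>w. x w + y w) \<le> q x + q y" if "q \<in> A" "x \<in> V" "y \<in> V" for q x y using that by (auto simp: A_def)
 have Ah: "q (\<lambda>w. c * x w) \<le> c * q x" if "q \<in> A" "x \<in> V" "0 \<le> c" for q x c using that by (auto simp: A_def)
 have Ap: "q x \<le> p x" if "q \<in> A" "x \<in> V" for q x using that by (auto simp: A_def)
 have A0: "q (\<lambda>_. 0) = 0" if q: "q \<in> A" for q using As[OF q V0 V0] Ah[OF q V0, of 0] by simp
 have Vneg: "(\<lambda>w. - x w) \<in> V" if "x \<in> V" for x using Vmul[OF that, of "-1"] by simp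
 have Alow: "q x \<ge> - q (\<lambda>w. - x w)" if q: "q \<in> A" and x: "x \<in> V" for q x
  using As[OF q x Vneg[OF x]] A0[OF q] by simp
 have Alow': "q x \<ge> - p (\<lambda>w. - x w)" if q: "q \<in> A" and x: "x \<in> V" for q x
  using Alow[OF q x] Ap[OF q Vneg[OF x]] by simp
 have Ah': "q (\<lambda>w. c * x w) = c * q x" if q: "q \<in> A" and x: "x \<in> V" and c: "c \<ge> 0" for q x c
 proof (cases "c = 0")
  case True then show ?thesis using A0[OF q] by simp
 next
  case False
  have "q (\<lambda>w. (1/c) * (c * x w)) \<le> (1/c) * q (\<lambda>w. c * x w)" by (rule Ah[OF q Vmul[OF x]]) (use c in simp)
  then have "c * q x \<le> q (\<lambda>w. c * x w)" using False c by (simp add: field_simps)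
  then show ?thesis using Ah[OF q x c] by simp
 qed
 have "\<exists>m\<in>A. \<forall>a\<in>A. P m a \<longrightarrow> a = m" proof (rule predicate_Zorn)
  show "partial_order_on A (relation_of P A)" proof (rule partial_order_on_relation_ofI)
   show "P a a" for a by (simp add: P_def)
   show "P a c" if "P a b" "P b c" for a b c unfolding P_def proof
    fix x assume x: "x \<in> V"
    have "c x \<le> b x" "b x \<le> a x" using that x by (auto simp: P_def)
    then show "c x \<le> a x" by simp
   qed
   show "a = b" if "a \<in> A" "b \<in> A" "P a b" "P b a" for a b proof
    fix x show "a x = b x" using that by (cases "x \<in> V") (auto simp: P_def A_def antisym)
   qed
  qed
  fix C assume C: "C \<in> Chains (relation_of P A)"
  have CA: "C \<subseteq> A" and Cc: "\<And>a b. a \<in> C \<Longrightarrow> b \<in> C \<Longrightarrow> P a b \<or> P b a"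
   using C by (auto simp: Chains_def relation_of_def)
  show "\<exists>u\<in>A. \<forall>a\<in>C. P a u" proof (cases "C = {}")
   case True
   have "(\<lambda>x. if x \<in> V then p x else 0) \<in> A" using sub hom by (auto simp: A_def Vadd Vmul)
   then show ?thesis using True by auto
  next
   case False
   define u where "u x = (if x \<in> V then (INF q\<in>C. q x) else 0)" for x
   have bdd: "bdd_below ((\<lambda>q. q x) ` C)" if "x \<in> V" for x
    using Alow'[OF _ that] CA by (intro bdd_belowI[of _ "- p (\<lambda>w. - x w)"]) auto
   have ul: "u x \<le> q x" if "q \<in> C" "x \<in> V" for q x
    using that bdd[OF that(2)] by (auto simp: u_def intro: cINF_lower)
   have ug: "t \<le> u x" if "x \<in> V" "\<And>q. q \<in> C \<Longrightarrow> t \<le> q x" for t x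
    using that False by (auto simp: u_def intro: cINF_greatest)
   have "u \<in> A" unfolding A_def proof (intro CollectI conjI ballI allI impI)
    fix x show "x \<notin> V \<Longrightarrow> u x = 0" by (simp add: u_def)
   next
    fix x assume x: "x \<in> V"
    obtain q where "q \<in> C" using False by auto
    then show "u x \<le> p x" using ul[of q x] Ap[of q x] CA x by auto
   next
    fix x y assume x: "x \<in> V" and y: "y \<in> V"
    have two: "u (\<lambda>w. x w + y w) \<le> q1 x + q2 y" if q: "q1 \<in> C" "q2 \<in> C" for q1 q2 proof -
     obtain q where q': "q \<in> C" "q x \<le> q1 x" "q y \<le> q2 y" using Cc[OF q] q x y by (auto simp: P_def)
     have "u (\<lambda>w. x w + y w) \<le> q (\<lambda>w. x w + y w)" using ul[OF q'(1)] Vadd[OF x y] by simp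
     also have "\<dots> \<le> q x + q y" using As[of q] q'(1) CA x y by auto
     finally show ?thesis using q' by simp
    qed
    have one: "u (\<lambda>w. x w + y w) - q1 x \<le> u y" if q1: "q1 \<in> C" for q1 proof (rule ug[OF y])
     fix q assume "q \<in> C"
     from two[OF q1 this] show "u (\<lambda>w. x w + y w) - q1 x \<le> q y" by simp
    qed
    have "u (\<lambda>w. x w + y w) - u y \<le> u x" proof (rule ug[OF x])
     fix q assume "q \<in> C"
     from one[OF this] show "u (\<lambda>w. x w + y w) - u y \<le> q x" by simp
    qed
    then show "u (\<lambda>w. x w + y w) \<le> u x + u y" by simp
   next
    fix x and c :: real assume x: "x \<in> V" and c: "0 \<le> c"
    show "u (\<lambda>w. c * x w) \<le> c * u x" proof (cases "c = 0")
     case True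
     obtain q where q: "q \<in> C" using False by auto
     then show ?thesis using ul[OF q V0] A0[of q] CA True by auto
    next
     case False
     then have cp: "c > 0" using c by simp
     have "u (\<lambda>w. c * x w) / c \<le> u x" proof (rule ug[OF x])
      fix q assume q: "q \<in> C"
      have "u (\<lambda>w. c * x w) \<le> q (\<lambda>w. c * x w)" by (rule ul[OF q Vmul[OF x]])
      also have "\<dots> \<le> c * q x" using Ah[of q x c] q CA x c by auto
      finally show "u (\<lambda>w. c * x w) / c \<le> q x" using cp by (simp add: field_simps)
     qed
     then show ?thesis using cp by (simp add: field_simps)
    qed
   qed
   then show ?thesis using ul by (auto simp: P_def)
  qed
 qed
 then obtain q where q: "q \<in> A" and min: "\<And>a. a \<in> A \<Longrightarrow> P q a \<Longrightarrow> a = q" by auto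
 \<comment> \<open>a minimal sublinear functional cannot be lowered in the direction \<open>z\<close>, so it is additive\<close>
 have super: "q x + q z \<le> q (\<lambda>w. x w + z w)" if x: "x \<in> V" and z: "z \<in> V" for x z proof -
  define g where "g x t = q (\<lambda>w. x w + t * z w) - t * q z" for x :: "'w \<Rightarrow> real" and t
  define qz where "qz x = (if x \<in> V then (INF t\<in>{0..}. g x t) else 0)" for x
  have Vt: "(\<lambda>w. x w + t * z w) \<in> V" if "x \<in> V" for x t by (rule Vadd[OF that Vmul[OF z]])
  have low: "- q (\<lambda>w. - x w) \<le> g x t" if x: "x \<in> V" and t: "t \<ge> 0" for x t
   using As[OF q Vt[OF x, of t] Vneg[OF x]] Ah'[OF q z t] by (simp add: g_def)
  have bdd: "bdd_below (g x ` {0..})" if "x \<in> V" for x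
   using low[OF that] by (intro bdd_belowI[of _ "- q (\<lambda>w. - x w)"]) auto
  have l: "qz x \<le> g x t" if "x \<in> V" "t \<ge> 0" for x t
   using that bdd[OF that(1)] by (auto simp: qz_def intro: cINF_lower)
  have gr: "s \<le> qz x" if "x \<in> V" "\<And>t. t \<ge> 0 \<Longrightarrow> s \<le> g x t" for s x
   using that by (auto simp: qz_def intro!: cINF_greatest)
  have le: "qz x \<le> q x" if "x \<in> V" for x using l[OF that, of 0] by (simp add: g_def)
  have "qz \<in> A" unfolding A_def proof (intro CollectI conjI ballI allI impI)
   fix x show "x \<notin> V \<Longrightarrow> qz x = 0" by (simp add: qz_def)
  next
   fix x assume "x \<in> V" then show "qz x \<le> p x" using le[of x] Ap[OF q, of x] by simp
  next
   fix x y assume x: "x \<in> V" and y: "y \<in> V"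
   have two: "qz (\<lambda>w. x w + y w) \<le> g x s + g y t" if "s \<ge> 0" "t \<ge> 0" for s t proof -
    have "qz (\<lambda>w. x w + y w) \<le> g (\<lambda>w. x w + y w) (s + t)" using l[OF Vadd[OF x y]] that by simp
    also have "\<dots> = q (\<lambda>w. (x w + s * z w) + (y w + t * z w)) - (s + t) * q z" by (simp add: g_def algebra_simps)
    also have "\<dots> \<le> g x s + g y t"
     using As[OF q Vt[OF x, of s] Vt[OF y, of t]] by (simp add: g_def algebra_simps)
    finally show ?thesis .
   qed
   have one: "qz (\<lambda>w. x w + y w) - g x s \<le> qz y" if s: "s \<ge> 0" for s proof (rule gr[OF y])
    fix t :: real assume "t \<ge> 0"
    from two[OF s this] show "qz (\<lambda>w. x w + y w) - g x s \<le> g y t" by simp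
   qed
   have "qz (\<lambda>w. x w + y w) - qz y \<le> qz x" proof (rule gr[OF x])
    fix s :: real assume "s \<ge> 0"
    from one[OF this] show "qz (\<lambda>w. x w + y w) - qz y \<le> g x s" by simp
   qed
   then show "qz (\<lambda>w. x w + y w) \<le> qz x + qz y" by simp
  next
   fix x and c :: real assume x: "x \<in> V" and c: "0 \<le> c"
   have st: "qz (\<lambda>w. c * x w) \<le> c * g x t" if "t \<ge> 0" for t proof -
    have "qz (\<lambda>w. c * x w) \<le> g (\<lambda>w. c * x w) (c * t)" using l[OF Vmul[OF x]] that c by simp
    also have "\<dots> = q (\<lambda>w. c * (x w + t * z w)) - c * t * q z" by (simp add: g_def algebra_simps)
    also have "\<dots> \<le> c * g x t" using Ah[OF q Vt[OF x, of t] c] by (simp add: g_def algebra_simps)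
    finally show ?thesis .
   qed
   show "qz (\<lambda>w. c * x w) \<le> c * qz x" proof (cases "c = 0")
    case True then show ?thesis using st[of 0] by simp
   next
    case False
    then have "qz (\<lambda>w. c * x w) / c \<le> qz x" using st c by (intro gr[OF x]) (auto simp: field_simps)
    then show ?thesis using False c by (simp add: field_simps)
   qed
  qed
  then have "qz = q" using min le by (auto simp: P_def)
  then show ?thesis using l[OF x, of 1] by (simp add: g_def)
 qed
 have add: "q (\<lambda>w. x w + y w) = q x + q y" if "x \<in> V" "y \<in> V" for x y using super[OF that] As[OF q that] by simp
 have neg: "q (\<lambda>w. - x w) = - q x" if x: "x \<in> V" for x using add[OF x Vneg[OF x]] A0[OF q] by simp
 have "q (\<lambda>w. c * x w) = c * q x" if x: "x \<in> V" for c x proof (cases "c \<ge> 0")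
  case True then show ?thesis using Ah'[OF q x] by simp
 next
  case False
  then show ?thesis using neg[OF Vmul[OF x, of "-c"]] Ah'[OF q x, of "-c"] by simp
 qed
 then show ?thesis using add Ap[OF q] by blast
qed

context cond_space
begin

definition monetary :: "(('w \<Rightarrow> real) \<Rightarrow> real) \<Rightarrow> bool" where
 "monetary r \<longleftrightarrow>
   (\<forall>x\<in>Linf M. \<forall>y\<in>Linf M. (AE w in M. x w \<le> y w) \<longrightarrow> r y \<le> r x) \<and>
   (\<forall>x\<in>Linf M. \<forall>c. r (\<lambda>w. x w + c) = r x - c) \<and>
   (\<forall>x\<in>Linf M. \<forall>y\<in>Linf M. \<forall>t. 0 \<le> t \<and> t \<le> 1 \<longrightarrow>
    r (\<lambda>w. t * x w + (1 - t) * y w) \<le> t * r x + (1 - t) * r y)"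

definition upper_lebesgue :: "(('w \<Rightarrow> real) \<Rightarrow> real) \<Rightarrow> bool" where
 "upper_lebesgue r \<longleftrightarrow> (\<forall>x x0. bounded_as_conv M x x0 \<longrightarrow> (\<forall>e>0. \<forall>\<^sub>F n in sequentially. r (x n) < r x0 + e))"

definition lower_fatou :: "(('w \<Rightarrow> real) \<Rightarrow> real) \<Rightarrow> bool" where
 "lower_fatou r \<longleftrightarrow> (\<forall>x x0. bounded_as_conv M x x0 \<longrightarrow> (\<forall>e>0. \<forall>\<^sub>F n in sequentially. r x0 - e < r (x n)))"

definition subgradient :: "(('w \<Rightarrow> real) \<Rightarrow> real) \<Rightarrow> ('w \<Rightarrow> real) \<Rightarrow> real \<Rightarrow> ('w \<Rightarrow> real) \<Rightarrow> bool" where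
 "subgradient r x0 e y \<longleftrightarrow> integrable M y \<and>
   (\<forall>x\<in>Linf M. r x0 - e + (\<integral>w. (x w - x0 w) * y w \<partial>M) \<le> r x)"

lemma monetary_mono: "monetary r \<Longrightarrow> x \<in> Linf M \<Longrightarrow> y \<in> Linf M \<Longrightarrow> (AE w in M. x w \<le> y w) \<Longrightarrow> r y \<le> r x"
 and monetary_cash: "monetary r \<Longrightarrow> x \<in> Linf M \<Longrightarrow> r (\<lambda>w. x w + c) = r x - c"
 and monetary_convex: "monetary r \<Longrightarrow> x \<in> Linf M \<Longrightarrow> y \<in> Linf M \<Longrightarrow> 0 \<le> t \<Longrightarrow> t \<le> 1 \<Longrightarrow>
   r (\<lambda>w. t * x w + (1 - t) * y w) \<le> t * r x + (1 - t) * r y" by (auto simp: monetary_def)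


lemma monetary_lipschitz:
 assumes "monetary r" "x \<in> Linf M" "y \<in> Linf M" "AE w in M. x w \<le> y w + c" shows "r y - c \<le> r x"
 using monetary_mono[OF assms(1,2) Linf_add[OF assms(3) Linf_const] assms(4)]
  monetary_cash[OF assms(1,3)] by simp

lemma monetary_translate:
 assumes r: "monetary r" and x0: "x0 \<in> Linf M"
 shows "monetary (\<lambda>x. r (\<lambda>w. x0 w + x w) - r x0)" unfolding monetary_def proof (intro conjI ballI allI impI)
 fix x y assume "x \<in> Linf M" "y \<in> Linf M" "AE w in M. x w \<le> y w"
 then show "r (\<lambda>w. x0 w + y w) - r x0 \<le> r (\<lambda>w. x0 w + x w) - r x0"
  using monetary_mono[OF r Linf_add[OF x0] Linf_add[OF x0]] by auto
next
 fix x and c :: real assume "x \<in> Linf M"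
 then show "r (\<lambda>w. x0 w + (x w + c)) - r x0 = r (\<lambda>w. x0 w + x w) - r x0 - c"
  using monetary_cash[OF r Linf_add[OF x0], of x c] by (simp add: add.assoc)
next
 fix x y and t :: real assume x: "x \<in> Linf M" and y: "y \<in> Linf M" and t: "0 \<le> t \<and> t \<le> 1"
 have eq: "(\<lambda>w. x0 w + (t * x w + (1 - t) * y w)) = (\<lambda>w. t * (x0 w + x w) + (1 - t) * (x0 w + y w))"
  by (auto simp: algebra_simps)
 show "r (\<lambda>w. x0 w + (t * x w + (1 - t) * y w)) - r x0
   \<le> t * (r (\<lambda>w. x0 w + x w) - r x0) + (1 - t) * (r (\<lambda>w. x0 w + y w) - r x0)"
  using monetary_convex[OF r Linf_add[OF x0 x] Linf_add[OF x0 y], of t] t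
  unfolding eq by (simp add: algebra_simps)
qed

lemma bounded_as_conv_shift:
 assumes "bounded_as_conv M x x1" "x0 \<in> Linf M"
 shows "bounded_as_conv M (\<lambda>n w. x0 w + x n w) (\<lambda>w. x0 w + x1 w)" proof -
 obtain C where C: "\<And>n. AE w in M. \<bar>x n w\<bar> \<le> C" using assms by (auto simp: bounded_as_conv_def)
 obtain D where D: "AE w in M. \<bar>x0 w\<bar> \<le> D" using LinfE[OF assms(2)] by blast
 have "AE w in M. \<bar>x0 w + x n w\<bar> \<le> D + C" for n using C[of n] D by eventually_elim auto
 moreover have "AE w in M. (\<lambda>n. x n w) \<longlonglongrightarrow> x1 w" using assms(1) by (simp add: bounded_as_conv_def)
 then have "AE w in M. (\<lambda>n. x0 w + x n w) \<longlonglongrightarrow> x0 w + x1 w" by eventually_elim (auto intro: tendsto_intros)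
 ultimately show ?thesis using assms unfolding bounded_as_conv_def by (auto intro: Linf_add)
qed

subsection \<open>Functionals represented by integrable functions\<close>

text \<open>Continuity makes \<open>A \<mapsto> l (indicator A)\<close> a countably additive measure dominated by the given
  one; its Radon--Nikodym derivative represents \<open>l\<close> on simple functions, and monotone approximation
  does the rest.\<close>

lemma positive_functional_density:
 assumes add: "\<And>x y. x \<in> Linf M \<Longrightarrow> y \<in> Linf M \<Longrightarrow> l (\<lambda>w. x w + y w) = l x + l y"
  and mul: "\<And>x c. x \<in> Linf M \<Longrightarrow> l (\<lambda>w. c * x w) = c * l x"
  and pos: "\<And>x. x \<in> Linf M \<Longrightarrow> AE w in M. 0 \<le> x w \<Longrightarrow> 0 \<le> l x"
  and cont: "\<And>x. bounded_as_conv M x (\<lambda>_. 0) \<Longrightarrow> (\<lambda>n. l (x n)) \<longlonglongrightarrow> 0"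
 shows "\<exists>y. integrable M y \<and> (AE w in M. 0 \<le> y w) \<and> (\<forall>x\<in>Linf M. l x = (\<integral>w. x w * y w \<partial>M))" proof -
 have neg: "l (\<lambda>w. - x w) = - l x" if "x \<in> Linf M" for x using mul[OF that, of "-1"] by simp
 have diff: "l (\<lambda>w. x w - y w) = l x - l y" if "x \<in> Linf M" "y \<in> Linf M" for x y
  using add[OF that(1) Linf_uminus[OF that(2)]] neg[OF that(2)] by simp
 have cong: "l x = l y" if "x \<in> Linf M" "y \<in> Linf M" "AE w in M. x w = y w" for x y proof (rule antisym)
  have "AE w in M. 0 \<le> y w - x w" "AE w in M. 0 \<le> x w - y w" using that(3) by auto
  then show "l x \<le> l y" "l y \<le> l x" using pos[OF Linf_diff[OF that(2,1)]] pos[OF Linf_diff[OF that(1,2)]]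
    diff[OF that(2,1)] diff[OF that(1,2)] by simp_all
 qed
 have ipos: "0 \<le> l (indicator A)" if "A \<in> sets M" for A
  by (rule pos[OF Linf_ind[OF that]]) (auto simp: indicator_def)
 define \<mu> where "\<mu> A = ennreal (l (indicator A))" for A
 define N where "N = measure_of (space M) (sets M) \<mu>"
 have setsN: "sets N = sets M" and spaceN: "space N = space M" by (simp_all add: N_def)
 have l0: "l (\<lambda>_. 0) = 0" using mul[OF Linf_const[of 0], of 0] by simp
 have iempty: "(indicator {} :: 'w \<Rightarrow> real) = (\<lambda>_. 0)" by (auto simp: indicator_def)
 have pos\<mu>: "positive (sets M) \<mu>" by (simp add: positive_def \<mu>_def iempty l0)
 have add\<mu>: "additive (sets M) \<mu>" unfolding additive_def proof (intro ballI impI)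
  fix A B assume AB: "A \<in> sets M" "B \<in> sets M" "A \<inter> B = {}"
  have "(indicator (A \<union> B) :: 'w \<Rightarrow> real) = (\<lambda>w. indicator A w + indicator B w)"
   using AB(3) by (auto simp: fun_eq_iff split: split_indicator)
  then have "l (indicator (A \<union> B)) = l (indicator A) + l (indicator B)"
   using add[OF Linf_ind[OF AB(1)] Linf_ind[OF AB(2)]] by simp
  then show "\<mu> (A \<union> B) = \<mu> A + \<mu> B" using ipos[OF AB(1)] ipos[OF AB(2)] by (simp add: \<mu>_def ennreal_plus)
 qed
 have ca: "countably_additive (sets M) \<mu>"
 proof (rule sets.empty_continuous_imp_countably_additive[OF pos\<mu> add\<mu>])
  show "\<forall>A\<in>sets M. \<mu> A \<noteq> \<infinity>" by (simp add: \<mu>_def)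
  fix A :: "nat \<Rightarrow> 'w set" assume A: "range A \<subseteq> sets M" "decseq A" "(\<Inter>i. A i) = {}"
  have "bounded_as_conv M (\<lambda>n. indicator (A n)) (\<lambda>_. 0)" unfolding bounded_as_conv_def proof (intro conjI allI)
   fix n show "indicator (A n) \<in> Linf M" using A(1) by (intro Linf_ind) auto
  next
   show "(\<lambda>_. 0) \<in> Linf M" by (rule Linf_const)
   show "\<exists>C. \<forall>n. AE w in M. \<bar>indicator (A n) w :: real\<bar> \<le> C" by (intro exI[of _ 1]) (auto simp: indicator_def)
   show "AE w in M. (\<lambda>n. indicator (A n) w :: real) \<longlonglongrightarrow> 0" proof (rule AE_I2)
    fix w
    have "(\<lambda>n. indicator (A n) w :: real) \<longlonglongrightarrow> indicator (\<Inter>i. A i) w" by (rule LIMSEQ_indicator_decseq[OF A(2)])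
    then show "(\<lambda>n. indicator (A n) w :: real) \<longlonglongrightarrow> 0" using A(3) by simp
   qed
  qed
  from cont[OF this] have "(\<lambda>n. ennreal (l (indicator (A n)))) \<longlonglongrightarrow> ennreal 0" by (rule tendsto_ennrealI)
  then show "(\<lambda>i. \<mu> (A i)) \<longlonglongrightarrow> 0" by (simp add: \<mu>_def)
 qed
 have emN: "emeasure N A = ennreal (l (indicator A))" if "A \<in> sets M" for A
  using emeasure_measure_of_sigma[OF sets.sigma_algebra_axioms pos\<mu> ca that] by (simp add: N_def \<mu>_def)
 have "absolutely_continuous M N" unfolding absolutely_continuous_def proof
  fix A assume A: "A \<in> null_sets M"
  then have As: "A \<in> sets M" by auto
  have "AE w in M. w \<notin> A" using AE_not_in[OF A] .
  then have "AE w in M. (indicator A w :: real) = 0" by eventually_elim (simp add: indicator_def)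
  then have "l (indicator A) = l (\<lambda>_. 0)" by (rule cong[OF Linf_ind[OF As] Linf_const])
  then show "A \<in> null_sets N" using emN[OF As] l0 As setsN by (auto simp: null_sets_def)
 qed
 from Radon_Nikodym[OF this setsN] obtain f where f: "f \<in> borel_measurable M" "density M f = N" by auto
 have "(\<integral>\<^sup>+w. f w \<partial>M) = emeasure N (space M)"
  unfolding f(2)[symmetric] by (simp add: emeasure_density[OF f(1)] cong: nn_integral_cong)
 also have "\<dots> < \<infinity>" using emN by simp
 finally have ffin: "(\<integral>\<^sup>+w. f w \<partial>M) \<noteq> \<infinity>" by simp
 have fAE: "AE w in M. f w \<noteq> \<infinity>" by (rule nn_integral_PInf_AE[OF f(1) ffin])
 define y where "y w = enn2real (f w)" for w
 have ym: "y \<in> L0 M" unfolding y_def using f(1) by measurable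
 have y0: "0 \<le> y w" for w by (simp add: y_def)
 have yf: "AE w in M. ennreal (y w) = f w" using fAE by eventually_elim (simp add: y_def less_top)
 have "(\<integral>\<^sup>+w. ennreal (y w) \<partial>M) = (\<integral>\<^sup>+w. f w \<partial>M)" by (rule nn_integral_cong_AE[OF yf])
 then have yi: "integrable M y" using ym y0 ffin by (intro integrableI_nonneg) (auto simp: less_top)
 have ind: "l (indicator A) = (\<integral>w. indicator A w * y w \<partial>M)" if A: "A \<in> sets M" for A proof -
  have "ennreal (l (indicator A)) = (\<integral>\<^sup>+w. f w * indicator A w \<partial>M)"
   using emN[OF A] emeasure_density[OF f(1) A] f(2) by simp
  also have "\<dots> = (\<integral>\<^sup>+w. ennreal (indicator A w * y w) \<partial>M)"
   by (rule nn_integral_cong_AE) (use yf in \<open>eventually_elim, auto simp: indicator_def\<close>)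
  also have "\<dots> = ennreal (\<integral>w. indicator A w * y w \<partial>M)"
   using y0 integrable_Linf_L1[OF Linf_ind[OF A] yi] by (intro nn_integral_eq_integral) auto
  finally show ?thesis using ipos[OF A] y0 by (subst (asm) ennreal_inj) (auto intro!: integral_nonneg_AE)
 qed
 have nonneg: "u \<in> Linf M \<longrightarrow> l u = (\<integral>w. u w * y w \<partial>M)" if u: "u \<in> L0 M" "\<And>w. 0 \<le> u w" for u using u
 proof (induction rule: borel_measurable_induct_real)
  case (set A) then show ?case using ind by simp
 next
  case (mult u c)
  show ?case proof
   assume cu: "(\<lambda>x. c * u x) \<in> Linf M"
   show "l (\<lambda>x. c * u x) = (\<integral>w. c * u w * y w \<partial>M)" proof (cases "c = 0")
    case True then show ?thesis using l0 by simp
   next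
    case False
    then have "u = (\<lambda>w. (1/c) * (c * u w))" by auto
    then have uL: "u \<in> Linf M" using Linf_cmult[OF cu, of "1/c"] by simp
    show ?thesis using mult.IH uL mul[OF uL, of c] by (simp add: mult.assoc)
   qed
  qed
 next
  case (add u v)
  show ?case proof
   assume uv: "(\<lambda>x. v x + u x) \<in> Linf M"
   obtain C where C: "AE w in M. \<bar>v w + u w\<bar> \<le> C" using LinfE[OF uv] by blast
   have u0: "0 \<le> u w" and v0: "0 \<le> v w" for w by (fact add)+
   have "\<bar>u w\<bar> \<le> \<bar>v w + u w\<bar>" "\<bar>v w\<bar> \<le> \<bar>v w + u w\<bar>" for w using u0[of w] v0[of w] by auto
   then have "AE w in M. \<bar>u w\<bar> \<le> C" "AE w in M. \<bar>v w\<bar> \<le> C"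
    using C by (auto elim!: eventually_mono intro: order_trans)
   moreover have "u \<in> L0 M" "v \<in> L0 M" by (fact add)+
   ultimately have L: "u \<in> Linf M" "v \<in> Linf M" by (auto intro: LinfI)
   then show "l (\<lambda>x. v x + u x) = (\<integral>w. (v w + u w) * y w \<partial>M)"
    using add assms(1)[of v u] integrable_Linf_L1[OF _ yi] by (simp add: distrib_right)
  qed
 next
  case (seq U)
  show ?case proof
   assume uL: "u \<in> Linf M"
   obtain C where C: "AE w in M. \<bar>u w\<bar> \<le> C" using LinfE[OF uL] by blast
   have Ule: "U i w \<le> u w" if "w \<in> space M" for i w
    using seq(3) seq(4)[OF that] by (intro incseq_le) (auto simp: incseq_def le_fun_def)
   have UC: "AE w in M. \<bar>U i w\<bar> \<le> C" for i using C AE_space proof eventually_elim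
    case (elim w) then show ?case using Ule[OF elim(2), of i] seq(2)[of i w] by simp
   qed
   have UL: "U i \<in> Linf M" for i using seq(1) UC by (rule LinfI)
   have "bounded_as_conv M (\<lambda>i w. u w - U i w) (\<lambda>_. 0)" unfolding bounded_as_conv_def
   proof (intro conjI allI exI)
    fix i show "(\<lambda>w. u w - U i w) \<in> Linf M" by (rule Linf_diff[OF uL UL])
    show "AE w in M. \<bar>u w - U i w\<bar> \<le> C + C" using C UC[of i] by eventually_elim auto
   next
    show "(\<lambda>_. 0) \<in> Linf M" by (rule Linf_const)
    show "AE w in M. (\<lambda>n. u w - U n w) \<longlonglongrightarrow> 0" using AE_space proof eventually_elim
     case (elim w) then show ?case using tendsto_diff[OF tendsto_const seq(4)[OF elim], of "u w"] by simp
    qed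
   qed
   from cont[OF this] have "(\<lambda>i. l u - l (U i)) \<longlonglongrightarrow> 0" using diff[OF uL UL] by simp
   then have c1: "(\<lambda>i. l (U i)) \<longlonglongrightarrow> l u"
    using tendsto_diff[OF tendsto_const, of "\<lambda>i. l u - l (U i)" 0 sequentially "l u"] by simp
   have "(\<lambda>i. \<integral>w. U i w * y w \<partial>M) \<longlonglongrightarrow> (\<integral>w. u w * y w \<partial>M)"
   proof (rule integral_dominated_convergence[where w = "\<lambda>w. C * y w"])
    show "(\<lambda>w. u w * y w) \<in> L0 M" using Linf_borel[OF uL] ym by measurable
    show "(\<lambda>w. U i w * y w) \<in> L0 M" for i using seq(1)[of i] ym by measurable
    show "integrable M (\<lambda>w. C * y w)" using yi by simp
    show "AE w in M. (\<lambda>i. U i w * y w) \<longlonglongrightarrow> u w * y w"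
     using AE_space by eventually_elim (auto intro!: tendsto_intros seq(4))
    show "AE w in M. norm (U i w * y w) \<le> C * y w" for i
     using UC[of i] by eventually_elim (auto simp: abs_mult y0 intro: mult_right_mono)
   qed
   moreover have "(\<integral>w. U i w * y w \<partial>M) = l (U i)" for i using seq(5)[of i] UL[of i] by simp
   ultimately show "l u = (\<integral>w. u w * y w \<partial>M)" using c1 LIMSEQ_unique by auto
  qed
 qed
 have "l x = (\<integral>w. x w * y w \<partial>M)" if x: "x \<in> Linf M" for x proof -
  let ?p = "\<lambda>w. max (x w) 0" and ?n = "\<lambda>w. max (- x w) 0"
  have p: "?p \<in> Linf M" and n: "?n \<in> Linf M"
   using Linf_max[OF x Linf_const[of 0]] Linf_max[OF Linf_uminus[OF x] Linf_const[of 0]] by auto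
  have eq: "x = (\<lambda>w. ?p w - ?n w)" by (auto simp: max_def)
  have "l x = l ?p - l ?n" using diff[OF p n] eq by simp
  also have "\<dots> = (\<integral>w. ?p w * y w \<partial>M) - (\<integral>w. ?n w * y w \<partial>M)"
   using nonneg[of ?p] nonneg[of ?n] p n Linf_borel[OF p] Linf_borel[OF n] by simp
  also have "\<dots> = (\<integral>w. ?p w * y w - ?n w * y w \<partial>M)"
   using integrable_Linf_L1[OF p yi] integrable_Linf_L1[OF n yi] by simp
  also have "\<dots> = (\<integral>w. x w * y w \<partial>M)" by (intro Bochner_Integration.integral_cong) (auto simp: max_def)
  finally show ?thesis .
 qed
 then show ?thesis using yi y0 by (intro exI[of _ y]) auto
qed

text \<open>The directional derivative of \<open>r\<close> at \<open>x0\<close> is sublinear and inherits upper semicontinuity along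
  bounded convergent sequences, so every linear functional below it has a density.\<close>

lemma upper_lebesgue_imp_subgradient:
 assumes r: "monetary r" and u: "upper_lebesgue r" and x0: "x0 \<in> Linf M"
 shows "\<exists>y. subgradient r x0 0 y" proof -
 define D where "D x t = (r (\<lambda>w. x0 w + t * x w) - r x0) / t" for x t
 define p where "p x = (INF t\<in>{0<..}. D x t)" for x
 have L: "(\<lambda>w. x0 w + t * x w) \<in> Linf M" if "x \<in> Linf M" for x t by (rule Linf_add[OF x0 Linf_cmult[OF that]])
 have bdd: "bdd_below (D x ` {0<..})" if x: "x \<in> Linf M" for x proof -
  obtain C where C: "AE w in M. \<bar>x w\<bar> \<le> C" using LinfE[OF x] by blast
  show ?thesis proof (rule bdd_belowI2[of _ "- C"])
   fix t :: real assume "t \<in> {0<..}"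
   then have t: "t > 0" by simp
   have "AE w in M. x0 w + t * x w \<le> x0 w + t * C" using C by eventually_elim (use t in auto)
   from monetary_lipschitz[OF r L[OF x] x0 this] have "r x0 - t * C \<le> r (\<lambda>w. x0 w + t * x w)" .
   then show "- C \<le> D x t" using t by (simp add: D_def pos_le_divide_eq algebra_simps)
  qed
 qed
 have pl: "p x \<le> D x t" if "x \<in> Linf M" "t > 0" for x t
  unfolding p_def using that by (intro cINF_lower[OF bdd]) auto
 have pg: "s \<le> p x" if "\<And>t. t > 0 \<Longrightarrow> s \<le> D x t" for s x unfolding p_def using that by (intro cINF_greatest) auto
 have sub: "p (\<lambda>w. x w + y w) \<le> p x + p y" if x: "x \<in> Linf M" and y: "y \<in> Linf M" for x y proof -
  have two: "p (\<lambda>w. x w + y w) \<le> D x s + D y t" if s: "s > 0" and t: "t > 0" for s t proof -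
   let ?u = "s * t / (s + t)"
   have up: "?u > 0" and st: "s + t > 0" using s t by auto
   have a: "t / (s + t) + s / (s + t) = 1" using st by (simp flip: add_divide_distrib add.commute)
   have b: "1 - t / (s + t) = s / (s + t)" using a by simp
   have eq: "(\<lambda>w. x0 w + ?u * (x w + y w))
     = (\<lambda>w. t/(s+t) * (x0 w + s * x w) + (1 - t/(s+t)) * (x0 w + t * y w))" proof
    fix w
    have "t/(s+t) * (x0 w + s * x w) + s/(s+t) * (x0 w + t * y w)
      = (t/(s+t) + s/(s+t)) * x0 w + ?u * (x w + y w)" by (simp add: algebra_simps add_divide_distrib)
    then show "x0 w + ?u * (x w + y w) = t/(s+t) * (x0 w + s * x w) + (1 - t/(s+t)) * (x0 w + t * y w)"
     unfolding a b by simp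
   qed
   have "r (\<lambda>w. x0 w + ?u * (x w + y w)) \<le> t/(s+t) * r (\<lambda>w. x0 w + s * x w) + (1 - t/(s+t)) * r (\<lambda>w. x0 w + t * y w)"
    unfolding eq using s t by (intro monetary_convex[OF r L[OF x] L[OF y]]) auto
   then have "r (\<lambda>w. x0 w + ?u * (x w + y w)) - (t/(s+t) + s/(s+t)) * r x0
     \<le> t/(s+t) * (r (\<lambda>w. x0 w + s * x w) - r x0) + s/(s+t) * (r (\<lambda>w. x0 w + t * y w) - r x0)"
    unfolding b by (simp add: algebra_simps)
   also have "r (\<lambda>w. x0 w + s * x w) - r x0 = s * D x s" using s by (simp add: D_def)
   also have "r (\<lambda>w. x0 w + t * y w) - r x0 = t * D y t" using t by (simp add: D_def)
   also have "t/(s+t) * (s * D x s) + s/(s+t) * (t * D y t) = ?u * (D x s + D y t)"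
    by (simp add: algebra_simps add_divide_distrib)
   finally have "D (\<lambda>w. x w + y w) ?u \<le> D x s + D y t"
    using up unfolding a by (simp only: D_def pos_divide_le_eq) (simp add: mult.commute)
   then show ?thesis using pl[OF Linf_add[OF x y] up] by simp
  qed
  have one: "p (\<lambda>w. x w + y w) - D x s \<le> p y" if s: "s > 0" for s proof (rule pg)
   fix t :: real assume "t > 0"
   from two[OF s this] show "p (\<lambda>w. x w + y w) - D x s \<le> D y t" by simp
  qed
  have "p (\<lambda>w. x w + y w) - p y \<le> p x" proof (rule pg)
   fix s :: real assume "s > 0"
   from one[OF this] show "p (\<lambda>w. x w + y w) - p y \<le> D x s" by simp
  qed
  then show ?thesis by simp
 qed
 have hom: "p (\<lambda>w. c * x w) \<le> c * p x" if x: "x \<in> Linf M" and c: "0 \<le> c" for x c proof (cases "c = 0")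
  case True
  then show ?thesis using pl[OF Linf_const[of 0], of 1] by (simp add: D_def)
 next
  case False
  then have c: "c > 0" using c by simp
  have "p (\<lambda>w. c * x w) / c \<le> p x" proof (rule pg)
   fix t :: real assume t: "t > 0"
   have "p (\<lambda>w. c * x w) \<le> D (\<lambda>w. c * x w) (t / c)" using t c by (intro pl[OF Linf_cmult[OF x]]) auto
   also have "\<dots> = c * D x t" using c t by (simp add: D_def)
   finally show "p (\<lambda>w. c * x w) / c \<le> D x t" using c by (simp add: pos_divide_le_eq mult.commute)
  qed
  then show ?thesis using c by (simp add: pos_divide_le_eq mult.commute)
 qed
 obtain l where ladd: "\<And>x y. x \<in> Linf M \<Longrightarrow> y \<in> Linf M \<Longrightarrow> l (\<lambda>w. x w + y w) = l x + l y"
  and lmul: "\<And>x c. x \<in> Linf M \<Longrightarrow> l (\<lambda>w. c * x w) = c * l x" and lp: "\<And>x. x \<in> Linf M \<Longrightarrow> l x \<le> p x"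
  using linear_functional_below_sublinear[of "Linf M" p, OF Linf_const Linf_add Linf_cmult sub hom] by blast
 have lr: "l x \<le> r (\<lambda>w. x0 w + x w) - r x0" if "x \<in> Linf M" for x
  using lp[OF that] pl[OF that, of 1] by (simp add: D_def)
 have lneg: "l (\<lambda>w. - x w) = - l x" if "x \<in> Linf M" for x using lmul[OF that, of "-1"] by simp
 have "\<exists>y. integrable M y \<and> (AE w in M. 0 \<le> y w) \<and> (\<forall>x\<in>Linf M. - l x = (\<integral>w. x w * y w \<partial>M))"
 proof (rule positive_functional_density)
  fix x assume x: "x \<in> Linf M" and p: "AE w in M. 0 \<le> x w"
  have "r (\<lambda>w. x0 w + x w) \<le> r x0" using p by (intro monetary_mono[OF r x0 Linf_add[OF x0 x]]) auto
  then show "0 \<le> - l x" using lr[OF x] by simp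
 next
  fix x assume x: "bounded_as_conv M x (\<lambda>_. 0)"
  have xL: "x n \<in> Linf M" for n using x by (simp add: bounded_as_conv_def)
  have x': "bounded_as_conv M (\<lambda>n w. - x n w) (\<lambda>_. 0)"
   using x tendsto_minus[of _ "0::real"] unfolding bounded_as_conv_def
   by (auto intro: Linf_uminus elim!: eventually_mono)
  show "(\<lambda>n. - l (x n)) \<longlonglongrightarrow> 0" proof (rule tendstoI)
   fix e :: real assume e: "e > 0"
   have "\<forall>\<^sub>F n in sequentially. r (\<lambda>w. x0 w + x n w) < r (\<lambda>w. x0 w + 0) + e"
    using u e bounded_as_conv_shift[OF x x0] unfolding upper_lebesgue_def by blast
   moreover have "\<forall>\<^sub>F n in sequentially. r (\<lambda>w. x0 w + - x n w) < r (\<lambda>w. x0 w + 0) + e"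
    using u e bounded_as_conv_shift[OF x' x0] unfolding upper_lebesgue_def by blast
   ultimately show "\<forall>\<^sub>F n in sequentially. dist (- l (x n)) 0 < e" proof eventually_elim
    case (elim n)
    then show ?case using lr[OF xL[of n]] lr[OF Linf_uminus[OF xL[of n]]] lneg[OF xL[of n]]
     by (auto simp: dist_real_def abs_less_iff)
   qed
  qed
 qed (auto simp: ladd lmul)
 then obtain y where y: "integrable M y" "\<And>x. x \<in> Linf M \<Longrightarrow> - l x = (\<integral>w. x w * y w \<partial>M)" by blast
 have "subgradient r x0 0 (\<lambda>w. - y w)" unfolding subgradient_def proof (intro conjI ballI)
  show "integrable M (\<lambda>w. - y w)" using y(1) by simp
  fix x assume x: "x \<in> Linf M"
  have d: "(\<lambda>w. x w - x0 w) \<in> Linf M" by (rule Linf_diff[OF x x0])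
  have "(\<integral>w. (x w - x0 w) * - y w \<partial>M) = l (\<lambda>w. x w - x0 w)" using y(2)[OF d] by simp
  then show "r x0 - 0 + (\<integral>w. (x w - x0 w) * - y w \<partial>M) \<le> r x" using lr[OF d] by simp
 qed
 then show ?thesis by blast
qed

subsection \<open>Attained suprema force continuity from below\<close>

section \<open>The argument of James and Simons\<close>

text \<open>The tail suprema of the distances to the limit form a decreasing majorant, so bounded
  convergence reduces to bounded decreasing sequences.\<close>

lemma bounded_as_conv_tail:
 assumes "bounded_as_conv M x x0"
 obtains z C where "\<And>n. z n \<in> Linf M" "\<And>n w. 0 \<le> z n w" "\<And>n w. z n w \<le> C"
  "\<And>m n w. m \<le> n \<Longrightarrow> z n w \<le> z m w" "AE w in M. (\<lambda>n. z n w) \<longlonglongrightarrow> 0"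
  "\<And>n. AE w in M. \<bar>x n w - x0 w\<bar> \<le> z n w" proof -
 have xL: "\<And>n. x n \<in> Linf M" and x0L: "x0 \<in> Linf M"
  and lim: "AE w in M. (\<lambda>n. x n w) \<longlonglongrightarrow> x0 w" using assms by (auto simp: bounded_as_conv_def)
 obtain C1 where C1: "\<And>n. AE w in M. \<bar>x n w\<bar> \<le> C1" using assms by (auto simp: bounded_as_conv_def)
 obtain C0 where C0: "AE w in M. \<bar>x0 w\<bar> \<le> C0" using LinfE[OF x0L] by blast
 define C where "C = \<bar>C1\<bar> + \<bar>C0\<bar>"
 define d where "d n w = min C \<bar>x n w - x0 w\<bar>" for n w
 have d0: "0 \<le> d n w" and dC: "d n w \<le> C" for n w by (auto simp: d_def C_def)
 have dm: "d n \<in> L0 M" for n unfolding d_def using Linf_borel[OF xL[of n]] Linf_borel[OF x0L] by measurable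
 define z where "z n w = (SUP k\<in>{n..}. d k w)" for n w
 have bdd: "bdd_above ((\<lambda>k. d k w) ` {n..})" for n w using dC by (intro bdd_aboveI[of _ C]) auto
 have le: "d k w \<le> z n w" if "n \<le> k" for n k w unfolding z_def using that by (intro cSUP_upper[OF _ bdd]) auto
 have least: "z n w \<le> t" if "\<And>k. n \<le> k \<Longrightarrow> d k w \<le> t" for n w t
  unfolding z_def using that by (intro cSUP_least) auto
 have z0: "0 \<le> z n w" for n w using le[of n n w] d0[of n w] by simp
 have zC: "z n w \<le> C" for n w by (rule least) (rule dC)
 have zm: "z n \<in> L0 M" for n unfolding z_def using bdd dm by (intro borel_measurable_cSUP) auto
 have zL: "z n \<in> Linf M" for n by (rule LinfI[OF zm, of n C]) (use z0 zC in auto)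
 have anti: "z n w \<le> z m w" if "m \<le> n" for m n w by (rule least) (use that in \<open>auto intro: le\<close>)
 have zlim: "AE w in M. (\<lambda>n. z n w) \<longlonglongrightarrow> 0" using lim proof eventually_elim
  case (elim w)
  show ?case proof (rule LIMSEQ_I)
   fix e :: real assume e: "0 < e"
   obtain N where N: "\<And>n. n \<ge> N \<Longrightarrow> norm (x n w - x0 w) < e / 2" using LIMSEQ_D[OF elim, of "e / 2"] e by auto
   have "z n w \<le> e / 2" if "n \<ge> N" for n proof (rule least)
    fix k assume "n \<le> k"
    then have "\<bar>x k w - x0 w\<bar> \<le> e / 2" using N[of k] that by simp
    then show "d k w \<le> e / 2" unfolding d_def by (rule min.coboundedI2)
   qed
   then show "\<exists>no. \<forall>n\<ge>no. norm (z n w - 0) < e" using z0 e by (intro exI[of _ N]) (force simp: abs_less_iff)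
  qed
 qed
 have bound: "AE w in M. \<bar>x n w - x0 w\<bar> \<le> z n w" for n using C1[of n] C0 proof eventually_elim
  case (elim w)
  have "\<bar>x n w - x0 w\<bar> \<le> C" using elim by (auto simp: C_def)
  then have "\<bar>x n w - x0 w\<bar> = d n w" by (simp add: d_def)
  then show ?case using le[of n n w] by simp
 qed
 show ?thesis by (rule that[OF zL z0 zC anti zlim bound])
qed

text \<open>Suppose that subtracting \<open>z n\<close>, decreasing to zero, raises \<open>r\<close> by at least \<open>e\<close> for all \<open>n\<close>.
  Choose the terms of a series \<open>\<Sum> 2^-n z (k n)\<close> so that each is minimal up to a summable error. A
  subgradient at the sum \<open>G\<close> then still registers a fixed gain against every late \<open>z n\<close>, although
  its integral against \<open>z n\<close> tends to zero.\<close>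

lemma subgradients_imp_upper_lebesgue:
 assumes r: "monetary r" and sg: "\<And>x. x \<in> Linf M \<Longrightarrow> \<exists>y. subgradient r x 0 y"
 shows "upper_lebesgue r" unfolding upper_lebesgue_def proof (intro allI impI)
 fix x x0 and e :: real assume bc: "bounded_as_conv M x x0" and e: "0 < e"
 have x0: "x0 \<in> Linf M" and xL: "\<And>n. x n \<in> Linf M" using bc by (auto simp: bounded_as_conv_def)
 obtain z C where zL: "\<And>n. z n \<in> Linf M" and z0: "\<And>n w. 0 \<le> z n w" and zC: "\<And>n w. z n w \<le> C"
  and anti: "\<And>m n w. m \<le> n \<Longrightarrow> z n w \<le> z m w" and zlim: "AE w in M. (\<lambda>n. z n w) \<longlonglongrightarrow> 0"
  and xz: "\<And>n. AE w in M. \<bar>x n w - x0 w\<bar> \<le> z n w" using bounded_as_conv_tail[OF bc] by blast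
 define p where "p v = r (\<lambda>w. x0 w - v w) - r x0" for v
 have L: "(\<lambda>w. x0 w - v w) \<in> Linf M" if "v \<in> Linf M" for v by (rule Linf_diff[OF x0 that])
 have pmono: "p u \<le> p v" if "u \<in> Linf M" "v \<in> Linf M" "\<And>w. u w \<le> v w" for u v
  using monetary_mono[OF r L[OF that(2)] L[OF that(1)]] that(3) by (auto simp: p_def)
 have plip: "p u - c \<le> p v" if "u \<in> Linf M" "v \<in> Linf M" "\<And>w. u w - c \<le> v w" for u v c
  using monetary_lipschitz[OF r L[OF that(2)] L[OF that(1)], of c] that(3) by (auto simp: p_def algebra_simps)
 have phalf: "p (\<lambda>w. (u w + v w) / 2) \<le> (p u + p v) / 2" if "u \<in> Linf M" "v \<in> Linf M" for u v proof -
  have "(\<lambda>w. x0 w - (u w + v w) / 2) = (\<lambda>w. 1/2 * (x0 w - u w) + (1 - 1/2) * (x0 w - v w))"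
   by (auto simp: field_simps)
  then show ?thesis using monetary_convex[OF r L[OF that(1)] L[OF that(2)], of "1/2"]
   by (simp add: p_def field_simps)
 qed
 have "\<exists>n. p (z n) < e" proof (rule ccontr)
  assume "\<not> ?thesis"
  then have low: "\<And>n. e \<le> p (z n)" by (meson not_less)
  define T where "T s n k = p (\<lambda>w. s w + (1/2)^n * z k w)" for s n k
  define m where "m s n = (INF k. T s n k)" for s n
  define ep where "ep n = e / 4 * (1/4)^n" for n :: nat
  have epos: "ep n > 0" for n using e by (simp add: ep_def)
  have sL: "(\<lambda>w. s w + c * z k w) \<in> Linf M" if "s \<in> Linf M" for s c k
   by (rule Linf_add[OF that Linf_cmult[OF zL]])
  have Tb: "p s \<le> T s n k" if "s \<in> Linf M" for s n k
   unfolding T_def by (rule pmono[OF that sL[OF that]]) (simp add: z0)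
  have bdd: "bdd_below (range (T s n))" if "s \<in> Linf M" for s n
   using Tb[OF that] by (intro bdd_belowI[of _ "p s"]) auto
  have mle: "m s n \<le> T s n k" if "s \<in> Linf M" for s n k
   unfolding m_def by (rule cINF_lower[OF bdd[OF that]]) simp
  have ex: "\<exists>k\<ge>n. T s n k \<le> m s n + ep n" if s: "s \<in> Linf M" for s n proof -
   have "\<exists>k\<in>UNIV. T s n k < m s n + ep n"
    by (subst cINF_less_iff[OF _ bdd[OF s, of n], symmetric]) (use epos[of n] in \<open>auto simp: m_def\<close>)
   then obtain k where k: "T s n k < m s n + ep n" by blast
   have "T s n (max n k) \<le> T s n k" unfolding T_def by (rule pmono[OF sL[OF s] sL[OF s]]) (simp add: anti)
   then show ?thesis using k by (intro exI[of _ "max n k"]) auto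
  qed
  define K where "K n s = (SOME k. n \<le> k \<and> T s n k \<le> m s n + ep n)" for n s
  have K: "n \<le> K n s" "T s n (K n s) \<le> m s n + ep n" if "s \<in> Linf M" for n s
   using someI_ex[OF ex[OF that, of n], unfolded] by (auto simp: K_def)
  define S where "S = rec_nat (\<lambda>_. 0) (\<lambda>n s w. s w + (1/2)^Suc n * z (K n s) w)"
  have S0: "S 0 = (\<lambda>_. 0)" and SS: "S (Suc n) = (\<lambda>w. S n w + (1/2)^Suc n * z (K n (S n)) w)" for n
   by (simp_all add: S_def)
  have SL: "S n \<in> Linf M" for n by (induction n) (auto simp: S0 SS simp del: power_Suc intro: Linf_const sL)
  define k where "k n = K n (S n)" for n
  have kn: "n \<le> k n" for n using K(1)[OF SL] by (simp add: k_def)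
  have SS': "S (Suc n) w = S n w + (1/2)^Suc n * z (k n) w" for n w by (simp add: SS k_def)
  \<comment> \<open>the partial sums increase, and what is missing after \<open>n\<close> terms is a \<open>2 ^ -n\<close> multiple
   of an average of late members of the sequence\<close>
  have up: "S (n + j) w \<le> S n w + ((1/2)^n - (1/2)^(n+j)) * z n w" for n j w proof (induction j)
   case (Suc j)
   have "z (k (n + j)) w \<le> z n w" using kn[of "n + j"] by (intro anti) simp
   moreover define q where "q = (1/2 :: real)^Suc (n+j)"
   ultimately have le: "q * z (k (n + j)) w \<le> q * z n w" by (intro mult_left_mono) (simp_all add: q_def)
   have "(1/2)^(n+j) = 2 * q" by (simp add: q_def)
   then have "S (n + j) w \<le> S n w + ((1/2)^n - 2 * q) * z n w" using Suc by simp
   moreover have "((1/2)^n - 2 * q) * z n w + q * z n w = ((1/2)^n - q) * z n w" by (simp add: algebra_simps)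
   moreover have "S (n + Suc j) w = S (n + j) w + q * z (k (n + j)) w"
    using SS'[of "n+j" w] by (simp add: q_def)
   ultimately have "S (n + Suc j) w \<le> S n w + ((1/2)^n - q) * z n w" using le by linarith
   then show ?case by (simp add: q_def)
  qed simp
  have mono: "S n w \<le> S (n + j) w" for n j w proof (induction j)
   case (Suc j)
   have "0 \<le> (1/2)^Suc (n+j) * z (k (n+j)) w" using z0 by simp
   then show ?case using Suc SS'[of "n+j" w] by simp
  qed simp
  have incS: "incseq (\<lambda>n. S n w)" for w using mono[of _ w 1] by (intro incseq_SucI) simp
  have SC: "S n w \<le> C" for n w proof -
   have "S (0 + n) w \<le> S 0 w + ((1/2)^0 - (1/2)^(0+n)) * z 0 w" by (rule up)
   also have "\<dots> \<le> 1 * z 0 w" using z0[of 0 w] by (simp add: S0 left_diff_distrib)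
   finally show ?thesis using zC[of 0 w] by simp
  qed
  define G where "G w = lim (\<lambda>n. S n w)" for w
  have Glim: "(\<lambda>n. S n w) \<longlonglongrightarrow> G w" for w proof -
   obtain L where "(\<lambda>n. S n w) \<longlonglongrightarrow> L" by (rule incseq_convergent[OF incS, of w C]) (use SC in auto)
   then show ?thesis unfolding G_def by (simp add: limI)
  qed
  have SG: "S n w \<le> G w" for n w by (rule incseq_le[OF incS Glim])
  have GS: "G w \<le> S n w + (1/2)^n * z n w" for n w proof (rule LIMSEQ_le_const2[OF Glim])
   have "S i w \<le> S n w + (1/2)^n * z n w" if "i \<ge> n" for i proof -
    have "((1/2)^n - (1/2)^(n+(i-n))) * z n w \<le> (1/2)^n * z n w"
     using z0[of n w] by (intro mult_right_mono) auto
    then show ?thesis using up[of n "i - n" w] that by simp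
   qed
   then show "\<exists>N. \<forall>i\<ge>N. S i w \<le> S n w + (1/2)^n * z n w" by blast
  qed
  have GL: "G \<in> Linf M" proof (rule LinfI[of _ C])
   show "G \<in> L0 M" by (rule borel_measurable_LIMSEQ_real[OF Glim Linf_borel[OF SL]])
   have "0 \<le> G w" for w using SG[of 0 w] by (simp add: S0)
   moreover have "G w \<le> C" for w using GS[of w 0] zC[of 0 w] by (simp add: S0)
   ultimately show "AE w in M. \<bar>G w\<bar> \<le> C" by simp
  qed
  have lower: "S n w + ((1/2)^n - (1/2)^(n+j)) * z l w \<le> S (n + j) w" if "\<And>i. i < j \<Longrightarrow> k (n + i) \<le> l" for n j l w
   using that proof (induction j)
   case (Suc j)
   have "z l w \<le> z (k (n + j)) w" by (rule anti) (use Suc(2) in simp)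
   moreover define q where "q = (1/2 :: real)^Suc (n+j)"
   ultimately have le: "q * z l w \<le> q * z (k (n + j)) w" by (intro mult_left_mono) (simp_all add: q_def)
   have "(1/2)^(n+j) = 2 * q" by (simp add: q_def)
   then have "S n w + ((1/2)^n - 2 * q) * z l w \<le> S (n + j) w" using Suc by simp
   moreover have "((1/2)^n - 2 * q) * z l w + q * z l w = ((1/2)^n - q) * z l w" by (simp add: algebra_simps)
   moreover have "S (n + Suc j) w = S (n + j) w + q * z (k (n + j)) w"
    using SS'[of "n+j" w] by (simp add: q_def)
   ultimately have "S n w + ((1/2)^n - q) * z l w \<le> S (n + Suc j) w" using le by linarith
   then show ?case by (simp add: q_def)
  qed simp
  have pG: "m (S n) n \<le> p G" for n proof -
   have "m (S n) n - (1/2)^(n+j) * C \<le> p G" for j proof -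
    define l where "l = Max (insert 0 ((\<lambda>i. k (n + i)) ` {..<j}))"
    have l: "k (n + i) \<le> l" if "i < j" for i unfolding l_def using that by (intro Max_ge) auto
    have "(S n w + (1/2)^n * z l w) - (1/2)^(n+j) * C \<le> G w" for w proof -
     have "(1/2)^(n+j) * z l w \<le> (1/2)^(n+j) * C" by (intro mult_left_mono zC) simp
     moreover have "((1/2)^n - (1/2)^(n+j)) * z l w = (1/2)^n * z l w - (1/2)^(n+j) * z l w"
      by (rule left_diff_distrib)
     ultimately show ?thesis using lower[OF l, of j w] SG[of "n+j" w] by linarith
    qed
    then have "T (S n) n l - (1/2)^(n+j) * C \<le> p G" unfolding T_def by (intro plip[OF sL[OF SL] GL])
    then show ?thesis using mle[OF SL[of n], of n l] by simp
   qed
   moreover have "(\<lambda>j. m (S n) n - (1/2)^(n+j) * C) \<longlonglongrightarrow> m (S n) n - 0 * C"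
    by (intro tendsto_intros LIMSEQ_ignore_initial_segment[of "\<lambda>j. (1/2::real)^j" 0 n, unfolded add.commute[of _ n]])
     (auto intro: LIMSEQ_power_zero)
   ultimately show ?thesis by (intro LIMSEQ_le_const2[of "\<lambda>j. m (S n) n - (1/2)^(n+j) * C"]) auto
  qed
  have gap: "p G - p (S n) \<ge> (1/2)^n * (e / 2 + e / 2 * (1/2)^n)" for n proof (induction n)
   case 0
   have "e \<le> m (S 0) 0" unfolding m_def using low by (intro cINF_greatest) (auto simp: T_def S0)
   moreover have "p (S 0) = 0" by (simp add: S0 p_def)
   ultimately show ?case using pG[of 0] by simp
  next
   case (Suc n)
   have eq: "S (Suc n) = (\<lambda>w. (S n w + (S n w + (1/2)^n * z (k n) w)) / 2)" by (auto simp: SS')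
   have "p (S (Suc n)) \<le> (p (S n) + T (S n) n (k n)) / 2" unfolding eq T_def by (rule phalf[OF SL sL[OF SL]])
   also have "T (S n) n (k n) \<le> p G + ep n" using K(2)[OF SL, of n n] pG[of n] by (simp add: k_def)
   finally have "(p G - p (S n) - ep n) / 2 \<le> p G - p (S (Suc n))" by (simp add: field_simps)
   moreover have "(1/2)^n * (e / 2 + e / 2 * (1/2)^n) - ep n = 2 * ((1/2)^Suc n * (e / 2 + e / 2 * (1/2)^Suc n))"
   proof -
    have q: "(1/4::real)^n = (1/2)^n * (1/2)^n" by (simp flip: power_mult_distrib)
    show ?thesis unfolding ep_def q by (simp add: field_simps)
   qed
   moreover have "b \<le> x" if "(c - u) / 2 \<le> x" "a - u = 2 * b" "a \<le> c" for a b c u x :: real using that by simp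
   ultimately show ?case using Suc by blast
  qed
  obtain y where y: "integrable M y"
   "\<And>x. x \<in> Linf M \<Longrightarrow> r (\<lambda>w. x0 w - G w) - 0 + (\<integral>w. (x w - (x0 w - G w)) * y w \<partial>M) \<le> r x"
   using sg[OF L[OF GL]] by (auto simp: subgradient_def)
  have big: "e / 2 \<le> (\<integral>w. z n w * \<bar>y w\<bar> \<partial>M)" for n proof -
   have i1: "integrable M (\<lambda>w. (G w - S n w) * y w)" by (rule integrable_Linf_L1[OF Linf_diff[OF GL SL] y(1)])
   have i2: "integrable M (\<lambda>w. z n w * \<bar>y w\<bar>)" by (rule integrable_Linf_L1[OF zL integrable_abs[OF y(1)]])
   have eq: "(\<lambda>w. ((x0 w - S n w) - (x0 w - G w)) * y w) = (\<lambda>w. (G w - S n w) * y w)" by auto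
   have "p G + (\<integral>w. (G w - S n w) * y w \<partial>M) \<le> p (S n)"
    using y(2)[OF L[OF SL[of n]]] unfolding eq by (simp add: p_def)
   then have "p G - p (S n) \<le> - (\<integral>w. (G w - S n w) * y w \<partial>M)" by simp
   also have "\<dots> = (\<integral>w. - ((G w - S n w) * y w) \<partial>M)" by simp
   also have "\<dots> \<le> (\<integral>w. (1/2)^n * (z n w * \<bar>y w\<bar>) \<partial>M)" proof (rule integral_mono)
    show "integrable M (\<lambda>w. - ((G w - S n w) * y w))" using i1 by simp
    show "integrable M (\<lambda>w. (1/2)^n * (z n w * \<bar>y w\<bar>))" using i2 by simp
    fix w
    have "- ((G w - S n w) * y w) \<le> \<bar>(G w - S n w) * y w\<bar>" by simp
    also have "\<dots> = (G w - S n w) * \<bar>y w\<bar>" using SG[of n w] by (simp add: abs_mult)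
    also have "\<dots> \<le> ((1/2)^n * z n w) * \<bar>y w\<bar>" using GS[of w n] by (intro mult_right_mono) auto
    finally show "- ((G w - S n w) * y w) \<le> (1/2)^n * (z n w * \<bar>y w\<bar>)" by (simp add: mult.assoc)
   qed
   also have "\<dots> = (1/2)^n * (\<integral>w. z n w * \<bar>y w\<bar> \<partial>M)" by simp
   finally have "p G - p (S n) \<le> (1/2)^n * (\<integral>w. z n w * \<bar>y w\<bar> \<partial>M)" .
   with gap[of n] have "(1/2)^n * (e / 2 + e / 2 * (1/2)^n) \<le> (1/2)^n * (\<integral>w. z n w * \<bar>y w\<bar> \<partial>M)"
    by (rule order_trans)
   then have "e / 2 + e / 2 * (1/2)^n \<le> (\<integral>w. z n w * \<bar>y w\<bar> \<partial>M)" by (rule mult_left_le_imp_le) simp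
   moreover have "0 \<le> e / 2 * (1/2)^n" using e by simp
   ultimately show ?thesis by linarith
  qed
  have "(\<lambda>n. \<integral>w. z n w * \<bar>y w\<bar> \<partial>M) \<longlonglongrightarrow> (\<integral>w. 0 \<partial>M)"
  proof (rule integral_dominated_convergence[where w = "\<lambda>w. C * \<bar>y w\<bar>"])
   show "(\<lambda>w. z n w * \<bar>y w\<bar>) \<in> L0 M" for n using Linf_borel[OF zL[of n]] y(1) by measurable
   show "integrable M (\<lambda>w. C * \<bar>y w\<bar>)" using y(1) by simp
   show "AE w in M. (\<lambda>n. z n w * \<bar>y w\<bar>) \<longlonglongrightarrow> 0" using zlim proof eventually_elim
    case (elim w) show ?case using tendsto_mult_right[OF elim, of "\<bar>y w\<bar>"] by simp
   qed
   show "AE w in M. norm (z n w * \<bar>y w\<bar>) \<le> C * \<bar>y w\<bar>" for n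
    using z0 zC by (intro AE_I2) (auto simp: abs_mult intro: mult_right_mono)
  qed simp
  then have "e / 2 \<le> 0" using big LIMSEQ_le_const[of _ _ "e / 2"] by fastforce
  then show False using e by simp
 qed
 then obtain n where n: "p (z n) < e" by blast
 have "r (x i) < r x0 + e" if "i \<ge> n" for i proof -
  have "r (x i) \<le> r (\<lambda>w. x0 w - z i w)"
   using xz[of i] by (intro monetary_mono[OF r L[OF zL] xL]) (auto elim!: eventually_mono)
  also have "\<dots> = p (z i) + r x0" by (simp add: p_def)
  also have "p (z i) \<le> p (z n)" using that anti by (intro pmono zL)
  finally show ?thesis using n by simp
 qed
 then show "\<forall>\<^sub>F n in sequentially. r (x n) < r x0 + e" by (auto simp: eventually_sequentially)
qed

subsection \<open>Approximate representation under the Fatou property\<close>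

section \<open>Approximate subgradients under the Fatou property\<close>

text \<open>The parallelogram identity makes almost norm-minimal elements Cauchy in \<open>L2\<close>; a subsequence
  that converges fast converges almost surely.\<close>

lemma nested_convex_AE_convergent:
 fixes D :: "nat \<Rightarrow> ('w \<Rightarrow> real) set"
 assumes ne: "\<And>k. D k \<noteq> {}" and dec: "\<And>k. D (Suc k) \<subseteq> D k"
  and mid: "\<And>k x y. x \<in> D k \<Longrightarrow> y \<in> D k \<Longrightarrow> (\<lambda>w. (x w + y w) / 2) \<in> D k"
  and meas: "\<And>k x. x \<in> D k \<Longrightarrow> x \<in> L0 M" and bnd: "\<And>k x w. x \<in> D k \<Longrightarrow> 0 \<le> x w \<and> x w \<le> C"
 obtains z where "\<And>k. z k \<in> D k" "AE w in M. convergent (\<lambda>k. z k w)" proof -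
 have decm: "D j \<subseteq> D i" if "i \<le> j" for i j using that by (induction rule: dec_induct) (use dec in auto)
 define Q where "Q x = (\<integral>w. x w * x w \<partial>M)" for x :: "'w \<Rightarrow> real"
 obtain x0 where x0: "x0 \<in> D 0" using ne by blast
 have C0: "0 \<le> C" using bnd[OF x0] by (meson order_trans)
 have sqb: "x w * x w \<le> C * C" if "x \<in> D k" for x k w using bnd[OF that, of w] by (intro mult_mono) auto
 have int: "integrable M (\<lambda>w. x w * y w)" if "x \<in> D k" "y \<in> D j" for x y k j
 proof (rule integrable_const_bound[of _ "C * C"])
  show "AE w in M. norm (x w * y w) \<le> C * C"
   using bnd[OF that(1)] bnd[OF that(2)] C0 by (intro AE_I2) (auto simp: abs_mult intro!: mult_mono)
  show "(\<lambda>w. x w * y w) \<in> L0 M" using meas[OF that(1)] meas[OF that(2)] by measurable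
 qed
 have Q0: "0 \<le> Q x" for x unfolding Q_def by (intro integral_nonneg_AE) simp
 have QC: "Q x \<le> C * C" if "x \<in> D k" for x k proof -
  have "Q x \<le> (\<integral>w. C * C \<partial>M)" unfolding Q_def
   by (rule integral_mono[OF int[OF that that]]) (simp_all add: sqb[OF that])
  then show ?thesis by (simp add: prob_space)
 qed
 define m where "m k = (INF x\<in>D k. Q x)" for k
 have bdd: "bdd_below (Q ` D k)" for k using Q0 by (intro bdd_belowI[of _ 0]) auto
 have ml: "m k \<le> Q x" if "x \<in> D k" for x k unfolding m_def by (rule cINF_lower[OF bdd that])
 have mC: "m k \<le> C * C" for k  proof -
  obtain x where x: "x \<in> D k" using ne by blast
  show ?thesis using ml[OF x] QC[OF x] by (rule order_trans)
 qed
 have minc: "m i \<le> m j" if "i \<le> j" for i j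
  unfolding m_def by (rule cINF_superset_mono[OF ne bdd decm[OF that]]) simp
 define s where "s = (SUP k. m k)"
 have mbdd: "bdd_above (range m)" using mC by (intro bdd_aboveI[of _ "C * C"]) auto
 have ms: "m k \<le> s" for k unfolding s_def by (rule cSUP_upper[OF _ mbdd]) simp
 \<comment> \<open>almost minimal elements of \<open>D j\<close>, for \<open>j\<close> late enough, are close to one another in \<open>L2\<close>\<close>
 have "\<exists>j x. k \<le> j \<and> x \<in> D j \<and> Q x \<le> s + (1/8)^k \<and> s - (1/8)^k \<le> m j" for k :: nat proof -
  have "\<exists>j\<in>UNIV. s - (1/8)^k < m j" by (subst less_cSUP_iff[OF _ mbdd, symmetric]) (auto simp: s_def)
  then obtain j0 where "s - (1/8)^k < m j0" by blast
  then have j: "s - (1/8)^k \<le> m (max k j0)" using minc[of j0 "max k j0"] by simp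
  have "\<exists>x\<in>D (max k j0). Q x < m (max k j0) + (1/8)^k"
   by (subst cINF_less_iff[OF ne bdd, symmetric]) (auto simp: m_def)
  then obtain x where x: "x \<in> D (max k j0)" "Q x < m (max k j0) + (1/8)^k" by blast
  then have "Q x \<le> s + (1/8)^k" using ms[of "max k j0"] by simp
  then show ?thesis using j x(1) by (intro exI[of _ "max k j0"] exI[of _ x]) auto
 qed
 then obtain J z where J: "\<And>k. k \<le> J k" and zJ: "\<And>k. z k \<in> D (J k)"
  and zQ: "\<And>k. Q (z k) \<le> s + (1/8)^k" and mJ: "\<And>k. s - (1/8)^k \<le> m (J k)" by metis
 have zD: "z k \<in> D i" if "i \<le> J k" for i k using zJ decm[OF that] by blast
 define d where "d k w = z (Suc k) w - z k w" for k w
 have dm: "d k \<in> L0 M" for k unfolding d_def using meas[OF zJ[of k]] meas[OF zJ[of "Suc k"]] by measurable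
 have dint: "integrable M (\<lambda>w. d k w * d k w)" for k proof -
  have "integrable M (\<lambda>w. z (Suc k) w * z (Suc k) w + z k w * z k w - 2 * (z (Suc k) w * z k w))"
   using int[OF zJ zJ] by auto
  then show ?thesis by (simp add: d_def algebra_simps)
 qed
 have dQ: "Q (d k) \<le> 8 * (1/8)^k" for k proof -
  define i where "i = min (J k) (J (Suc k))"
  have zi: "z k \<in> D i" "z (Suc k) \<in> D i" by (auto simp: i_def intro: zD)
  have "s - (1/8)^k \<le> s - (1/8)^Suc k" by simp
  from order_trans[OF this mJ] have "s - (1/8)^k \<le> m (J (Suc k))" .
  then have mi: "s - (1/8)^k \<le> m i" using mJ[of k] by (auto simp: i_def min_def)
  have "m i \<le> Q (\<lambda>w. (z (Suc k) w + z k w) / 2)" by (rule ml[OF mid[OF zi(2,1)]])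
  also have "\<dots> = (\<integral>w. (z (Suc k) w * z (Suc k) w) / 2 + (z k w * z k w) / 2 - (d k w * d k w) / 4 \<partial>M)"
   unfolding Q_def d_def by (intro Bochner_Integration.integral_cong) (auto simp: field_simps)
  also have "\<dots> = Q (z (Suc k)) / 2 + Q (z k) / 2 - Q (d k) / 4" unfolding Q_def using int[OF zJ zJ] dint by simp
  finally have "Q (d k) / 4 \<le> Q (z (Suc k)) / 2 + Q (z k) / 2 - m i" by simp
  moreover have "Q (z (Suc k)) \<le> s + (1/8)^k" using zQ[of "Suc k"] by (simp add: field_simps)
  ultimately show ?thesis using zQ[of k] mi by simp
 qed
 have dL1: "(\<integral>\<^sup>+w. ennreal \<bar>d k w\<bar> \<partial>M) \<le> ennreal (9 * (1/2)^k)" for k proof -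
  have "(\<integral>\<^sup>+w. ennreal \<bar>d k w\<bar> \<partial>M) \<le> (\<integral>\<^sup>+w. ennreal (2^k * (d k w * d k w) + (1/2)^k) \<partial>M)"
  proof (rule nn_integral_mono, rule ennreal_leI)
   fix w
   have "(2^k * \<bar>d k w\<bar> - 1)^2 \<ge> 0" by simp
   then have "2 * (2^k * \<bar>d k w\<bar>) \<le> 2^k * (2^k * (d k w * d k w)) + 1"
    by (simp add: power2_diff power_mult_distrib power2_eq_square algebra_simps)
   then have "2^k * (2 * \<bar>d k w\<bar>) \<le> 2^k * (2^k * (d k w * d k w) + (1/2)^k)"
    by (simp add: algebra_simps power_divide)
   then have "2 * \<bar>d k w\<bar> \<le> 2^k * (d k w * d k w) + (1/2)^k" by simp
   then show "\<bar>d k w\<bar> \<le> 2^k * (d k w * d k w) + (1/2)^k" by simp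
  qed
  also have "\<dots> = ennreal (\<integral>w. 2^k * (d k w * d k w) + (1/2)^k \<partial>M)"
   using dint[of k] by (intro nn_integral_eq_integral) auto
  also have "(\<integral>w. 2^k * (d k w * d k w) + (1/2)^k \<partial>M) = 2^k * Q (d k) + (1/2)^k"
   unfolding Q_def using dint[of k] by (simp add: prob_space)
  also have "2^k * Q (d k) \<le> 2^k * (8 * (1/8)^k)" using dQ[of k] by (intro mult_left_mono) auto
  also have "2^k * (8 * (1/8)^k) = 8 * (1/4 :: real)^k" proof -
   have "(2::real)^k * (1/8)^k = (1/4)^k" by (simp flip: power_mult_distrib)
   then show ?thesis by simp
  qed
  also have "8 * (1/4 :: real)^k \<le> 8 * (1/2)^k" by (intro mult_left_mono power_mono) auto
  finally show ?thesis by (simp add: ennreal_leI)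
 qed
 have "(\<integral>\<^sup>+w. (\<Sum>k. ennreal \<bar>d k w\<bar>) \<partial>M) = (\<Sum>k. \<integral>\<^sup>+w. ennreal \<bar>d k w\<bar> \<partial>M)"
  using dm by (intro nn_integral_suminf) simp
 also have "\<dots> \<le> (\<Sum>k. ennreal (9 * (1/2)^k))" by (intro suminf_le dL1) auto
 also have "\<dots> = ennreal (\<Sum>k. 9 * (1/2)^k)"
  by (rule suminf_ennreal2) (auto intro: summable_mult summable_geometric)
 also have "\<dots> < \<infinity>" by simp
 finally have "AE w in M. (\<Sum>k. ennreal \<bar>d k w\<bar>) \<noteq> \<infinity>" using dm by (intro nn_integral_PInf_AE) auto
 then have conv: "AE w in M. convergent (\<lambda>k. z k w)" proof eventually_elim
  case (elim w)
  have "summable (\<lambda>k. \<bar>d k w\<bar>)" by (rule summable_suminf_not_top) (use elim in auto)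
  then have "summable (\<lambda>k. d k w)" by (rule summable_rabs_cancel)
  then have "convergent (\<lambda>n. z 0 w + (\<Sum>k<n. d k w))"
   by (intro convergent_add convergent_const) (simp add: summable_iff_convergent)
  moreover have "z 0 w + (\<Sum>k<n. d k w) = z n w" for n
   unfolding d_def using sum_lessThan_telescope[of "\<lambda>k. z k w" n] by simp
  ultimately show ?case by simp
 qed
 show ?thesis by (rule that[OF zD[OF J] conv])
qed


definition excess :: "nat \<Rightarrow> ('w \<Rightarrow> real) \<Rightarrow> real" where
 "excess i z = (\<integral>w. max 0 (z w - real i) \<partial>M)"

definition cube :: "nat \<Rightarrow> ('w \<Rightarrow> real) set" where
 "cube n = {z \<in> L0 M. \<forall>w. 0 \<le> z w \<and> z w \<le> real n}"

lemma cube_Linf: "z \<in> cube n \<Longrightarrow> z \<in> Linf M"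
 by (rule LinfI[of _ "real n"]) (auto simp: cube_def)

lemma cube_mono: "m \<le> n \<Longrightarrow> cube m \<subseteq> cube n"
 by (auto simp: cube_def) (meson of_nat_mono order_trans)

lemma excess_integrable: "z \<in> Linf M \<Longrightarrow> integrable M (\<lambda>w. max 0 (z w - real i))"
 using integrable_Linf_L1[of "\<lambda>w. max 0 (z w - real i)" "\<lambda>_. 1"]
  Linf_max[OF Linf_const[of 0] Linf_diff[OF _ Linf_const]] by auto

lemma excess_nonneg: "0 \<le> excess i z"
 unfolding excess_def by (intro integral_nonneg_AE) simp

lemma excess_above: "z \<in> cube n \<Longrightarrow> n \<le> i \<Longrightarrow> excess i z = 0"
proof -
 assume "z \<in> cube n" "n \<le> i"
 then have "z w \<le> real n" "real n \<le> real i" for w by (auto simp: cube_def)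
 then have "z w \<le> real i" for w by (meson order_trans)
 then have "max 0 (z w - real i) = 0" for w by (simp add: max.absorb1)
 then show ?thesis by (simp add: excess_def)
qed

lemma excess_convex:
 assumes x: "x \<in> Linf M" and y: "y \<in> Linf M" and t: "0 \<le> t" "t \<le> 1"
 shows "excess i (\<lambda>w. t * x w + (1 - t) * y w) \<le> t * excess i x + (1 - t) * excess i y" proof -
 have "excess i (\<lambda>w. t * x w + (1 - t) * y w)
   \<le> (\<integral>w. t * max 0 (x w - real i) + (1 - t) * max 0 (y w - real i) \<partial>M)" unfolding excess_def
 proof (rule integral_mono)
  show "integrable M (\<lambda>w. max 0 (t * x w + (1 - t) * y w - real i))"
   by (rule excess_integrable) (intro Linf_add Linf_cmult x y)
  show "integrable M (\<lambda>w. t * max 0 (x w - real i) + (1 - t) * max 0 (y w - real i))"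
   using excess_integrable[OF x] excess_integrable[OF y] by auto
  fix w
  have "t * (x w - real i) \<le> t * max 0 (x w - real i)" using t by (intro mult_left_mono) auto
  moreover have "(1 - t) * (y w - real i) \<le> (1 - t) * max 0 (y w - real i)" using t by (intro mult_left_mono) auto
  moreover have "0 \<le> t * max 0 (x w - real i)" "0 \<le> (1 - t) * max 0 (y w - real i)" using t by auto
  moreover have "t * x w + (1 - t) * y w - real i = t * (x w - real i) + (1 - t) * (y w - real i)"
   by (simp add: algebra_simps)
  ultimately show "max 0 (t * x w + (1 - t) * y w - real i)
    \<le> t * max 0 (x w - real i) + (1 - t) * max 0 (y w - real i)" by simp
 qed
 also have "\<dots> = t * excess i x + (1 - t) * excess i y"
  unfolding excess_def using excess_integrable[OF x] excess_integrable[OF y] by simp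
 finally show ?thesis .
qed

lemma excess_scale:
 assumes z: "z \<in> Linf M" and t: "0 \<le> t" "t \<le> 1"
 shows "excess i (\<lambda>w. t * z w) \<le> t * excess i z" proof -
 have "excess i (\<lambda>w. t * z w + (1 - t) * 0) \<le> t * excess i z + (1 - t) * excess i (\<lambda>_. 0)"
  by (rule excess_convex[OF z Linf_const t])
 then show ?thesis by (simp add: excess_def)
qed

lemma excess_tendsto:
 assumes z: "\<And>k. z k \<in> cube n" and z0: "z0 \<in> L0 M" and lim: "AE w in M. (\<lambda>k. z k w) \<longlonglongrightarrow> z0 w"
 shows "(\<lambda>k. excess i (z k)) \<longlonglongrightarrow> excess i z0" unfolding excess_def
proof (rule integral_dominated_convergence[where w = "\<lambda>_. real n"])
 show "(\<lambda>w. max 0 (z0 w - real i)) \<in> L0 M" using z0 by measurable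
 show "(\<lambda>w. max 0 (z k w - real i)) \<in> L0 M" for k using excess_integrable[OF cube_Linf[OF z]] by simp
 show "AE w in M. (\<lambda>k. max 0 (z k w - real i)) \<longlonglongrightarrow> max 0 (z0 w - real i)" using lim
  by eventually_elim (intro tendsto_intros)
 show "AE w in M. norm (max 0 (z k w - real i)) \<le> real n" for k proof (rule AE_I2)
  fix w
  have "z k w \<le> real n" "0 \<le> real i" using z[of k] by (auto simp: cube_def)
  then show "norm (max 0 (z k w - real i)) \<le> real n" by (simp add: max_def)
 qed
qed simp

text \<open>The constants \<open>\<kappa> i\<close> are found one after the other: if no value of \<open>\<kappa> n\<close> were large enough, the
  sets that violate the claim for larger and larger values would be nested and convex, and an almost
  surely convergent selection would contradict the Fatou property at its limit, which lies in \<open>cube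
  n\<close>.\<close>

lemma lower_fatou_excess:
 assumes r: "monetary r" and f: "lower_fatou r" and r0: "r (\<lambda>_. 0) = 0" and dl: "\<delta> > 0"
 obtains \<kappa> where "\<And>i. 0 \<le> \<kappa> i"
  "\<And>n z. z \<in> cube n \<Longrightarrow> r z \<le> - \<delta> \<Longrightarrow> \<exists>i<n. 1 < \<kappa> i * excess i z" proof -
 define P where "P n \<kappa> \<longleftrightarrow> (\<forall>i. 0 \<le> \<kappa> i) \<and> (\<forall>z\<in>cube n. (\<forall>i<n. \<kappa> i * excess i z \<le> 1) \<longrightarrow> - \<delta> < r z)"
  for n and \<kappa> :: "nat \<Rightarrow> real"
 have "\<exists>f. \<forall>n. P n (f n) \<and> (\<forall>i<n. f (Suc n) i = f n i)" proof (rule dependent_nat_choice)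
  have "z = (\<lambda>_. 0)" if "z \<in> cube 0" for z using that by (auto simp: cube_def antisym)
  then show "\<exists>\<kappa>. P 0 \<kappa>" using r0 dl by (intro exI[of _ "\<lambda>_. 0"]) (auto simp: P_def)
 next
  fix \<kappa> n assume P: "P n \<kappa>"
  have k0: "0 \<le> \<kappa> i" for i using P by (simp add: P_def)
  define D where "D k = {z \<in> cube (Suc n). (\<forall>i<n. \<kappa> i * excess i z \<le> 1) \<and> real k * excess n z \<le> 1 \<and> r z \<le> - \<delta>}"
   for k :: nat
  have "\<exists>k. D k = {}" proof (rule ccontr)
   assume "\<not> ?thesis"
   then have ne: "\<And>k. D k \<noteq> {}" by blast
   have DL: "z \<in> Linf M" and Db: "z \<in> cube (Suc n)" if "z \<in> D k" for z k
    using that cube_Linf by (auto simp: D_def)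
   have half: "c * excess i (\<lambda>w. (x w + y w) / 2) \<le> 1"
    if "x \<in> Linf M" "y \<in> Linf M" "c * excess i x \<le> 1" "c * excess i y \<le> 1" "0 \<le> c" for x y c i proof -
    have "excess i (\<lambda>w. (x w + y w) / 2) \<le> (excess i x + excess i y) / 2"
     using excess_convex[OF that(1,2), of "1/2" i] by (simp add: field_simps)
    then have "c * excess i (\<lambda>w. (x w + y w) / 2) \<le> c * ((excess i x + excess i y) / 2)"
     using that(5) by (rule mult_left_mono)
    then show ?thesis using that(3,4) by (simp add: field_simps)
   qed
   obtain z where z: "\<And>k. z k \<in> D k" and conv: "AE w in M. convergent (\<lambda>k. z k w)"
   proof (rule nested_convex_AE_convergent[OF ne, where C = "real (Suc n)"])
    show "D (Suc k) \<subseteq> D k" for k proof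
     fix z assume z: "z \<in> D (Suc k)"
     have "real k * excess n z \<le> real (Suc k) * excess n z" by (intro mult_right_mono excess_nonneg) simp
     then show "z \<in> D k" using z by (auto simp: D_def)
    qed
    show "(\<lambda>w. (x w + y w) / 2) \<in> D k" if x: "x \<in> D k" and y: "y \<in> D k" for k x y proof -
     have "r (\<lambda>w. 1/2 * x w + (1 - 1/2) * y w) \<le> 1/2 * r x + (1 - 1/2) * r y"
      by (rule monetary_convex[OF r DL[OF x] DL[OF y]]) auto
     then have "r (\<lambda>w. (x w + y w) / 2) \<le> - \<delta>" using x y by (simp add: D_def add_divide_distrib)
     moreover have "(\<lambda>w. (x w + y w) / 2) \<in> cube (Suc n)" unfolding cube_def proof (intro CollectI conjI allI)
      show "(\<lambda>w. (x w + y w) / 2) \<in> L0 M" using Linf_borel[OF DL[OF x]] Linf_borel[OF DL[OF y]] by measurable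
      fix w
      have "0 \<le> x w" "x w \<le> real (Suc n)" "0 \<le> y w" "y w \<le> real (Suc n)"
       using Db[OF x] Db[OF y] by (auto simp: cube_def)
      then show "0 \<le> (x w + y w) / 2" "(x w + y w) / 2 \<le> real (Suc n)" by simp_all
     qed
     ultimately show ?thesis using x y half[OF DL[OF x] DL[OF y]] k0 by (simp add: D_def)
    qed
    show "x \<in> L0 M" if "x \<in> D k" for k x by (rule Linf_borel[OF DL[OF that]])
    show "0 \<le> x w \<and> x w \<le> real (Suc n)" if "x \<in> D k" for k x w using Db[OF that] by (auto simp: cube_def)
   qed blast
   have zb: "z k \<in> cube (Suc n)" for k by (rule Db[OF z])
   have zm: "z k \<in> L0 M" for k using zb by (simp add: cube_def)
   define z0 where "z0 w = lim (\<lambda>k. z k w)" for w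
   have z0m: "z0 \<in> L0 M" unfolding z0_def using zm by (rule borel_measurable_lim_metric)
   have lim: "AE w in M. (\<lambda>k. z k w) \<longlonglongrightarrow> z0 w"
    using conv by eventually_elim (simp add: z0_def convergent_LIMSEQ_iff)
   have exlim: "(\<lambda>k. excess i (z k)) \<longlonglongrightarrow> excess i z0" for i by (rule excess_tendsto[OF zb z0m lim])
   have bound: "\<kappa> i * excess i z0 \<le> 1" if "i < n" for i
    using z that by (intro LIMSEQ_le_const2[OF tendsto_mult_left[OF exlim]]) (auto simp: D_def)
   have "excess n z0 \<le> 0" proof (rule ccontr)
    assume "\<not> ?thesis"
    then obtain j where j: "1 < real j * (excess n z0)" using reals_Archimedean3 by (meson not_le)
    have "real j * excess n z0 \<le> 1"
    proof (rule LIMSEQ_le_const2[OF tendsto_mult_left[OF exlim]], intro exI allI impI)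
     fix k assume "k \<ge> j"
     then have "real j * excess n (z k) \<le> real k * excess n (z k)" by (intro mult_right_mono excess_nonneg) simp
     then show "real j * excess n (z k) \<le> 1" using z[of k] by (simp add: D_def)
    qed
    then show False using j by simp
   qed
   moreover have "integrable M (\<lambda>w. max 0 (z0 w - real n))"
   proof (rule integrable_const_bound[of _ "real (Suc n)"])
    show "AE w in M. norm (max 0 (z0 w - real n)) \<le> real (Suc n)" using lim proof eventually_elim
     case (elim w)
     have "z0 w \<le> real (Suc n)" by (rule LIMSEQ_le_const2[OF elim]) (use zb in \<open>auto simp: cube_def\<close>)
     then show ?case by (simp add: max_def)
    qed
    show "(\<lambda>w. max 0 (z0 w - real n)) \<in> L0 M" using z0m by measurable
   qed
   ultimately have "AE w in M. max 0 (z0 w - real n) = 0"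
    using integral_nonneg_eq_0_iff_AE[of M "\<lambda>w. max 0 (z0 w - real n)"]
     antisym[OF _ excess_nonneg[of n z0]] by (simp add: excess_def)
   then have zn: "AE w in M. z0 w \<le> real n" by eventually_elim (simp add: max_def split: if_splits)
   define z1 where "z1 w = max 0 (min (real n) (z0 w))" for w
   have z1m: "z1 \<in> L0 M" unfolding z1_def using z0m by measurable
   have z1b: "z1 \<in> cube n" using z1m by (auto simp: cube_def z1_def)
   have z10: "AE w in M. z1 w = z0 w" using zn lim proof eventually_elim
    case (elim w)
    have "0 \<le> z0 w" by (rule LIMSEQ_le_const[OF elim(2)]) (use zb in \<open>auto simp: cube_def\<close>)
    then show ?case using elim by (simp add: z1_def)
   qed
   have "AE w in M. max 0 (z1 w - real i) = max 0 (z0 w - real i)" for i using z10 by eventually_elim simp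
   then have "excess i z1 = excess i z0" for i
    unfolding excess_def using z0m z1m by (intro integral_cong_AE) auto
   then have "- \<delta> < r z1" using P z1b bound by (simp add: P_def)
   moreover have "bounded_as_conv M z z1" unfolding bounded_as_conv_def
   proof (intro conjI allI exI[of _ "real (Suc n)"])
    show "z k \<in> Linf M" for k by (rule cube_Linf[OF zb])
    show "z1 \<in> Linf M" by (rule cube_Linf[OF z1b])
    show "AE w in M. \<bar>z k w\<bar> \<le> real (Suc n)" for k using zb[of k] by (auto simp: cube_def)
    show "AE w in M. (\<lambda>n. z n w) \<longlonglongrightarrow> z1 w" using lim z10 by eventually_elim simp
   qed
   ultimately have "\<forall>\<^sub>F k in sequentially. r z1 - (r z1 + \<delta>) < r (z k)"
    using f[unfolded lower_fatou_def, rule_format, of z z1 "r z1 + \<delta>"] by simp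
   then obtain k where "- \<delta> < r (z k)" by (auto simp: eventually_sequentially)
   then show False using z[of k] by (simp add: D_def)
  qed
  then obtain k where k: "D k = {}" by blast
  have "P (Suc n) (\<kappa>(n := real k))" unfolding P_def proof (intro conjI ballI impI allI)
   show "0 \<le> (\<kappa>(n := real k)) i" for i using k0 by simp
   fix z assume z: "z \<in> cube (Suc n)" and le: "\<forall>i<Suc n. (\<kappa>(n := real k)) i * excess i z \<le> 1"
   have "\<kappa> i * excess i z \<le> 1" if "i < n" for i using le[rule_format, of i] that by simp
   moreover have "real k * excess n z \<le> 1" using le[rule_format, of n] by simp
   ultimately show "- \<delta> < r z" using k z by (force simp: D_def not_le[symmetric])
  qed
  then show "\<exists>\<kappa>'. P (Suc n) \<kappa>' \<and> (\<forall>i<n. \<kappa>' i = \<kappa> i)" by (intro exI[of _ "\<kappa>(n := real k)"]) auto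
 qed
 then obtain f where fP: "\<And>n. P n (f n)" and fs: "\<And>n i. i < n \<Longrightarrow> f (Suc n) i = f n i" by blast
 have stab: "f n i = f (Suc i) i" if "i < n" for n i proof -
  have "Suc i \<le> n" using that by simp
  then show ?thesis by (induction n rule: dec_induct) (simp_all add: fs)
 qed
 show ?thesis proof (rule that[of "\<lambda>i. f (Suc i) i"])
  show "0 \<le> f (Suc i) i" for i using fP[of "Suc i"] by (simp add: P_def)
  fix n z assume z: "z \<in> cube n" and rz: "r z \<le> - \<delta>"
  then have "\<exists>i<n. 1 < f n i * excess i z" using fP[of n] unfolding P_def by (meson not_le)
  then show "\<exists>i<n. 1 < f (Suc i) i * excess i z" using stab by metis
 qed
qed

text \<open>Adding the penalty \<open>\<delta> * q\<close> with \<open>q z = \<Sum> \<kappa> i * excess i z\<close> keeps \<open>r\<close> above \<open>- \<delta>\<close> on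
  nonnegative functions. The inf-convolution of \<open>r\<close> with the penalty lies below \<open>r\<close>, has value at
  least \<open>- \<delta>\<close> at zero, and is upper semicontinuous along bounded convergent sequences, because small
  perturbations cost little. Its exact subgradient at zero is an approximate one of \<open>r\<close>.\<close>

lemma lower_fatou_imp_approx_subgradient_at_0:
 assumes r: "monetary r" and f: "lower_fatou r" and r0: "r (\<lambda>_. 0) = 0" and dl: "\<delta> > 0"
 shows "\<exists>y. subgradient r (\<lambda>_. 0) \<delta> y" proof -
 obtain \<kappa> where k0: "\<And>i. 0 \<le> \<kappa> i"
  and k1: "\<And>n z. z \<in> cube n \<Longrightarrow> r z \<le> - \<delta> \<Longrightarrow> \<exists>i<n. 1 < \<kappa> i * excess i z"
  using lower_fatou_excess[OF assms] by blast
 define B where "B = (\<Union>n. cube n)"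
 define q where "q z = (\<Sum>i. \<kappa> i * excess i z)" for z
 have qn: "q z = (\<Sum>i<n. \<kappa> i * excess i z)" if "z \<in> cube n" for n z
  unfolding q_def by (rule suminf_finite) (use excess_above[OF that] in auto)
 have q0: "0 \<le> q z" if "z \<in> B" for z using that qn k0 excess_nonneg by (auto simp: B_def intro!: sum_nonneg)
 have BL: "z \<in> Linf M" if "z \<in> B" for z using that cube_Linf by (auto simp: B_def)
 have zB: "(\<lambda>_. 0) \<in> B" by (auto simp: B_def cube_def)
 have q00: "q (\<lambda>_. 0) = 0" using qn[of "\<lambda>_. 0" 0] by (simp add: cube_def)
 have pen: "- \<delta> \<le> r z + \<delta> * q z" if z: "z \<in> B" for z proof (cases "r z \<le> - \<delta>")
  case False then show ?thesis using mult_nonneg_nonneg[of \<delta> "q z"] q0[OF z] dl by linarith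
 next
  case True
  define t where "t = \<delta> / - r z"
  have t: "0 < t" "t \<le> 1" and tr: "t * r z = - \<delta>" using True dl by (auto simp: t_def field_simps)
  obtain n where n: "z \<in> cube n" using z by (auto simp: B_def)
  have zL: "z \<in> Linf M" by (rule BL[OF z])
  have "t * z w \<le> z w" if "0 \<le> z w" for w using t that by (simp add: mult_left_le_one_le)
  then have tz: "(\<lambda>w. t * z w) \<in> cube n" using n t by (auto simp: cube_def intro: order_trans)
  have "r (\<lambda>w. t * z w + (1 - t) * 0) \<le> t * r z + (1 - t) * r (\<lambda>_. 0)"
   using t by (intro monetary_convex[OF r zL Linf_const]) auto
  then have "r (\<lambda>w. t * z w) \<le> - \<delta>" using r0 tr by simp
  from k1[OF tz this] obtain i where i: "i < n" "1 < \<kappa> i * excess i (\<lambda>w. t * z w)" by blast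
  have "\<kappa> i * excess i (\<lambda>w. t * z w) \<le> \<kappa> i * (t * excess i z)"
   using excess_scale[OF zL, of t i] t k0 by (intro mult_left_mono) auto
  moreover have "\<kappa> i * excess i z \<le> (\<Sum>i<n. \<kappa> i * excess i z)"
   using i(1) k0 excess_nonneg by (intro member_le_sum) auto
  then have "t * (\<kappa> i * excess i z) \<le> t * q z" using t qn[OF n] by (intro mult_left_mono) auto
  ultimately have "1 \<le> t * q z" using i(2) by (simp add: algebra_simps)
  then have "1 \<le> \<delta> * q z / - r z" by (simp only: t_def times_divide_eq_left)
  moreover have "0 < - r z" using True dl by simp
  ultimately have "- r z \<le> \<delta> * q z" by (simp only: pos_le_divide_eq mult_1)
  then show ?thesis using dl by simp
 qed
 have qconv: "q (\<lambda>w. t * u w + (1 - t) * v w) \<le> t * q u + (1 - t) * q v"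
  and Bconv: "(\<lambda>w. t * u w + (1 - t) * v w) \<in> B" if u: "u \<in> B" and v: "v \<in> B" and t: "0 \<le> t" "t \<le> 1" for u v t
 proof -
  obtain m1 m2 where "u \<in> cube m1" "v \<in> cube m2" using u v by (auto simp: B_def)
  then obtain n where un: "u \<in> cube n" and vn: "v \<in> cube n"
   using cube_mono[of m1 "max m1 m2"] cube_mono[of m2 "max m1 m2"] by auto
  have "t * u w + (1 - t) * v w \<le> real n" for w using un vn t by (intro convex_bound_le) (auto simp: cube_def)
  then have cn: "(\<lambda>w. t * u w + (1 - t) * v w) \<in> cube n" using un vn t by (auto simp: cube_def)
  then show "(\<lambda>w. t * u w + (1 - t) * v w) \<in> B" by (auto simp: B_def)
  have "q (\<lambda>w. t * u w + (1 - t) * v w) = (\<Sum>i<n. \<kappa> i * excess i (\<lambda>w. t * u w + (1 - t) * v w))"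
   by (rule qn[OF cn])
  also have "\<dots> \<le> (\<Sum>i<n. \<kappa> i * (t * excess i u + (1 - t) * excess i v))"
   using k0 t by (intro sum_mono mult_left_mono excess_convex BL u v) auto
  also have "\<dots> = t * q u + (1 - t) * q v" unfolding qn[OF un] qn[OF vn] sum_distrib_left sum.distrib[symmetric]
   by (intro sum.cong) (auto simp: algebra_simps)
  finally show "q (\<lambda>w. t * u w + (1 - t) * v w) \<le> t * q u + (1 - t) * q v" .
 qed
 \<comment> \<open>the inf-convolution of \<open>r\<close> with the penalty inherits all properties of a monetary functional\<close>
 define s where "s x = (INF v\<in>B. r (\<lambda>w. x w + v w) + \<delta> * q v)" for x
 have xv: "(\<lambda>w. x w + v w) \<in> Linf M" if "x \<in> Linf M" "v \<in> B" for x v by (rule Linf_add[OF that(1) BL[OF that(2)]])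
 have slow: "- \<delta> - C \<le> r (\<lambda>w. x w + v w) + \<delta> * q v"
  if x: "x \<in> Linf M" and C: "AE w in M. x w \<le> C" and v: "v \<in> B" for x C v proof -
  have "AE w in M. x w + v w \<le> v w + C" using C by eventually_elim simp
  from monetary_lipschitz[OF r xv[OF x v] BL[OF v] this] show ?thesis using pen[OF v] by simp
 qed
 have bdd: "bdd_below ((\<lambda>v. r (\<lambda>w. x w + v w) + \<delta> * q v) ` B)" if x: "x \<in> Linf M" for x proof -
  obtain C where "AE w in M. \<bar>x w\<bar> \<le> C" using LinfE[OF x] by blast
  then have "AE w in M. x w \<le> C" by eventually_elim simp
  from slow[OF x this] show ?thesis by (intro bdd_belowI2) auto
 qed
 have sl: "s x \<le> r (\<lambda>w. x w + v w) + \<delta> * q v" if "x \<in> Linf M" "v \<in> B" for x v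
  unfolding s_def by (rule cINF_lower[OF bdd[OF that(1)] that(2)])
 have sg: "t \<le> s x" if "\<And>v. v \<in> B \<Longrightarrow> t \<le> r (\<lambda>w. x w + v w) + \<delta> * q v" for t x
  unfolding s_def using zB that by (intro cINF_greatest) auto
 have sm: "monetary s" unfolding monetary_def proof (intro conjI ballI allI impI)
  fix x y assume x: "x \<in> Linf M" and y: "y \<in> Linf M" and le: "AE w in M. x w \<le> y w"
  show "s y \<le> s x" proof (rule sg)
   fix v assume v: "v \<in> B"
   have "r (\<lambda>w. y w + v w) \<le> r (\<lambda>w. x w + v w)"
    using le by (intro monetary_mono[OF r xv[OF x v] xv[OF y v]]) auto
   then show "s y \<le> r (\<lambda>w. x w + v w) + \<delta> * q v" using sl[OF y v] by simp
  qed
 next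
  fix x and c :: real assume x: "x \<in> Linf M"
  have xc: "(\<lambda>w. x w + c) \<in> Linf M" by (rule Linf_add[OF x Linf_const])
  have eq: "r (\<lambda>w. x w + c + v w) = r (\<lambda>w. x w + v w) - c" if "v \<in> B" for v
   using monetary_cash[OF r xv[OF x that], of c] by (simp add: algebra_simps)
  show "s (\<lambda>w. x w + c) = s x - c" proof (rule antisym)
   have "s (\<lambda>w. x w + c) + c \<le> s x" using sl[OF xc] eq by (intro sg) fastforce
   then show "s (\<lambda>w. x w + c) \<le> s x - c" by simp
   show "s x - c \<le> s (\<lambda>w. x w + c)" using sl[OF x] eq by (intro sg) fastforce
  qed
 next
  fix x y and t :: real assume x: "x \<in> Linf M" and y: "y \<in> Linf M" and t: "0 \<le> t \<and> t \<le> 1"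
  let ?c = "\<lambda>w. t * x w + (1 - t) * y w"
  have c: "?c \<in> Linf M" by (intro Linf_add Linf_cmult x y)
  have key: "s ?c \<le> t * (r (\<lambda>w. x w + u w) + \<delta> * q u) + (1 - t) * (r (\<lambda>w. y w + v w) + \<delta> * q v)"
   if u: "u \<in> B" and v: "v \<in> B" for u v proof -
   have eq: "(\<lambda>w. ?c w + (t * u w + (1 - t) * v w)) = (\<lambda>w. t * (x w + u w) + (1 - t) * (y w + v w))"
    by (auto simp: algebra_simps)
   have "s ?c \<le> r (\<lambda>w. ?c w + (t * u w + (1 - t) * v w)) + \<delta> * q (\<lambda>w. t * u w + (1 - t) * v w)"
    using t by (intro sl[OF c Bconv[OF u v]]) auto
   also have "r (\<lambda>w. ?c w + (t * u w + (1 - t) * v w)) \<le> t * r (\<lambda>w. x w + u w) + (1 - t) * r (\<lambda>w. y w + v w)"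
    unfolding eq using t by (intro monetary_convex[OF r xv[OF x u] xv[OF y v]]) auto
   also have "\<delta> * q (\<lambda>w. t * u w + (1 - t) * v w) \<le> \<delta> * (t * q u + (1 - t) * q v)"
    using t dl by (intro mult_left_mono qconv u v) auto
   finally show ?thesis by (simp add: algebra_simps)
  qed
  have lim: "a \<le> t * b + (1 - t) * d" if "\<And>e. 0 < e \<Longrightarrow> a \<le> t * (b + e) + (1 - t) * (d + e)" for a b d :: real
   by (rule field_le_epsilon) (use that in \<open>simp add: algebra_simps\<close>)
  show "s ?c \<le> t * s x + (1 - t) * s y" proof (rule lim)
   fix e :: real assume e: "0 < e"
   have "\<exists>u\<in>B. r (\<lambda>w. x w + u w) + \<delta> * q u < s x + e"
    by (subst cINF_less_iff[OF _ bdd[OF x], symmetric]) (use e zB in \<open>auto simp: s_def\<close>)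
   then obtain u where u: "u \<in> B" "r (\<lambda>w. x w + u w) + \<delta> * q u \<le> s x + e" by force
   have "\<exists>u\<in>B. r (\<lambda>w. y w + u w) + \<delta> * q u < s y + e"
    by (subst cINF_less_iff[OF _ bdd[OF y], symmetric]) (use e zB in \<open>auto simp: s_def\<close>)
   then obtain v where v: "v \<in> B" "r (\<lambda>w. y w + v w) + \<delta> * q v \<le> s y + e" by force
   have "t * (r (\<lambda>w. x w + u w) + \<delta> * q u) + (1 - t) * (r (\<lambda>w. y w + v w) + \<delta> * q v)
     \<le> t * (s x + e) + (1 - t) * (s y + e)"
    by (rule add_mono[OF mult_left_mono[OF u(2)] mult_left_mono[OF v(2)]]) (use t in auto)
   then show "s ?c \<le> t * (s x + e) + (1 - t) * (s y + e)" using key[OF u(1) v(1)] by simp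
  qed
 qed
 have su: "upper_lebesgue s" unfolding upper_lebesgue_def proof (intro allI impI)
  fix x x0 and e :: real assume bc: "bounded_as_conv M x x0" and e: "0 < e"
  have xL: "\<And>n. x n \<in> Linf M" and x0: "x0 \<in> Linf M" and lim: "AE w in M. (\<lambda>n. x n w) \<longlonglongrightarrow> x0 w"
   using bc by (auto simp: bounded_as_conv_def)
  obtain C where C: "\<And>n. AE w in M. \<bar>x n w\<bar> \<le> C" using bc by (auto simp: bounded_as_conv_def)
  obtain D where D: "AE w in M. \<bar>x0 w\<bar> \<le> D" using LinfE[OF x0] by blast
  have "\<exists>v\<in>B. r (\<lambda>w. x0 w + v w) + \<delta> * q v < s x0 + e"
   by (subst cINF_less_iff[OF _ bdd[OF x0], symmetric]) (use e zB in \<open>auto simp: s_def\<close>)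
  then obtain v where v: "v \<in> B" "r (\<lambda>w. x0 w + v w) + \<delta> * q v < s x0 + e" by blast
  obtain n where n: "v \<in> cube n" using v(1) by (auto simp: B_def)
  obtain m :: nat where m: "real n + C + D \<le> real m" using real_arch_simple by blast
  define u where "u k w = min (real m) (max 0 (x0 w + v w - x k w))" for k w
  have vL: "v \<in> Linf M" by (rule BL[OF v(1)])
  have um: "u k \<in> L0 M" for k
   unfolding u_def using Linf_borel[OF vL] Linf_borel[OF x0] Linf_borel[OF xL[of k]] by measurable
  have ub: "u k \<in> cube m" for k using um by (auto simp: cube_def u_def)
  have uB: "u k \<in> B" for k using ub by (auto simp: B_def)
  have "0 \<le> C + D" proof -
   have "AE w in M. 0 \<le> C + D" using C[of 0] D by eventually_elim linarith
   then show ?thesis using AE_const by simp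
  qed
  then have nm: "real n \<le> real m" using m by linarith
  have ulim: "AE w in M. (\<lambda>k. u k w) \<longlonglongrightarrow> v w" using lim proof eventually_elim
   case (elim w)
   have "(\<lambda>k. u k w) \<longlonglongrightarrow> min (real m) (max 0 (x0 w + v w - x0 w))" unfolding u_def by (intro tendsto_intros elim)
   moreover have "0 \<le> v w" "v w \<le> real m" using n nm by (auto simp: cube_def intro: order_trans)
   ultimately show ?case by (simp add: max.absorb2 min.absorb2)
  qed
  have vm: "v \<in> cube m" using n nm by (auto simp: cube_def intro: order_trans)
  have "(\<lambda>k. \<Sum>i<m. \<kappa> i * excess i (u k)) \<longlonglongrightarrow> (\<Sum>i<m. \<kappa> i * excess i v)"
   by (intro tendsto_intros excess_tendsto[OF ub Linf_borel[OF vL] ulim])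
  then have "(\<lambda>k. r (\<lambda>w. x0 w + v w) + \<delta> * q (u k)) \<longlonglongrightarrow> r (\<lambda>w. x0 w + v w) + \<delta> * q v"
   unfolding qn[OF ub] qn[OF vm] by (rule tendsto_add[OF tendsto_const tendsto_mult_left])
  from order_tendstoD(2)[OF this v(2)]
  show "\<forall>\<^sub>F k in sequentially. s (x k) < s x0 + e" proof eventually_elim
   case (elim k)
   have "AE w in M. x0 w + v w \<le> x k w + u k w" using C[of k] D proof eventually_elim
    case (elim w)
    have "v w \<le> real n" using n by (auto simp: cube_def)
    then have "x0 w + v w - x k w \<le> real m" using elim m by linarith
    then show ?case by (simp add: u_def)
   qed
   then have "r (\<lambda>w. x k w + u k w) \<le> r (\<lambda>w. x0 w + v w)"
    by (intro monetary_mono[OF r xv[OF x0 v(1)] xv[OF xL uB]])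
   then show ?case using sl[OF xL uB, of k k] elim by simp
  qed
 qed
 obtain y where y: "integrable M y"
  "\<And>x. x \<in> Linf M \<Longrightarrow> s (\<lambda>_. 0) - 0 + (\<integral>w. (x w - 0) * y w \<partial>M) \<le> s x"
  using upper_lebesgue_imp_subgradient[OF sm su Linf_const[of 0]] by (auto simp: subgradient_def)
 have s0: "- \<delta> \<le> s (\<lambda>_. 0)" by (rule sg) (use pen in simp)
 have sr: "s x \<le> r x" if "x \<in> Linf M" for x using sl[OF that zB] q00 by simp
 have "subgradient r (\<lambda>_. 0) \<delta> y" unfolding subgradient_def proof (intro conjI ballI)
  show "integrable M y" by (rule y(1))
  fix x assume x: "x \<in> Linf M"
  show "r (\<lambda>_. 0) - \<delta> + (\<integral>w. (x w - 0) * y w \<partial>M) \<le> r x" using y(2)[OF x] sr[OF x] s0 r0 by linarith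
 qed
 then show ?thesis by (rule exI[of _ y])
qed

lemma lower_fatou_imp_approx_subgradient:
 assumes r: "monetary r" and f: "lower_fatou r" and x0: "x0 \<in> Linf M" and dl: "\<delta> > 0"
 shows "\<exists>y. subgradient r x0 \<delta> y" proof -
 let ?r = "\<lambda>x. r (\<lambda>w. x0 w + x w) - r x0"
 have "lower_fatou ?r" unfolding lower_fatou_def proof (intro allI impI)
  fix x x1 and e :: real assume "bounded_as_conv M x x1" "0 < e"
  from bounded_as_conv_shift[OF this(1) x0] this(2)
  have "\<forall>\<^sub>F n in sequentially. r (\<lambda>w. x0 w + x1 w) - e < r (\<lambda>w. x0 w + x n w)"
   using f unfolding lower_fatou_def by blast
  then show "\<forall>\<^sub>F n in sequentially. ?r x1 - e < ?r (x n)" by eventually_elim simp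
 qed
 from lower_fatou_imp_approx_subgradient_at_0[OF monetary_translate[OF r x0] this _ dl]
 obtain y where y: "subgradient ?r (\<lambda>_. 0) \<delta> y" by auto
 have "subgradient r x0 \<delta> y" unfolding subgradient_def proof (intro conjI ballI)
  show "integrable M y" using y by (simp add: subgradient_def)
  fix x assume "x \<in> Linf M"
  then have "(\<lambda>w. x w - x0 w) \<in> Linf M" by (rule Linf_diff[OF _ x0])
  from y[unfolded subgradient_def, THEN conjunct2, THEN bspec, OF this]
  show "r x0 - \<delta> + (\<integral>w. (x w - x0 w) * y w \<partial>M) \<le> r x" by simp
 qed
 then show ?thesis by blast
qed

section \<open>Exhaustion and essential suprema\<close>

text \<open>A countable union of members of almost maximal probability covers each member up to a null
  set.\<close>

lemma exhaustion:
 assumes sub: "\<C> \<subseteq> sets F" and ne: "\<C> \<noteq> {}"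
 shows "\<exists>D. (\<forall>n::nat. D n \<in> \<C>) \<and> (\<forall>C\<in>\<C>. AE w\<in>C in M. w \<in> (\<Union>n. D n))" proof -
 define \<D> where "\<D> = {D :: nat \<Rightarrow> 'w set. \<forall>n. D n \<in> \<C>}"
 define p where "p D = prob (\<Union>n. D n)" for D :: "nat \<Rightarrow> 'w set"
 obtain C0 where "C0 \<in> \<C>" using ne by blast
 then have Dne: "\<D> \<noteq> {}" by (auto simp: \<D>_def)
 have bdd: "bdd_above (p ` \<D>)" by (intro bdd_aboveI[of _ 1]) (auto simp: p_def)
 define S where "S = (SUP D\<in>\<D>. p D)"
 have pS: "p D \<le> S" if "D \<in> \<D>" for D unfolding S_def by (rule cSUP_upper[OF that bdd])
 have "\<exists>D\<in>\<D>. S - 1 / real (Suc k) < p D" for k by (subst less_cSUP_iff[OF Dne bdd, symmetric]) (simp add: S_def)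
 then obtain D where D: "\<And>k. D k \<in> \<D>" "\<And>k. S - 1 / real (Suc k) < p (D k)" by metis
 define E where "E n = D (fst (prod_decode n)) (snd (prod_decode n))" for n
 have Eset: "E n \<in> \<C>" for n using D(1) by (auto simp: E_def \<D>_def)
 have EM: "(\<Union>n. E n) \<in> sets M" using Eset sub sets_M by blast
 have DE: "D k n \<subseteq> (\<Union>n. E n)" for k n proof -
  have "D k n = E (prod_encode (k, n))" by (simp add: E_def)
  then show ?thesis by blast
 qed
 have "S - 1 / real (Suc k) \<le> p E" for k proof -
  have "p (D k) \<le> p E" unfolding p_def by (rule finite_measure_mono[OF _ EM]) (use DE in blast)
  then show ?thesis using D(2)[of k] by simp
 qed
 moreover have "(\<lambda>k. S - 1 / real (Suc k)) \<longlonglongrightarrow> S - 0"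
  by (intro tendsto_diff tendsto_const LIMSEQ_Suc[OF lim_1_over_n])
 ultimately have SE: "S \<le> p E" by (intro LIMSEQ_le_const2[of _ S]) auto
 show ?thesis proof (intro exI[of _ E] conjI allI ballI Eset)
  fix C assume C: "C \<in> \<C>"
  then have CM: "C \<in> sets M" using sub sets_M by blast
  define E' where "E' = case_nat C E"
  have "E' \<in> \<D>" using C Eset by (auto simp: E'_def \<D>_def split: nat.split)
  moreover have U: "(\<Union>n. E' n) = C \<union> (\<Union>n. E n)" unfolding E'_def by (auto split: nat.splits)
  ultimately have "prob (C \<union> (\<Union>n. E n)) \<le> prob (\<Union>n. E n)" using pS SE by (force simp: p_def)
  moreover have "prob (C \<union> (\<Union>n. E n)) = prob (\<Union>n. E n) + prob (C - (\<Union>n. E n))"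
   by (subst Un_commute, rule finite_measure_Union') (use CM EM in auto)
  ultimately have "prob (C - (\<Union>n. E n)) = 0" by (simp add: antisym measure_nonneg)
  then have "AE w in M. w \<notin> C - (\<Union>n. E n)"
   using CM EM by (intro AE_not_in) (auto simp: null_sets_def emeasure_eq_measure)
  then show "AE w\<in>C in M. w \<in> (\<Union>n. E n)" by eventually_elim auto
 qed
qed

text \<open>Exhaustion applied to the superlevel sets at rational heights.\<close>

lemma ess_sup_sequence:
 assumes S: "S \<subseteq> L0bar F" and ne: "S \<noteq> {}"
 obtains s where "\<And>n::nat. s n \<in> S" "\<And>t. t \<in> S \<Longrightarrow> AE w in M. t w \<le> (SUP n. s n w)" proof -
 let ?C = "\<lambda>q::rat. (\<lambda>t. {w \<in> space F. ereal (real_of_rat q) < t w}) ` S"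
 have ex: "\<exists>D. (\<forall>n::nat. D n \<in> S) \<and> (\<forall>t\<in>S. AE w in M. ereal (real_of_rat q) < t w \<longrightarrow> (\<exists>n. ereal (real_of_rat q) < D n w))" for q
 proof -
  have "?C q \<subseteq> sets F" using S by auto
  moreover have "?C q \<noteq> {}" using ne by simp
  ultimately have "\<exists>D. (\<forall>n::nat. D n \<in> ?C q) \<and> (\<forall>C\<in>?C q. AE w\<in>C in M. w \<in> (\<Union>n. D n))" by (rule exhaustion)
  then obtain D :: "nat \<Rightarrow> 'w set" where D: "\<And>n. D n \<in> ?C q"
   "\<And>C. C \<in> ?C q \<Longrightarrow> AE w\<in>C in M. w \<in> (\<Union>n. D n)" by blast
  have "\<forall>n. \<exists>t\<in>S. D n = {w \<in> space F. ereal (real_of_rat q) < t w}" using D(1) by blast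
  then obtain T where T: "\<And>n. T n \<in> S" "\<And>n. D n = {w \<in> space F. ereal (real_of_rat q) < T n w}" by metis
  have "AE w in M. ereal (real_of_rat q) < t w \<longrightarrow> (\<exists>n. ereal (real_of_rat q) < T n w)" if "t \<in> S" for t proof -
   have "AE w in M. w \<in> {w \<in> space F. ereal (real_of_rat q) < t w} \<longrightarrow> w \<in> (\<Union>n. D n)"
    by (rule D(2)) (use that in blast)
   then show ?thesis using AE_space by eventually_elim (auto simp: space_F T(2))
  qed
  then show ?thesis using T(1) by (intro exI[of _ T] conjI allI ballI)
 qed
 have "\<exists>T. \<forall>q. (\<forall>n::nat. T q n \<in> S) \<and> (\<forall>t\<in>S. AE w in M. ereal (real_of_rat q) < t w \<longrightarrow> (\<exists>n. ereal (real_of_rat q) < T q n w))"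
 proof (rule choice, rule allI)
  fix q show "\<exists>D. (\<forall>n::nat. D n \<in> S) \<and> (\<forall>t\<in>S. AE w in M. ereal (real_of_rat q) < t w \<longrightarrow> (\<exists>n. ereal (real_of_rat q) < D n w))"
   by (rule ex)
 qed
 then obtain T where TT: "\<forall>q. (\<forall>n::nat. T q n \<in> S) \<and> (\<forall>t\<in>S. AE w in M. ereal (real_of_rat q) < t w \<longrightarrow> (\<exists>n. ereal (real_of_rat q) < T q n w))"
  by (rule exE)
 have T1: "T q n \<in> S" for q n by (rule conjunct1[OF TT[THEN spec], THEN spec])
 have T2: "AE w in M. ereal (real_of_rat q) < t w \<longrightarrow> (\<exists>n. ereal (real_of_rat q) < T q n w)" if "t \<in> S" for q t
  by (rule conjunct2[OF TT[THEN spec], THEN bspec, OF that])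
 define s where "s i = (case from_nat i of (q :: rat, n) \<Rightarrow> T q n)" for i
 show ?thesis proof (rule that[of s])
  show "s n \<in> S" for n using T1 by (auto simp: s_def split: prod.split)
  fix t assume t: "t \<in> S"
  have "AE w in M. \<forall>q. ereal (real_of_rat q) < t w \<longrightarrow> (\<exists>n. ereal (real_of_rat q) < T q n w)"
   by (subst AE_all_countable) (use T2[OF t] in blast)
  then show "AE w in M. t w \<le> (SUP n. s n w)" proof eventually_elim
   case (elim w)
   show ?case proof (rule ccontr)
    assume "\<not> ?thesis"
    then obtain q where q: "(SUP n. s n w) < ereal (real_of_rat q)" "ereal (real_of_rat q) < t w"
     using ereal_dense3[of "SUP n. s n w" "t w"] by (auto simp: not_le)
    then obtain n where n: "ereal (real_of_rat q) < T q n w" using elim by blast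
    have "T q n w = s (to_nat (q, n)) w" by (simp add: s_def)
    also have "\<dots> \<le> (SUP n. s n w)" by (rule SUP_upper) simp
    finally show False using n q(1) by simp
   qed
  qed
 qed
qed

lemma is_esssup_ess_sup:
 assumes S: "S \<subseteq> L0bar F" and ne: "S \<noteq> {}"
 shows "is_esssup M (L0bar F) S (ess_sup M F S)" proof -
 obtain s where s: "\<And>n::nat. s n \<in> S" "\<And>t. t \<in> S \<Longrightarrow> AE w in M. t w \<le> (SUP n. s n w)"
  using ess_sup_sequence[OF assms] by blast
 have "is_esssup M (L0bar F) S (\<lambda>w. SUP n. s n w)" unfolding is_esssup_def proof (intro conjI ballI impI)
  show "(\<lambda>w. SUP n. s n w) \<in> L0bar F" using s(1) S by (intro borel_measurable_SUP) auto
  show "AE w in M. t w \<le> (SUP n. s n w)" if "t \<in> S" for t by (rule s(2)[OF that])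
  fix g assume "\<forall>t\<in>S. AE w in M. t w \<le> g w"
  then have "AE w in M. \<forall>n. s n w \<le> g w" using s(1) by (subst AE_all_countable) blast
  then show "AE w in M. (SUP n. s n w) \<le> g w" by eventually_elim (auto intro: SUP_least)
 qed
 then show ?thesis unfolding ess_sup_def by (rule someI[of "is_esssup M (L0bar F) S"])
qed

lemma is_essinf_ess_inf:
 assumes S: "S \<subseteq> L0bar F" and ne: "S \<noteq> {}"
 shows "is_essinf M (L0bar F) S (ess_inf M F S)" proof -
 let ?m = "\<lambda>t w. - t w :: ereal"
 have "is_esssup M (L0bar F) (?m ` S) (ess_sup M F (?m ` S))" using S ne by (intro is_esssup_ess_sup) auto
 then have h: "ess_sup M F (?m ` S) \<in> L0bar F" "\<And>t. t \<in> S \<Longrightarrow> AE w in M. - t w \<le> ess_sup M F (?m ` S) w"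
  "\<And>g. g \<in> L0bar F \<Longrightarrow> \<forall>t\<in>S. AE w in M. - t w \<le> g w \<Longrightarrow> AE w in M. ess_sup M F (?m ` S) w \<le> g w"
  by (auto simp: is_esssup_def)
 have "is_essinf M (L0bar F) S (\<lambda>w. - ess_sup M F (?m ` S) w)" unfolding is_essinf_def
 proof (intro conjI ballI impI)
  show "(\<lambda>w. - ess_sup M F (?m ` S) w) \<in> L0bar F" using h(1) by simp
  show "AE w in M. - ess_sup M F (?m ` S) w \<le> t w" if "t \<in> S" for t
   using h(2)[OF that] by eventually_elim (simp add: ereal_uminus_le_reorder)
  fix g assume g: "g \<in> L0bar F" "\<forall>s\<in>S. AE w in M. g w \<le> s w"
  have "AE w in M. ess_sup M F (?m ` S) w \<le> - g w" by (rule h(3)) (use g in \<open>auto\<close>)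
  then show "AE w in M. g w \<le> - ess_sup M F (?m ` S) w"
   by eventually_elim (metis ereal_minus_le_minus ereal_uminus_uminus)
 qed
 then show ?thesis unfolding ess_inf_def by (rule someI[of "is_essinf M (L0bar F) S"])
qed

lemma decreasing_AE_tendsto_0:
 fixes g :: "nat \<Rightarrow> 'w \<Rightarrow> real"
 assumes int: "\<And>n. integrable M (g n)" and g0: "\<And>n. AE w in M. 0 \<le> g n w"
  and dec: "\<And>n. AE w in M. g (Suc n) w \<le> g n w" and lim: "(\<lambda>n. \<integral>w. g n w \<partial>M) \<longlonglongrightarrow> 0"
 shows "AE w in M. (\<lambda>n. g n w) \<longlonglongrightarrow> 0" proof -
 have gm: "g n \<in> L0 M" for n using int by simp
 have "AE w in M. \<forall>n. 0 \<le> g n w \<and> g (Suc n) w \<le> g n w"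
  using g0 dec by (subst AE_all_countable) (simp add: AE_conj_iff)
 then have ord: "AE w in M. decseq (\<lambda>n. g n w) \<and> (\<forall>n. 0 \<le> g n w)" by eventually_elim (auto intro: decseq_SucI)
 define G where "G w = lim (\<lambda>n. g n w)" for w
 have Gm: "G \<in> L0 M" unfolding G_def using gm by (rule borel_measurable_lim_metric)
 have glim: "AE w in M. (\<lambda>n. g n w) \<longlonglongrightarrow> G w" using ord proof eventually_elim
  case (elim w)
  have "convergent (\<lambda>n. g n w)" by (rule decseq_convergent[of _ 0]) (use elim in \<open>auto simp: convergent_def\<close>)
  then show ?case by (simp add: G_def convergent_LIMSEQ_iff)
 qed
 have gb: "AE w in M. norm (g n w) \<le> g 0 w" for n using ord by eventually_elim (auto simp: decseq_def)
 have Gb: "AE w in M. 0 \<le> G w \<and> G w \<le> g 0 w" using glim ord proof eventually_elim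
  case (elim w)
  have "0 \<le> G w" by (rule LIMSEQ_le_const[OF elim(1)]) (use elim(2) in auto)
  moreover have "G w \<le> g 0 w" by (rule LIMSEQ_le_const2[OF elim(1)]) (use elim(2) in \<open>auto simp: decseq_def\<close>)
  ultimately show ?case by simp
 qed
 have "(\<lambda>n. \<integral>w. g n w \<partial>M) \<longlonglongrightarrow> (\<integral>w. G w \<partial>M)"
  by (rule integral_dominated_convergence[OF Gm gm int[of 0] glim gb])
 then have G0: "(\<integral>w. G w \<partial>M) = 0" using lim LIMSEQ_unique by blast
 have Gi: "integrable M G"
  by (rule Bochner_Integration.integrable_bound[OF int[of 0] Gm]) (use Gb in \<open>auto elim: eventually_mono\<close>)
 have "AE w in M. 0 \<le> G w" using Gb by eventually_elim simp
 then have "AE w in M. G w = 0" using integral_nonneg_eq_0_iff_AE[OF Gi] G0 by simp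
 then show ?thesis using glim by eventually_elim simp
qed

lemma Xinf_levels:
 assumes x: "x \<in> Xinf"
 obtains N s where "N \<in> rnat" "\<And>k::nat. s k \<in> Linf M" "x = cat N s" proof -
 obtain \<eta> where e: "\<eta> \<in> L0 F" "\<And>w. \<eta> w \<ge> 1" "AE w in M. \<bar>x w\<bar> \<le> \<eta> w" using XinfE[OF x] by blast
 define N where "N w = nat \<lceil>\<eta> w\<rceil>" for w
 have N: "N \<in> rnat" unfolding N_def using e(1) by measurable
 define s where "s k w = (if N w = k then x w else 0)" for k w
 have NM: "N \<in> measurable M (count_space UNIV)" by (rule measurable_F_M[OF N])
 have sL: "s k \<in> Linf M" for k proof (rule LinfI[of _ "real k"])
  show "s k \<in> L0 M" unfolding s_def using Xinf_borel[OF x] NM by measurable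
  show "AE w in M. \<bar>s k w\<bar> \<le> real k" using e(3) proof eventually_elim
   case (elim w)
   have "\<eta> w \<le> real (N w)" unfolding N_def by (rule real_nat_ceiling_ge)
   then show ?case using elim by (simp add: s_def)
  qed
 qed
 have "x = cat N s" by (auto simp: cat_def s_def)
 then show ?thesis by (rule that[of N s, OF N sL])
qed

lemma integrable_in_X1: "integrable M y \<Longrightarrow> y \<in> X1"
 by (rule L1_in_X1) (simp add: L1_def)

lemma AE_nonneg_from_integrals:
 assumes D: "D \<in> L0 F" "integrable M D" and pos: "\<And>A. A \<in> sets F \<Longrightarrow> 0 \<le> (\<integral>w. indicator A w * D w \<partial>M)"
 shows "AE w in M. 0 \<le> D w" proof -
 define A where "A = {w \<in> space F. D w < 0}"
 have A: "A \<in> sets F" unfolding A_def using D(1) by measurable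
 have i: "integrable M (\<lambda>w. - (indicator A w * D w))"
  using integrable_mult_indicator[OF sets_M[OF A] D(2)] by (simp add: indicator_def)
 have nn: "0 \<le> - (indicator A w * D w)" for w by (auto simp: A_def indicator_def)
 have "(\<integral>w. - (indicator A w * D w) \<partial>M) \<le> 0" using pos[OF A] i by simp
 then have "(\<integral>w. - (indicator A w * D w) \<partial>M) = 0" using nn by (intro antisym integral_nonneg_AE) auto
 then have "AE w in M. - (indicator A w * D w) = 0" using integral_nonneg_eq_0_iff_AE[OF i] nn by simp
 then show ?thesis using AE_space by eventually_elim (auto simp: A_def indicator_def space_F split: if_splits)
qed

lemma integral_indicator_cexp:
 assumes "integrable M y" "A \<in> sets F"
 shows "(\<integral>w. indicator A w * cexp M F y w \<partial>M) = (\<integral>w. indicator A w * y w \<partial>M)" proof -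
 have y: "y \<in> X1" by (rule integrable_in_X1[OF assms(1)])
 have i: "indicator A \<in> L0 F" using assms(2) by simp
 have iy: "integrable M (\<lambda>w. indicator A w * y w)"
  by (rule integrable_Linf_L1[OF Linf_ind[OF sets_M[OF assms(2)]] assms(1)])
 have m: "cpair (indicator A) y \<in> L0 M" using cexp_integral(1)[OF iy] by simp
 have m2: "(\<lambda>w. indicator A w * cexp M F y w) \<in> L0 M" using L0_M[OF i] L0_M[OF cexp_L0[OF y]] by measurable
 have "(\<integral>w. indicator A w * cexp M F y w \<partial>M) = (\<integral>w. cpair (indicator A) y w \<partial>M)"
  by (rule integral_cong_AE[OF m2 m]) (use cexp_mult[OF i y] in auto)
 also have "\<dots> = (\<integral>w. indicator A w * y w \<partial>M)" by (rule cexp_integral(2)[OF iy])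
 finally show ?thesis .
qed

lemma L0N_measurable: "n \<in> L0N F \<Longrightarrow> n \<in> rnat"
 unfolding L0N_def by (rule measurable_compose[of n F "count_space {1..}" "\<lambda>x. x" "count_space UNIV", simplified]) auto

lemma L0N_ge: "n \<in> L0N F \<Longrightarrow> w \<in> space M \<Longrightarrow> 1 \<le> n w"
 unfolding L0N_def using measurable_space[of n F "count_space {1..}" w] by (auto simp: space_F)

lemma L0N_I: "n \<in> rnat \<Longrightarrow> (\<And>w. 1 \<le> n w) \<Longrightarrow> n \<in> L0N F"
 unfolding L0N_def by (rule measurable_count_space_extend[of "{1..}" UNIV]) auto

lemma L0N_max: "m \<in> L0N F \<Longrightarrow> 1 \<le> k \<Longrightarrow> (\<lambda>w. max (m w) k) \<in> L0N F"
proof (rule L0N_I)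
 assume "m \<in> L0N F"
 from L0N_measurable[OF this] show "(\<lambda>w. max (m w) k) \<in> rnat" by measurable
qed (simp add: max.coboundedI2)

lemma L0N_const: "1 \<le> k \<Longrightarrow> (\<lambda>_. k) \<in> L0N F"
 by (rule L0N_I) auto

end

section \<open>Conditional risk measures and their scalarisations\<close>

locale cond_risk = cond_space M F for M F :: "'w measure" +
 fixes \<rho> :: "('w \<Rightarrow> real) \<Rightarrow> 'w \<Rightarrow> real"
 assumes crm: "convex_risk_measure M F \<rho>"
begin

lemma rho_L0: "x \<in> Xinf \<Longrightarrow> \<rho> x \<in> L0 F"
 using crm by (simp add: convex_risk_measure_def)

lemma rho_mono: "x \<in> Xinf \<Longrightarrow> y \<in> Xinf \<Longrightarrow> AE w in M. x w \<le> y w \<Longrightarrow> AE w in M. \<rho> y w \<le> \<rho> x w"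
 using crm unfolding convex_risk_measure_def by blast

lemma rho_cash: "x \<in> Xinf \<Longrightarrow> \<eta> \<in> L0 F \<Longrightarrow> AE w in M. \<rho> (\<lambda>w. x w + \<eta> w) w = \<rho> x w - \<eta> w"
 using crm unfolding convex_risk_measure_def by blast

lemma rho_convex: "x \<in> Xinf \<Longrightarrow> y \<in> Xinf \<Longrightarrow> 0 \<le> t \<Longrightarrow> t \<le> 1 \<Longrightarrow>
  AE w in M. \<rho> (\<lambda>w. t * x w + (1 - t) * y w) w \<le> t * \<rho> x w + (1 - t) * \<rho> y w"
 using crm unfolding convex_risk_measure_def by blast

text \<open>Conditional cash invariance yields locality of \<open>\<rho>\<close>: an inequality that holds on a set of the
  small algebra can be enforced everywhere by cash supported off that set.\<close>

lemma rho_lipschitz_on: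
 assumes x: "x \<in> Xinf" and y: "y \<in> Xinf" and A: "A \<in> sets F" and e: "\<eta> \<in> L0 F"
  and le: "AE w\<in>A in M. x w \<le> y w + \<eta> w"
 shows "AE w\<in>A in M. \<rho> y w - \<eta> w \<le> \<rho> x w" proof -
 obtain K where K: "K \<in> L0 F" "AE w in M. \<bar>x w - y w\<bar> \<le> K w" using XinfE[OF Xinf_diff[OF x y]] by blast
 \<comment> \<open>off \<open>A\<close> the difference is absorbed by cash, which leaves no trace on \<open>A\<close>\<close>
 define h where "h w = (if w \<in> A then \<eta> w else K w)" for w
 have h: "h \<in> L0 F" unfolding h_def using A e K(1) by (intro measurable_If_set) auto
 have yh: "(\<lambda>w. y w + h w) \<in> Xinf" by (rule Xinf_add[OF y L0_in_Xinf[OF h]])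
 have "AE w in M. x w \<le> y w + h w" using le K(2) by eventually_elim (auto simp: h_def)
 from rho_mono[OF x yh this] rho_cash[OF y h]
 show ?thesis by eventually_elim (auto simp: h_def)
qed

lemma rho_local:
 assumes x: "x \<in> Xinf" and y: "y \<in> Xinf" and A: "A \<in> sets F" and eq: "AE w\<in>A in M. x w = y w"
 shows "AE w\<in>A in M. \<rho> x w = \<rho> y w" proof -
 have "AE w\<in>A in M. x w \<le> y w + 0" "AE w\<in>A in M. y w \<le> x w + 0" using eq by (auto elim!: eventually_mono)
 from rho_lipschitz_on[OF x y A _ this(1)] rho_lipschitz_on[OF y x A _ this(2)]
 have "AE w\<in>A in M. \<rho> y w - 0 \<le> \<rho> x w" "AE w\<in>A in M. \<rho> x w - 0 \<le> \<rho> y w" by auto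
 then show ?thesis by eventually_elim auto
qed

lemma rho_cong:
 assumes "x \<in> Xinf" "y \<in> Xinf" "AE w in M. x w = y w"
 shows "AE w in M. \<rho> x w = \<rho> y w"
 using rho_local[OF assms(1,2) sets.top] assms(3) AE_space by (auto simp: space_F)

lemma rho_cat:
 assumes N: "N \<in> rnat" and s: "\<And>k::nat. s k \<in> Xinf" and x: "x \<in> Xinf" and eq: "\<And>w. x w = s (N w) w"
 shows "AE w in M. \<rho> x w = \<rho> (s (N w)) w" proof (rule AE_levels[of N])
 fix k
 have "AE w in M. w \<in> {w \<in> space M. N w = k} \<longrightarrow> \<rho> x w = \<rho> (s k) w"
  by (rule rho_local[OF x s N_level[OF N]]) (auto simp: eq)
 then show "AE w in M. N w = k \<longrightarrow> \<rho> x w = \<rho> (s (N w)) w" using AE_space by eventually_elim auto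
qed

definition scal :: "('w \<Rightarrow> real) \<Rightarrow> ('w \<Rightarrow> real) \<Rightarrow> real" where
 "scal x1 x = (\<integral>w. \<rho> (\<lambda>v. x1 v + x v) w - \<rho> x1 w \<partial>M)"

lemma scal_bound:
 assumes x1: "x1 \<in> Xinf" and x: "x \<in> Linf M" and C: "AE w in M. \<bar>x w\<bar> \<le> C"
 shows "AE w in M. \<bar>\<rho> (\<lambda>v. x1 v + x v) w - \<rho> x1 w\<bar> \<le> C" proof -
 have s: "(\<lambda>v. x1 v + x v) \<in> Xinf" by (rule Xinf_add[OF x1 Linf_in_Xinf[OF x]])
 have "AE w\<in>space F in M. x1 w + x w \<le> x1 w + C" "AE w\<in>space F in M. x1 w \<le> x1 w + x w + C"
  using C by (auto elim!: eventually_mono)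
 from rho_lipschitz_on[OF s x1 sets.top _ this(1)] rho_lipschitz_on[OF x1 s sets.top _ this(2)]
 have "AE w\<in>space F in M. \<rho> x1 w - C \<le> \<rho> (\<lambda>v. x1 v + x v) w"
  "AE w\<in>space F in M. \<rho> (\<lambda>v. x1 v + x v) w - C \<le> \<rho> x1 w" by auto
 then show ?thesis using AE_space by eventually_elim (auto simp: space_F)
qed

lemma scal_measurable:
 assumes x1: "x1 \<in> Xinf" and x: "x \<in> Linf M"
 shows "(\<lambda>w. \<rho> (\<lambda>v. x1 v + x v) w - \<rho> x1 w) \<in> L0 F"
 using rho_L0[OF x1] rho_L0[OF Xinf_add[OF x1 Linf_in_Xinf[OF x]]] by measurable

lemma scal_integrable:
 assumes x1: "x1 \<in> Xinf" and x: "x \<in> Linf M"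
 shows "integrable M (\<lambda>w. \<rho> (\<lambda>v. x1 v + x v) w - \<rho> x1 w)" proof -
 obtain C where C: "AE w in M. \<bar>x w\<bar> \<le> C" using LinfE[OF x] by blast
 show ?thesis using scal_bound[OF x1 x C] L0_M[OF scal_measurable[OF x1 x]]
  by (intro integrable_const_bound[of _ C]) auto
qed

lemma scal_monetary:
 assumes x1: "x1 \<in> Xinf" shows "monetary (scal x1)" unfolding monetary_def proof (intro conjI ballI allI impI)
 have s: "(\<lambda>v. x1 v + x v) \<in> Xinf" if "x \<in> Linf M" for x by (rule Xinf_add[OF x1 Linf_in_Xinf[OF that]])
 {
  fix x y assume x: "x \<in> Linf M" and y: "y \<in> Linf M" and le: "AE w in M. x w \<le> y w"
  have "AE w in M. \<rho> (\<lambda>v. x1 v + y v) w \<le> \<rho> (\<lambda>v. x1 v + x v) w"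
   by (rule rho_mono[OF s[OF x] s[OF y]]) (use le in auto)
  then show "scal x1 y \<le> scal x1 x" unfolding scal_def by (intro integral_mono_AE scal_integrable x1 x y) auto
 next
  fix x and c :: real assume x: "x \<in> Linf M"
  have "AE w in M. \<rho> (\<lambda>v. (x1 v + x v) + c) w = \<rho> (\<lambda>v. x1 v + x v) w - c" by (rule rho_cash[OF s[OF x]]) simp
  then have "AE w in M. \<rho> (\<lambda>v. x1 v + (x v + c)) w - \<rho> x1 w = \<rho> (\<lambda>v. x1 v + x v) w - \<rho> x1 w - c"
   by (simp add: add.assoc)
  then have "scal x1 (\<lambda>w. x w + c) = (\<integral>w. \<rho> (\<lambda>v. x1 v + x v) w - \<rho> x1 w - c \<partial>M)" unfolding scal_def
   using L0_M[OF scal_measurable[OF x1 Linf_add[OF x Linf_const]]] L0_M[OF scal_measurable[OF x1 x]]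
   by (intro integral_cong_AE) auto
  also have "\<dots> = scal x1 x - c" unfolding scal_def using scal_integrable[OF x1 x] by (simp add: prob_space)
  finally show "scal x1 (\<lambda>w. x w + c) = scal x1 x - c" .
 next
  fix x y and t :: real assume x: "x \<in> Linf M" and y: "y \<in> Linf M" and t: "0 \<le> t \<and> t \<le> 1"
  have xy: "(\<lambda>w. t * x w + (1 - t) * y w) \<in> Linf M" by (intro Linf_add Linf_cmult x y)
  have eq: "(\<lambda>v. x1 v + (t * x v + (1 - t) * y v)) = (\<lambda>v. t * (x1 v + x v) + (1 - t) * (x1 v + y v))"
   by (auto simp: algebra_simps)
  have "AE w in M. \<rho> (\<lambda>v. t * (x1 v + x v) + (1 - t) * (x1 v + y v)) w
    \<le> t * \<rho> (\<lambda>v. x1 v + x v) w + (1 - t) * \<rho> (\<lambda>v. x1 v + y v) w" using t by (intro rho_convex s x y) auto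
  then have "AE w in M. \<rho> (\<lambda>v. x1 v + (t * x v + (1 - t) * y v)) w - \<rho> x1 w
    \<le> t * (\<rho> (\<lambda>v. x1 v + x v) w - \<rho> x1 w) + (1 - t) * (\<rho> (\<lambda>v. x1 v + y v) w - \<rho> x1 w)"
   unfolding eq by eventually_elim (simp add: algebra_simps)
  then have "scal x1 (\<lambda>w. t * x w + (1 - t) * y w)
    \<le> (\<integral>w. t * (\<rho> (\<lambda>v. x1 v + x v) w - \<rho> x1 w) + (1 - t) * (\<rho> (\<lambda>v. x1 v + y v) w - \<rho> x1 w) \<partial>M)"
   unfolding scal_def using scal_integrable[OF x1 x] scal_integrable[OF x1 y]
   by (intro integral_mono_AE scal_integrable[OF x1 xy]) auto
  also have "\<dots> = t * scal x1 x + (1 - t) * scal x1 y"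
   unfolding scal_def using scal_integrable[OF x1 x] scal_integrable[OF x1 y] by simp
  finally show "scal x1 (\<lambda>w. t * x w + (1 - t) * y w) \<le> t * scal x1 x + (1 - t) * scal x1 y" .
 }
qed

lemma lebesgue_shifted:
 assumes l: "lebesgue_property M \<rho>" and x1: "x1 \<in> Xinf" and bc: "bounded_as_conv M x x0"
 shows "AE w in M. (\<lambda>n. \<rho> (\<lambda>v. x1 v + x n v) w) \<longlonglongrightarrow> \<rho> (\<lambda>v. x1 v + x0 v) w" proof -
 obtain N s where N: "N \<in> rnat" and s: "\<And>k::nat. s k \<in> Linf M" and x1s: "x1 = cat N s"
  using Xinf_levels[OF x1] by blast
 have xL: "\<And>n. x n \<in> Linf M" and x0L: "x0 \<in> Linf M" using bc by (auto simp: bounded_as_conv_def)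
 have "AE w in M. \<forall>k. (\<lambda>n. \<rho> (\<lambda>v. s k v + x n v) w) \<longlonglongrightarrow> \<rho> (\<lambda>v. s k v + x0 v) w"
  using l bounded_as_conv_shift[OF bc s] unfolding lebesgue_property_def by (subst AE_all_countable) blast
 moreover have e: "AE w in M. \<rho> (\<lambda>v. x1 v + x' v) w = \<rho> (\<lambda>v. s (N w) v + x' v) w" if x': "x' \<in> Linf M" for x'
 proof (rule rho_cat[OF N, where s = "\<lambda>k v. s k v + x' v"])
  show "(\<lambda>v. s k v + x' v) \<in> Xinf" for k by (intro Xinf_add Linf_in_Xinf s x')
  show "(\<lambda>v. x1 v + x' v) \<in> Xinf" by (intro Xinf_add Linf_in_Xinf x1 x')
 qed (simp add: x1s cat_def)
 have "AE w in M. \<forall>n. \<rho> (\<lambda>v. x1 v + x n v) w = \<rho> (\<lambda>v. s (N w) v + x n v) w"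
  by (subst AE_all_countable) (use e[OF xL] in blast)
 ultimately show ?thesis using e[OF x0L] by eventually_elim simp
qed

lemma lebesgue_imp_upper_lebesgue_scal:
 assumes l: "lebesgue_property M \<rho>" and x1: "x1 \<in> Xinf"
 shows "upper_lebesgue (scal x1)" unfolding upper_lebesgue_def proof (intro allI impI)
 fix x x0 and e :: real assume bc: "bounded_as_conv M x x0" and e: "0 < e"
 have xL: "\<And>n. x n \<in> Linf M" and x0L: "x0 \<in> Linf M" using bc by (auto simp: bounded_as_conv_def)
 obtain C where C: "\<And>n. AE w in M. \<bar>x n w\<bar> \<le> C" using bc by (auto simp: bounded_as_conv_def)
 have "(\<lambda>n. scal x1 (x n)) \<longlonglongrightarrow> scal x1 x0" unfolding scal_def
 proof (rule integral_dominated_convergence[where w = "\<lambda>_. C"])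
  show "(\<lambda>w. \<rho> (\<lambda>v. x1 v + x0 v) w - \<rho> x1 w) \<in> L0 M" using scal_integrable[OF x1 x0L] by simp
  show "(\<lambda>w. \<rho> (\<lambda>v. x1 v + x n v) w - \<rho> x1 w) \<in> L0 M" for n using scal_integrable[OF x1 xL] by simp
  show "AE w in M. (\<lambda>n. \<rho> (\<lambda>v. x1 v + x n v) w - \<rho> x1 w) \<longlonglongrightarrow> \<rho> (\<lambda>v. x1 v + x0 v) w - \<rho> x1 w"
   using lebesgue_shifted[OF l x1 bc] by eventually_elim (intro tendsto_intros)
  show "AE w in M. norm (\<rho> (\<lambda>v. x1 v + x n v) w - \<rho> x1 w) \<le> C" for n using scal_bound[OF x1 xL C] by simp
 qed simp
 from order_tendstoD(2)[OF this] e show "\<forall>\<^sub>F n in sequentially. scal x1 (x n) < scal x1 x0 + e" by simp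
qed

text \<open>Monotone majorants reduce the claim to decreasing sequences, where convergence of the
  integrals gives convergence almost surely.\<close>

lemma upper_lebesgue_scal_imp_lebesgue:
 assumes u: "upper_lebesgue (scal (\<lambda>_. 0))" shows "lebesgue_property M \<rho>" unfolding lebesgue_property_def
proof (intro allI impI)
 fix x x0 assume bc: "bounded_as_conv M x x0"
 have xL: "\<And>n. x n \<in> Linf M" and x0L: "x0 \<in> Linf M" using bc by (auto simp: bounded_as_conv_def)
 obtain z C where zL: "\<And>n. z n \<in> Linf M" and z0: "\<And>n w. 0 \<le> z n w" and zC: "\<And>n w. z n w \<le> C"
  and anti: "\<And>m n w. m \<le> n \<Longrightarrow> z n w \<le> z m w" and zlim: "AE w in M. (\<lambda>n. z n w) \<longlonglongrightarrow> 0"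
  and xz: "\<And>n. AE w in M. \<bar>x n w - x0 w\<bar> \<le> z n w" using bounded_as_conv_tail[OF bc] by blast
 note LL = Linf_in_Xinf
 have dL: "(\<lambda>w. x0 w - z n w) \<in> Linf M" and uL: "(\<lambda>w. x0 w + z n w) \<in> Linf M" for n
  by (intro Linf_diff Linf_add x0L zL)+
 define g where "g n = (\<lambda>w. \<rho> (\<lambda>v. x0 v - z n v) w - \<rho> x0 w)" for n
 have g0: "AE w in M. 0 \<le> g n w" for n using rho_mono[OF LL[OF dL] LL[OF x0L], of n] z0 by (simp add: g_def)
 have ganti: "AE w in M. g (Suc n) w \<le> g n w" for n
  using rho_mono[OF LL[OF dL] LL[OF dL], of n "Suc n"] anti[of n "Suc n"] by (simp add: g_def)
 have z0c: "(\<lambda>_. 0::real) \<in> Xinf" by (rule Xinf_const)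
 have int: "integrable M (\<lambda>w. \<rho> x w - \<rho> (\<lambda>_. 0) w)" if "x \<in> Linf M" for x
  using scal_integrable[OF z0c that] by simp
 have gint: "integrable M (g n)" for n
  using Bochner_Integration.integrable_diff[OF int[OF dL[of n]] int[OF x0L]] by (simp add: g_def)
 have gscal: "(\<integral>w. g n w \<partial>M) = scal (\<lambda>_. 0) (\<lambda>w. x0 w - z n w) - scal (\<lambda>_. 0) x0" for n
  using Bochner_Integration.integral_diff[OF int[OF dL[of n]] int[OF x0L]] by (simp add: g_def scal_def)
 have bcd: "bounded_as_conv M (\<lambda>n w. x0 w - z n w) x0" proof -
  obtain D where D: "AE w in M. \<bar>x0 w\<bar> \<le> D" using LinfE[OF x0L] by blast
  have "AE w in M. \<bar>x0 w - z n w\<bar> \<le> D + C" for n using D proof eventually_elim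
   case (elim w) then show ?case using z0[of n w] zC[of n w] by linarith
  qed
  moreover have "AE w in M. (\<lambda>n. x0 w - z n w) \<longlonglongrightarrow> x0 w" using zlim proof eventually_elim
   case (elim w) show ?case using tendsto_diff[OF tendsto_const elim, of "x0 w"] by simp
  qed
  ultimately show ?thesis using dL x0L unfolding bounded_as_conv_def by blast
 qed
 have "(\<lambda>n. \<integral>w. g n w \<partial>M) \<longlonglongrightarrow> 0" proof (rule order_tendstoI)
  fix a :: real assume "a < 0"
  moreover have "0 \<le> (\<integral>w. g n w \<partial>M)" for n by (rule integral_nonneg_AE[OF g0])
  ultimately show "\<forall>\<^sub>F n in sequentially. a < (\<integral>w. g n w \<partial>M)"
   by (intro always_eventually allI) (rule less_le_trans)
 next
  fix a :: real assume "0 < a"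
  then have "\<forall>\<^sub>F n in sequentially. scal (\<lambda>_. 0) (\<lambda>w. x0 w - z n w) < scal (\<lambda>_. 0) x0 + a"
   using u bcd unfolding upper_lebesgue_def by blast
  then show "\<forall>\<^sub>F n in sequentially. (\<integral>w. g n w \<partial>M) < a" by eventually_elim (simp add: gscal)
 qed
 then have gzero: "AE w in M. (\<lambda>n. g n w) \<longlonglongrightarrow> 0" by (rule decreasing_AE_tendsto_0[of g, OF gint g0 ganti])
 have "AE w in M. \<bar>\<rho> (x n) w - \<rho> x0 w\<bar> \<le> g n w" for n proof -
  have a: "AE w in M. \<rho> (x n) w \<le> \<rho> (\<lambda>v. x0 v - z n v) w"
   by (rule rho_mono[OF LL[OF dL] LL[OF xL]]) (use xz[of n] in eventually_elim, auto)
  have b: "AE w in M. \<rho> (\<lambda>v. x0 v + z n v) w \<le> \<rho> (x n) w"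
   by (rule rho_mono[OF LL[OF xL] LL[OF uL]]) (use xz[of n] in eventually_elim, auto)
  \<comment> \<open>convexity bounds the downward deviation by the upward one\<close>
  have "AE w in M. \<rho> (\<lambda>v. 1/2 * (x0 v + z n v) + (1 - 1/2) * (x0 v - z n v)) w
    \<le> 1/2 * \<rho> (\<lambda>v. x0 v + z n v) w + (1 - 1/2) * \<rho> (\<lambda>v. x0 v - z n v) w"
   by (rule rho_convex[OF LL[OF uL] LL[OF dL]]) auto
  moreover have "(\<lambda>v. 1/2 * (x0 v + z n v) + (1 - 1/2) * (x0 v - z n v)) = x0" by (auto simp: field_simps)
  ultimately have "AE w in M. \<rho> x0 w \<le> 1/2 * \<rho> (\<lambda>v. x0 v + z n v) w + (1 - 1/2) * \<rho> (\<lambda>v. x0 v - z n v) w" by simp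
  with a b show ?thesis by eventually_elim (simp add: g_def abs_le_iff)
 qed
 then have "AE w in M. \<forall>n. \<bar>\<rho> (x n) w - \<rho> x0 w\<bar> \<le> g n w" by (subst AE_all_countable) blast
 then show "AE w in M. (\<lambda>n. \<rho> (x n) w) \<longlonglongrightarrow> \<rho> x0 w" using gzero proof eventually_elim
  case (elim w)
  have "(\<lambda>n. \<rho> (x n) w - \<rho> x0 w) \<longlonglongrightarrow> 0" by (rule Lim_null_comparison[OF _ elim(2)]) (use elim(1) in auto)
  then show ?case by (simp add: LIM_zero_iff)
 qed
qed

text \<open>Fatou's lemma, with the bound on the increments of \<open>\<rho>\<close> as integrable minorant.\<close>

lemma fatou_imp_lower_fatou_scal:
 assumes f: "fatou_property M \<rho>" shows "lower_fatou (scal (\<lambda>_. 0))" unfolding lower_fatou_def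
proof (intro allI impI)
 fix x x0 and e :: real assume bc: "bounded_as_conv M x x0" and e: "0 < e"
 have xL: "\<And>n. x n \<in> Linf M" and x0L: "x0 \<in> Linf M" using bc by (auto simp: bounded_as_conv_def)
 obtain C where C: "\<And>n. AE w in M. \<bar>x n w\<bar> \<le> C" using bc by (auto simp: bounded_as_conv_def)
 obtain D where D: "AE w in M. \<bar>x0 w\<bar> \<le> D" using LinfE[OF x0L] by blast
 have z0c: "(\<lambda>_. 0::real) \<in> Xinf" by (rule Xinf_const)
 define h where "h x = (\<lambda>w. \<rho> x w - \<rho> (\<lambda>_. 0) w)" for x
 have hi: "integrable M (h x)" and hs: "scal (\<lambda>_. 0) x = (\<integral>w. h x w \<partial>M)" if "x \<in> Linf M" for x
  using scal_integrable[OF z0c that] by (simp_all add: h_def scal_def)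
 have hb: "AE w in M. \<bar>h x w\<bar> \<le> C" if "x \<in> Linf M" "AE w in M. \<bar>x w\<bar> \<le> C" for x C
  using scal_bound[OF z0c that] by (simp add: h_def)
 define k where "k n w = min (h (x n) w - h x0 w) 0" for n w
 have km: "k n \<in> L0 M" for n unfolding k_def using hi[OF xL[of n]] hi[OF x0L] by measurable
 have kb: "AE w in M. norm (k n w) \<le> C + D" for n
  using hb[OF xL C, of n] hb[OF x0L D] by eventually_elim (auto simp: k_def)
 have klim: "AE w in M. (\<lambda>n. k n w) \<longlonglongrightarrow> 0" using f[unfolded fatou_property_def, rule_format, OF bc]
 proof eventually_elim
  case (elim w)
  show ?case proof (rule order_tendstoI)
   fix a :: real assume a: "a < 0"
   then have "ereal (\<rho> x0 w + a) < ereal (\<rho> x0 w)" by simp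
   also note elim
   finally have "ereal (\<rho> x0 w + a) < liminf (\<lambda>n. ereal (\<rho> (x n) w))" .
   from less_LiminfD[OF this] show "\<forall>\<^sub>F n in sequentially. a < k n w"
    by eventually_elim (use a in \<open>auto simp: k_def h_def\<close>)
  next
   fix a :: real assume "0 < a"
   then show "\<forall>\<^sub>F n in sequentially. k n w < a" by (intro always_eventually) (auto simp: k_def)
  qed
 qed
 have ki: "integrable M (k n)" for n using integrable_const_bound[OF kb km] by simp
 have "(\<lambda>n. \<integral>w. k n w \<partial>M) \<longlonglongrightarrow> (\<integral>w. 0 \<partial>M)"
  by (rule integral_dominated_convergence[OF _ km _ klim kb]) auto
 then have "\<forall>\<^sub>F n in sequentially. - e < (\<integral>w. k n w \<partial>M)" using e by (intro order_tendstoD(1)) auto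
 then show "\<forall>\<^sub>F n in sequentially. scal (\<lambda>_. 0) x0 - e < scal (\<lambda>_. 0) (x n)" proof eventually_elim
  case (elim n)
  have "(\<integral>w. k n w \<partial>M) \<le> (\<integral>w. h (x n) w - h x0 w \<partial>M)"
   using hi[OF xL] hi[OF x0L] ki by (intro integral_mono) (auto simp: k_def)
  also have "\<dots> = scal (\<lambda>_. 0) (x n) - scal (\<lambda>_. 0) x0" using hi[OF xL] hi[OF x0L] hs[OF xL] hs[OF x0L] by simp
  finally show ?case using elim by simp
 qed
qed

end

section \<open>Conditional subgradients\<close>

context cond_space
begin

lemma cexp_zero_imp_zero:
 assumes u: "u \<in> X1" and u0: "AE w in M. 0 \<le> u w" and c: "AE w in M. cexp M F u w = 0"
 shows "AE w in M. u w = 0" proof -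
 obtain \<eta> where e: "\<eta> \<in> L0 F" "\<And>w. \<eta> w \<ge> 1" "integrable M (\<lambda>w. u w / \<eta> w)" using X1E[OF u] by blast
 have epos: "0 < \<eta> w" for w using e(2)[of w] by simp
 have ie: "(\<lambda>w. 1 / \<eta> w) \<in> L0 F" using e(1) by measurable
 have "AE w in M. cexp M F (\<lambda>w. 1 / \<eta> w * u w) w = 0" using cexp_mult[OF ie u] c by eventually_elim simp
 then have "(\<integral>w. cexp M F (\<lambda>w. u w / \<eta> w) w \<partial>M) = (\<integral>w. 0 \<partial>M)"
  using cexp_integral(1)[OF e(3)] by (intro integral_cong_AE) (auto simp: borel_measurable_integrable)
 then have "(\<integral>w. u w / \<eta> w \<partial>M) = 0" using cexp_integral(2)[OF e(3)] by simp
 moreover have "AE w in M. 0 \<le> u w / \<eta> w" using u0 proof eventually_elim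
  case (elim w) then show ?case using epos[of w] by simp
 qed
 ultimately have "AE w in M. u w / \<eta> w = 0" using integral_nonneg_eq_0_iff_AE[OF e(3)] by simp
 then show ?thesis proof eventually_elim
  case (elim w) then show ?case using epos[of w] by simp
 qed
qed

end

context cond_risk
begin

text \<open>Large multiples decide both signs: adding cash \<open>t\<close> shows that \<open>t * (E[y|F] + 1)\<close> is bounded
  over all real \<open>t\<close>, and adding \<open>k * indicator {y > 0}\<close> lowers \<open>\<rho>\<close> while the pairing would grow with
  \<open>k\<close>.\<close>

lemma dominated_functional_density:
 assumes x1: "x1 \<in> Xinf" and y: "y \<in> X1" and b: "b \<in> sets F" and h: "h \<in> L0 F"
  and le: "\<And>x. x \<in> Linf M \<Longrightarrow> AE w\<in>b in M. cpair x y w \<le> \<rho> (\<lambda>v. x1 v + x v) w + h w"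
 shows "AE w\<in>b in M. y w \<le> 0" "AE w\<in>b in M. cexp M F y w = -1" proof -
 have ym: "y \<in> L0 M" by (rule X1_borel[OF y])
 have arch: "t \<le> 0" if "\<And>k::nat. real k * t \<le> s" for s t :: real using that by (meson not_le reals_Archimedean3)
 show "AE w\<in>b in M. cexp M F y w = -1" proof -
  have "AE w\<in>b in M. t * (cexp M F y w + 1) \<le> \<rho> x1 w + h w" for t proof -
   have "AE w in M. \<rho> (\<lambda>w. x1 w + t) w = \<rho> x1 w - t" by (rule rho_cash[OF x1]) simp
   with le[OF Linf_const[of t]] cexp_mult[OF borel_measurable_const y, of t]
   show ?thesis by eventually_elim (auto simp: algebra_simps)
  qed
  from this[of "real _"] this[of "- real _"]
  have "AE w in M. \<forall>k::nat. w \<in> b \<longrightarrow> real k * (cexp M F y w + 1) \<le> \<rho> x1 w + h w"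
   "AE w in M. \<forall>k::nat. w \<in> b \<longrightarrow> - real k * (cexp M F y w + 1) \<le> \<rho> x1 w + h w"
   by (auto simp only: AE_all_countable)
  then show ?thesis proof eventually_elim
   case (elim w)
   show ?case proof
    assume w: "w \<in> b"
    have "cexp M F y w + 1 \<le> 0" using elim(1) w by (intro arch[of _ "\<rho> x1 w + h w"]) blast
    moreover have "- (cexp M F y w + 1) \<le> 0"
     using elim(2) w by (intro arch[of _ "\<rho> x1 w + h w"]) (simp only: mult_minus_left mult_minus_right)
    ultimately show "cexp M F y w = -1" by simp
   qed
  qed
 qed
 show "AE w\<in>b in M. y w \<le> 0" proof -
  define B where "B = {w \<in> space M. 0 < y w}"
  have B: "B \<in> sets M" unfolding B_def using ym by measurable
  have iL: "indicator B \<in> Linf M" by (rule Linf_ind[OF B])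
  have uX: "(\<lambda>w. indicator B w * y w) \<in> X1" by (rule X1_mult[OF Linf_in_Xinf[OF iL] y])
  have "AE w\<in>b in M. real k * cpair (indicator B) y w \<le> \<rho> x1 w + h w" for k proof -
   have kL: "(\<lambda>w. real k * indicator B w) \<in> Linf M" by (rule Linf_cmult[OF iL])
   have "AE w in M. \<rho> (\<lambda>w. x1 w + real k * indicator B w) w \<le> \<rho> x1 w"
    by (rule rho_mono[OF x1 Xinf_add[OF x1 Linf_in_Xinf[OF kL]]]) (simp add: indicator_def)
   with le[OF kL] cexp_mult[OF borel_measurable_const uX, of "real k"]
   show ?thesis by eventually_elim (auto simp: mult.assoc)
  qed
  then have "AE w in M. \<forall>k::nat. w \<in> b \<longrightarrow> real k * cpair (indicator B) y w \<le> \<rho> x1 w + h w"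
   by (subst AE_all_countable) blast
  then have up: "AE w\<in>b in M. cpair (indicator B) y w \<le> 0" proof eventually_elim
   case (elim w) show ?case using elim by (intro impI arch[of _ "\<rho> x1 w + h w"]) blast
  qed
  have nn: "0 \<le> indicator B w * y w" for w by (auto simp: B_def indicator_def)
  have ib: "indicator b \<in> L0 F" using b by simp
  have "AE w in M. indicator b w * (indicator B w * y w) = 0" proof (rule cexp_zero_imp_zero)
   show "(\<lambda>w. indicator b w * (indicator B w * y w)) \<in> X1" by (rule X1_mult[OF L0_in_Xinf[OF ib] uX])
   show "AE w in M. 0 \<le> indicator b w * (indicator B w * y w)" using nn by (intro AE_I2) (simp split: split_indicator)
   have "AE w in M. 0 \<le> cpair (indicator B) y w" by (rule cexp_nonneg[OF uX]) (simp add: nn)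
   with up cexp_mult[OF ib uX] show "AE w in M. cexp M F (\<lambda>w. indicator b w * (indicator B w * y w)) w = 0"
    by eventually_elim (auto simp: indicator_def)
  qed
  then show ?thesis using AE_space by eventually_elim (auto simp: B_def indicator_def split: if_splits)
 qed
qed

lemma scal_indicator:
 assumes x1: "x1 \<in> Xinf" and x: "x \<in> Linf M" and A: "A \<in> sets F"
 shows "scal x1 (\<lambda>w. indicator A w * x w) = (\<integral>w. indicator A w * (\<rho> (\<lambda>v. x1 v + x v) w - \<rho> x1 w) \<partial>M)" proof -
 have ix: "(\<lambda>w. indicator A w * x w) \<in> Linf M" by (rule Linf_mult[OF Linf_ind[OF sets_M[OF A]] x])
 have s: "(\<lambda>v. x1 v + x v) \<in> Xinf" and si: "(\<lambda>v. x1 v + indicator A v * x v) \<in> Xinf"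
  by (intro Xinf_add x1 Linf_in_Xinf x ix)+
 have Ac: "space F - A \<in> sets F" using A by auto
 have "AE w\<in>A in M. \<rho> (\<lambda>v. x1 v + indicator A v * x v) w = \<rho> (\<lambda>v. x1 v + x v) w"
  by (rule rho_local[OF si s A]) (simp add: indicator_def)
 moreover have "AE w\<in>space F - A in M. \<rho> (\<lambda>v. x1 v + indicator A v * x v) w = \<rho> x1 w"
  by (rule rho_local[OF si x1 Ac]) (simp add: indicator_def)
 ultimately have ae: "AE w in M. \<rho> (\<lambda>v. x1 v + indicator A v * x v) w - \<rho> x1 w
   = indicator A w * (\<rho> (\<lambda>v. x1 v + x v) w - \<rho> x1 w)"
  using AE_space by eventually_elim (auto simp: indicator_def space_F)
 show ?thesis unfolding scal_def proof (rule integral_cong_AE[OF _ _ ae])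
  show "(\<lambda>w. \<rho> (\<lambda>v. x1 v + indicator A v * x v) w - \<rho> x1 w) \<in> L0 M" by (rule L0_M[OF scal_measurable[OF x1 ix]])
  have "indicator A \<in> L0 M" using sets_M[OF A] by simp
  then show "(\<lambda>w. indicator A w * (\<rho> (\<lambda>v. x1 v + x v) w - \<rho> x1 w)) \<in> L0 M"
   using L0_M[OF scal_measurable[OF x1 x]] by measurable
 qed
qed

text \<open>Testing with \<open>indicator A * x\<close> localises the scalar inequality to every \<open>A\<close> in the small
  algebra.\<close>

lemma scal_subgradient_conditional:
 assumes x1: "x1 \<in> Xinf" and sg: "subgradient (scal x1) (\<lambda>_. 0) 0 y"
 shows "y \<in> L1 M" "AE w in M. y w \<le> 0" "AE w in M. cexp M F y w = -1"
  "\<And>x. x \<in> Linf M \<Longrightarrow> AE w in M. cpair x y w \<le> \<rho> (\<lambda>v. x1 v + x v) w - \<rho> x1 w" proof -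
 have yi: "integrable M y" using sg by (simp add: subgradient_def)
 then show yL: "y \<in> L1 M" by (simp add: L1_def)
 have "scal x1 (\<lambda>_. 0) = 0" by (simp add: scal_def)
 then have le: "(\<integral>w. x w * y w \<partial>M) \<le> scal x1 x" if "x \<in> Linf M" for x
  using sg that by (auto simp: subgradient_def)
 show cond: "AE w in M. cpair x y w \<le> \<rho> (\<lambda>v. x1 v + x v) w - \<rho> x1 w" if x: "x \<in> Linf M" for x proof -
  have xyi: "integrable M (\<lambda>w. x w * y w)" by (rule integrable_Linf_L1[OF x yi])
  have xyL: "(\<lambda>w. x w * y w) \<in> X1" by (rule integrable_in_X1[OF xyi])
  have "AE w in M. 0 \<le> (\<rho> (\<lambda>v. x1 v + x v) w - \<rho> x1 w) - cpair x y w" proof (rule AE_nonneg_from_integrals)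
   show "(\<lambda>w. (\<rho> (\<lambda>v. x1 v + x v) w - \<rho> x1 w) - cpair x y w) \<in> L0 F"
    using scal_measurable[OF x1 x] cexp_L0[OF xyL] by measurable
   show "integrable M (\<lambda>w. (\<rho> (\<lambda>v. x1 v + x v) w - \<rho> x1 w) - cpair x y w)"
    by (rule Bochner_Integration.integrable_diff[OF scal_integrable[OF x1 x] cexp_integral(1)[OF xyi]])
   fix A assume A: "A \<in> sets F"
   have ix: "(\<lambda>w. indicator A w * x w) \<in> Linf M" by (rule Linf_mult[OF Linf_ind[OF sets_M[OF A]] x])
   have i1: "integrable M (\<lambda>w. indicator A w * (\<rho> (\<lambda>v. x1 v + x v) w - \<rho> x1 w))"
    by (rule integrable_Linf_L1[OF Linf_ind[OF sets_M[OF A]] scal_integrable[OF x1 x]])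
   have i2: "integrable M (\<lambda>w. indicator A w * cpair x y w)"
    by (rule integrable_Linf_L1[OF Linf_ind[OF sets_M[OF A]] cexp_integral(1)[OF xyi]])
   have "(\<integral>w. indicator A w * cpair x y w \<partial>M) = (\<integral>w. indicator A w * x w * y w \<partial>M)"
    using integral_indicator_cexp[OF xyi A] by (simp add: mult.assoc)
   also have "\<dots> \<le> (\<integral>w. indicator A w * (\<rho> (\<lambda>v. x1 v + x v) w - \<rho> x1 w) \<partial>M)"
    using le[OF ix] scal_indicator[OF x1 x A] by simp
   finally show "0 \<le> (\<integral>w. indicator A w * ((\<rho> (\<lambda>v. x1 v + x v) w - \<rho> x1 w) - cpair x y w) \<partial>M)"
    using Bochner_Integration.integral_diff[OF i1 i2] by (simp add: right_diff_distrib)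
  qed
  then show ?thesis by eventually_elim simp
 qed
 have "AE w\<in>space F in M. cpair x y w \<le> \<rho> (\<lambda>v. x1 v + x v) w + - \<rho> x1 w" if "x \<in> Linf M" for x
  using cond[OF that] by eventually_elim simp
 from dominated_functional_density[OF x1 L1_in_X1[OF yL] sets.top _ this] rho_L0[OF x1]
 have "AE w\<in>space F in M. y w \<le> 0" "AE w\<in>space F in M. cexp M F y w = -1" by auto
 then show "AE w in M. y w \<le> 0" "AE w in M. cexp M F y w = -1"
  using AE_space by (auto simp: space_F elim: eventually_elim2)
qed

text \<open>Estimates against bounded test functions extend to conditionally bounded ones by gluing.\<close>

lemma subgradient_extend:
 assumes x1: "x1 \<in> Xinf" and y: "y \<in> X1" and b: "b \<in> sets F" and h: "h \<in> L0 F"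
  and le: "\<And>x. x \<in> Linf M \<Longrightarrow> AE w\<in>b in M. cpair x y w \<le> \<rho> (\<lambda>v. x1 v + x v) w + h w" and x: "x \<in> Xinf"
 shows "AE w\<in>b in M. cpair x y w \<le> \<rho> (\<lambda>v. x1 v + x v) w + h w" proof -
 obtain N s where N: "N \<in> rnat" and s: "\<And>k::nat. s k \<in> Linf M" and xs: "x = cat N s"
  using Xinf_levels[OF x] by blast
 have sc: "s k \<in> Xinf" for k by (rule Linf_in_Xinf[OF s])
 have a: "AE w in M. \<rho> (\<lambda>v. x1 v + x v) w = \<rho> (\<lambda>v. x1 v + s (N w) v) w"
 proof (rule rho_cat[OF N, where s = "\<lambda>k v. x1 v + s k v"])
  show "(\<lambda>v. x1 v + s k v) \<in> Xinf" for k by (rule Xinf_add[OF x1 sc])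
  show "(\<lambda>v. x1 v + x v) \<in> Xinf" by (rule Xinf_add[OF x1 x])
 qed (simp add: xs cat_def)
 have "cat N (\<lambda>k v. s k v * y v) = (\<lambda>v. x v * y v)" by (auto simp: xs cat_def)
 then have b: "AE w in M. cpair x y w = cexp M F (\<lambda>v. s (N w) v * y v) w"
  using cexp_cat[OF N, of "\<lambda>k v. s k v * y v"] X1_mult[OF sc y] by simp
 have "AE w in M. \<forall>k. w \<in> b \<longrightarrow> cpair (s k) y w \<le> \<rho> (\<lambda>v. x1 v + s k v) w + h w"
  by (subst AE_all_countable) (use le[OF s] in blast)
 with a b show ?thesis by eventually_elim simp
qed

subsection \<open>The conjugate\<close>

section \<open>Attainment in the dual representation\<close>

lemma conj_fun_esssup:
 assumes X: "X \<subseteq> Xinf" "X \<noteq> {}" and y: "y \<in> X1"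
 shows "conj_fun M F X \<rho> y \<in> L0bar F"
  "\<And>x. x \<in> X \<Longrightarrow> AE w in M. ereal (cpair x y w - \<rho> x w) \<le> conj_fun M F X \<rho> y w"
  "\<And>g. g \<in> L0bar F \<Longrightarrow> (\<And>x. x \<in> X \<Longrightarrow> AE w in M. ereal (cpair x y w - \<rho> x w) \<le> g w) \<Longrightarrow>
    AE w in M. conj_fun M F X \<rho> y w \<le> g w" proof -
 let ?S = "(\<lambda>x w. ereal (cpair x y w - \<rho> x w)) ` X"
 have "?S \<subseteq> L0bar F" proof
  fix s assume "s \<in> ?S"
  then obtain x where x: "x \<in> X" "s = (\<lambda>w. ereal (cpair x y w - \<rho> x w))" by blast
  have "x \<in> Xinf" using x(1) X(1) by blast
  then show "s \<in> L0bar F" unfolding x(2) using cexp_L0[OF X1_mult[OF _ y], of x] rho_L0[of x] by measurable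
 qed
 moreover have "?S \<noteq> {}" using X(2) by simp
 ultimately have "is_esssup M (L0bar F) ?S (conj_fun M F X \<rho> y)"
  unfolding conj_fun_def by (rule is_esssup_ess_sup)
 then have h: "conj_fun M F X \<rho> y \<in> L0bar F" "\<forall>s\<in>?S. AE w in M. s w \<le> conj_fun M F X \<rho> y w"
  "\<forall>g\<in>L0bar F. (\<forall>s\<in>?S. AE w in M. s w \<le> g w) \<longrightarrow> (AE w in M. conj_fun M F X \<rho> y w \<le> g w)"
  unfolding is_esssup_def by simp_all
 show "conj_fun M F X \<rho> y \<in> L0bar F" by (rule h(1))
 show "AE w in M. ereal (cpair x y w - \<rho> x w) \<le> conj_fun M F X \<rho> y w" if "x \<in> X" for x
  using h(2)[THEN bspec, OF imageI[OF that]] .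
 show "AE w in M. conj_fun M F X \<rho> y w \<le> g w"
  if g: "g \<in> L0bar F" and le: "\<And>x. x \<in> X \<Longrightarrow> AE w in M. ereal (cpair x y w - \<rho> x w) \<le> g w" for g proof -
  have "\<forall>s\<in>?S. AE w in M. s w \<le> g w" using le by simp
  then show ?thesis using h(3) g by simp
 qed
qed

lemma conj_fun_le_iff:
 assumes X: "X \<subseteq> Xinf" "X \<noteq> {}" and y: "y \<in> X1" and b: "b \<in> sets F" and c: "c \<in> L0 F"
 shows "(AE w\<in>b in M. conj_fun M F X \<rho> y w \<le> ereal (c w)) \<longleftrightarrow>
     (\<forall>x\<in>X. AE w\<in>b in M. cpair x y w \<le> \<rho> x w + c w)" proof
 assume le: "AE w\<in>b in M. conj_fun M F X \<rho> y w \<le> ereal (c w)"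
 show "\<forall>x\<in>X. AE w\<in>b in M. cpair x y w \<le> \<rho> x w + c w" proof
  fix x assume "x \<in> X"
  from conj_fun_esssup(2)[OF X y this] le
  show "AE w\<in>b in M. cpair x y w \<le> \<rho> x w + c w" proof eventually_elim
   case (elim w)
   show ?case proof
    assume "w \<in> b"
    then have "ereal (cpair x y w - \<rho> x w) \<le> ereal (c w)" using elim by (meson order_trans)
    then show "cpair x y w \<le> \<rho> x w + c w" by simp
   qed
  qed
 qed
next
 assume le: "\<forall>x\<in>X. AE w\<in>b in M. cpair x y w \<le> \<rho> x w + c w"
 define g where "g w = (if w \<in> b then ereal (c w) else \<infinity>)" for w
 have g: "g \<in> L0bar F" unfolding g_def using b c by (intro measurable_If_set) auto
 have "AE w in M. conj_fun M F X \<rho> y w \<le> g w" proof (rule conj_fun_esssup(3)[OF X y g])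
  fix x assume "x \<in> X"
  then have "AE w\<in>b in M. cpair x y w \<le> \<rho> x w + c w" using le by blast
  then show "AE w in M. ereal (cpair x y w - \<rho> x w) \<le> g w" by eventually_elim (auto simp: g_def)
 qed
 then show "AE w\<in>b in M. conj_fun M F X \<rho> y w \<le> ereal (c w)" by eventually_elim (auto simp: g_def)
qed

text \<open>A conditional subgradient at \<open>x1\<close> attains at \<open>x1\<close> the supremum that defines the conjugate.\<close>

lemma conj_fun_attained:
 assumes X: "X \<subseteq> Xinf" and y: "y \<in> X1" and x1: "x1 \<in> X"
  and le: "\<And>x. x \<in> Linf M \<Longrightarrow> AE w in M. cpair x y w \<le> \<rho> (\<lambda>v. x1 v + x v) w - \<rho> x1 w"
 shows "AE w in M. ereal (\<rho> x1 w) = ereal (cpair x1 y w) - conj_fun M F X \<rho> y w" proof -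
 have x1c: "x1 \<in> Xinf" and ne: "X \<noteq> {}" using X x1 by auto
 let ?c = "\<lambda>w. cpair x1 y w - \<rho> x1 w"
 have rL: "\<rho> x1 \<in> L0 F" by (rule rho_L0[OF x1c])
 have c: "?c \<in> L0 F" using cexp_L0[OF X1_mult[OF x1c y]] rL by measurable
 have mr: "(\<lambda>w. - \<rho> x1 w) \<in> L0 F" using rL by simp
 have "\<forall>x\<in>X. AE w\<in>space F in M. cpair x y w \<le> \<rho> x w + ?c w" proof
  fix x assume "x \<in> X"
  then have x: "x \<in> Xinf" using X by blast
  have d: "(\<lambda>w. x w - x1 w) \<in> Xinf" by (rule Xinf_diff[OF x x1c])
  have "AE w\<in>space F in M. cexp M F (\<lambda>v. (x v - x1 v) * y v) w \<le> \<rho> (\<lambda>v. x1 v + (x v - x1 v)) w + - \<rho> x1 w"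
  proof (rule subgradient_extend[OF x1c y sets.top mr _ d])
   fix x' assume "x' \<in> Linf M"
   from le[OF this] show "AE w\<in>space F in M. cpair x' y w \<le> \<rho> (\<lambda>v. x1 v + x' v) w + - \<rho> x1 w"
    by eventually_elim simp
  qed
  moreover have "AE w in M. cexp M F (\<lambda>v. x v * y v - x1 v * y v) w = cpair x y w - cpair x1 y w"
   by (rule cexp_diff[OF X1_mult[OF x y] X1_mult[OF x1c y]])
  ultimately show "AE w\<in>space F in M. cpair x y w \<le> \<rho> x w + ?c w"
   by eventually_elim (auto simp: left_diff_distrib)
 qed
 then have "AE w\<in>space F in M. conj_fun M F X \<rho> y w \<le> ereal (?c w)"
  using conj_fun_le_iff[OF X ne y sets.top c] by simp
 moreover have "AE w in M. ereal (?c w) \<le> conj_fun M F X \<rho> y w" by (rule conj_fun_esssup(2)[OF X ne y x1])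
 ultimately show ?thesis using AE_space proof eventually_elim
  case (elim w)
  then have "conj_fun M F X \<rho> y w = ereal (?c w)" by (intro antisym) (auto simp: space_F)
  then show ?case by simp
 qed
qed

lemma lebesgue_imp_attained:
 assumes l: "lebesgue_property M \<rho>" and X: "X \<subseteq> Xinf" and x1: "x1 \<in> X"
 shows "\<exists>y\<in>L1 M. (AE w in M. y w \<le> 0) \<and> (AE w in M. cexp M F y w = -1) \<and>
   (AE w in M. ereal (\<rho> x1 w) = ereal (cpair x1 y w) - conj_fun M F X \<rho> y w)" proof -
 have x1c: "x1 \<in> Xinf" using X x1 by blast
 obtain y where y: "subgradient (scal x1) (\<lambda>_. 0) 0 y"
  using upper_lebesgue_imp_subgradient[OF scal_monetary[OF x1c] lebesgue_imp_upper_lebesgue_scal[OF l x1c] Linf_const] by blast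
 note sg = scal_subgradient_conditional[OF x1c y]
 show ?thesis using sg(1-3) conj_fun_attained[OF X L1_in_X1[OF sg(1)] x1 sg(4)] by (intro bexI[of _ y] conjI)
qed

text \<open>The conditional expectation of \<open>- y\<close> is 1, so the integrals of \<open>- y\<close> over sets exhausting the
  space stay bounded by 1.\<close>

lemma conditional_density_integrable:
 assumes y: "y \<in> X1" and neg: "AE w in M. y w \<le> 0" and one: "AE w in M. cexp M F y w = -1"
 shows "y \<in> L1 M" proof -
 obtain \<eta> where e: "\<eta> \<in> L0 F" "\<And>w. \<eta> w \<ge> 1" "integrable M (\<lambda>w. y w / \<eta> w)" using X1E[OF y] by blast
 define A where "A k = {w \<in> space F. \<eta> w \<le> real k}" for k :: nat
 have A: "A k \<in> sets F" for k unfolding A_def using e(1) by measurable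
 have ym: "y \<in> L0 M" by (rule X1_borel[OF y])
 have em: "\<eta> \<in> L0 M" by (rule L0_M[OF e(1)])
 have Ai: "(indicator (A k) :: 'w \<Rightarrow> real) \<in> L0 F" for k using A by simp
 have int: "integrable M (\<lambda>w. - (indicator (A k) w * y w))" for k proof -
  have "(\<lambda>w. indicator (A k) w * \<eta> w) \<in> Linf M" proof (rule LinfI[of _ "real k"])
   show "(\<lambda>w. indicator (A k) w * \<eta> w) \<in> L0 M" using L0_M[OF Ai] em by measurable
   show "AE w in M. \<bar>indicator (A k) w * \<eta> w\<bar> \<le> real k" proof (rule AE_I2)
    fix w show "\<bar>indicator (A k) w * \<eta> w\<bar> \<le> real k" using e(2)[of w] by (auto simp: A_def indicator_def)
   qed
  qed
  from integrable_Linf_L1[OF this e(3)]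
  have "integrable M (\<lambda>w. indicator (A k) w * \<eta> w * (y w / \<eta> w))" .
  moreover have "indicator (A k) w * \<eta> w * (y w / \<eta> w) = indicator (A k) w * y w" for w using e(2)[of w] by simp
  ultimately show ?thesis by simp
 qed
 have val: "(\<integral>w. - (indicator (A k) w * y w) \<partial>M) \<le> 1" for k proof -
  have i: "integrable M (\<lambda>w. indicator (A k) w * y w)" using int[of k] by simp
  have "(\<integral>w. - (indicator (A k) w * y w) \<partial>M) = - (\<integral>w. cexp M F (\<lambda>w. indicator (A k) w * y w) w \<partial>M)"
   using cexp_integral(2)[OF i] by simp
  also have "\<dots> = (\<integral>w. - cexp M F (\<lambda>w. indicator (A k) w * y w) w \<partial>M)" by simp
  also have "\<dots> \<le> (\<integral>w. 1 \<partial>M)" proof (rule integral_mono_AE)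
   show "integrable M (\<lambda>w. - cexp M F (\<lambda>w. indicator (A k) w * y w) w)" using cexp_integral(1)[OF i] by simp
   show "AE w in M. - cexp M F (\<lambda>w. indicator (A k) w * y w) w \<le> 1"
    using cexp_mult[OF Ai y, of k] one by eventually_elim (auto simp: indicator_def)
  qed simp
  also have "\<dots> = 1" by (simp add: prob_space)
  finally show ?thesis .
 qed
 have "(\<integral>\<^sup>+w. ennreal \<bar>y w\<bar> \<partial>M) = (\<integral>\<^sup>+w. (SUP k. ennreal (- (indicator (A k) w * y w))) \<partial>M)"
 proof (rule nn_integral_cong_AE)
  show "AE w in M. ennreal \<bar>y w\<bar> = (SUP k. ennreal (- (indicator (A k) w * y w)))" using neg AE_space
  proof eventually_elim
   case (elim w)
   obtain k where k: "\<eta> w \<le> real k" using real_arch_simple by blast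
   have "ennreal \<bar>y w\<bar> = ennreal (- (indicator (A k) w * y w))" using k elim by (simp add: A_def space_F)
   also have "\<dots> \<le> (SUP k. ennreal (- (indicator (A k) w * y w)))" by (rule SUP_upper) simp
   finally have "ennreal \<bar>y w\<bar> \<le> (SUP k. ennreal (- (indicator (A k) w * y w)))" .
   moreover have "(SUP k. ennreal (- (indicator (A k) w * y w))) \<le> ennreal \<bar>y w\<bar>"
    by (rule SUP_least) (auto simp: indicator_def intro: ennreal_leI)
   ultimately show ?case by simp
  qed
 qed
 also have "\<dots> = (SUP k. \<integral>\<^sup>+w. ennreal (- (indicator (A k) w * y w)) \<partial>M)"
 proof (rule nn_integral_monotone_convergence_SUP_AE)
  show "(\<lambda>w. ennreal (- (indicator (A k) w * y w))) \<in> borel_measurable M" for k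
   using L0_M[OF Ai] ym by measurable
  show "AE w in M. ennreal (- (indicator (A k) w * y w)) \<le> ennreal (- (indicator (A (Suc k)) w * y w))" for k
   using neg by eventually_elim (auto simp: A_def indicator_def intro!: ennreal_leI)
 qed
 also have "\<dots> \<le> 1" proof (rule SUP_least)
  fix k
  have "(\<integral>\<^sup>+w. ennreal (- (indicator (A k) w * y w)) \<partial>M) = ennreal (\<integral>w. - (indicator (A k) w * y w) \<partial>M)"
   by (rule nn_integral_eq_integral[OF int]) (use neg in eventually_elim, auto simp: indicator_def)
  also have "\<dots> \<le> 1" using val[of k] by (metis ennreal_1 ennreal_leI)
  finally show "(\<integral>\<^sup>+w. ennreal (- (indicator (A k) w * y w)) \<partial>M) \<le> 1" .
 qed
 also have "(1::ennreal) < \<infinity>" by simp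
 finally have "(\<integral>\<^sup>+w. ennreal \<bar>y w\<bar> \<partial>M) < \<infinity>" .
 then have "integrable M y" using ym by (intro integrableI_bounded) auto
 then show ?thesis by (simp add: L1_def)
qed

text \<open>Integrating the conditional inequality at the maximiser gives an exact subgradient of the
  scalarisation.\<close>

lemma attained_imp_lebesgue:
 assumes X: "Linf M \<subseteq> X" "X \<subseteq> Xinf"
  and att: "\<And>x. x \<in> Linf M \<Longrightarrow> \<exists>y\<in>X1. (AE w in M. y w \<le> 0) \<and> (AE w in M. cexp M F y w = -1) \<and>
   (AE w in M. ereal (\<rho> x w) = ereal (cpair x y w) - conj_fun M F X \<rho> y w)"
 shows "lebesgue_property M \<rho>"
proof (rule upper_lebesgue_scal_imp_lebesgue, rule subgradients_imp_upper_lebesgue)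
 have z0c: "(\<lambda>_. 0::real) \<in> Xinf" by (rule Xinf_const)
 show "monetary (scal (\<lambda>_. 0))" by (rule scal_monetary[OF z0c])
 have int: "integrable M (\<lambda>w. \<rho> x w - \<rho> (\<lambda>_. 0) w)" if "x \<in> Linf M" for x
  using scal_integrable[OF z0c that] by simp
 fix x assume x: "x \<in> Linf M"
 obtain y where y: "y \<in> X1" "AE w in M. y w \<le> 0" "AE w in M. cexp M F y w = -1"
  and eq: "AE w in M. ereal (\<rho> x w) = ereal (cpair x y w) - conj_fun M F X \<rho> y w" using att[OF x] by blast
 have yL: "y \<in> L1 M" by (rule conditional_density_integrable[OF y])
 then have yi: "integrable M y" by (simp add: L1_def)
 have ne: "X \<noteq> {}" using X(1) x by blast
 have "scal (\<lambda>_. 0) x - 0 + (\<integral>w. (x' w - x w) * y w \<partial>M) \<le> scal (\<lambda>_. 0) x'" if x': "x' \<in> Linf M" for x' proof -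
  have "x' \<in> X" using X(1) x' by blast
  from conj_fun_esssup(2)[OF X(2) ne y(1) this] eq
  have le: "AE w in M. cpair x' y w - \<rho> x' w \<le> cpair x y w - \<rho> x w" proof eventually_elim
   case (elim w) then show ?case by (cases "conj_fun M F X \<rho> y w") auto
  qed
  have i: "integrable M (\<lambda>w. x w * y w)" "integrable M (\<lambda>w. x' w * y w)"
   using integrable_Linf_L1[OF _ yi] x x' by auto
  note ci = cexp_integral(1)[OF i(1)] cexp_integral(1)[OF i(2)]
  have dr: "integrable M (\<lambda>w. \<rho> x w - \<rho> x' w)"
   using Bochner_Integration.integrable_diff[OF int[OF x] int[OF x']] by simp
  have "(\<integral>w. cpair x' y w - cpair x y w + (\<rho> x w - \<rho> x' w) \<partial>M) \<le> (\<integral>w. 0 \<partial>M)" proof (rule integral_mono_AE)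
   show "integrable M (\<lambda>w. cpair x' y w - cpair x y w + (\<rho> x w - \<rho> x' w))" using ci dr by auto
   show "AE w in M. cpair x' y w - cpair x y w + (\<rho> x w - \<rho> x' w) \<le> 0" using le by eventually_elim simp
  qed simp
  then have "(\<integral>w. x' w * y w \<partial>M) - (\<integral>w. x w * y w \<partial>M) + (\<integral>w. \<rho> x w - \<rho> x' w \<partial>M) \<le> 0"
   using ci dr cexp_integral(2)[OF i(1)] cexp_integral(2)[OF i(2)] by simp
  moreover have "(\<integral>w. \<rho> x w - \<rho> x' w \<partial>M) = scal (\<lambda>_. 0) x - scal (\<lambda>_. 0) x'"
   using Bochner_Integration.integral_diff[OF int[OF x] int[OF x']] by (simp add: scal_def)
  moreover have "(\<integral>w. (x' w - x w) * y w \<partial>M) = (\<integral>w. x' w * y w \<partial>M) - (\<integral>w. x w * y w \<partial>M)"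
   using Bochner_Integration.integral_diff[OF i(2,1)] by (simp add: left_diff_distrib)
  ultimately show ?thesis by simp
 qed
 then have "subgradient (scal (\<lambda>_. 0)) x 0 y" using yi by (simp add: subgradient_def)
 then show "\<exists>y. subgradient (scal (\<lambda>_. 0)) x 0 y" by (rule exI[of _ y])
qed

section \<open>The conditional Lebesgue property\<close>

text \<open>Negation is an order-reversing bijection of the conditionally bounded functions, so suprema
  need no separate treatment.\<close>

lemma is_essinf_uminus_iff:
 "is_essinf M (Xinf) ((\<lambda>s w. - s w) ` S) (\<lambda>w. - h w) \<longleftrightarrow> is_esssup M (Xinf) S h" proof -
 have iff: "(\<lambda>w. - g w) \<in> Xinf \<longleftrightarrow> g \<in> Xinf" for g using Xinf_uminus[of g] Xinf_uminus[of "\<lambda>w. - g w"] by auto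
 have all: "(\<forall>g\<in>Xinf. Q g) \<longleftrightarrow> (\<forall>g\<in>Xinf. Q (\<lambda>w. - g w))" for Q proof
  assume Q: "\<forall>g\<in>Xinf. Q (\<lambda>w. - g w)"
  show "\<forall>g\<in>Xinf. Q g" proof
   fix g assume "g \<in> Xinf"
   then show "Q g" using Q[THEN bspec, of "\<lambda>w. - g w"] by (simp add: iff)
  qed
 qed (simp add: iff)
 show ?thesis unfolding is_essinf_def is_esssup_def by (subst all) (simp add: iff)
qed

lemma is_esssup_uminus_iff:
 "is_esssup M (Xinf) ((\<lambda>s w. - s w) ` S) (\<lambda>w. - h w) \<longleftrightarrow> is_essinf M (Xinf) S h"
 using is_essinf_uminus_iff[of "(\<lambda>s w. - s w) ` S" "\<lambda>w. - h w"] by (simp add: image_image)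

text \<open>The infimum of the conditional sequence over all random indices beyond \<open>m\<close> is the pointwise
 infimum: the indices \<open>max m k\<close> with constant \<open>k\<close> already attain it.\<close>

lemma cond_tail_infima:
 assumes ym: "\<And>k. y k \<in> L0 M" and yb: "\<And>k w. \<bar>y k w\<bar> \<le> C"
  and x0L: "x0 \<in> Linf M" and ylim: "AE w in M. (\<lambda>n. y n w) \<longlonglongrightarrow> x0 w"
 shows "\<exists>u. (\<forall>m\<in>L0N F. is_essinf M (Xinf) ((\<lambda>n. cat n y) ` {n \<in> L0N F. AE w in M. m w \<le> n w}) (u m)) \<and>
  is_esssup M (Xinf) (u ` L0N F) x0" proof -
 define X where "X n = cat n y" for n
 define lo where "lo m w = (INF k\<in>{m..}. y k w)" for m :: nat and w
 have ab: "y k w \<le> C" "- C \<le> y k w" for k w using yb[of k w] by auto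
 have bb: "bdd_below ((\<lambda>k. y k w) ` {m..})" for m w using ab by (auto intro!: bdd_belowI[of _ "- C"])
 have lo: "lo m w \<le> y k w" if "m \<le> k" for m k w unfolding lo_def using that by (auto intro!: cINF_lower[OF bb])
 have lo_g: "t \<le> lo m w" if "\<And>k. m \<le> k \<Longrightarrow> t \<le> y k w" for t m w
  unfolding lo_def by (rule cINF_greatest) (use that in auto)
 have lob: "\<bar>lo m w\<bar> \<le> C" for m w
  using lo[of m m w] lo_g[of m "- C" w] ab[of m w] ab by (auto simp: abs_le_iff intro: order_trans)
 have lom: "lo m \<in> L0 M" for m unfolding lo_def using bb ym by (auto intro!: borel_measurable_cINF)
 define u where "u m = cat m lo" for m
 have uL: "u m \<in> Xinf" if "m \<in> L0N F" for m proof (rule Linf_in_Xinf, rule LinfI[of _ C])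
  show "u m \<in> L0 M" unfolding u_def by (rule cat_measurable[OF measurable_F_M[OF L0N_measurable[OF that]] lom])
 qed (simp add: u_def cat_def lob)
 have "(\<forall>m\<in>L0N F. is_essinf M (Xinf) (X ` {n \<in> L0N F. AE w in M. m w \<le> n w}) (u m)) \<and>
  is_esssup M (Xinf) (u ` L0N F) x0" proof (intro conjI ballI)
  fix m assume m: "m \<in> L0N F"
  show "is_essinf M (Xinf) (X ` {n \<in> L0N F. AE w in M. m w \<le> n w}) (u m)" unfolding is_essinf_def
  proof (intro conjI ballI impI)
   show "u m \<in> Xinf" by (rule uL[OF m])
   show "AE w in M. u m w \<le> s w" if "s \<in> X ` {n \<in> L0N F. AE w in M. m w \<le> n w}" for s proof -
    obtain n where n: "AE w in M. m w \<le> n w" "s = X n" using \<open>s \<in> _\<close> by blast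
    from n(1) show ?thesis by eventually_elim (simp add: n(2) u_def X_def cat_def lo)
   qed
   fix g assume g: "\<forall>s\<in>X ` {n \<in> L0N F. AE w in M. m w \<le> n w}. AE w in M. g w \<le> s w"
   have "AE w in M. \<forall>k\<ge>1. g w \<le> X (\<lambda>w. max (m w) k) w" proof (subst AE_all_countable, rule allI)
    fix k :: nat
    show "AE w in M. 1 \<le> k \<longrightarrow> g w \<le> X (\<lambda>w. max (m w) k) w" proof (cases "1 \<le> k")
     case True
     have "X (\<lambda>w. max (m w) k) \<in> X ` {n \<in> L0N F. AE w in M. m w \<le> n w}"
      by (intro imageI CollectI conjI L0N_max[OF m True]) simp
     with g have "AE w in M. g w \<le> X (\<lambda>w. max (m w) k) w" by (rule bspec)
     then show ?thesis by eventually_elim simp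
    qed simp
   qed
   then show "AE w in M. g w \<le> u m w" using AE_space proof eventually_elim
    case (elim w)
    show ?case unfolding u_def cat_def proof (rule lo_g)
     fix k assume "m w \<le> k"
     moreover have "1 \<le> k" using L0N_ge[OF m elim(2)] \<open>m w \<le> k\<close> by simp
     ultimately show "g w \<le> y k w" using elim(1) by (auto simp: X_def cat_def max_def dest!: spec[of _ k])
    qed
   qed
  qed
 next
  show "is_esssup M (Xinf) (u ` L0N F) x0" unfolding is_esssup_def proof (intro conjI ballI impI)
   show "x0 \<in> Xinf" by (rule Linf_in_Xinf[OF x0L])
   show "AE w in M. s w \<le> x0 w" if su: "s \<in> u ` L0N F" for s proof -
    obtain m where s: "s = u m" using su by blast
    from ylim show ?thesis proof eventually_elim
     case (elim w)
     show ?case unfolding s u_def cat_def by (rule LIMSEQ_le_const[OF elim]) (use lo in blast)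
    qed
   qed
   fix g assume g: "\<forall>s\<in>u ` L0N F. AE w in M. s w \<le> g w"
   have "AE w in M. \<forall>k. u (\<lambda>_. Suc k) w \<le> g w" by (subst AE_all_countable) (use g L0N_const in force)
   then show "AE w in M. x0 w \<le> g w" using ylim proof eventually_elim
    case (elim w)
    show ?case proof (rule field_le_epsilon)
     fix e :: real assume e: "0 < e"
     obtain K where K: "\<And>n. n \<ge> K \<Longrightarrow> norm (y n w - x0 w) < e" using LIMSEQ_D[OF elim(2) e] by blast
     have "x0 w - e \<le> lo (Suc K) w" proof (rule lo_g)
      fix k assume "Suc K \<le> k" then show "x0 w - e \<le> y k w" using K[of k] by (simp add: abs_less_iff)
     qed
     also have "\<dots> \<le> g w" using elim(1)[rule_format, of K] by (simp add: u_def cat_def)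
     finally show "x0 w \<le> g w + e" by simp
    qed
   qed
  qed
 qed
 then show ?thesis unfolding X_def by (rule exI[of _ u])
qed

text \<open>A sequence extends to random indices by gluing. If the extension converges with precision \<open>1 / (j + 1)\<close>
  from a random index \<open>m j\<close> on, it does so from a constant index on at almost every point, because
  \<open>m j\<close> is finite there.\<close>

lemma cond_lebesgue_imp_lebesgue:
 assumes cl: "cond_lebesgue_property M F \<rho>" shows "lebesgue_property M \<rho>" unfolding lebesgue_property_def
proof (intro allI impI)
 fix x x0 assume bc: "bounded_as_conv M x x0"
 have xL: "\<And>n. x n \<in> Linf M" and x0L: "x0 \<in> Linf M" and lim: "AE w in M. (\<lambda>n. x n w) \<longlonglongrightarrow> x0 w"
  using bc by (auto simp: bounded_as_conv_def)
 obtain C0 where C0: "\<And>n. AE w in M. \<bar>x n w\<bar> \<le> C0" using bc by (auto simp: bounded_as_conv_def)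
 define C where "C = max 1 C0"
 define y where "y k w = max (- C) (min C (x k w))" for k w
 have yb: "\<bar>y k w\<bar> \<le> C" for k w by (auto simp: y_def C_def)
 have ym: "y k \<in> L0 M" for k unfolding y_def using Linf_borel[OF xL[of k]] by measurable
 have yL: "y k \<in> Linf M" for k by (rule LinfI[OF ym, of k C]) (simp add: yb)
 have yx: "AE w in M. y k w = x k w" for k using C0[of k] by eventually_elim (auto simp: y_def C_def)
 have yxall: "AE w in M. \<forall>k. y k w = x k w" by (subst AE_all_countable) (use yx in blast)
 have ylim: "AE w in M. (\<lambda>n. y n w) \<longlonglongrightarrow> x0 w" using lim yxall by eventually_elim simp
 define X where "X n = cat n y" for n
 have XL: "X n \<in> Linf M" if "n \<in> L0N F" for n proof (rule LinfI[of _ C])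
  show "X n \<in> L0 M" unfolding X_def by (rule cat_measurable[OF measurable_F_M[OF L0N_measurable[OF that]] ym])
  show "AE w in M. \<bar>X n w\<bar> \<le> C" by (simp add: X_def cat_def yb)
 qed
 have Xc: "X n \<in> Xinf" if "n \<in> L0N F" for n by (rule Linf_in_Xinf[OF XL[OF that]])
 have st: "stable_fun M F (L0N F) (Xinf) X" unfolding stable_fun_def proof (intro conjI ballI allI impI)
  show "X n \<in> Xinf" if "n \<in> L0N F" for n by (rule Xc[OF that])
  fix A n z assume h: "(\<forall>k. n k \<in> L0N F) \<and> z \<in> L0N F \<and> is_concat M A n z"
  show "is_concat M A (\<lambda>k. X (n k)) (X z)" unfolding is_concat_def proof
   fix k
   have "AE w\<in>A k in M. z w = n k w" using h by (auto simp: is_concat_def cobj_eq_iff)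
   then have "AE w\<in>A k in M. X z w = X (n k) w" by eventually_elim (simp add: X_def cat_def)
   then show "cobj M (X z) (A k) = cobj M (X (n k)) (A k)" by (simp add: cobj_eq_iff)
  qed
 qed
 have bd: "cond_bounded M F X" unfolding cond_bounded_def proof (intro bexI ballI)
  show "(\<lambda>_. C) \<in> L0pos M F" by (simp add: L0pos_def C_def)
  fix n assume n: "n \<in> L0N F"
  let ?S = "{h \<in> L0bar F. AE w in M. ereal \<bar>X n w\<bar> \<le> h w}"
  have CS: "(\<lambda>_. ereal C) \<in> ?S" by (simp add: X_def cat_def yb)
  have "is_essinf M (L0bar F) ?S (ess_inf M F ?S)" by (rule is_essinf_ess_inf) (use CS in blast)+
  from this[unfolded is_essinf_def, THEN conjunct2, THEN conjunct1, THEN bspec, OF CS] show "AE w in M. cnorm_inf M F (X n) w \<le> ereal C"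
   unfolding cnorm_inf_def .
 qed
 have cv: "cond_conv_as M F X x0" proof -
  from cond_tail_infima[OF ym yb x0L ylim] obtain u
   where u: "(\<forall>m\<in>L0N F. is_essinf M (Xinf) ((\<lambda>n. cat n y) ` {n \<in> L0N F. AE w in M. m w \<le> n w}) (u m)) \<and>
    is_esssup M (Xinf) (u ` L0N F) x0" by (rule exE)
  define y' where "y' k w = - y k w" for k w
  have "AE w in M. (\<lambda>n. y' n w) \<longlonglongrightarrow> - x0 w" using ylim unfolding y'_def by eventually_elim (rule tendsto_minus)
  moreover have "y' k \<in> L0 M" "\<bar>y' k w\<bar> \<le> C" for k w unfolding y'_def using ym yb by auto
  ultimately have "\<exists>v. (\<forall>m\<in>L0N F. is_essinf M (Xinf) ((\<lambda>n. cat n y') ` {n \<in> L0N F. AE w in M. m w \<le> n w}) (v m)) \<and>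
    is_esssup M (Xinf) (v ` L0N F) (\<lambda>w. - x0 w)"
   by (intro cond_tail_infima[of y' C]) (auto intro: Linf_uminus[OF x0L])
  then obtain v where v: "(\<forall>m\<in>L0N F. is_essinf M (Xinf) ((\<lambda>n. cat n y') ` {n \<in> L0N F. AE w in M. m w \<le> n w}) (v m)) \<and>
    is_esssup M (Xinf) (v ` L0N F) (\<lambda>w. - x0 w)" by (rule exE)
  have cat': "(\<lambda>w. - cat n y' w) = cat n y" for n by (rule ext) (simp add: cat_def y'_def)
  have "\<forall>m\<in>L0N F. is_esssup M (Xinf) ((\<lambda>n. cat n y) ` {n \<in> L0N F. AE w in M. m w \<le> n w}) (\<lambda>w. - v m w)" proof
   fix m assume "m \<in> L0N F"
   from conjunct1[OF v, THEN bspec, OF this, folded is_esssup_uminus_iff]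
   show "is_esssup M (Xinf) ((\<lambda>n. cat n y) ` {n \<in> L0N F. AE w in M. m w \<le> n w}) (\<lambda>w. - v m w)"
    by (simp add: image_image cat')
  qed
  moreover have "is_essinf M (Xinf) ((\<lambda>m w. - v m w) ` L0N F) x0"
   using conjunct2[OF v, folded is_essinf_uminus_iff] by (simp add: image_image)
  ultimately show ?thesis unfolding cond_conv_as_def X_def[abs_def] using u
   by (intro exI[of _ u] exI[of _ "\<lambda>m w. - v m w"]) simp
 qed
 have cl: "cond_lim M F (\<lambda>n. \<rho> (X n)) (\<rho> x0)"
  by (rule cl[unfolded cond_lebesgue_property_def, rule_format, OF Linf_in_Xinf[OF x0L]])
   (intro conjI st bd cv)
 have ex: "\<exists>m. \<forall>k\<ge>1. AE w in M. m w \<le> k \<longrightarrow> \<bar>\<rho> (y k) w - \<rho> x0 w\<bar> \<le> 1 / real (Suc j)" for j proof -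
  have "(\<lambda>_. 1 / real (Suc j)) \<in> L0pos M F" by (simp add: L0pos_def)
  from cl[unfolded cond_lim_def, THEN bspec, OF this]
  obtain m where m: "m \<in> L0N F" and mle: "\<forall>n\<in>L0N F. (AE w in M. m w \<le> n w) \<longrightarrow>
    (AE w in M. \<bar>\<rho> (X n) w - \<rho> x0 w\<bar> \<le> 1 / real (Suc j))" by (rule bexE)
  have "AE w in M. m w \<le> k \<longrightarrow> \<bar>\<rho> (y k) w - \<rho> x0 w\<bar> \<le> 1 / real (Suc j)" if k: "1 \<le> k" for k proof -
   let ?n = "\<lambda>w. max (m w) k"
   have n: "?n \<in> L0N F" by (rule L0N_max[OF m k])
   have "{w \<in> space F. m w \<le> k} \<in> sets F" using L0N_measurable[OF m] by measurable
   from rho_local[OF Xc[OF n] Linf_in_Xinf[OF yL[of k]] this]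
   have "AE w in M. w \<in> {w \<in> space F. m w \<le> k} \<longrightarrow> \<rho> (X ?n) w = \<rho> (y k) w" by (simp add: X_def cat_def max_def)
   moreover have "AE w in M. \<bar>\<rho> (X ?n) w - \<rho> x0 w\<bar> \<le> 1 / real (Suc j)"
    by (rule mle[THEN bspec, OF n, THEN mp]) simp
   ultimately show ?thesis using AE_space by eventually_elim (auto simp: space_F)
  qed
  then show ?thesis by (intro exI[of _ m] allI impI)
 qed
 have "\<forall>j. \<exists>m. \<forall>k\<ge>1. AE w in M. m w \<le> k \<longrightarrow> \<bar>\<rho> (y k) w - \<rho> x0 w\<bar> \<le> 1 / real (Suc j)"
  by (rule allI, rule ex)
 from choice[OF this]
 obtain m where m: "\<forall>j. \<forall>k\<ge>1. AE w in M. m j w \<le> k \<longrightarrow> \<bar>\<rho> (y k) w - \<rho> x0 w\<bar> \<le> 1 / real (Suc j)"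
  by (rule exE)
 have "AE w in M. \<forall>j k. 1 \<le> k \<longrightarrow> m j w \<le> k \<longrightarrow> \<bar>\<rho> (y k) w - \<rho> x0 w\<bar> \<le> 1 / real (Suc j)"
 proof (subst AE_all_countable, rule allI, subst AE_all_countable, rule allI)
  fix j k show "AE w in M. 1 \<le> k \<longrightarrow> m j w \<le> k \<longrightarrow> \<bar>\<rho> (y k) w - \<rho> x0 w\<bar> \<le> 1 / real (Suc j)"
   using m[THEN spec, of j, THEN spec, of k] by (cases "1 \<le> k") simp_all
 qed
 moreover have "AE w in M. \<forall>k. \<rho> (y k) w = \<rho> (x k) w"
  by (subst AE_all_countable) (use rho_cong[OF Linf_in_Xinf[OF yL] Linf_in_Xinf[OF xL] yx] in blast)
 ultimately show "AE w in M. (\<lambda>n. \<rho> (x n) w) \<longlonglongrightarrow> \<rho> x0 w" proof eventually_elim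
  case (elim w)
  show ?case proof (rule LIMSEQ_I)
   fix e :: real assume "0 < e"
   then obtain j where j: "1 / real (Suc j) < e" using nat_approx_posE by blast
   show "\<exists>no. \<forall>n\<ge>no. norm (\<rho> (x n) w - \<rho> x0 w) < e" proof (intro exI allI impI)
    fix k assume "max 1 (m j w) \<le> k"
    then have "\<bar>\<rho> (y k) w - \<rho> x0 w\<bar> \<le> 1 / real (Suc j)" using elim(1) by simp
    then show "norm (\<rho> (x k) w - \<rho> x0 w) < e" using j elim(2) by simp
   qed
  qed
 qed
qed

end

context cond_space
begin

lemma first_index:
 fixes P :: "nat \<Rightarrow> 'w \<Rightarrow> bool"
 assumes P: "\<And>k. {w \<in> space F. P k w} \<in> sets F" and ex: "AE w in M. \<exists>k\<ge>1. P k w"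
 obtains m where "m \<in> rnat" "\<And>w. 1 \<le> m w" "AE w in M. P (m w) w" proof -
 define Q where "Q k w \<longleftrightarrow> 1 \<le> k \<and> (P k w \<or> \<not> (\<exists>j\<ge>1. P j w))" for k :: nat and w
 define m where "m w = (LEAST k. Q k w)" for w
 have exQ: "\<exists>k. Q k w" for w unfolding Q_def by (cases "\<exists>j\<ge>1. P j w") auto
 have Qm: "Q (m w) w" for w unfolding m_def using exQ by (rule LeastI_ex)
 have [measurable]: "Measurable.pred F (P k)" for k using P by (simp add: pred_def)
 have "Measurable.pred F (Q k)" for k unfolding Q_def by measurable
 then have "m \<in> rnat" unfolding m_def by (rule measurable_Least)
 moreover have "1 \<le> m w" for w using Qm[of w] by (simp add: Q_def)
 moreover have "AE w in M. P (m w) w" using ex proof eventually_elim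
  case (elim w) then show ?case using Qm[of w] by (auto simp: Q_def)
 qed
 ultimately show ?thesis by (rule that)
qed


definition idx :: "(nat \<Rightarrow> 'w set) \<Rightarrow> 'w \<Rightarrow> nat" where
 "idx b w = (LEAST k. w \<in> b k \<or> (\<forall>j. w \<notin> b j))"

lemma idx_in: "w \<in> b k \<Longrightarrow> w \<in> b (idx b w)"
proof -
 assume "w \<in> b k"
 then have "idx b w = (LEAST k. w \<in> b k)" unfolding idx_def by (intro arg_cong[of _ _ Least]) auto
 then show "w \<in> b (idx b w)" using LeastI[of "\<lambda>k. w \<in> b k" k] \<open>w \<in> b k\<close> by simp
qed

lemma idx_measurable:
 assumes "\<And>k. b k \<in> sets F" shows "idx b \<in> rnat" proof -
 have [measurable]: "b k \<in> sets F" for k by (rule assms)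
 show ?thesis unfolding idx_def[abs_def] by measurable
qed

lemma partition_idx:
 assumes A: "A \<in> partitions M F (space M)"
 shows "AE w in M. w \<in> A (idx A w) \<and> (\<forall>k. w \<in> A k \<longrightarrow> idx A w = k)" proof -
 have "AE w in M. \<forall>i j. i \<noteq> j \<longrightarrow> w \<notin> A i \<inter> A j"
 proof (subst AE_all_countable, rule allI, subst AE_all_countable, rule allI)
  fix i j show "AE w in M. i \<noteq> j \<longrightarrow> w \<notin> A i \<inter> A j" using A by (cases "i = j") (auto simp: partitions_def)
 qed
 moreover have "AE w in M. w \<in> space M \<longleftrightarrow> w \<in> (\<Union>k. A k)" using A by (simp add: partitions_def)
 ultimately show ?thesis using AE_space proof eventually_elim
  case (elim w)
  then obtain k where "w \<in> A k" by blast
  then have "w \<in> A (idx A w)" by (rule idx_in)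
  then show ?case using elim(1) by blast
 qed
qed

lemma idx_partition:
 assumes N: "N \<in> rnat"
 shows "(\<lambda>k. {w \<in> space M. N w = k}) \<in> partitions M F (space M)"
 unfolding partitions_def using N_level[OF N] by auto

text \<open>Stability along a two-piece partition.\<close>

lemma stable_fun_local:
 assumes f: "stable_fun M F X Z f" and x: "x \<in> X" and z: "z \<in> X" and A: "A \<in> sets F"
  and eq: "AE w\<in>A in M. x w = z w"
 shows "AE w\<in>A in M. f x w = f z w" proof -
 define B where "B k = (if k = 0 then A else if k = 1 then space M - A else {})" for k :: nat
 define s where "s k = (if k = 0 then z else x)" for k :: nat
 have B: "B \<in> partitions M F (space M)" unfolding partitions_def proof (intro CollectI conjI allI impI)
  show "B k \<in> sets F" for k using A by (auto simp: B_def space_F[symmetric])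
  show "AE w in M. w \<notin> B i \<inter> B j" if "i \<noteq> j" for i j using that by (auto simp: B_def)
  show "AE w in M. w \<in> space M \<longleftrightarrow> w \<in> (\<Union>k. B k)" proof (rule AE_I2)
   fix w assume w: "w \<in> space M"
   have "w \<in> B 0 \<or> w \<in> B 1" using w by (simp add: B_def)
   then show "w \<in> space M \<longleftrightarrow> w \<in> (\<Union>k. B k)" using w by blast
  qed
 qed
 have "is_concat M B s x" using eq by (auto simp: is_concat_def cobj_eq_iff s_def B_def)
 moreover have "\<forall>k. s k \<in> X" using x z by (simp add: s_def)
 ultimately have "is_concat M B (\<lambda>k. f (s k)) (f x)"
  using f[unfolded stable_fun_def, THEN conjunct2, THEN bspec, OF B, THEN spec, of s, THEN spec, of x] x
  by blast
 then have "cobj M (f x) (B 0) = cobj M (f (s 0)) (B 0)" unfolding is_concat_def by blast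
 then show ?thesis by (simp add: cobj_eq_iff B_def s_def)
qed

end

context cond_risk
begin

text \<open>On the level sets of an integer-valued bound, the sequence coincides with a bounded one.\<close>

lemma lebesgue_cond_bounded:
 assumes l: "lebesgue_property M \<rho>" and x: "\<And>n. x n \<in> Xinf" and x0: "x0 \<in> Xinf"
  and e: "\<eta> \<in> L0 F" and b: "\<And>n. AE w in M. \<bar>x n w\<bar> \<le> \<eta> w" and b0: "AE w in M. \<bar>x0 w\<bar> \<le> \<eta> w"
  and lim: "AE w in M. (\<lambda>n. x n w) \<longlonglongrightarrow> x0 w"
 shows "AE w in M. (\<lambda>n. \<rho> (x n) w) \<longlonglongrightarrow> \<rho> x0 w" proof -
 define N where "N w = nat \<lceil>\<eta> w\<rceil>" for w
 have N: "N \<in> rnat" unfolding N_def using e by measurable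
 have Ne: "\<eta> w \<le> real (N w)" for w unfolding N_def by (rule real_nat_ceiling_ge)
 show ?thesis proof (rule AE_levels[of N])
  fix k
  let ?A = "{w \<in> space M. N w = k}"
  have A: "?A \<in> sets F" by (rule N_level[OF N])
  define c where "c y w = indicator ?A w * y w" for y :: "'w \<Rightarrow> real" and w
  have cL: "c y \<in> Linf M" and cb: "AE w in M. \<bar>c y w\<bar> \<le> real k"
   if y: "y \<in> Xinf" and yb: "AE w in M. \<bar>y w\<bar> \<le> \<eta> w" for y proof -
   show cb: "AE w in M. \<bar>c y w\<bar> \<le> real k" using yb proof eventually_elim
    case (elim w) then show ?case using Ne[of w] by (auto simp: c_def indicator_def)
   qed
   have "(indicator ?A :: 'w \<Rightarrow> real) \<in> L0 M" using sets_M[OF A] by simp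
   then have "c y \<in> L0 M" unfolding c_def using Xinf_borel[OF y] by measurable
   then show "c y \<in> Linf M" using cb by (rule LinfI)
  qed
  have loc: "AE w\<in>?A in M. \<rho> (c y) w = \<rho> y w" if y: "y \<in> Xinf" and yb: "AE w in M. \<bar>y w\<bar> \<le> \<eta> w" for y
   by (rule rho_local[OF Linf_in_Xinf[OF cL[OF y yb]] y A]) (simp add: c_def indicator_def)
  have "bounded_as_conv M (\<lambda>n. c (x n)) (c x0)" unfolding bounded_as_conv_def
  proof (intro conjI allI exI[of _ "real k"])
   show "c (x n) \<in> Linf M" "AE w in M. \<bar>c (x n) w\<bar> \<le> real k" for n using cL[OF x b] cb[OF x b] by auto
   show "c x0 \<in> Linf M" by (rule cL[OF x0 b0])
   show "AE w in M. (\<lambda>n. c (x n) w) \<longlonglongrightarrow> c x0 w" using lim by eventually_elim (simp add: c_def tendsto_mult_left)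
  qed
  with l have "AE w in M. (\<lambda>n. \<rho> (c (x n)) w) \<longlonglongrightarrow> \<rho> (c x0) w" unfolding lebesgue_property_def by blast
  moreover have "AE w in M. \<forall>n. w \<in> ?A \<longrightarrow> \<rho> (c (x n)) w = \<rho> (x n) w"
   by (subst AE_all_countable) (use loc[OF x b] in blast)
  ultimately show "AE w in M. N w = k \<longrightarrow> (\<lambda>n. \<rho> (x n) w) \<longlonglongrightarrow> \<rho> x0 w"
   using loc[OF x0 b0] AE_space by eventually_elim auto
 qed
qed

text \<open>Only the constant indices matter: the infima over the indices beyond \<open>k + 1\<close> increase to
 the conditional limit, because on each level set of a random index it may be replaced by a constant.\<close>

lemma cond_liminf_tails:
 assumes st: "stable_fun M F (L0N F) (Xinf) x"
  and u': "\<forall>m\<in>L0N F. is_essinf M (Xinf) (x ` {n \<in> L0N F. AE w in M. m w \<le> n w}) (u m)"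
  and us: "is_esssup M (Xinf) (u ` L0N F) x0"
 shows "u (\<lambda>_. Suc k) \<in> Xinf"
  and "m \<in> L0N F \<Longrightarrow> n \<in> L0N F \<Longrightarrow> AE w in M. m w \<le> n w \<Longrightarrow> AE w in M. m w = Suc k \<longrightarrow> u (\<lambda>_. Suc k) w \<le> x n w"
  and "AE w in M. \<forall>k. u (\<lambda>_. Suc 0) w \<le> u (\<lambda>_. Suc k) w \<and> u (\<lambda>_. Suc k) w \<le> x0 w"
  and "AE w in M. (\<lambda>k. u (\<lambda>_. Suc k) w) \<longlonglongrightarrow> x0 w" proof -
 have x0: "x0 \<in> Xinf" using us by (simp add: is_esssup_def)
 note u = u'[THEN bspec]
 have uL: "u m \<in> Xinf" if "m \<in> L0N F" for m using u[OF that] by (simp add: is_essinf_def)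
 have ul: "AE w in M. u m w \<le> x n w" if m: "m \<in> L0N F" and n: "n \<in> L0N F" "AE w in M. m w \<le> n w" for m n
  using u[OF m, unfolded is_essinf_def, THEN conjunct2, THEN conjunct1] n by simp
 have ug: "AE w in M. g w \<le> u m w" if m: "m \<in> L0N F" and g: "g \<in> Xinf"
  and le: "\<And>n. n \<in> L0N F \<Longrightarrow> AE w in M. m w \<le> n w \<Longrightarrow> AE w in M. g w \<le> x n w" for m g
  using u[OF m, unfolded is_essinf_def, THEN conjunct2, THEN conjunct2, THEN bspec, OF g] le by simp
 define K where "K k = (\<lambda>_::'w. Suc k)" for k
 have K: "K k \<in> L0N F" for k unfolding K_def by (rule L0N_const) simp
 define uk where "uk k = u (K k)" for k
 have ukL: "uk k \<in> Xinf" for k unfolding uk_def by (rule uL[OF K])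
 have lev: "{w \<in> space M. m w = Suc k} \<in> sets F" if "m \<in> L0N F" for m k
  by (rule N_level[OF L0N_measurable[OF that]])
 have xloc: "AE w in M. w \<in> {w \<in> space M. m w = Suc k} \<longrightarrow> x (\<lambda>w. max (n w) (Suc k)) w = x n w"
  if m: "m \<in> L0N F" and n: "n \<in> L0N F" "AE w in M. m w \<le> n w" for m n k
  by (rule stable_fun_local[OF st L0N_max[OF n(1)] n(1) lev[OF m]]) (use n(2) in auto)
 have uk_le: "AE w in M. m w = Suc k \<longrightarrow> uk k w \<le> x n w"
  if m: "m \<in> L0N F" and n: "n \<in> L0N F" "AE w in M. m w \<le> n w" for m n k proof -
  have "AE w in M. uk k w \<le> x (\<lambda>w. max (n w) (Suc k)) w"
   unfolding uk_def by (rule ul[OF K L0N_max[OF n(1)]]) (simp_all add: K_def)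
  with xloc[OF m n, of k] AE_space show ?thesis by eventually_elim auto
 qed
 have LmaxN: "(\<lambda>w. max (n w) (m w)) \<in> L0N F" if "m \<in> L0N F" "n \<in> L0N F" for m n proof -
  have mn: "m \<in> rnat" "n \<in> rnat" by (rule L0N_measurable[OF that(1)], rule L0N_measurable[OF that(2)])
  have A: "(\<lambda>w. max (max (n w) (m w)) 1) \<in> L0N F" proof (rule L0N_I)
   show "(\<lambda>w. max (max (n w) (m w)) 1) \<in> rnat" using mn by measurable
  qed simp
  have eq: "max (max (n w) (m w)) 1 = max (n w) (m w)" if "w \<in> space F" for w
   using L0N_ge[OF \<open>m \<in> L0N F\<close>, of w] that by (simp add: space_F)
  show ?thesis unfolding L0N_def by (rule iffD1[OF measurable_cong[OF eq] A[unfolded L0N_def]])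
 qed
 have u_uk: "AE w in M. m w = Suc k \<longrightarrow> u m w \<le> uk k w" if m: "m \<in> L0N F" for m k proof -
  define N where "N w = (if m w = Suc k then 0 else 1 :: nat)" for w
  define s where "s j = (if j = 0 then u m else uk k)" for j :: nat
  have Nm: "N \<in> rnat" unfolding N_def using L0N_measurable[OF m] by measurable
  have sL: "s j \<in> Xinf" for j using uL[OF m] ukL by (simp add: s_def)
  have "AE w in M. cat N s w \<le> u (K k) w" proof (rule ug[OF K cat_Xinf[OF Nm sL]])
   fix n assume n: "n \<in> L0N F" and kn: "AE w in M. K k w \<le> n w"
   have a: "AE w in M. u m w \<le> x (\<lambda>w. max (n w) (m w)) w" by (rule ul[OF m LmaxN[OF m n]]) simp
   have b: "AE w in M. w \<in> {w \<in> space M. m w = Suc k} \<longrightarrow> x (\<lambda>w. max (n w) (m w)) w = x n w"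
    by (rule stable_fun_local[OF st LmaxN[OF m n] n lev[OF m]]) (use kn in \<open>auto simp: K_def\<close>)
   have c: "AE w in M. uk k w \<le> x n w" unfolding uk_def by (rule ul[OF K n kn])
   from a b c AE_space show "AE w in M. cat N s w \<le> x n w" by eventually_elim (auto simp: cat_def N_def s_def)
  qed
  then show ?thesis by eventually_elim (auto simp: cat_def N_def s_def uk_def)
 qed
 have ukx0: "AE w in M. uk k w \<le> x0 w" for k using us K unfolding is_esssup_def uk_def by blast
 have uk_inc: "AE w in M. uk k w \<le> uk (Suc k) w" for k unfolding uk_def proof (rule ug[OF K uL[OF K]])
  fix n assume n: "n \<in> L0N F" "AE w in M. K (Suc k) w \<le> n w"
  then have "AE w in M. K k w \<le> n w" by (auto simp: K_def)
  then show "AE w in M. u (K k) w \<le> x n w" by (rule ul[OF K n(1)])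
 qed
 have "AE w in M. \<forall>k. uk k w \<le> x0 w \<and> uk k w \<le> uk (Suc k) w"
  by (subst AE_all_countable) (use ukx0 uk_inc in auto)
 then have ord: "AE w in M. incseq (\<lambda>k. uk k w) \<and> (\<forall>k. uk k w \<le> x0 w)"
  by eventually_elim (auto intro: incseq_SucI)
 then have bnd: "AE w in M. \<forall>k. uk 0 w \<le> uk k w \<and> uk k w \<le> x0 w" by eventually_elim (auto simp: incseq_def)
 obtain e1 where e1: "e1 \<in> L0 F" "AE w in M. \<bar>uk 0 w\<bar> \<le> e1 w" using XinfE[OF ukL] by blast
 obtain e2 where e2: "e2 \<in> L0 F" "AE w in M. \<bar>x0 w\<bar> \<le> e2 w" using XinfE[OF x0] by blast
 define \<eta> where "\<eta> w = max (e1 w) (e2 w)" for w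
 have \<eta>: "\<eta> \<in> L0 F" unfolding \<eta>_def using e1(1) e2(1) by measurable
 have abs: "AE w in M. \<forall>k. \<bar>uk k w\<bar> \<le> \<eta> w" using bnd e1(2) e2(2) proof eventually_elim
  case (elim w)
  show ?case proof
   fix k show "\<bar>uk k w\<bar> \<le> \<eta> w" using elim(1)[THEN spec, of k] elim(2,3) by (auto simp: \<eta>_def)
  qed
 qed
 have ulim: "AE w in M. (\<lambda>k. uk k w) \<longlonglongrightarrow> x0 w" proof -
  define U where "U w = lim (\<lambda>k. uk k w)" for w
  have Um: "U \<in> L0 M" unfolding U_def using Xinf_borel[OF ukL] by (rule borel_measurable_lim_metric)
  have Ulim: "AE w in M. (\<lambda>k. uk k w) \<longlonglongrightarrow> U w" using ord proof eventually_elim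
   case (elim w)
   have "convergent (\<lambda>k. uk k w)" by (rule incseq_convergent[of _ "x0 w"]) (use elim in \<open>auto simp: convergent_def\<close>)
   then show ?case by (simp add: U_def convergent_LIMSEQ_iff)
  qed
  have UL: "U \<in> Xinf" proof (rule XinfI[OF Um \<eta>])
   show "AE w in M. \<bar>U w\<bar> \<le> \<eta> w" using Ulim abs
    by eventually_elim (rule LIMSEQ_le_const2[OF tendsto_rabs], auto)
  qed
  have "AE w in M. x0 w \<le> U w" proof -
   have "AE w in M. u m w \<le> U w" if m: "m \<in> L0N F" for m proof -
    have "AE w in M. \<forall>k. m w = Suc k \<longrightarrow> u m w \<le> uk k w" by (subst AE_all_countable) (use u_uk[OF m] in blast)
    then show ?thesis using Ulim ord AE_space proof eventually_elim
     case (elim w)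
     obtain k where k: "m w = Suc k" using L0N_ge[OF m elim(4)] by (cases "m w") auto
     have "uk k w \<le> U w" using elim(2,3) by (intro incseq_le) auto
     then show ?case using elim(1) k by (meson order_trans)
    qed
   qed
   then have "\<forall>s\<in>u ` L0N F. AE w in M. s w \<le> U w" by blast
   then show ?thesis using us UL unfolding is_esssup_def by blast
  qed
  moreover have "AE w in M. U w \<le> x0 w" using Ulim ord by eventually_elim (rule LIMSEQ_le_const2, auto)
  ultimately show ?thesis using Ulim by eventually_elim simp
 qed
 show "u (\<lambda>_. Suc k) \<in> Xinf" using ukL[of k] by (simp add: uk_def K_def)
 show "AE w in M. m w = Suc k \<longrightarrow> u (\<lambda>_. Suc k) w \<le> x n w" if "m \<in> L0N F" "n \<in> L0N F" "AE w in M. m w \<le> n w"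
  using uk_le[OF that, of k] by (simp add: uk_def K_def)
 show "AE w in M. \<forall>k. u (\<lambda>_. Suc 0) w \<le> u (\<lambda>_. Suc k) w \<and> u (\<lambda>_. Suc k) w \<le> x0 w"
  using bnd by (simp add: uk_def K_def)
 show "AE w in M. (\<lambda>k. u (\<lambda>_. Suc k) w) \<longlonglongrightarrow> x0 w" using ulim by (simp add: uk_def K_def)
qed

text \<open>By monotonicity and locality, \<open>\<rho>\<close> of a member lies between its values at the tail infimum and
  supremum, and these converge; a random index picks the first constant from which both are
  \<open>\<epsilon>\<close>-close.\<close>

lemma lebesgue_imp_cond_lebesgue:
 assumes l: "lebesgue_property M \<rho>" shows "cond_lebesgue_property M F \<rho>" unfolding cond_lebesgue_property_def
proof (intro allI ballI impI)
 fix x x0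
 assume x0: "x0 \<in> Xinf" and h: "stable_fun M F (L0N F) (Xinf) x \<and> cond_bounded M F x \<and> cond_conv_as M F x x0"
 have st: "stable_fun M F (L0N F) (Xinf) x" using h by blast
 have xL: "x n \<in> Xinf" if "n \<in> L0N F" for n using st that by (simp add: stable_fun_def)
 define S where "S m = x ` {n \<in> L0N F. AE w in M. m w \<le> n w}" for m
 obtain u v where
  u: "\<forall>m\<in>L0N F. is_essinf M (Xinf) (S m) (u m)" and
  v: "\<forall>m\<in>L0N F. is_esssup M (Xinf) (S m) (v m)" and
  us: "is_esssup M (Xinf) (u ` L0N F) x0" and
  vi: "is_essinf M (Xinf) (v ` L0N F) x0" using h unfolding cond_conv_as_def S_def by blast
 have neg: "(\<lambda>n w. - x n w) ` N = (\<lambda>s w. - s w) ` x ` N" "(\<lambda>m w. - v m w) ` N = (\<lambda>s w. - s w) ` v ` N" for N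
  by (simp_all add: image_image)
 have "is_concat M A (\<lambda>k w. - x (n k) w) (\<lambda>w. - x z w)" if "is_concat M A (\<lambda>k. x (n k)) (x z)" for A n z
  using that by (auto simp: is_concat_def cobj_eq_iff elim: eventually_mono)
 then have st': "stable_fun M F (L0N F) (Xinf) (\<lambda>n w. - x n w)"
  using st Xinf_uminus unfolding stable_fun_def by blast
 have v': "\<forall>m\<in>L0N F. is_essinf M (Xinf) ((\<lambda>n w. - x n w) ` {n \<in> L0N F. AE w in M. m w \<le> n w}) (\<lambda>w. - v m w)"
  using v unfolding neg is_essinf_uminus_iff S_def .
 have vi': "is_esssup M (Xinf) ((\<lambda>m w. - v m w) ` L0N F) (\<lambda>w. - x0 w)"
  using vi unfolding neg is_esssup_uminus_iff .
 note U = cond_liminf_tails[of x u x0, OF st u[unfolded S_def] us]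
 note V = cond_liminf_tails[of "\<lambda>n w. - x n w" "\<lambda>m w. - v m w", OF st' v' vi']
 define uk where "uk k = u (\<lambda>_. Suc k)" for k
 define vk where "vk k = v (\<lambda>_. Suc k)" for k
 have ukL: "uk k \<in> Xinf" for k unfolding uk_def by (rule U(1))
 have vkL: "vk k \<in> Xinf" for k using Xinf_uminus[OF V(1)[of k]] by (simp add: vk_def)
 have uk_le: "AE w in M. m w = Suc k \<longrightarrow> uk k w \<le> x n w" and vk_ge: "AE w in M. m w = Suc k \<longrightarrow> x n w \<le> vk k w"
  if "m \<in> L0N F" "n \<in> L0N F" "AE w in M. m w \<le> n w" for m n k
  using U(2)[OF that, of k] V(2)[OF that, of k] by (simp_all add: uk_def vk_def)
 have ulim: "AE w in M. (\<lambda>k. uk k w) \<longlonglongrightarrow> x0 w" using U(4) by (simp add: uk_def)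
 have vlim: "AE w in M. (\<lambda>k. vk k w) \<longlonglongrightarrow> x0 w"
  using V(4) unfolding vk_def by eventually_elim (drule tendsto_minus, simp)
 obtain e1 where e1: "e1 \<in> L0 F" "AE w in M. \<bar>uk 0 w\<bar> \<le> e1 w" using XinfE[OF ukL] by blast
 obtain e2 where e2: "e2 \<in> L0 F" "AE w in M. \<bar>vk 0 w\<bar> \<le> e2 w" using XinfE[OF vkL] by blast
 define \<eta> where "\<eta> w = max (e1 w) (e2 w)" for w
 have \<eta>: "\<eta> \<in> L0 F" unfolding \<eta>_def using e1(1) e2(1) by measurable
 have bnd: "AE w in M. \<forall>k. \<bar>uk k w\<bar> \<le> \<eta> w \<and> \<bar>vk k w\<bar> \<le> \<eta> w \<and> \<bar>x0 w\<bar> \<le> \<eta> w" using U(3) V(3) e1(2) e2(2)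
 proof eventually_elim
  case (elim w)
  show ?case proof
   fix k
   show "\<bar>uk k w\<bar> \<le> \<eta> w \<and> \<bar>vk k w\<bar> \<le> \<eta> w \<and> \<bar>x0 w\<bar> \<le> \<eta> w"
    using elim(1,2)[THEN spec, of k] elim(3,4) by (auto simp: \<eta>_def uk_def vk_def)
  qed
 qed
 have lev: "{w \<in> space M. m w = Suc k} \<in> sets F" if "m \<in> L0N F" for m k
  by (rule N_level[OF L0N_measurable[OF that]])
 have ru: "AE w in M. (\<lambda>k. \<rho> (uk k) w) \<longlonglongrightarrow> \<rho> x0 w"
  by (rule lebesgue_cond_bounded[OF l ukL x0 \<eta> _ _ ulim]) (use bnd in \<open>auto elim: eventually_mono\<close>)
 have rv: "AE w in M. (\<lambda>k. \<rho> (vk k) w) \<longlonglongrightarrow> \<rho> x0 w"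
  by (rule lebesgue_cond_bounded[OF l vkL x0 \<eta> _ _ vlim]) (use bnd in \<open>auto elim: eventually_mono\<close>)
 show "cond_lim M F (\<lambda>n. \<rho> (x n)) (\<rho> x0)" unfolding cond_lim_def proof
  fix \<epsilon> assume eps: "\<epsilon> \<in> L0pos M F"
  then have e: "\<epsilon> \<in> L0 F" "AE w in M. 0 < \<epsilon> w" by (auto simp: L0pos_def)
  define P where "P k w \<longleftrightarrow> \<bar>\<rho> (uk (k - 1)) w - \<rho> x0 w\<bar> \<le> \<epsilon> w \<and> \<bar>\<rho> (vk (k - 1)) w - \<rho> x0 w\<bar> \<le> \<epsilon> w" for k w
  have P: "{w \<in> space F. P k w} \<in> sets F" for k
   unfolding P_def using rho_L0[OF ukL[of "k - 1"]] rho_L0[OF vkL[of "k - 1"]] rho_L0[OF x0] e(1) by measurable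
  have ex: "AE w in M. \<exists>k\<ge>1. P k w" using ru rv e(2) proof eventually_elim
   case (elim w)
   have "\<forall>\<^sub>F k in sequentially. dist (\<rho> (uk k) w) (\<rho> x0 w) < \<epsilon> w" using elim(1,3) by (rule tendstoD)
   moreover have "\<forall>\<^sub>F k in sequentially. dist (\<rho> (vk k) w) (\<rho> x0 w) < \<epsilon> w" using elim(2,3) by (rule tendstoD)
   ultimately have "\<forall>\<^sub>F k in sequentially. P (Suc k) w" by eventually_elim (simp add: P_def dist_real_def)
   then obtain k where "P (Suc k) w" by (auto simp: eventually_sequentially)
   then show ?case by (intro exI[of _ "Suc k"]) simp
  qed
  obtain m where m: "m \<in> rnat" "\<And>w. 1 \<le> m w" "AE w in M. P (m w) w" using first_index[OF P ex] by blast
  have mN: "m \<in> L0N F" using m(1,2) by (rule L0N_I)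
  show "\<exists>m\<in>L0N F. \<forall>n\<in>L0N F. (AE w in M. m w \<le> n w) \<longrightarrow> (AE w in M. \<bar>\<rho> (x n) w - \<rho> x0 w\<bar> \<le> \<epsilon> w)"
  proof (intro bexI[OF _ mN] ballI impI)
   fix n assume n: "n \<in> L0N F" "AE w in M. m w \<le> n w"
   have "AE w in M. \<forall>k. m w = Suc k \<longrightarrow> \<rho> (vk k) w \<le> \<rho> (x n) w \<and> \<rho> (x n) w \<le> \<rho> (uk k) w"
   proof (subst AE_all_countable, rule allI)
    fix k
    have z: "(\<lambda>_. 0::real) \<in> L0 F" by simp
    have "AE w in M. w \<in> {w \<in> space M. m w = Suc k} \<longrightarrow> \<rho> (vk k) w - 0 \<le> \<rho> (x n) w"
     by (rule rho_lipschitz_on[OF xL[OF n(1)] vkL lev[OF mN] z]) (use vk_ge[OF mN n, of k] in \<open>auto\<close>)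
    moreover have "AE w in M. w \<in> {w \<in> space M. m w = Suc k} \<longrightarrow> \<rho> (x n) w - 0 \<le> \<rho> (uk k) w"
     by (rule rho_lipschitz_on[OF ukL xL[OF n(1)] lev[OF mN] z]) (use uk_le[OF mN n, of k] in \<open>auto\<close>)
    ultimately show "AE w in M. m w = Suc k \<longrightarrow> \<rho> (vk k) w \<le> \<rho> (x n) w \<and> \<rho> (x n) w \<le> \<rho> (uk k) w"
     using AE_space by eventually_elim auto
   qed
   then show "AE w in M. \<bar>\<rho> (x n) w - \<rho> x0 w\<bar> \<le> \<epsilon> w" using m(3) proof eventually_elim
    case (elim w)
    obtain k where k: "m w = Suc k" using m(2)[of w] by (cases "m w") auto
    then show ?case using elim by (auto simp: P_def)
   qed
  qed
 qed
qed

end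

section \<open>Conditional subsets of the space of conditionally integrable functions\<close>

context cond_space
begin


lemma le_algI: "b \<subseteq> a \<Longrightarrow> le_alg M b a" by (auto simp: le_alg_def)

lemma cobj_cong: "AE w\<in>b in M. z w = z' w \<Longrightarrow> cobj M z b = cobj M z' b"
 by (simp add: cobj_eq_iff)

lemma cobj_null: "AE w in M. w \<notin> b \<Longrightarrow> AE w in M. w \<notin> b' \<Longrightarrow> cobj M z b = cobj M z' b'"
 unfolding cobj_eq_iff by (auto elim: eventually_mono eventually_elim2)

text \<open>Closure under restriction and under gluing along countable covers characterises the
 conditional subsets.\<close>

definition gluable :: "(('w \<Rightarrow> real) \<times> 'w set) set set \<Rightarrow> bool" where
 "gluable S \<longleftrightarrow> S \<noteq> {} \<and> (\<forall>s\<in>S. \<exists>z b. s = cobj M z b \<and> z \<in> X1 \<and> b \<in> sets F) \<and>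
  (\<forall>z\<in>X1. \<forall>b\<in>sets F. \<forall>b'\<in>sets F. cobj M z b \<in> S \<longrightarrow> le_alg M b' b \<longrightarrow> cobj M z b' \<in> S) \<and>
  (\<forall>z\<in>X1. \<forall>b\<in>sets F. \<forall>c::nat \<Rightarrow> 'w set. (\<forall>k. c k \<in> sets F) \<longrightarrow>
    (AE w\<in>b in M. (\<exists>k. w \<in> c k)) \<longrightarrow> (\<forall>k. cobj M z (c k) \<in> S) \<longrightarrow> cobj M z b \<in> S)"

lemma gluableD:
 assumes "gluable S"
 shows "\<And>s. s \<in> S \<Longrightarrow> \<exists>z b. s = cobj M z b \<and> z \<in> X1 \<and> b \<in> sets F"
  and "\<And>z b b'. z \<in> X1 \<Longrightarrow> b \<in> sets F \<Longrightarrow> b' \<in> sets F \<Longrightarrow> cobj M z b \<in> S \<Longrightarrow> le_alg M b' b \<Longrightarrow> cobj M z b' \<in> S"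
  and "\<And>z b c. z \<in> X1 \<Longrightarrow> b \<in> sets F \<Longrightarrow> (\<And>k::nat. c k \<in> sets F) \<Longrightarrow>
    AE w\<in>b in M. (\<exists>k. w \<in> c k) \<Longrightarrow> (\<And>k. cobj M z (c k) \<in> S) \<Longrightarrow> cobj M z b \<in> S" proof -
 note g = assms[unfolded gluable_def, THEN conjunct2]
 show "\<exists>z b. s = cobj M z b \<and> z \<in> X1 \<and> b \<in> sets F" if "s \<in> S" for s
  by (rule g[THEN conjunct1, THEN bspec, OF that])
 show "cobj M z b' \<in> S" if "z \<in> X1" "b \<in> sets F" "b' \<in> sets F" "cobj M z b \<in> S" "le_alg M b' b" for z b b'
  by (rule g[THEN conjunct2, THEN conjunct1, THEN bspec, OF that(1), THEN bspec, OF that(2), THEN bspec, OF that(3),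
     THEN mp, OF that(4), THEN mp, OF that(5)])
 show "cobj M z b \<in> S" if "z \<in> X1" "b \<in> sets F" "\<And>k::nat. c k \<in> sets F"
  "AE w\<in>b in M. (\<exists>k. w \<in> c k)" "\<And>k. cobj M z (c k) \<in> S" for z b c
  by (rule g[THEN conjunct2, THEN conjunct2, THEN bspec, OF that(1), THEN bspec, OF that(2), THEN spec, of c, THEN mp,
     OF allI[OF that(3)], THEN mp, OF that(4), THEN mp, OF allI[OF that(5)]])
qed

lemma gluable_null:
 assumes S: "gluable S" and b: "AE w in M. w \<notin> b" shows "cobj M z b \<in> S" proof -
 obtain s where "s \<in> S" using S by (auto simp: gluable_def)
 then obtain z' b' where z': "cobj M z' b' \<in> S" "z' \<in> X1" "b' \<in> sets F" using gluableD(1)[OF S] by metis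
 have "cobj M z' {} \<in> S" by (rule gluableD(2)[OF S z'(2,3) _ z'(1)]) (auto simp: le_alg_def)
 moreover have "cobj M z' {} = cobj M z b" using b by (intro cobj_null) auto
 ultimately show ?thesis by simp
qed

text \<open>Exhaust the sets on which \<open>S\<close> has an object, glue the objects along this exhaustion, and
  extend the objects of \<open>S\<close> by the result to elements defined everywhere.\<close>

lemma gluable_imp_csubset:
 assumes S: "gluable S" shows "\<exists>a. csubset_on M F X1 a S" proof -
 define \<C> where "\<C> = {b \<in> sets F. \<exists>z\<in>X1. cobj M z b \<in> S}"
 obtain s where "s \<in> S" using S by (auto simp: gluable_def)
 then have "\<C> \<noteq> {}" using gluableD(1)[OF S] unfolding \<C>_def by blast
 moreover have "\<C> \<subseteq> sets F" by (auto simp: \<C>_def)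
 ultimately obtain b where b: "\<And>n::nat. b n \<in> \<C>" and bex: "\<And>C. C \<in> \<C> \<Longrightarrow> AE w\<in>C in M. w \<in> (\<Union>n. b n)"
  using exhaustion[of \<C>] by blast
 have bF: "b n \<in> sets F" for n using b by (simp add: \<C>_def)
 have "\<forall>n. \<exists>z. z \<in> X1 \<and> cobj M z (b n) \<in> S" using b by (auto simp: \<C>_def)
 from choice[OF this] obtain z where z: "\<And>n. z n \<in> X1" "\<And>n. cobj M (z n) (b n) \<in> S" by blast
 define a where "a = (\<Union>n. b n)"
 have aF: "a \<in> sets F" unfolding a_def using bF by auto
 define z' where "z' = cat (idx b) z"
 have z'X: "z' \<in> X1" unfolding z'_def by (rule cat_X1[OF idx_measurable[of b, OF bF] z(1)])
 have z'a: "cobj M z' a \<in> S"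
 proof (rule gluableD(3)[OF S z'X aF, where c = "\<lambda>n. {w \<in> space M. idx b w = n} \<inter> b n"])
  have c: "{w \<in> space M. idx b w = n} \<inter> b n \<in> sets F" for n
   by (rule sets.Int[OF N_level[OF idx_measurable[of b, OF bF]] bF])
  then show "{w \<in> space M. idx b w = n} \<inter> b n \<in> sets F" for n .
  show "AE w\<in>a in M. (\<exists>k. w \<in> {w \<in> space M. idx b w = k} \<inter> b k)"
   using AE_space by eventually_elim (auto simp: a_def intro: idx_in)
  fix n
  have "cobj M (z n) ({w \<in> space M. idx b w = n} \<inter> b n) \<in> S"
   by (rule gluableD(2)[OF S z(1) bF c z(2)]) (auto intro: le_algI)
  moreover have "cobj M z' ({w \<in> space M. idx b w = n} \<inter> b n) = cobj M (z n) ({w \<in> space M. idx b w = n} \<inter> b n)"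
   by (rule cobj_cong) (auto simp: z'_def cat_def)
  ultimately show "cobj M z' ({w \<in> space M. idx b w = n} \<inter> b n) \<in> S" by simp
 qed
 define Y where "Y = {z \<in> X1. cobj M z a \<in> S}"
 have st: "stable M F X1 Y" unfolding stable_def proof (intro conjI)
  show "Y \<noteq> {}" using z'X z'a by (auto simp: Y_def)
  show "Y \<subseteq> X1" by (auto simp: Y_def)
  show "stable_hull M F X1 Y \<subseteq> Y" proof
   fix x assume "x \<in> stable_hull M F X1 Y"
   then obtain A y where x: "x \<in> X1" and A: "A \<in> partitions M F (space M)" and y: "\<And>k. y k \<in> Y"
    and cc: "is_concat M A y x" by (auto simp: stable_hull_def)
   have AF: "A k \<in> sets F" for k using A by (simp add: partitions_def)
   have "cobj M x a \<in> S" proof (rule gluableD(3)[OF S x aF, where c = "\<lambda>k. A k \<inter> a"])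
    show "A k \<inter> a \<in> sets F" for k using AF aF by blast
    show "AE w\<in>a in M. (\<exists>k. w \<in> A k \<inter> a)" using partition_idx[OF A] by eventually_elim auto
    fix k
    have "cobj M (y k) (A k \<inter> a) \<in> S"
     by (rule gluableD(2)[OF S _ aF]) (use y AF aF in \<open>auto simp: Y_def intro: le_algI\<close>)
    moreover have "AE w\<in>A k in M. x w = y k w" using cc by (simp add: is_concat_def cobj_eq_iff)
    then have "cobj M x (A k \<inter> a) = cobj M (y k) (A k \<inter> a)" by (intro cobj_cong) (auto elim: eventually_mono)
    ultimately show "cobj M x (A k \<inter> a) \<in> S" by simp
   qed
   then show "x \<in> Y" using x by (simp add: Y_def)
  qed
 qed
 have "S = csub M F Y a" proof
  show "csub M F Y a \<subseteq> S" proof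
   fix s assume "s \<in> csub M F Y a"
   then obtain x c where "s = cobj M x c" "x \<in> Y" "c \<in> sets F" "le_alg M c a" by (auto simp: csub_def)
   then show "s \<in> S" using gluableD(2)[OF S _ aF] by (auto simp: Y_def)
  qed
  show "S \<subseteq> csub M F Y a" proof
   fix s assume s: "s \<in> S"
   then obtain x c where x: "s = cobj M x c" "x \<in> X1" "c \<in> sets F" using gluableD(1)[OF S] by metis
   have "c \<in> \<C>" using x s by (auto simp: \<C>_def)
   from bex[OF this] have ca: "le_alg M c a" by (simp add: le_alg_def a_def)
   define N where "N w = (if w \<in> c then 0 else 1 :: nat)" for w
   define t where "t j = (if j = 0 then x else z')" for j :: nat
   have Nm: "N \<in> rnat" unfolding N_def using x(3) by measurable
   have tX: "t j \<in> X1" for j using x(2) z'X by (simp add: t_def)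
   have yX: "cat N t \<in> X1" by (rule cat_X1[OF Nm tX])
   have "cobj M (cat N t) a \<in> S"
   proof (rule gluableD(3)[OF S yX aF, where c = "\<lambda>k. if k = 0 then c else a - c"])
    show "(if k = 0 then c else a - c) \<in> sets F" for k :: nat using x(3) aF by auto
    show "AE w\<in>a in M. (\<exists>k. w \<in> (if k = (0::nat) then c else a - c))" proof (rule AE_I2, rule impI)
     fix w assume "w \<in> a"
     then show "\<exists>k. w \<in> (if k = (0::nat) then c else a - c)"
      by (cases "w \<in> c") (auto intro: exI[of _ 0] exI[of _ 1])
    qed
    fix k :: nat
    have "cobj M (cat N t) c = cobj M x c" by (rule cobj_cong) (simp add: cat_def N_def t_def)
    moreover have "cobj M (cat N t) (a - c) = cobj M z' (a - c)" by (rule cobj_cong) (simp add: cat_def N_def t_def)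
    moreover have "cobj M z' (a - c) \<in> S"
     by (rule gluableD(2)[OF S z'X aF _ z'a]) (use x(3) aF in \<open>auto intro: le_algI\<close>)
    ultimately show "cobj M (cat N t) (if k = 0 then c else a - c) \<in> S" using s x(1) by simp
   qed
   then have "cat N t \<in> Y" using yX by (simp add: Y_def)
   moreover have "s = cobj M (cat N t) c" unfolding x(1) by (rule cobj_cong) (simp add: cat_def N_def t_def)
   ultimately show "s \<in> csub M F Y a" using x(3) ca by (auto simp: csub_def)
  qed
 qed
 then show ?thesis using st aF unfolding csubset_on_def by blast
qed

lemma csubset_on_imp_gluable:
 assumes S: "csubset_on M F X1 a S"
 shows "gluable S" and "\<And>z b. cobj M z b \<in> S \<Longrightarrow> le_alg M b a" proof -
 obtain Y where aF: "a \<in> sets F" and st: "stable M F X1 Y" and SY: "S = csub M F Y a"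
  using S by (auto simp: csubset_on_def)
 have YX: "Y \<subseteq> X1" and Yne: "Y \<noteq> {}" and Yh: "stable_hull M F X1 Y \<subseteq> Y" using st by (auto simp: stable_def)
 have mem: "\<exists>y\<in>Y. (AE w\<in>b in M. z w = y w) \<and> le_alg M b a" if "cobj M z b \<in> S" for z b proof -
  obtain y c where y: "cobj M z b = cobj M y c" "y \<in> Y" "le_alg M c a" using \<open>cobj M z b \<in> S\<close> by (auto simp: SY csub_def)
  then have e: "AE w in M. w \<in> b \<longleftrightarrow> w \<in> c" "AE w\<in>b in M. z w = y w" by (auto simp: cobj_eq_iff)
  have "le_alg M b a" unfolding le_alg_def using e(1) y(3)[unfolded le_alg_def] by eventually_elim simp
  then show ?thesis using e(2) y(2) by blast
 qed
 show "le_alg M b a" if "cobj M z b \<in> S" for z b using mem[OF that] by blast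
 have intro: "cobj M z b \<in> S" if "y \<in> Y" "AE w\<in>b in M. z w = y w" "b \<in> sets F" "le_alg M b a" for z b y proof -
  have "cobj M z b = cobj M y b" by (rule cobj_cong[OF that(2)])
  then show ?thesis unfolding SY csub_def using that by blast
 qed
 show "gluable S" unfolding gluable_def proof (intro conjI ballI allI impI)
  obtain y where "y \<in> Y" using Yne by blast
  then have "cobj M y {} \<in> S" by (intro intro) (auto simp: le_alg_def)
  then show "S \<noteq> {}" by blast
 next
  fix s assume "s \<in> S"
  then show "\<exists>z b. s = cobj M z b \<and> z \<in> X1 \<and> b \<in> sets F" using YX unfolding SY csub_def by blast
 next
  fix z b b' assume z: "z \<in> X1" "b \<in> sets F" and b': "b' \<in> sets F" and zb: "cobj M z b \<in> S" and le: "le_alg M b' b"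
  obtain y where y: "y \<in> Y" "AE w\<in>b in M. z w = y w" "le_alg M b a" using mem[OF zb] by blast
  show "cobj M z b' \<in> S" proof (rule intro[OF y(1) _ b'])
   show "AE w\<in>b' in M. z w = y w" using y(2) le[unfolded le_alg_def] by eventually_elim simp
   show "le_alg M b' a" unfolding le_alg_def using y(3)[unfolded le_alg_def] le[unfolded le_alg_def] by eventually_elim simp
  qed
 next
  fix z b and c :: "nat \<Rightarrow> 'w set"
  assume z: "z \<in> X1" "b \<in> sets F" and c: "\<forall>k. c k \<in> sets F" and cov: "AE w\<in>b in M. (\<exists>k. w \<in> c k)"
   and zc: "\<forall>k. cobj M z (c k) \<in> S"
  have cF: "c k \<in> sets F" for k using c by blast
  have "\<forall>k. \<exists>y. y \<in> Y \<and> (AE w\<in>c k in M. z w = y w)" using mem zc by blast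
  from choice[OF this] obtain y where y: "\<And>k. y k \<in> Y" "\<And>k. AE w\<in>c k in M. z w = y k w" by blast
  have ca: "le_alg M (c k) a" for k using mem[of z "c k"] zc by blast
  have im: "idx c \<in> rnat" by (rule idx_measurable[of c, OF cF])
  have yX: "cat (idx c) y \<in> X1" by (rule cat_X1[OF im]) (use y(1) YX in blast)
  have "is_concat M (\<lambda>k. {w \<in> space M. idx c w = k}) y (cat (idx c) y)"
   by (auto simp: is_concat_def cobj_eq_iff cat_def)
  then have "cat (idx c) y \<in> stable_hull M F X1 Y"
   unfolding stable_hull_def using yX idx_partition[OF im] y(1) by blast
  then have yY: "cat (idx c) y \<in> Y" using Yh by blast
  have "AE w in M. \<forall>k. (w \<in> c k \<longrightarrow> z w = y k w) \<and> (w \<in> c k \<longrightarrow> w \<in> a)"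
   by (subst AE_all_countable) (use y(2) ca in \<open>auto simp: le_alg_def\<close>)
  then have *: "AE w\<in>b in M. z w = cat (idx c) y w \<and> w \<in> a" using cov proof eventually_elim
   case (elim w)
   show ?case proof
    assume "w \<in> b"
    then obtain k where "w \<in> c k" using elim(2) by blast
    then have "w \<in> c (idx c w)" by (rule idx_in)
    then show "z w = cat (idx c) y w \<and> w \<in> a" using elim(1) by (simp add: cat_def)
   qed
  qed
  show "cobj M z b \<in> S" by (rule intro[OF yY _ z(2)]) (use * in \<open>auto simp: le_alg_def elim: eventually_mono\<close>)
 qed
qed

lemma csubset_iff_gluable: "csubset M F X1 S \<longleftrightarrow> gluable S"
 unfolding csubset_def using gluable_imp_csubset csubset_on_imp_gluable(1) by blast

text \<open>A join consists of the objects that are countably covered by pieces of its members.\<close>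

definition covered :: "(('w \<Rightarrow> real) \<times> 'w set) set set set \<Rightarrow> ('w \<Rightarrow> real) \<Rightarrow> 'w set \<Rightarrow> bool" where
 "covered \<U> z b \<longleftrightarrow> (\<exists>c::nat \<Rightarrow> 'w set. (\<forall>k. c k \<in> sets F) \<and> (AE w\<in>b in M. (\<exists>k. w \<in> c k)) \<and>
   (\<forall>k. (AE w in M. w \<notin> c k) \<or> (\<exists>U\<in>\<U>. cobj M z (c k) \<in> U)))"

lemma covered_imp_cjoin:
 assumes z: "z \<in> X1" and b: "b \<in> sets F" and cov: "covered \<U> z b"
 shows "cobj M z b \<in> cjoin M F X1 \<U>" unfolding cjoin_def proof
 fix S assume "S \<in> {S. csubset M F X1 S \<and> (\<forall>T\<in>\<U>. T \<subseteq> S)}"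
 then have S: "gluable S" and sub: "\<And>T. T \<in> \<U> \<Longrightarrow> T \<subseteq> S" by (auto simp: csubset_iff_gluable)
 obtain c where c: "\<And>k::nat. c k \<in> sets F" "AE w\<in>b in M. (\<exists>k. w \<in> c k)"
  "\<And>k. (AE w in M. w \<notin> c k) \<or> (\<exists>U\<in>\<U>. cobj M z (c k) \<in> U)" using cov unfolding covered_def by blast
 have "cobj M z (c k) \<in> S" for k using c(3)[of k] gluable_null[OF S] sub by blast
 then show "cobj M z b \<in> S" by (rule gluableD(3)[OF S z b c(1,2)])
qed

lemma covered_cong:
 assumes U: "\<And>U. U \<in> \<U> \<Longrightarrow> gluable U" and z: "z \<in> X1" and z': "z' \<in> X1" and b': "b' \<in> sets F"
  and cov: "covered \<U> z b" and le: "le_alg M b' b" and eq: "AE w\<in>b' in M. z w = z' w"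
 shows "covered \<U> z' b'" proof -
 obtain c where c: "\<And>k::nat. c k \<in> sets F" "AE w\<in>b in M. (\<exists>k. w \<in> c k)"
  "\<And>k. (AE w in M. w \<notin> c k) \<or> (\<exists>U\<in>\<U>. cobj M z (c k) \<in> U)" using cov unfolding covered_def by blast
 show ?thesis unfolding covered_def proof (intro exI[of _ "\<lambda>k. c k \<inter> b'"] conjI allI)
  show F: "c k \<inter> b' \<in> sets F" for k using c(1) b' by blast
  show "AE w\<in>b' in M. (\<exists>k. w \<in> c k \<inter> b')" using c(2) le[unfolded le_alg_def] by eventually_elim auto
  fix k
  show "(AE w in M. w \<notin> c k \<inter> b') \<or> (\<exists>U\<in>\<U>. cobj M z' (c k \<inter> b') \<in> U)" proof (cases "AE w in M. w \<notin> c k")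
   case True then show ?thesis by (auto elim: eventually_mono)
  next
   case False
   then obtain V where V: "V \<in> \<U>" "cobj M z (c k) \<in> V" using c(3)[of k] by blast
   have "cobj M z (c k \<inter> b') \<in> V" by (rule gluableD(2)[OF U[OF V(1)] z c(1) F V(2)]) (auto intro: le_algI)
   moreover have "cobj M z' (c k \<inter> b') = cobj M z (c k \<inter> b')"
    by (rule cobj_cong) (use eq in \<open>auto elim: eventually_mono\<close>)
   ultimately show ?thesis using V(1) by auto
  qed
 qed
qed

text \<open>The covered objects form a gluable set that contains all members, hence the join.\<close>

lemma cjoin_imp_covered:
 assumes U: "\<And>U. U \<in> \<U> \<Longrightarrow> gluable U" and z: "z \<in> X1" and b: "b \<in> sets F" and mem: "cobj M z b \<in> cjoin M F X1 \<U>"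
 shows "covered \<U> z b" proof -
 define J where "J = {cobj M z b | z b. z \<in> X1 \<and> b \<in> sets F \<and> covered \<U> z b}"
 have J: "covered \<U> z b" if zb: "z \<in> X1" "b \<in> sets F" "cobj M z b \<in> J" for z b proof -
  obtain y c where y: "cobj M z b = cobj M y c" "y \<in> X1" "c \<in> sets F" "covered \<U> y c" using zb(3) by (auto simp: J_def)
  then have e: "AE w in M. w \<in> b \<longleftrightarrow> w \<in> c" "AE w\<in>b in M. z w = y w" by (auto simp: cobj_eq_iff)
  show ?thesis
   by (rule covered_cong[OF U y(2) zb(1,2) y(4)]) (use e in \<open>auto simp: le_alg_def elim: eventually_mono\<close>)
 qed
 have Ji: "cobj M z b \<in> J" if "z \<in> X1" "b \<in> sets F" "covered \<U> z b" for z b using that by (auto simp: J_def)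
 have "gluable J" unfolding gluable_def proof (intro conjI ballI allI impI)
  have "covered \<U> z {}" unfolding covered_def by (intro exI[of _ "\<lambda>_. {}"]) auto
  then show "J \<noteq> {}" using Ji[OF z, of "{}"] by auto
 next
  show "\<exists>z b. s = cobj M z b \<and> z \<in> X1 \<and> b \<in> sets F" if "s \<in> J" for s using that unfolding J_def by blast
 next
  fix z b b' assume z: "z \<in> X1" "b \<in> sets F" "b' \<in> sets F" and zb: "cobj M z b \<in> J" and le: "le_alg M b' b"
  have "covered \<U> z b'" by (rule covered_cong[OF U z(1,1,3) J[OF z(1,2) zb] le]) auto
  then show "cobj M z b' \<in> J" by (rule Ji[OF z(1,3)])
 next
  fix z b and c :: "nat \<Rightarrow> 'w set"
  assume z: "z \<in> X1" "b \<in> sets F" and c: "\<forall>k. c k \<in> sets F" and cov: "AE w\<in>b in M. (\<exists>k. w \<in> c k)"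
   and zc: "\<forall>k. cobj M z (c k) \<in> J"
  have "\<forall>k. \<exists>d::nat \<Rightarrow> 'w set. (\<forall>i. d i \<in> sets F) \<and> (AE w\<in>c k in M. (\<exists>i. w \<in> d i)) \<and>
    (\<forall>i. (AE w in M. w \<notin> d i) \<or> (\<exists>U\<in>\<U>. cobj M z (d i) \<in> U))"
   using J[OF z(1)] c zc unfolding covered_def by blast
  from choice[OF this] obtain d where d: "\<forall>k. (\<forall>i. d k i \<in> sets F) \<and> (AE w\<in>c k in M. (\<exists>i::nat. w \<in> d k i)) \<and>
    (\<forall>i. (AE w in M. w \<notin> d k i) \<or> (\<exists>U\<in>\<U>. cobj M z (d k i) \<in> U))" by blast
  have "covered \<U> z b" unfolding covered_def
  proof (intro exI[of _ "\<lambda>n. d (fst (prod_decode n)) (snd (prod_decode n))"] conjI allI)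
   show "d (fst (prod_decode n)) (snd (prod_decode n)) \<in> sets F" for n using d by blast
   show "(AE w in M. w \<notin> d (fst (prod_decode n)) (snd (prod_decode n))) \<or>
     (\<exists>U\<in>\<U>. cobj M z (d (fst (prod_decode n)) (snd (prod_decode n))) \<in> U)" for n using d by blast
   have "AE w in M. \<forall>k. w \<in> c k \<longrightarrow> (\<exists>i. w \<in> d k i)" by (subst AE_all_countable) (use d in blast)
   then show "AE w\<in>b in M. (\<exists>n. w \<in> d (fst (prod_decode n)) (snd (prod_decode n)))" using cov
   proof eventually_elim
    case (elim w)
    show ?case proof
     assume "w \<in> b"
     then obtain k i where "w \<in> d k i" using elim by blast
     then show "\<exists>n. w \<in> d (fst (prod_decode n)) (snd (prod_decode n))"
      by (intro exI[of _ "prod_encode (k, i)"]) simp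
    qed
   qed
  qed
  then show "cobj M z b \<in> J" by (rule Ji[OF z])
 qed
 moreover have "T \<subseteq> J" if T: "T \<in> \<U>" for T proof
  fix s assume s: "s \<in> T"
  then obtain y c where y: "s = cobj M y c" "y \<in> X1" "c \<in> sets F" using gluableD(1)[OF U[OF T]] by metis
  have "covered \<U> y c" unfolding covered_def by (intro exI[of _ "\<lambda>_. c"]) (use y s T in auto)
  then show "s \<in> J" using Ji[OF y(2,3)] y(1) by simp
 qed
 ultimately have "cjoin M F X1 \<U> \<subseteq> J" unfolding cjoin_def by (intro Inter_lower) (simp add: csubset_iff_gluable)
 then show ?thesis using J[OF z b] mem by blast
qed

lemma cobj_in_crestrict:
 assumes S: "gluable S" and z: "z \<in> X1" and b: "b \<in> sets F"
 shows "cobj M z b \<in> crestrict M F S a \<longleftrightarrow> cobj M z b \<in> S \<and> le_alg M b a" proof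
 assume h: "cobj M z b \<in> crestrict M F S a"
 then obtain x c where x: "cobj M z b = cobj M x c" "le_alg M c a" by (auto simp: crestrict_def)
 then have "AE w in M. w \<in> b \<longleftrightarrow> w \<in> c" by (simp add: cobj_eq_iff)
 then have "le_alg M b a" unfolding le_alg_def using x(2)[unfolded le_alg_def] by eventually_elim simp
 then show "cobj M z b \<in> S \<and> le_alg M b a" using h by (simp add: crestrict_def)
next
 assume "cobj M z b \<in> S \<and> le_alg M b a"
 then show "cobj M z b \<in> crestrict M F S a" using b by (auto simp: crestrict_def)
qed

lemma gluable_crestrict:
 assumes S: "gluable S" shows "gluable (crestrict M F S a)" unfolding gluable_def
proof (intro conjI ballI allI impI)
 have "(\<lambda>_. 0) \<in> X1" by (rule Xinf_in_X1[OF Xinf_const])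
 then have "cobj M (\<lambda>_. 0) {} \<in> crestrict M F S a"
  using gluable_null[OF S, of "{}" "\<lambda>_. 0"] by (subst cobj_in_crestrict[OF S]) (auto simp: le_alg_def)
 then show "crestrict M F S a \<noteq> {}" by blast
next
 show "\<exists>z b. s = cobj M z b \<and> z \<in> X1 \<and> b \<in> sets F" if "s \<in> crestrict M F S a" for s
 proof (rule gluableD(1)[OF S])
  show "s \<in> S" using that by (simp add: crestrict_def)
 qed
next
 fix z b b' assume z: "z \<in> X1" "b \<in> sets F" and b': "b' \<in> sets F" and zb: "cobj M z b \<in> crestrict M F S a" and le: "le_alg M b' b"
 have h: "cobj M z b \<in> S" "le_alg M b a" using zb cobj_in_crestrict[OF S z] by auto
 have "le_alg M b' a" unfolding le_alg_def using h(2)[unfolded le_alg_def] le[unfolded le_alg_def] by eventually_elim simp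
 then show "cobj M z b' \<in> crestrict M F S a"
  using cobj_in_crestrict[OF S z(1) b'] gluableD(2)[OF S z b' h(1) le] by simp
next
 fix z b and c :: "nat \<Rightarrow> 'w set"
 assume z: "z \<in> X1" "b \<in> sets F" and c: "\<forall>k. c k \<in> sets F" and cov: "AE w\<in>b in M. (\<exists>k. w \<in> c k)"
  and zc: "\<forall>k. cobj M z (c k) \<in> crestrict M F S a"
 have h: "cobj M z (c k) \<in> S" "le_alg M (c k) a" for k using zc c cobj_in_crestrict[OF S z(1)] by auto
 have "AE w in M. \<forall>k. w \<in> c k \<longrightarrow> w \<in> a" by (subst AE_all_countable) (use h(2) in \<open>auto simp: le_alg_def\<close>)
 then have "le_alg M b a" unfolding le_alg_def using cov by eventually_elim blast
 moreover have "cobj M z b \<in> S" by (rule gluableD(3)[OF S z _ cov h(1)]) (use c in blast)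
 ultimately show "cobj M z b \<in> crestrict M F S a" using cobj_in_crestrict[OF S z] by simp
qed

text \<open>The form in which concrete conditional subsets arise: objects satisfying a local property.\<close>

lemma gluable_predicate:
 assumes sub: "\<And>z b b'. z \<in> X1 \<Longrightarrow> b \<in> sets F \<Longrightarrow> b' \<in> sets F \<Longrightarrow> P z b \<Longrightarrow> le_alg M b' b \<Longrightarrow> P z b'"
  and glue: "\<And>z b c. z \<in> X1 \<Longrightarrow> b \<in> sets F \<Longrightarrow> (\<And>k::nat. c k \<in> sets F) \<Longrightarrow>
    AE w\<in>b in M. (\<exists>k. w \<in> c k) \<Longrightarrow> (\<And>k. P z (c k)) \<Longrightarrow> P z b"
  and cong: "\<And>z z' b. z \<in> X1 \<Longrightarrow> z' \<in> X1 \<Longrightarrow> b \<in> sets F \<Longrightarrow> P z b \<Longrightarrow> AE w\<in>b in M. z w = z' w \<Longrightarrow> P z' b"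
  and null: "\<And>z. z \<in> X1 \<Longrightarrow> P z {}"
 shows "gluable {cobj M z b | z b. z \<in> X1 \<and> b \<in> sets F \<and> P z b} \<and>
  (\<forall>z\<in>X1. \<forall>b\<in>sets F. cobj M z b \<in> {cobj M z b | z b. z \<in> X1 \<and> b \<in> sets F \<and> P z b} \<longleftrightarrow> P z b)"
  (is "gluable ?S \<and> _") proof -
 have iff: "cobj M z b \<in> ?S \<longleftrightarrow> P z b" if z: "z \<in> X1" "b \<in> sets F" for z b proof
  assume "cobj M z b \<in> ?S"
  then obtain y c where y: "cobj M z b = cobj M y c" "y \<in> X1" "c \<in> sets F" "P y c" by blast
  then have e: "AE w in M. w \<in> b \<longleftrightarrow> w \<in> c" "AE w\<in>b in M. z w = y w" by (auto simp: cobj_eq_iff)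
  have "le_alg M b c" unfolding le_alg_def using e(1) by eventually_elim simp
  from sub[OF y(2,3) z(2) y(4) this] have "P y b" .
  then show "P z b" by (rule cong[OF y(2) z]) (use e(2) in \<open>auto elim: eventually_mono\<close>)
 qed (use z in blast)
 have "gluable ?S" unfolding gluable_def proof (intro conjI ballI allI impI)
  have "(\<lambda>_. 0) \<in> X1" by (rule Xinf_in_X1[OF Xinf_const])
  then have "cobj M (\<lambda>_. 0) {} \<in> ?S" using iff[of "\<lambda>_. 0" "{}"] null by simp
  then show "?S \<noteq> {}" by blast
 next
  show "\<exists>z b. s = cobj M z b \<and> z \<in> X1 \<and> b \<in> sets F" if "s \<in> ?S" for s using that by blast
 next
  fix z b b' assume z: "z \<in> X1" "b \<in> sets F" and b': "b' \<in> sets F" and zb: "cobj M z b \<in> ?S" and le: "le_alg M b' b"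
  have "P z b" using zb iff[OF z] by simp
  from sub[OF z b' this le] show "cobj M z b' \<in> ?S" using iff[OF z(1) b'] by simp
 next
  fix z b and c :: "nat \<Rightarrow> 'w set"
  assume z: "z \<in> X1" "b \<in> sets F" and c: "\<forall>k. c k \<in> sets F" and cov: "AE w\<in>b in M. (\<exists>k. w \<in> c k)"
   and zc: "\<forall>k. cobj M z (c k) \<in> ?S"
  have "P z (c k)" for k using zc c iff[OF z(1)] by blast
  then have "P z b" using c by (intro glue[OF z _ cov]) auto
  then show "cobj M z b \<in> ?S" using iff[OF z] by simp
 qed
 then show ?thesis using iff by (intro conjI ballI)
qed

section \<open>The conditional weak topology\<close>

lemma weak_nbhdI:
 assumes z: "z \<in> X1" and b: "b \<in> sets F" and le: "\<And>x. x \<in> Xinf \<Longrightarrow> cobj M x (space M) \<in> G \<Longrightarrow>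
   AE w in M. \<bar>cexp M F (\<lambda>v. x v * (z v - y v)) w\<bar> \<le> r w"
 shows "cobj M z b \<in> crestrict M F (weak_nbhd M F G r y) b" proof -
 let ?N = "{z \<in> X1. \<forall>x\<in>Xinf. cobj M x (space M) \<in> G \<longrightarrow>
  (AE w in M. \<bar>cexp M F (\<lambda>v. x v * (z v - y v)) w\<bar> \<le> r w)}"
 have N: "z \<in> ?N" using z le by simp
 have zm: "(\<lambda>_. 0::nat) \<in> rnat" by simp
 have "is_concat M (\<lambda>k. {w \<in> space M. (0::nat) = k}) (\<lambda>_. z) z" by (simp add: is_concat_def)
 then have "z \<in> stable_hull M F X1 ?N" unfolding stable_hull_def using z N
  by (intro CollectI conjI bexI[OF _ idx_partition[OF zm]] exI[of _ "\<lambda>_. z"]) simp_all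
 moreover have "le_alg M b (space M)" unfolding le_alg_def by (rule AE_I2) simp
 ultimately have "cobj M z b \<in> weak_nbhd M F G r y" unfolding weak_nbhd_def csub_def using b by blast
 then show ?thesis using b by (auto simp: crestrict_def intro: le_algI)
qed

lemma weak_nbhdE:
 assumes s: "s \<in> crestrict M F (weak_nbhd M F G r y) b" and y: "y \<in> X1"
 shows "\<exists>z c. s = cobj M z c \<and> z \<in> X1 \<and> c \<in> sets F \<and> le_alg M c b \<and>
  (\<forall>x\<in>Xinf. cobj M x (space M) \<in> G \<longrightarrow>
   (AE w in M. \<bar>cexp M F (\<lambda>v. x v * (z v - y v)) w\<bar> \<le> r w))" proof -
 let ?N = "{z \<in> X1. \<forall>x\<in>Xinf. cobj M x (space M) \<in> G \<longrightarrow>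
  (AE w in M. \<bar>cexp M F (\<lambda>v. x v * (z v - y v)) w\<bar> \<le> r w)}"
 obtain z c where z: "s = cobj M z c" "z \<in> stable_hull M F X1 ?N" "c \<in> sets F"
  using s unfolding crestrict_def weak_nbhd_def csub_def by blast
 obtain x' b' where "s = cobj M x' b'" "le_alg M b' b" using s unfolding crestrict_def by blast
 then have "AE w in M. w \<in> c \<longleftrightarrow> w \<in> b'" "AE w\<in>b' in M. w \<in> b" using z(1) by (auto simp: cobj_eq_iff le_alg_def)
 then have cb: "le_alg M c b" unfolding le_alg_def by eventually_elim simp
 obtain A u where zX: "z \<in> X1" and A: "A \<in> partitions M F (space M)" and u: "\<And>k. u k \<in> ?N"
  and cc: "is_concat M A u z" using z(2) unfolding stable_hull_def by blast
 have "AE w in M. \<bar>cexp M F (\<lambda>v. x v * (z v - y v)) w\<bar> \<le> r w"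
  if x: "x \<in> Xinf" and xG: "cobj M x (space M) \<in> G" for x proof -
  have "AE w\<in>A k in M. \<bar>cexp M F (\<lambda>v. x v * (z v - y v)) w\<bar> \<le> r w" for k proof -
   have uX: "u k \<in> X1" and ub: "AE w in M. \<bar>cexp M F (\<lambda>v. x v * (u k v - y v)) w\<bar> \<le> r w"
    using u[of k] x xG by auto
   have AF: "A k \<in> sets F" using A by (simp add: partitions_def)
   have eq: "AE w\<in>A k in M. z w = u k w" using cc by (simp add: is_concat_def cobj_eq_iff)
   have "AE w\<in>A k in M. cexp M F (\<lambda>v. x v * (z v - y v)) w = cexp M F (\<lambda>v. x v * (u k v - y v)) w"
    by (rule cexp_local[OF X1_mult[OF x X1_diff[OF zX y]] X1_mult[OF x X1_diff[OF uX y]] AF])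
     (use eq in \<open>auto elim: eventually_mono\<close>)
   then show ?thesis using ub by eventually_elim simp
  qed
  then have "AE w in M. \<forall>k. w \<in> A k \<longrightarrow> \<bar>cexp M F (\<lambda>v. x v * (z v - y v)) w\<bar> \<le> r w"
   by (subst AE_all_countable) blast
  then show ?thesis using partition_idx[OF A] by eventually_elim blast
 qed
 then show ?thesis using z(1,3) zX cb by (intro exI[of _ z] exI[of _ c] conjI ballI impI)
qed

lemma singleton_csubset:
 assumes x: "x \<in> Xinf"
 shows "csubset_on M F (Xinf) (space M) {cobj M x b | b. b \<in> sets F}"
  and "cfinite M F (Xinf) {cobj M x b | b. b \<in> sets F}" proof -
 have spF: "space M \<in> sets F" using sets.top[of F] by (simp add: space_F)
 define Y where "Y = {y \<in> Xinf. AE w in M. y w = x w}"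
 have st: "stable M F (Xinf) Y" unfolding stable_def proof (intro conjI)
  show "Y \<noteq> {}" using x by (auto simp: Y_def)
  show "Y \<subseteq> Xinf" by (auto simp: Y_def)
  show "stable_hull M F (Xinf) Y \<subseteq> Y" proof
   fix z assume "z \<in> stable_hull M F (Xinf) Y"
   then obtain A y where z: "z \<in> Xinf" and A: "A \<in> partitions M F (space M)"
    and y: "\<And>k. y k \<in> Y" and cc: "is_concat M A y z" by (auto simp: stable_hull_def)
   have "AE w\<in>A k in M. z w = x w" for k proof -
    have "AE w\<in>A k in M. z w = y k w" using cc by (simp add: is_concat_def cobj_eq_iff)
    moreover have "AE w in M. y k w = x w" using y[of k] by (simp add: Y_def)
    ultimately show ?thesis by eventually_elim simp
   qed
   then have "AE w in M. \<forall>k. w \<in> A k \<longrightarrow> z w = x w" by (subst AE_all_countable) blast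
   then have "AE w in M. z w = x w" using partition_idx[OF A] by eventually_elim blast
   then show "z \<in> Y" using z by (simp add: Y_def)
  qed
 qed
 have all: "le_alg M b (space M)" for b unfolding le_alg_def by (rule AE_I2) simp
 have "{cobj M x b | b. b \<in> sets F} = csub M F Y (space M)" proof (intro equalityI subsetI)
  fix s assume "s \<in> {cobj M x b | b. b \<in> sets F}"
  then show "s \<in> csub M F Y (space M)" using x all by (auto simp: csub_def Y_def)
 next
  fix s assume "s \<in> csub M F Y (space M)"
  then obtain y b where y: "s = cobj M y b" "AE w in M. y w = x w" "b \<in> sets F" by (auto simp: csub_def Y_def)
  have "cobj M y b = cobj M x b" by (rule cobj_cong) (use y(2) in \<open>auto elim: eventually_mono\<close>)
  then show "s \<in> {cobj M x b | b. b \<in> sets F}" using y by auto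
 qed
 then show "csubset_on M F (Xinf) (space M) {cobj M x b | b. b \<in> sets F}"
  unfolding csubset_on_def using st spF by blast
 have one: "(\<lambda>_. 1) \<in> L0N F" by (simp add: L0N_def)
 show "cfinite M F (Xinf) {cobj M x b | b. b \<in> sets F}" unfolding cfinite_def Let_def
 proof (intro bexI[OF _ one] exI[of _ "\<lambda>_. x"] conjI ballI impI)
  show "stable_fun M F {k \<in> L0N F. AE w in M. 1 \<le> k w \<and> k w \<le> 1} (Xinf) (\<lambda>_. x)"
   using x by (simp add: stable_fun_def is_concat_def)
  fix k l :: "'w \<Rightarrow> nat"
  assume "k \<in> {k \<in> L0N F. AE w in M. 1 \<le> k w \<and> k w \<le> 1}" "l \<in> {k \<in> L0N F. AE w in M. 1 \<le> k w \<and> k w \<le> 1}"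
  then have "AE w in M. 1 \<le> k w \<and> k w \<le> 1" "AE w in M. 1 \<le> l w \<and> l w \<le> 1" by auto
  then show "AE w in M. k w = l w" by eventually_elim simp
 next
  have "(\<lambda>_. 1) \<in> {k \<in> L0N F. AE w in M. 1 \<le> k w \<and> k w \<le> 1}" using one by simp
  then show "{cobj M x b | b. b \<in> sets F} =
    {cobj M x b | k b. k \<in> {k \<in> L0N F. AE w in M. 1 \<le> k w \<and> k w \<le> 1} \<and> b \<in> sets F}" by blast
 qed
qed

lemma X1_abs: "y \<in> X1 \<Longrightarrow> (\<lambda>w. \<bar>y w\<bar>) \<in> X1"
proof -
 assume y: "y \<in> X1"
 have "(\<lambda>w. sgn (y w)) \<in> Xinf" proof (rule XinfI[of _ "\<lambda>_. 1"])
  show "(\<lambda>w. sgn (y w)) \<in> L0 M" using X1_borel[OF y] by measurable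
 qed (auto simp: sgn_if)
 from X1_mult[OF this y] show ?thesis by (simp add: abs_sgn mult.commute)
qed

text \<open>Divide \<open>y\<close> by an \<open>F\<close>-measurable function that makes it integrable; then the expectations
  decrease and their integrals tend to zero.\<close>

lemma cexp_tendsto_0:
 assumes zL: "\<And>n. z n \<in> Linf M" and z0: "\<And>n w. 0 \<le> z n w" and zC: "\<And>n w. z n w \<le> C"
  and anti: "\<And>m n w. m \<le> n \<Longrightarrow> z n w \<le> z m w" and zlim: "AE w in M. (\<lambda>n. z n w) \<longlonglongrightarrow> 0" and y: "y \<in> X1"
 shows "AE w in M. (\<lambda>n. cpair (z n) y w) \<longlonglongrightarrow> 0" proof -
 have ya: "(\<lambda>w. \<bar>y w\<bar>) \<in> X1" by (rule X1_abs[OF y])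
 obtain \<eta> where e: "\<eta> \<in> L0 F" "\<And>w. \<eta> w \<ge> 1" "integrable M (\<lambda>w. \<bar>y w\<bar> / \<eta> w)" using X1E[OF ya] by blast
 have epos: "0 < \<eta> w" for w using e(2)[of w] by simp
 define q where "q w = \<bar>y w\<bar> / \<eta> w" for w
 have qi: "integrable M q" using e(3) by (simp add: q_def[abs_def])
 have q0: "0 \<le> q w" for w using epos[of w] by (simp add: q_def)
 have qX: "q \<in> X1" by (rule integrable_in_X1[OF qi])
 note Lc = Linf_in_Xinf[OF zL]
 have zqi: "integrable M (\<lambda>w. z n w * q w)" for n by (rule integrable_Linf_L1[OF zL qi])
 define g where "g n = cpair (z n) q" for n
 have "AE w in M. (\<lambda>n. g n w) \<longlonglongrightarrow> 0" proof (rule decreasing_AE_tendsto_0)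
  show "integrable M (g n)" for n unfolding g_def by (rule cexp_integral(1)[OF zqi])
  show "AE w in M. 0 \<le> g n w" for n unfolding g_def
   by (rule cexp_nonneg[OF X1_mult[OF Lc qX]]) (simp add: z0 q0)
  show "AE w in M. g (Suc n) w \<le> g n w" for n proof -
   have "AE w\<in>space F in M. z (Suc n) w * q w \<le> z n w * q w" by (rule AE_I2) (simp add: mult_right_mono anti q0)
   from cexp_mono_on[OF X1_mult[OF Lc qX] X1_mult[OF Lc qX] sets.top this]
   show ?thesis unfolding g_def using AE_space by eventually_elim (simp add: space_F)
  qed
  have "(\<lambda>n. \<integral>w. z n w * q w \<partial>M) \<longlonglongrightarrow> (\<integral>w. 0 \<partial>M)"
  proof (rule integral_dominated_convergence[where w = "\<lambda>w. C * q w"])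
   show "(\<lambda>w. z n w * q w) \<in> L0 M" for n using zqi by simp
   show "integrable M (\<lambda>w. C * q w)" using qi by simp
   show "AE w in M. (\<lambda>n. z n w * q w) \<longlonglongrightarrow> 0" using zlim proof eventually_elim
    case (elim w) show ?case using tendsto_mult_right[OF elim, of "q w"] by simp
   qed
   show "AE w in M. norm (z n w * q w) \<le> C * q w" for n
    by (rule AE_I2) (simp add: abs_mult z0 q0 mult_right_mono zC)
  qed simp
  then show "(\<lambda>n. \<integral>w. g n w \<partial>M) \<longlonglongrightarrow> 0" unfolding g_def cexp_integral(2)[OF zqi] by simp
 qed
 moreover have "AE w in M. \<forall>n. \<bar>cpair (z n) y w\<bar> \<le> \<eta> w * g n w" proof (subst AE_all_countable, rule allI)
  fix n
  have eq: "(\<lambda>w. \<eta> w * (z n w * q w)) = (\<lambda>w. z n w * \<bar>y w\<bar>)" proof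
   fix w show "\<eta> w * (z n w * q w) = z n w * \<bar>y w\<bar>" using epos[of w] by (simp add: q_def)
  qed
  have h: "AE w in M. cexp M F (\<lambda>w. z n w * \<bar>y w\<bar>) w = \<eta> w * g n w"
   using cexp_mult[OF e(1) X1_mult[OF Lc qX], of n] unfolding eq g_def .
  have my: "(\<lambda>w. -1 * (z n w * y w)) \<in> X1" by (rule X1_mult[OF Xinf_const X1_mult[OF Lc y]])
  have a: "AE w\<in>space F in M. cpair (z n) y w \<le> cexp M F (\<lambda>w. z n w * \<bar>y w\<bar>) w"
   by (rule cexp_mono_on[OF X1_mult[OF Lc y] X1_mult[OF Lc ya] sets.top])
    (rule AE_I2, simp add: mult_left_mono z0)
  have "- (z n w * y w) \<le> z n w * \<bar>y w\<bar>" for w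
   using mult_left_mono[of "- y w" "\<bar>y w\<bar>" "z n w"] z0[of n w] by simp
  then have b: "AE w\<in>space F in M. cexp M F (\<lambda>w. -1 * (z n w * y w)) w \<le> cexp M F (\<lambda>w. z n w * \<bar>y w\<bar>) w"
   by (intro cexp_mono_on[OF my X1_mult[OF Lc ya] sets.top] AE_I2) simp
  from a b h cexp_mult[OF borel_measurable_const X1_mult[OF Lc y], of "-1" n] AE_space
  show "AE w in M. \<bar>cpair (z n) y w\<bar> \<le> \<eta> w * g n w" by eventually_elim (auto simp: space_F abs_le_iff)
 qed
 ultimately show ?thesis proof eventually_elim
  case (elim w)
  have "(\<lambda>n. \<eta> w * g n w) \<longlonglongrightarrow> 0" using tendsto_mult_left[OF elim(1), of "\<eta> w"] by simp
  then show ?case by (rule Lim_null_comparison[rotated]) (use elim(2) in auto)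
 qed
qed

definition small :: "(nat \<Rightarrow> 'w \<Rightarrow> real) \<Rightarrow> ('w \<Rightarrow> nat) \<Rightarrow> (('w \<Rightarrow> real) \<times> 'w set) set set" where
 "small z m = {cobj M y b | y b. y \<in> X1 \<and> b \<in> sets F \<and>
   (AE w\<in>b in M. \<bar>cpair (cat m z) y w\<bar> < 1)}"

lemma small_gluable:
 assumes z: "\<And>n. z n \<in> Xinf" and m: "m \<in> rnat"
 shows "gluable (small z m)" and "\<And>y b. y \<in> X1 \<Longrightarrow> b \<in> sets F \<Longrightarrow>
   cobj M y b \<in> small z m \<longleftrightarrow> (AE w\<in>b in M. \<bar>cpair (cat m z) y w\<bar> < 1)" proof -
 have x: "cat m z \<in> Xinf" by (rule cat_Xinf[OF m z])
 define P where "P y b \<longleftrightarrow> (AE w\<in>b in M. \<bar>cpair (cat m z) y w\<bar> < 1)" for y b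
 have 1: "P y b'" if "y \<in> X1" "b \<in> sets F" "b' \<in> sets F" "P y b" "le_alg M b' b" for y b b'
  using that(4,5) unfolding P_def le_alg_def by eventually_elim simp
 have 2: "P y b" if "y \<in> X1" "b \<in> sets F" "\<And>k. c k \<in> sets F" "AE w\<in>b in M. (\<exists>k. w \<in> c k)" "\<And>k::nat. P y (c k)" for y b c
 proof -
  have "AE w in M. \<forall>k. w \<in> c k \<longrightarrow> \<bar>cpair (cat m z) y w\<bar> < 1"
   by (subst AE_all_countable) (use that(5) in \<open>simp add: P_def\<close>)
  then show ?thesis using that(4) unfolding P_def by eventually_elim blast
 qed
 have 3: "P y' b" if "y \<in> X1" "y' \<in> X1" "b \<in> sets F" "P y b" "AE w\<in>b in M. y w = y' w" for y y' b proof -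
  have "AE w\<in>b in M. cpair (cat m z) y w = cpair (cat m z) y' w"
   by (rule cexp_local[OF X1_mult[OF x that(1)] X1_mult[OF x that(2)] that(3)])
    (use that(5) in \<open>auto elim: eventually_mono\<close>)
  then show ?thesis using that(4) unfolding P_def by eventually_elim simp
 qed
 have 4: "P y {}" if "y \<in> X1" for y by (simp add: P_def)
 have S: "small z m = {cobj M y b | y b. y \<in> X1 \<and> b \<in> sets F \<and> P y b}" by (simp add: small_def P_def)
 have "gluable (small z m) \<and> (\<forall>y\<in>X1. \<forall>b\<in>sets F. cobj M y b \<in> small z m \<longleftrightarrow> P y b)" unfolding S
 proof (rule gluable_predicate[where P = P])
  show "P y b'" if "y \<in> X1" "b \<in> sets F" "b' \<in> sets F" "P y b" "le_alg M b' b" for y b b' by (rule 1[OF that])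
  show "P y b" if "y \<in> X1" "b \<in> sets F" "\<And>k. c k \<in> sets F" "AE w\<in>b in M. (\<exists>k. w \<in> c k)" "\<And>k::nat. P y (c k)" for y b c
   by (rule 2[OF that])
  show "P y' b" if "y \<in> X1" "y' \<in> X1" "b \<in> sets F" "P y b" "AE w\<in>b in M. y w = y' w" for y y' b
   by (rule 3[OF that])
  show "P y {}" if "y \<in> X1" for y by (rule 4[OF that])
 qed
 then show "gluable (small z m)" "\<And>y b. y \<in> X1 \<Longrightarrow> b \<in> sets F \<Longrightarrow>
   cobj M y b \<in> small z m \<longleftrightarrow> (AE w\<in>b in M. \<bar>cpair (cat m z) y w\<bar> < 1)" by (simp_all add: P_def)
qed

text \<open>The test functions of the required neighbourhood form a conditionally finite set with a single
  element.\<close>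

lemma small_weak_open:
 assumes z: "\<And>n. z n \<in> Xinf" and m: "m \<in> rnat"
 shows "weak_open M F (small z m)" unfolding weak_open_def proof (intro conjI ballI impI)
 note S = small_gluable[OF z m]
 show "csubset M F X1 (small z m)" using S(1) by (simp add: csubset_iff_gluable)
 have x: "cat m z \<in> Xinf" by (rule cat_Xinf[OF m z])
 fix y b assume y: "y \<in> X1" and b: "b \<in> sets F" and yb: "cobj M y b \<in> small z m"
 define c where "c = cpair (cat m z) y"
 have c: "c \<in> L0 F" unfolding c_def by (rule cexp_L0[OF X1_mult[OF x y]])
 have c1: "AE w\<in>b in M. \<bar>c w\<bar> < 1" using yb S(2)[OF y b] by (simp add: c_def)
 define r where "r w = (if \<bar>c w\<bar> < 1 then (1 - \<bar>c w\<bar>) / 2 else 1)" for w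
 have r: "r \<in> L0pos M F" unfolding L0pos_def proof (intro CollectI conjI AE_I2)
  show "r \<in> L0 F" unfolding r_def using c by measurable
  show "0 < r w" for w by (simp add: r_def)
 qed
 let ?G = "{cobj M (cat m z) b | b. b \<in> sets F}"
 show "\<exists>r\<in>L0pos M F. \<exists>G. csubset_on M F (Xinf) (space M) G \<and> cfinite M F (Xinf) G \<and>
   crestrict M F (weak_nbhd M F G r y) b \<subseteq> small z m"
 proof (intro bexI[OF _ r] exI[of _ ?G] conjI singleton_csubset[OF x] subsetI)
  fix s assume "s \<in> crestrict M F (weak_nbhd M F ?G r y) b"
  then obtain z' d where z': "s = cobj M z' d" "z' \<in> X1" "d \<in> sets F" "le_alg M d b"
   and near: "\<forall>x\<in>Xinf. cobj M x (space M) \<in> ?G \<longrightarrow>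
    (AE w in M. \<bar>cexp M F (\<lambda>v. x v * (z' v - y v)) w\<bar> \<le> r w)" using weak_nbhdE[OF _ y] by blast
  have "cobj M (cat m z) (space M) \<in> ?G" using sets.top[of F] by (auto simp: space_F)
  from near[THEN bspec, OF x, THEN mp, OF this] have n: "AE w in M. \<bar>cexp M F (\<lambda>v. cat m z v * z' v - cat m z v * y v) w\<bar> \<le> r w"
   by (simp add: right_diff_distrib)
  have "AE w\<in>d in M. \<bar>cpair (cat m z) z' w\<bar> < 1"
   using n cexp_diff[OF X1_mult[OF x z'(2)] X1_mult[OF x y]] c1 z'(4)[unfolded le_alg_def] proof eventually_elim
   case (elim w)
   show ?case proof
    assume "w \<in> d"
    then have 1: "\<bar>c w\<bar> < 1" using elim by simp
    have "\<bar>cpair (cat m z) z' w - c w\<bar> \<le> r w" using elim(1,2) by (simp add: c_def)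
    then have "\<bar>cpair (cat m z) z' w - c w\<bar> \<le> (1 - \<bar>c w\<bar>) / 2" using 1 by (simp add: r_def)
    moreover have "\<bar>t\<bar> < 1" if "\<bar>t - s\<bar> \<le> (1 - \<bar>s\<bar>) / 2" "\<bar>s\<bar> < 1" for s t :: real
     using that abs_triangle_ineq[of "t - s" s] by simp
    ultimately show "\<bar>cpair (cat m z) z' w\<bar> < 1" using 1 by blast
   qed
  qed
  then show "s \<in> small z m" unfolding z'(1) using S(2)[OF z'(2,3)] by simp
 qed
qed

text \<open>Concatenating the sets for indices \<open>m k\<close> gives the set for the glued index, so the family is
  closed under concatenations.\<close>

lemma small_concat:
 assumes z: "\<And>n. z n \<in> Xinf"
 shows "concat_closed M F X1 (small z ` L0N F)" unfolding concat_closed_def proof (intro ballI allI impI)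
 fix A and U :: "nat \<Rightarrow> (('w \<Rightarrow> real) \<times> 'w set) set set"
 assume A: "A \<in> partitions M F (space M)" and U: "\<forall>k. U k \<in> small z ` L0N F"
 have AF: "A k \<in> sets F" for k using A by (simp add: partitions_def)
 have "\<forall>k. \<exists>m. m \<in> L0N F \<and> U k = small z m" using U by blast
 from choice[OF this] obtain m where m: "\<And>k. m k \<in> L0N F" "\<And>k. U k = small z (m k)" by blast
 have mm: "m k \<in> rnat" for k by (rule L0N_measurable[OF m(1)])
 define m' where "m' = cat (idx A) m"
 have im: "idx A \<in> rnat" by (rule idx_measurable[of A, OF AF])
 have m'N: "m' \<in> L0N F" proof -
  have "m' \<in> measurable F (count_space {1..})" unfolding m'_def
   by (rule cat_measurable[OF im]) (use m(1) in \<open>simp add: L0N_def\<close>)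
  then show ?thesis by (simp add: L0N_def)
 qed
 have mm': "m' \<in> rnat" by (rule L0N_measurable[OF m'N])
 have S: "gluable (U k)" for k unfolding m(2) by (rule small_gluable(1)[OF z mm])
 define \<W> where "\<W> = range (\<lambda>k. crestrict M F (U k) (A k))"
 have gW: "gluable T" if "T \<in> \<W>" for T using that gluable_crestrict[OF S] by (auto simp: \<W>_def)
 have eqx: "AE w\<in>A k in M. cpair (cat m' z) y w = cexp M F (\<lambda>v. cat (m k) z v * y v) w" if y: "y \<in> X1" for y k
 proof (rule cexp_local[OF X1_mult[OF cat_Xinf[OF mm' z] y] X1_mult[OF cat_Xinf[OF mm z] y] AF])
  show "AE w\<in>A k in M. cat m' z w * y w = cat (m k) z w * y w"
   using partition_idx[OF A] by eventually_elim (auto simp: m'_def cat_def)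
 qed
 have "cjoin M F X1 \<W> = small z m'" proof
  have J: "gluable (small z m')" by (rule small_gluable(1)[OF z mm'])
  have "T \<subseteq> small z m'" if TW: "T \<in> \<W>" for T proof
   fix s assume s: "s \<in> T"
   obtain k where k: "T = crestrict M F (U k) (A k)" using TW by (auto simp: \<W>_def)
   obtain y b where y: "s = cobj M y b" "y \<in> X1" "b \<in> sets F" using gluableD(1)[OF gW[OF TW] s] by blast
   have "cobj M y b \<in> U k" "le_alg M b (A k)" using s cobj_in_crestrict[OF S y(2,3)] by (auto simp: k y(1))
   then have "AE w\<in>b in M. \<bar>cexp M F (\<lambda>v. cat (m k) z v * y v) w\<bar> < 1" "AE w\<in>b in M. w \<in> A k"
    using small_gluable(2)[OF z mm y(2,3)] by (auto simp: m(2) le_alg_def)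
   then have "AE w\<in>b in M. \<bar>cpair (cat m' z) y w\<bar> < 1" using eqx[OF y(2), of k] by eventually_elim simp
   then show "s \<in> small z m'" unfolding y(1) using small_gluable(2)[OF z mm' y(2,3)] by simp
  qed
  then show "cjoin M F X1 \<W> \<subseteq> small z m'"
   unfolding cjoin_def using J by (intro Inter_lower) (simp add: csubset_iff_gluable)
  show "small z m' \<subseteq> cjoin M F X1 \<W>" proof
   fix s assume s: "s \<in> small z m'"
   obtain y b where y: "s = cobj M y b" "y \<in> X1" "b \<in> sets F" using gluableD(1)[OF J s] by blast
   have le: "AE w\<in>b in M. \<bar>cpair (cat m' z) y w\<bar> < 1"
    using s small_gluable(2)[OF z mm' y(2,3)] by (simp add: y(1))
   have "covered \<W> y b" unfolding covered_def proof (intro exI[of _ "\<lambda>k. b \<inter> A k"] conjI allI disjI2)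
    show bA: "b \<inter> A k \<in> sets F" for k using y(3) AF by blast
    show "AE w\<in>b in M. (\<exists>k. w \<in> b \<inter> A k)" using partition_idx[OF A] by eventually_elim blast
    fix k
    have "AE w\<in>b \<inter> A k in M. \<bar>cexp M F (\<lambda>v. cat (m k) z v * y v) w\<bar> < 1"
     using le eqx[OF y(2), of k] by eventually_elim auto
    then have "cobj M y (b \<inter> A k) \<in> U k" using small_gluable(2)[OF z mm y(2) bA] by (simp add: m(2))
    then have "cobj M y (b \<inter> A k) \<in> crestrict M F (U k) (A k)"
     using cobj_in_crestrict[OF S y(2) bA] by (simp add: le_algI)
    then show "\<exists>U\<in>\<W>. cobj M y (b \<inter> A k) \<in> U" by (auto simp: \<W>_def)
   qed
   then show "s \<in> cjoin M F X1 \<W>" unfolding y(1) by (rule covered_imp_cjoin[OF y(2,3)])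
  qed
 qed
 then show "cjoin M F X1 (range (\<lambda>k. crestrict M F (U k) (A k))) \<in> small z ` L0N F"
  using m'N by (simp add: \<W>_def)
qed

lemma finite_index_bound:
 assumes "finite W" "W \<subseteq> L0N F"
 shows "\<exists>m. m \<in> rnat \<and> (\<forall>i\<in>W. \<forall>w. i w \<le> (m w :: nat))" using assms proof (induction W rule: finite_induct)
 case empty then show ?case by (intro exI[of _ "\<lambda>_. 0"]) simp
next
 case (insert i W)
 then obtain m where m: "m \<in> rnat" "\<forall>i\<in>W. \<forall>w. i w \<le> m w" by blast
 have i: "i \<in> rnat" by (rule L0N_measurable) (use insert in blast)
 have "(\<lambda>w. max (i w) (m w)) \<in> rnat" using i m(1) by measurable
 then show ?case using m(2) by (intro exI[of _ "\<lambda>w. max (i w) (m w)"]) (auto intro: max.coboundedI2)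
qed

text \<open>A conditional form of Dini's theorem: on a conditionally compact set the expectations against
 a sequence decreasing to zero vanish uniformly, with a random index of the required accuracy.\<close>

lemma compact_uniform:
 assumes K: "cond_weakly_compact M F K"
  and zL: "\<And>n. z n \<in> Linf M" and z0: "\<And>n w. 0 \<le> z n w" and zC: "\<And>n w. z n w \<le> C"
  and anti: "\<And>m n w. m \<le> n \<Longrightarrow> z n w \<le> z m w" and zlim: "AE w in M. (\<lambda>n. z n w) \<longlonglongrightarrow> 0"
 obtains m where "m \<in> rnat"
  "\<And>y b n. y \<in> X1 \<Longrightarrow> b \<in> sets F \<Longrightarrow> cobj M y b \<in> K \<Longrightarrow> AE w in M. y w \<le> 0 \<Longrightarrow>
    AE w\<in>b in M. m w \<le> (n::nat) \<longrightarrow> \<bar>cpair (z n) y w\<bar> < 1" proof -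
 have zc: "z n \<in> Xinf" for n by (rule Linf_in_Xinf[OF zL])
 define \<U> where "\<U> = small z ` L0N F"
 obtain a where aK: "csubset_on M F X1 a K \<and> (\<forall>\<U>. (\<forall>U\<in>\<U>. weak_open M F U) \<and> concat_closed M F X1 \<U> \<and>
   K \<subseteq> cjoin M F X1 \<U> \<longrightarrow> (\<exists>A\<in>partitions M F a. \<exists>\<V>. \<forall>k. finite (\<V> k) \<and> \<V> k \<subseteq> \<U> \<and>
      crestrict M F K (A k) \<subseteq> cjoin M F X1 (\<V> k)))" using K[unfolded cond_weakly_compact_def] by (rule exE)
 note a = conjunct1[OF aK]
 note gK = csubset_on_imp_gluable[OF a]
 have open_U: "\<forall>U\<in>\<U>. weak_open M F U" proof
  fix U assume "U \<in> \<U>"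
  then obtain i where i: "i \<in> L0N F" "U = small z i" unfolding \<U>_def by (rule imageE)
  show "weak_open M F U" unfolding i(2) by (rule small_weak_open[of z, OF zc L0N_measurable[OF i(1)]])
 qed
 have sub: "K \<subseteq> cjoin M F X1 \<U>" proof
  fix s assume "s \<in> K"
  then obtain y b where y: "s = cobj M y b" "y \<in> X1" "b \<in> sets F" using gluableD(1)[OF gK(1)] by blast
  define P where "P k w \<longleftrightarrow> \<bar>cpair (z k) y w\<bar> < 1" for k w
  have P: "{w \<in> space F. P k w} \<in> sets F" for k
   unfolding P_def using cexp_L0[OF X1_mult[OF zc[of k] y(2)]] by measurable
  have "AE w in M. (\<lambda>n. cpair (z n) y w) \<longlonglongrightarrow> 0" by (rule cexp_tendsto_0[of z C]) (fact zL z0 zC anti zlim y(2))+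
  then have ex: "AE w in M. \<exists>k\<ge>1. P k w" proof eventually_elim
   case (elim w)
   have "\<forall>\<^sub>F k in sequentially. dist (cpair (z k) y w) 0 < 1" using elim by (rule tendstoD) simp
   then obtain n where "\<And>k. k \<ge> n \<Longrightarrow> \<bar>cpair (z k) y w\<bar> < 1" by (auto simp: eventually_sequentially dist_real_def)
   then show ?case unfolding P_def by (intro exI[of _ "max 1 n"]) simp
  qed
  obtain m where m: "m \<in> rnat" "\<And>w. 1 \<le> m w" "AE w in M. P (m w) w" using first_index[OF P ex] by blast
  have mN: "m \<in> L0N F" using m(1,2) by (rule L0N_I)
  have "cat m (\<lambda>k v. z k v * y v) = (\<lambda>v. cat m z v * y v)" by (auto simp: cat_def)
  then have "AE w in M. cpair (cat m z) y w = cexp M F (\<lambda>v. z (m w) v * y v) w"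
   using cexp_cat[OF m(1), of "\<lambda>k v. z k v * y v"] X1_mult[OF zc y(2)] by simp
  then have "AE w\<in>b in M. \<bar>cpair (cat m z) y w\<bar> < 1" using m(3) by eventually_elim (simp add: P_def)
  then have mem: "s \<in> small z m" unfolding y(1) using small_gluable(2)[OF zc m(1) y(2,3)] by simp
  have "covered \<U> y b" unfolding covered_def by (intro exI[of _ "\<lambda>_. b"]) (use mem mN y in \<open>auto simp: \<U>_def\<close>)
  then show "s \<in> cjoin M F X1 \<U>" unfolding y(1) by (rule covered_imp_cjoin[OF y(2,3)])
 qed
 have "concat_closed M F X1 \<U>" unfolding \<U>_def by (rule small_concat[OF zc])
 from aK[THEN conjunct2, THEN spec, of \<U>, THEN mp, OF conjI[OF open_U conjI[OF this sub]]]
 obtain A \<V> where A: "A \<in> partitions M F a" and V: "\<forall>k. finite (\<V> k) \<and> \<V> k \<subseteq> \<U> \<and>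
   crestrict M F K (A k) \<subseteq> cjoin M F X1 (\<V> k)" by (elim bexE exE)
 have fin: "finite (\<V> k)" and VU: "\<V> k \<subseteq> \<U>" and KV: "crestrict M F K (A k) \<subseteq> cjoin M F X1 (\<V> k)" for k
  using V[THEN spec, of k] by simp_all
 have AF: "A k \<in> sets F" for k using A by (simp add: partitions_def)
 have cover: "AE w\<in>a in M. w \<in> A (idx A w)" proof -
  have "AE w in M. w \<in> a \<longleftrightarrow> w \<in> (\<Union>k. A k)" using A by (simp add: partitions_def)
  then show ?thesis by eventually_elim (auto intro: idx_in)
 qed
 have "\<forall>k. \<exists>m. m \<in> rnat \<and> (\<forall>U\<in>\<V> k. \<exists>i\<in>L0N F. U = small z i \<and> (\<forall>w. i w \<le> (m w :: nat)))" proof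
  fix k
  obtain W where W: "W \<subseteq> L0N F" "finite W" "\<V> k = small z ` W"
   using finite_subset_image[OF fin VU[unfolded \<U>_def], of k] by blast
  obtain m where "m \<in> rnat" "\<forall>i\<in>W. \<forall>w. i w \<le> (m w :: nat)"
   using finite_index_bound[OF W(2,1)] by (elim exE conjE)
  then have "m \<in> rnat \<and> (\<forall>U\<in>\<V> k. \<exists>i\<in>L0N F. U = small z i \<and> (\<forall>w. i w \<le> m w))" using W(1) unfolding W(3) by auto
  then show "\<exists>m. m \<in> rnat \<and> (\<forall>U\<in>\<V> k. \<exists>i\<in>L0N F. U = small z i \<and> (\<forall>w. i w \<le> (m w :: nat)))"
   by (rule exI[of _ m])
 qed
 from choice[OF this] obtain m where mm: "\<forall>k. m k \<in> rnat \<and>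
  (\<forall>U\<in>\<V> k. \<exists>i\<in>L0N F. U = small z i \<and> (\<forall>w. i w \<le> (m k w :: nat)))" by (rule exE)
 have m: "m k \<in> rnat"
  "U \<in> \<V> k \<Longrightarrow> \<exists>i\<in>L0N F. U = small z i \<and> (\<forall>w. i w \<le> (m k w :: nat))" for k U using mm[THEN spec, of k] by simp_all
 show ?thesis proof (rule that[of "cat (idx A) m"])
  show "cat (idx A) m \<in> rnat" by (rule cat_measurable[OF idx_measurable[of A, OF AF] m(1)])
  fix y b n assume y: "y \<in> X1" and b: "b \<in> sets F" and yK: "cobj M y b \<in> K" and y0: "AE w in M. y w \<le> 0"
  have ba: "AE w\<in>b in M. w \<in> a" using gK(2)[OF yK] by (simp add: le_alg_def)
  have mono: "AE w in M. w \<in> c \<longrightarrow> i w \<le> n \<longrightarrow> \<bar>cpair (z n) y w\<bar> < 1"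
   if i: "i \<in> L0N F" and c: "c \<in> sets F" "cobj M y c \<in> small z i" for i c proof -
   have im: "i \<in> rnat" by (rule L0N_measurable[OF i])
   have x: "cat i z \<in> Xinf" by (rule cat_Xinf[OF im zc])
   have lev: "{w \<in> space F. i w \<le> n} \<in> sets F" using im by measurable
   have "AE w in M. w \<in> {w \<in> space F. i w \<le> n} \<longrightarrow> cat i z w * y w \<le> z n w * y w" using y0 proof eventually_elim
    case (elim w)
    show ?case proof
     assume "w \<in> {w \<in> space F. i w \<le> n}"
     then have "z n w \<le> cat i z w" by (simp add: cat_def anti)
     then show "cat i z w * y w \<le> z n w * y w" using elim by (rule mult_right_mono_neg)
    qed
   qed
   from cexp_mono_on[OF X1_mult[OF x y] X1_mult[OF zc y] lev this]
   have low: "AE w in M. w \<in> {w \<in> space F. i w \<le> n} \<longrightarrow> cpair (cat i z) y w \<le> cpair (z n) y w" .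
   have "AE w\<in>space F in M. z n w * y w \<le> 0" using y0 by eventually_elim (simp add: mult_nonneg_nonpos z0)
   from cexp_mono_on[OF X1_mult[OF zc y] Xinf_in_X1[OF Xinf_const] sets.top this]
   have up: "AE w\<in>space F in M. cpair (z n) y w \<le> cexp M F (\<lambda>_. 0) w" .
   have "AE w\<in>c in M. \<bar>cpair (cat i z) y w\<bar> < 1" using c(2) small_gluable(2)[OF zc im y c(1)] by simp
   then show ?thesis using low up cexp_F[OF borel_measurable_const, of 0] AE_space
    by eventually_elim (auto simp: space_F)
  qed
  have "AE w in M. w \<in> b \<inter> A k \<longrightarrow> m k w \<le> n \<longrightarrow> \<bar>cpair (z n) y w\<bar> < 1" for k proof -
   have bA: "b \<inter> A k \<in> sets F" using b AF by blast
   have "cobj M y (b \<inter> A k) \<in> K" by (rule gluableD(2)[OF gK(1) y b bA yK]) (auto intro: le_algI)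
   then have "cobj M y (b \<inter> A k) \<in> crestrict M F K (A k)"
    using cobj_in_crestrict[OF gK(1) y bA] by (simp add: le_algI)
   then have "cobj M y (b \<inter> A k) \<in> cjoin M F X1 (\<V> k)" using KV by blast
   moreover have "gluable U" if U: "U \<in> \<V> k" for U proof -
    obtain i where i: "i \<in> L0N F" "U = small z i" using m(2)[OF U] by blast
    show ?thesis unfolding i(2) by (rule small_gluable(1)[of z, OF zc L0N_measurable[OF i(1)]])
   qed
   ultimately have "covered (\<V> k) y (b \<inter> A k)" by (intro cjoin_imp_covered[OF _ y bA])
   then obtain c where c: "\<And>j::nat. c j \<in> sets F" "AE w\<in>b \<inter> A k in M. (\<exists>j. w \<in> c j)"
    "\<And>j. (AE w in M. w \<notin> c j) \<or> (\<exists>U\<in>\<V> k. cobj M y (c j) \<in> U)" unfolding covered_def by blast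
   have "AE w in M. w \<in> c j \<longrightarrow> m k w \<le> n \<longrightarrow> \<bar>cpair (z n) y w\<bar> < 1" for j using c(3)[of j] proof
    assume "AE w in M. w \<notin> c j" then show ?thesis by eventually_elim simp
   next
    assume "\<exists>U\<in>\<V> k. cobj M y (c j) \<in> U"
    then obtain i where i: "i \<in> L0N F" "cobj M y (c j) \<in> small z i" "\<forall>w. i w \<le> m k w" using m(2) by blast
    from mono[OF i(1) c(1) i(2)] show ?thesis by eventually_elim (use i(3) in \<open>meson order_trans\<close>)
   qed
   then have "AE w in M. \<forall>j. w \<in> c j \<longrightarrow> m k w \<le> n \<longrightarrow> \<bar>cpair (z n) y w\<bar> < 1" by (subst AE_all_countable) blast
   then show ?thesis using c(2) by eventually_elim blast
  qed
  then have "AE w in M. \<forall>k. w \<in> b \<inter> A k \<longrightarrow> m k w \<le> n \<longrightarrow> \<bar>cpair (z n) y w\<bar> < 1"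
   by (subst AE_all_countable) blast
  then show "AE w\<in>b in M. cat (idx A) m w \<le> n \<longrightarrow> \<bar>cpair (z n) y w\<bar> < 1"
   using ba cover by eventually_elim (auto simp: cat_def)
 qed
qed

end

section \<open>Compact sublevel sets imply the Lebesgue property\<close>

context cond_risk
begin

text \<open>The conditional excess \<open>D\<close> of the subgradient inequality has integral at most \<open>\<delta>\<close> for every
  test function. Gluing test functions turns this into a bound for their supremum, which therefore
  exceeds 1 with probability at most \<open>\<delta>\<close>.\<close>

lemma approx_subgradient_conditional:
 assumes x1: "x1 \<in> Linf M" and d: "0 < \<delta>" and sg: "subgradient (scal (\<lambda>_. 0)) x1 \<delta> y"
 shows "integrable M y" "AE w in M. y w \<le> 0" "AE w in M. cexp M F y w = -1"
  "\<exists>B\<in>sets F. 1 - \<delta> \<le> prob B \<and> (\<forall>x\<in>Linf M. AE w in M. w \<in> B \<longrightarrow>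
    cexp M F (\<lambda>v. (x v - x1 v) * y v) w \<le> \<rho> x w - \<rho> x1 w + 1)" proof -
 let ?r = "scal (\<lambda>_. 0)"
 have z0c: "(\<lambda>_. 0::real) \<in> Xinf" by (rule Xinf_const)
 have mon: "monetary ?r" by (rule scal_monetary[OF z0c])
 show yi: "integrable M y" using sg by (simp add: subgradient_def)
 have sg': "?r x1 - \<delta> + (\<integral>w. (x w - x1 w) * y w \<partial>M) \<le> ?r x" if "x \<in> Linf M" for x
  using sg that by (simp add: subgradient_def)
 have ym: "y \<in> L0 M" using yi by simp
 have yX: "y \<in> X1" by (rule integrable_in_X1[OF yi])
 have x1c: "x1 \<in> Xinf" by (rule Linf_in_Xinf[OF x1])
 have int: "integrable M (\<lambda>w. \<rho> x w - \<rho> (\<lambda>_. 0) w)" if "x \<in> Linf M" for x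
  using scal_integrable[OF z0c that] by simp
 have diff: "integrable M (\<lambda>w. \<rho> x w - \<rho> x1 w)" "(\<integral>w. \<rho> x w - \<rho> x1 w \<partial>M) = ?r x - ?r x1" if x: "x \<in> Linf M" for x
  using Bochner_Integration.integrable_diff[OF int[OF x] int[OF x1]]
   Bochner_Integration.integral_diff[OF int[OF x] int[OF x1]] by (simp_all add: scal_def)
 show "AE w in M. y w \<le> 0" proof -
  define B where "B = {w \<in> space M. 0 < y w}"
  have B: "B \<in> sets M" unfolding B_def using ym by measurable
  have iL: "indicator B \<in> Linf M" by (rule Linf_ind[OF B])
  have i: "integrable M (\<lambda>w. indicator B w * y w)" by (rule integrable_Linf_L1[OF iL yi])
  have "real k * (\<integral>w. indicator B w * y w \<partial>M) \<le> \<delta>" for k proof -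
   have kL: "(\<lambda>w. real k * indicator B w) \<in> Linf M" by (rule Linf_cmult[OF iL])
   have xL: "(\<lambda>w. x1 w + real k * indicator B w) \<in> Linf M" by (rule Linf_add[OF x1 kL])
   have "?r (\<lambda>w. x1 w + real k * indicator B w) \<le> ?r x1"
    by (rule monetary_mono[OF mon x1 xL]) (simp add: indicator_def)
   then show ?thesis using sg'[OF xL] by (simp add: mult.assoc)
  qed
  then have "(\<integral>w. indicator B w * y w \<partial>M) \<le> 0" by (meson not_le reals_Archimedean3)
  moreover have nn: "0 \<le> indicator B w * y w" for w by (auto simp: B_def indicator_def)
  ultimately have "(\<integral>w. indicator B w * y w \<partial>M) = 0" by (intro antisym integral_nonneg_AE) auto
  then have "AE w in M. indicator B w * y w = 0" using integral_nonneg_eq_0_iff_AE[OF i] nn by simp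
  then show ?thesis using AE_space by eventually_elim (auto simp: B_def indicator_def split: if_splits)
 qed
 show "AE w in M. cexp M F y w = -1" proof -
  have eqA: "(\<integral>w. indicator A w * (cexp M F y w + 1) \<partial>M) = 0" if A: "A \<in> sets F" for A proof -
   have AM: "A \<in> sets M" by (rule sets_M[OF A])
   have iL: "indicator A \<in> Linf M" by (rule Linf_ind[OF AM])
   have i: "integrable M (\<lambda>w. indicator A w * y w)" by (rule integrable_Linf_L1[OF iL yi])
   define I where "I = (\<integral>w. indicator A w * y w \<partial>M)"
   have key: "c * (I + prob A) \<le> \<delta>" for c proof -
    have cL: "(\<lambda>w. c * indicator A w) \<in> Linf M" by (rule Linf_cmult[OF iL])
    have xL: "(\<lambda>w. x1 w + c * indicator A w) \<in> Linf M" by (rule Linf_add[OF x1 cL])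
    have cF: "(\<lambda>w. c * indicator A w) \<in> L0 F" using A by measurable
    have ae: "AE w in M. \<rho> (\<lambda>w. x1 w + c * indicator A w) w - \<rho> x1 w = - (c * indicator A w)"
     using rho_cash[OF x1c cF] by eventually_elim simp
    have "?r (\<lambda>w. x1 w + c * indicator A w) - ?r x1 = (\<integral>w. - (c * indicator A w) \<partial>M)"
     unfolding diff(2)[OF xL, symmetric] using diff(1)[OF xL] AM by (intro integral_cong_AE[OF _ _ ae]) auto
    also have "\<dots> = - (c * prob A)" using AM by simp
    finally show ?thesis using sg'[OF xL] by (simp add: I_def mult.assoc algebra_simps)
   qed
   have "I + prob A = 0" proof (rule ccontr)
    assume ne: "I + prob A \<noteq> 0"
    show False using key[of "(\<delta> + 1) / (I + prob A)"] ne by simp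
   qed
   have i1: "integrable M (\<lambda>w. indicator A w * cexp M F y w)"
    by (rule integrable_Linf_L1[OF iL cexp_integral(1)[OF yi]])
   have i2: "integrable M (indicator A :: 'w \<Rightarrow> real)"
    using AM by (simp add: integrable_indicator_iff emeasure_eq_measure)
   have "(\<integral>w. indicator A w * (cexp M F y w + 1) \<partial>M) = (\<integral>w. indicator A w * cexp M F y w + indicator A w \<partial>M)"
    by (simp add: distrib_left)
   also have "\<dots> = I + prob A"
    unfolding I_def using Bochner_Integration.integral_add[OF i1 i2] integral_indicator_cexp[OF yi A] AM by simp
   finally show ?thesis using \<open>I + prob A = 0\<close> by simp
  qed
  have cF: "(\<lambda>w. cexp M F y w + 1) \<in> L0 F" using cexp_L0[OF yX] by measurable
  have ci: "integrable M (\<lambda>w. cexp M F y w + 1)" using cexp_integral(1)[OF yi] by simp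
  have "AE w in M. 0 \<le> cexp M F y w + 1" by (rule AE_nonneg_from_integrals[OF cF ci]) (simp add: eqA)
  moreover have "AE w in M. 0 \<le> - (cexp M F y w + 1)" proof (rule AE_nonneg_from_integrals)
   show "(\<lambda>w. - (cexp M F y w + 1)) \<in> L0 F" using cF by measurable
   show "integrable M (\<lambda>w. - (cexp M F y w + 1))" by (rule Bochner_Integration.integrable_minus[OF ci])
   fix A assume A: "A \<in> sets F"
   have "(\<integral>w. indicator A w * - (cexp M F y w + 1) \<partial>M) = - (\<integral>w. indicator A w * (cexp M F y w + 1) \<partial>M)"
    by (simp only: mult_minus_right Bochner_Integration.integral_minus)
   then show "0 \<le> (\<integral>w. indicator A w * - (cexp M F y w + 1) \<partial>M)" using eqA[OF A] by simp
  qed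
  ultimately show ?thesis by eventually_elim simp
 qed
 define D where "D x w = cexp M F (\<lambda>v. (x v - x1 v) * y v) w - (\<rho> x w - \<rho> x1 w)" for x w
 have dX: "(\<lambda>v. (x v - x1 v) * y v) \<in> X1" if "x \<in> Linf M" for x
  by (rule X1_mult[OF Linf_in_Xinf[OF Linf_diff[OF that x1]] yX])
 have DF: "D x \<in> L0 F" if x: "x \<in> Linf M" for x
  unfolding D_def using cexp_L0[OF dX[OF x]] rho_L0[OF Linf_in_Xinf[OF x]] rho_L0[OF x1c] by measurable
 have DI: "integrable M (D x)" "(\<integral>w. D x w \<partial>M) \<le> \<delta>" if x: "x \<in> Linf M" for x proof -
  have i: "integrable M (\<lambda>v. (x v - x1 v) * y v)" by (rule integrable_Linf_L1[OF Linf_diff[OF x x1] yi])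
  show "integrable M (D x)" unfolding D_def[abs_def]
   by (rule Bochner_Integration.integrable_diff[OF cexp_integral(1)[OF i] diff(1)[OF x]])
  show "(\<integral>w. D x w \<partial>M) \<le> \<delta>" unfolding D_def
   using Bochner_Integration.integral_diff[OF cexp_integral(1)[OF i] diff(1)[OF x]] cexp_integral(2)[OF i] diff(2)[OF x] sg'[OF x]
   by simp
 qed
 have Dloc: "AE w\<in>A in M. D x w = D x' w"
  if x: "x \<in> Linf M" and x': "x' \<in> Linf M" and A: "A \<in> sets F" and eq: "\<And>w. w \<in> A \<Longrightarrow> x w = x' w" for x x' A
 proof -
  have "AE w\<in>A in M. cexp M F (\<lambda>v. (x v - x1 v) * y v) w = cexp M F (\<lambda>v. (x' v - x1 v) * y v) w"
   by (rule cexp_local[OF dX[OF x] dX[OF x'] A]) (simp add: eq)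
  moreover have "AE w\<in>A in M. \<rho> x w = \<rho> x' w"
   by (rule rho_local[OF Linf_in_Xinf[OF x] Linf_in_Xinf[OF x'] A]) (simp add: eq)
  ultimately show ?thesis by eventually_elim (simp add: D_def)
 qed
 define \<C> where "\<C> = (\<lambda>x. {w \<in> space F. 1 < D x w}) ` Linf M"
 have "\<C> \<subseteq> sets F" proof
  fix C assume "C \<in> \<C>"
  then obtain x where x: "x \<in> Linf M" "C = {w \<in> space F. 1 < D x w}" by (auto simp: \<C>_def)
  show "C \<in> sets F" unfolding x(2) using DF[OF x(1)] by measurable
 qed
 moreover have "\<C> \<noteq> {}" using x1 by (auto simp: \<C>_def)
 ultimately obtain E where E: "\<And>n::nat. E n \<in> \<C>" and Eex: "\<And>C. C \<in> \<C> \<Longrightarrow> AE w\<in>C in M. w \<in> (\<Union>n. E n)"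
  using exhaustion[of \<C>] by blast
 have EF: "E n \<in> sets F" for n using E \<open>\<C> \<subseteq> sets F\<close> by blast
 \<comment> \<open>patching finitely many test functions gives one whose gain is at least one on all of their sets\<close>
 have patch: "\<exists>x\<in>Linf M. (AE w in M. 0 \<le> D x w) \<and> (AE w in M. w \<in> (\<Union>i<n. E i) \<longrightarrow> 1 \<le> D x w)" for n
 proof (induction n)
  case 0
  have "AE w in M. cexp M F (\<lambda>_. 0) w = 0" by (rule cexp_F) simp
  then have "AE w in M. 0 \<le> D x1 w" by eventually_elim (simp add: D_def)
  then show ?case using x1 by (intro bexI[of _ x1]) auto
 next
  case (Suc n)
  then obtain x where x: "x \<in> Linf M" "AE w in M. 0 \<le> D x w" "AE w in M. w \<in> (\<Union>i<n. E i) \<longrightarrow> 1 \<le> D x w" by blast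
  obtain u where u: "u \<in> Linf M" "E n = {w \<in> space F. 1 < D u w}" using E[of n] by (auto simp: \<C>_def)
  define t where "t w = indicator (E n) w * u w + indicator (space F - E n) w * x w" for w
  have cE: "space F - E n \<in> sets F" using EF by auto
  have tL: "t \<in> Linf M" unfolding t_def[abs_def] by (intro Linf_add Linf_mult Linf_ind sets_M EF cE u x)
  have 1: "AE w\<in>E n in M. D t w = D u w" by (rule Dloc[OF tL u(1) EF]) (simp add: t_def)
  have 2: "AE w in M. w \<in> space F - E n \<longrightarrow> D t w = D x w" by (rule Dloc[OF tL x(1) cE]) (simp add: t_def)
  have "AE w in M. 0 \<le> D t w" using 1 2 x(2) AE_space by eventually_elim (auto simp: u(2) space_F)
  moreover have "AE w in M. w \<in> (\<Union>i<Suc n. E i) \<longrightarrow> 1 \<le> D t w" using 1 2 x(3) AE_space proof eventually_elim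
   case (elim w)
   show ?case proof
    assume w: "w \<in> (\<Union>i<Suc n. E i)"
    show "1 \<le> D t w" proof (cases "w \<in> E n")
     case True then show ?thesis using elim(1) u(2) by auto
    next
     case False
     then have "w \<in> (\<Union>i<n. E i)" using w by (auto simp: less_Suc_eq)
     then show ?thesis using elim False by (simp add: space_F)
    qed
   qed
  qed
  ultimately show ?case using tL by blast
 qed
 have small: "prob (\<Union>i<n. E i) \<le> \<delta>" for n proof -
  obtain x where x: "x \<in> Linf M" "AE w in M. 0 \<le> D x w" "AE w in M. w \<in> (\<Union>i<n. E i) \<longrightarrow> 1 \<le> D x w" using patch by blast
  have UM: "(\<Union>i<n. E i) \<in> sets M" using sets_M[OF EF] by auto
  have "prob (\<Union>i<n. E i) = (\<integral>w. indicator (\<Union>i<n. E i) w \<partial>M)" using UM by simp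
  also have "\<dots> \<le> (\<integral>w. D x w \<partial>M)" proof (rule integral_mono_AE)
   show "integrable M (indicator (\<Union>i<n. E i) :: 'w \<Rightarrow> real)" using UM by (simp add: integrable_indicator_iff emeasure_eq_measure)
   show "integrable M (D x)" by (rule DI(1)[OF x(1)])
   show "AE w in M. indicator (\<Union>i<n. E i) w \<le> D x w" using x(2,3) by eventually_elim (simp split: split_indicator)
  qed
  also have "\<dots> \<le> \<delta>" by (rule DI(2)[OF x(1)])
  finally show ?thesis .
 qed
 have "incseq (\<lambda>n. \<Union>i<n. E i)" unfolding incseq_def by (intro allI impI UN_mono) auto
 then have "(\<lambda>n. prob (\<Union>i<n. E i)) \<longlonglongrightarrow> prob (\<Union>n. \<Union>i<n. E i)"
  by (intro finite_Lim_measure_incseq) (use sets_M[OF EF] in auto)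
 then have le: "prob (\<Union>n. \<Union>i<n. E i) \<le> \<delta>" by (rule LIMSEQ_le_const2) (use small in auto)
 have UE: "(\<Union>n. \<Union>i<n. E i) = (\<Union>n. E n)" by auto
 define B where "B = space F - (\<Union>n. E n)"
 have BF: "B \<in> sets F" unfolding B_def using EF by auto
 have "prob B = 1 - prob (\<Union>n. E n)" unfolding B_def space_F by (rule prob_compl) (use sets_M[OF EF] in auto)
 then have "1 - \<delta> \<le> prob B" using le UE by simp
 moreover have "AE w\<in>B in M. cexp M F (\<lambda>v. (x v - x1 v) * y v) w \<le> \<rho> x w - \<rho> x1 w + 1" if x: "x \<in> Linf M" for x
 proof -
  have "{w \<in> space F. 1 < D x w} \<in> \<C>" using x by (auto simp: \<C>_def)
  from Eex[OF this] show ?thesis by eventually_elim (auto simp: B_def D_def)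
 qed
 ultimately show "\<exists>B\<in>sets F. 1 - \<delta> \<le> prob B \<and> (\<forall>x\<in>Linf M. AE w in M. w \<in> B \<longrightarrow>
    cexp M F (\<lambda>v. (x v - x1 v) * y v) w \<le> \<rho> x w - \<rho> x1 w + 1)" using BF by blast
qed

text \<open>An approximate subgradient at \<open>x0 - z n\<close> lies, off a set of small probability, in a sublevel
  set whose level does not depend on \<open>n\<close>; there Dini's theorem makes its expectation against \<open>z n\<close>
  small, so \<open>r (x0 - z n)\<close> is close to \<open>r x0\<close>.\<close>

lemma compact_imp_lebesgue:
 assumes f: "fatou_property M \<rho>" and K: "\<And>c. c \<in> L0 F \<Longrightarrow> cond_weakly_compact M F (sublevel M F \<rho> c)"
 shows "lebesgue_property M \<rho>" proof (rule upper_lebesgue_scal_imp_lebesgue)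
 let ?r = "scal (\<lambda>_. 0)"
 have z0c: "(\<lambda>_. 0::real) \<in> Xinf" by (rule Xinf_const)
 have mon: "monetary ?r" by (rule scal_monetary[OF z0c])
 show "upper_lebesgue ?r" unfolding upper_lebesgue_def proof (intro allI impI)
  fix x x0 and e :: real assume bc: "bounded_as_conv M x x0" and e: "0 < e"
  have x0: "x0 \<in> Linf M" and xL: "\<And>n. x n \<in> Linf M" using bc by (auto simp: bounded_as_conv_def)
  obtain z C where zL: "\<And>n. z n \<in> Linf M" and z0: "\<And>n w. 0 \<le> z n w" and zC: "\<And>n w. z n w \<le> C"
   and anti: "\<And>m n w. m \<le> n \<Longrightarrow> z n w \<le> z m w" and zlim: "AE w in M. (\<lambda>n. z n w) \<longlonglongrightarrow> 0"
   and xz: "\<And>n. AE w in M. \<bar>x n w - x0 w\<bar> \<le> z n w" using bounded_as_conv_tail[OF bc] by blast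
  have C0: "0 \<le> C" using z0[of 0] zC[of 0] by (meson order_trans)
  obtain D where D: "AE w in M. \<bar>x0 w\<bar> \<le> D" using LinfE[OF x0] by blast
  define \<delta> where "\<delta> = e / (2 * (2 + 2 * C))"
  have d: "0 < \<delta>" using e C0 by (simp add: \<delta>_def)
  have de: "\<delta> + (\<delta> + C * (2 * \<delta>)) < e" proof -
   have "\<delta> * (2 + 2 * C) = e / 2" using C0 by (simp add: \<delta>_def field_simps)
   then show ?thesis using e by (simp add: algebra_simps)
  qed
  define c where "c w = 2 * (D + C) + 1 - \<rho> (\<lambda>_. 0) w" for w
  have cF: "c \<in> L0 F" unfolding c_def using rho_L0[OF z0c] by measurable
  define u where "u n w = z n w / \<delta>" for n w
  have uL: "u n \<in> Linf M" for n unfolding u_def using Linf_cmult[OF zL[of n], of "1 / \<delta>"] by simp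
  have ulim: "AE w in M. (\<lambda>n. u n w) \<longlonglongrightarrow> 0" using zlim proof eventually_elim
   case (elim w) show ?case unfolding u_def using tendsto_divide[OF elim tendsto_const, of \<delta>] d by simp
  qed
  obtain m where m: "m \<in> rnat"
   and unif: "\<And>y b n. y \<in> X1 \<Longrightarrow> b \<in> sets F \<Longrightarrow> cobj M y b \<in> sublevel M F \<rho> c \<Longrightarrow> AE w in M. y w \<le> 0 \<Longrightarrow>
    AE w in M. w \<in> b \<longrightarrow> m w \<le> n \<longrightarrow> \<bar>cpair (u n) y w\<bar> < 1" proof -
   have u0: "0 \<le> u n w" and uC: "u n w \<le> C / \<delta>" for n w using z0 zC d by (simp_all add: u_def divide_right_mono)
   have ua: "u n w \<le> u m w" if "m \<le> n" for m n w using anti[OF that] d by (simp add: u_def divide_right_mono)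
   show ?thesis proof (rule compact_uniform[where C = "C / \<delta>" and z = u, OF K[OF cF] uL])
    show "0 \<le> u n w" "u n w \<le> C / \<delta>" for n w by (rule u0, rule uC)
    show "u n w \<le> u m w" if "m \<le> n" for m n w by (rule ua[OF that])
    show "AE w in M. (\<lambda>n. u n w) \<longlonglongrightarrow> 0" by (rule ulim)
    fix m' assume "m' \<in> rnat"
     and "\<And>y b n. y \<in> X1 \<Longrightarrow> b \<in> sets F \<Longrightarrow> cobj M y b \<in> sublevel M F \<rho> c \<Longrightarrow> AE w in M. y w \<le> 0 \<Longrightarrow>
      AE w in M. w \<in> b \<longrightarrow> m' w \<le> n \<longrightarrow> \<bar>cpair (u n) y w\<bar> < 1"
    then show thesis by (rule that)
   qed
  qed
  have mM: "m \<in> measurable M (count_space UNIV)" by (rule measurable_F_M[OF m])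
  have late: "\<exists>n. prob {w \<in> space M. n < m w} \<le> \<delta>" proof -
   have "(\<lambda>n. prob {w \<in> space M. n < m w}) \<longlonglongrightarrow> prob (\<Inter>n. {w \<in> space M. n < m w})"
    by (rule finite_Lim_measure_decseq) (use mM in \<open>auto simp: decseq_def\<close>)
   moreover have "(\<Inter>n. {w \<in> space M. n < m w}) = {}" by auto
   ultimately have "(\<lambda>n. prob {w \<in> space M. n < m w}) \<longlonglongrightarrow> 0" by simp
   from order_tendstoD(2)[OF this d] show ?thesis by (auto simp: eventually_sequentially intro: less_imp_le)
  qed
  then obtain n where n: "prob {w \<in> space M. n < m w} \<le> \<delta>" by blast
  define x1 where "x1 w = x0 w - z n w" for w
  have x1: "x1 \<in> Linf M" unfolding x1_def by (rule Linf_diff[OF x0 zL])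
  have x1b: "AE w in M. \<bar>x1 w\<bar> \<le> D + C" using D proof eventually_elim
   case (elim w) then show ?case using z0[of n w] zC[of n w] by (simp add: x1_def abs_le_iff)
  qed
  obtain y where sg: "subgradient ?r x1 \<delta> y"
   using lower_fatou_imp_approx_subgradient[OF mon fatou_imp_lower_fatou_scal[OF f] x1 d] by blast
  note y = approx_subgradient_conditional[OF x1 d sg]
  obtain B where B: "B \<in> sets F" "1 - \<delta> \<le> prob B"
   and Bx: "\<And>x. x \<in> Linf M \<Longrightarrow> AE w\<in>B in M. cexp M F (\<lambda>v. (x v - x1 v) * y v) w \<le> \<rho> x w - \<rho> x1 w + 1"
   using y(4) by blast
  have yX: "y \<in> X1" by (rule integrable_in_X1[OF y(1)])
  note Lc = Linf_in_Xinf
  have bound: "AE w in M. \<bar>cpair t y w\<bar> \<le> E" if t: "t \<in> Linf M" and tb: "AE w in M. \<bar>t w\<bar> \<le> E" for t E proof -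
   have a: "AE w\<in>space F in M. E * y w \<le> t w * y w" using tb y(2)
    by eventually_elim (auto intro: mult_right_mono_neg)
   have b: "AE w\<in>space F in M. t w * y w \<le> (- E) * y w" using tb y(2) proof eventually_elim
    case (elim w)
    have "t w * y w \<le> (- E) * y w" using elim by (intro mult_right_mono_neg) auto
    then show ?case by blast
   qed
   from cexp_mono_on[OF X1_mult[OF Xinf_const yX] X1_mult[OF Lc[OF t] yX] sets.top a]
    cexp_mono_on[OF X1_mult[OF Lc[OF t] yX] X1_mult[OF Xinf_const yX] sets.top b]
    cexp_mult[OF borel_measurable_const yX, of E] cexp_mult[OF borel_measurable_const yX, of "- E"] y(3) AE_space
   show ?thesis by eventually_elim (simp add: space_F abs_le_iff)
  qed
  have "\<forall>x\<in>Xinf. AE w\<in>B in M. cpair x y w \<le> \<rho> x w + c w" proof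
   fix x' assume x': "x' \<in> Xinf"
   have "AE w\<in>B in M. cpair x' y w \<le> \<rho> (\<lambda>v. 0 + x' v) w + c w"
   proof (rule subgradient_extend[OF z0c yX B(1) cF _ x'])
    fix t assume t: "t \<in> Linf M"
    have lip: "AE w in M. - (D + C) \<le> \<rho> x1 w - \<rho> (\<lambda>_. 0) w"
     using scal_bound[OF z0c x1 x1b] by eventually_elim (simp add: abs_le_iff)
    have "AE w in M. cexp M F (\<lambda>v. t v * y v - x1 v * y v) w = cpair t y w - cpair x1 y w"
     by (rule cexp_diff[OF X1_mult[OF Lc[OF t] yX] X1_mult[OF Lc[OF x1] yX]])
    then have "AE w in M. cexp M F (\<lambda>v. (t v - x1 v) * y v) w = cpair t y w - cpair x1 y w"
     by (simp add: left_diff_distrib)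
    with Bx[OF t] lip bound[OF x1 x1b]
    show "AE w\<in>B in M. cpair t y w \<le> \<rho> (\<lambda>v. 0 + t v) w + c w" by eventually_elim (auto simp: c_def abs_le_iff)
   qed
   then show "AE w\<in>B in M. cpair x' y w \<le> \<rho> x' w + c w" by simp
  qed
  then have "AE w\<in>B in M. conj_fun M F (Xinf) \<rho> y w \<le> ereal (c w)"
   using conj_fun_le_iff[OF subset_refl _ yX B(1) cF] z0c by blast
  then have "cobj M y B \<in> sublevel M F \<rho> c" using yX B(1) by (auto simp: sublevel_def)
  from unif[OF yX B(1) this y(2), of n]
  have near: "AE w in M. w \<in> B \<longrightarrow> m w \<le> n \<longrightarrow> \<bar>cpair (u n) y w\<bar> < 1" .
  have zy: "AE w in M. w \<in> B \<longrightarrow> m w \<le> n \<longrightarrow> - cpair (z n) y w \<le> \<delta>" proof -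
   have "(\<lambda>v. \<delta> * (u n v * y v)) = (\<lambda>v. z n v * y v)" using d by (auto simp: u_def)
   then have "AE w in M. cpair (z n) y w = \<delta> * cpair (u n) y w"
    using cexp_mult[OF borel_measurable_const X1_mult[OF Lc[OF uL[of n]] yX], of \<delta>] by simp
   then show ?thesis using near proof eventually_elim
    case (elim w)
    show ?case proof (intro impI)
     assume "w \<in> B" "m w \<le> n"
     then have "- cpair (u n) y w \<le> 1" using elim(2) by (simp add: abs_less_iff)
     then have "\<delta> * - cpair (u n) y w \<le> \<delta> * 1" using d by (intro mult_left_mono) auto
     then show "- cpair (z n) y w \<le> \<delta>" using elim(1) by simp
    qed
   qed
  qed
  have zyC: "AE w in M. \<bar>cpair (z n) y w\<bar> \<le> C" by (rule bound[OF zL]) (simp add: z0 zC)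
  define Q where "Q = (space M - B) \<union> {w \<in> space M. n < m w}"
  have BM: "B \<in> sets M" by (rule sets_M[OF B(1)])
  have mS: "{w \<in> space M. n < m w} \<in> sets M" using mM by measurable
  have QM: "Q \<in> sets M" unfolding Q_def using BM mS by auto
  have "prob Q \<le> prob (space M - B) + prob {w \<in> space M. n < m w}"
   unfolding Q_def by (rule measure_Un_le) (use BM mS in auto)
  also have "prob (space M - B) = 1 - prob B" by (rule prob_compl[OF BM])
  finally have pQ: "prob Q \<le> 2 * \<delta>" using B(2) n by simp
  have zyi: "integrable M (\<lambda>w. z n w * y w)" by (rule integrable_Linf_L1[OF zL y(1)])
  have Qi: "integrable M (indicator Q :: 'w \<Rightarrow> real)" using QM by (simp add: integrable_indicator_iff emeasure_eq_measure)
  have "- (\<integral>w. z n w * y w \<partial>M) = (\<integral>w. - cpair (z n) y w \<partial>M)" using cexp_integral(2)[OF zyi] by simp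
  also have "\<dots> \<le> (\<integral>w. \<delta> + C * indicator Q w \<partial>M)" proof (rule integral_mono_AE)
   show "integrable M (\<lambda>w. - cpair (z n) y w)" using cexp_integral(1)[OF zyi] by simp
   show "integrable M (\<lambda>w. \<delta> + C * indicator Q w)" using Qi by simp
   show "AE w in M. - cpair (z n) y w \<le> \<delta> + C * indicator Q w" using zy zyC AE_space proof eventually_elim
    case (elim w)
    show ?case proof (cases "w \<in> Q")
     case True then show ?thesis using elim(2) d by (simp add: abs_le_iff)
    next
     case False then show ?thesis using elim(1,3) by (simp add: Q_def)
    qed
   qed
  qed
  also have "\<dots> = \<delta> + C * prob Q" using Qi QM by (simp add: prob_space)
  also have "\<dots> \<le> \<delta> + C * (2 * \<delta>)" using pQ C0 by (simp add: mult_left_mono)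
  finally have gap: "- (\<integral>w. z n w * y w \<partial>M) \<le> \<delta> + C * (2 * \<delta>)" .
  have "?r x1 - \<delta> + (\<integral>w. (x0 w - x1 w) * y w \<partial>M) \<le> ?r x0" using sg x0 by (simp add: subgradient_def)
  then have main: "?r x1 < ?r x0 + e" using gap de by (simp add: x1_def)
  have "?r (x i) < ?r x0 + e" if "n \<le> i" for i proof -
   have "?r (x i) \<le> ?r x1" proof (rule monetary_mono[OF mon x1 xL])
    show "AE w in M. x1 w \<le> x i w" using xz[of i] proof eventually_elim
     case (elim w) then show ?case using anti[OF that, of w] by (simp add: x1_def abs_le_iff)
    qed
   qed
   then show ?thesis using main by simp
  qed
  then show "\<forall>\<^sub>F n in sequentially. ?r (x n) < ?r x0 + e" by (auto simp: eventually_sequentially)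
 qed
qed

end

section \<open>The Lebesgue property makes sublevel sets compact\<close>

text \<open>Zorn's lemma; a set with property \<open>P\<close> that meets every member can be added to the filter
  base.\<close>

lemma maximal_filter_base:
 fixes P :: "'a set \<Rightarrow> bool"
 assumes Pint: "\<And>S T. P S \<Longrightarrow> P T \<Longrightarrow> P (S \<inter> T)" and FP: "\<And>S. S \<in> \<F> \<Longrightarrow> P S" and Fne: "\<F> \<noteq> {}"
  and Fem: "{} \<notin> \<F>" and Fint: "\<And>S T. S \<in> \<F> \<Longrightarrow> T \<in> \<F> \<Longrightarrow> S \<inter> T \<in> \<F>"
 shows "\<exists>\<G>. \<F> \<subseteq> \<G> \<and> (\<forall>S\<in>\<G>. P S) \<and> {} \<notin> \<G> \<and> (\<forall>S\<in>\<G>. \<forall>T\<in>\<G>. S \<inter> T \<in> \<G>) \<and>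
  (\<forall>T. P T \<longrightarrow> (\<forall>S\<in>\<G>. S \<inter> T \<noteq> {}) \<longrightarrow> T \<in> \<G>)" proof -
 define \<A> where "\<A> = {\<G>. \<F> \<subseteq> \<G> \<and> (\<forall>S\<in>\<G>. P S) \<and> {} \<notin> \<G> \<and> (\<forall>S\<in>\<G>. \<forall>T\<in>\<G>. S \<inter> T \<in> \<G>)}"
 have "\<F> \<in> \<A>" using FP Fem Fint by (simp add: \<A>_def)
 then have ne: "\<A> \<noteq> {}" by blast
 have "\<exists>\<G>\<in>\<A>. \<forall>X\<in>\<A>. \<G> \<subseteq> X \<longrightarrow> X = \<G>" proof (rule subset_Zorn_nonempty[OF ne])
  fix \<C> assume C: "\<C> \<noteq> {}" "subset.chain \<A> \<C>"
  have CA: "\<C> \<subseteq> \<A>" and tot: "\<And>X Y. X \<in> \<C> \<Longrightarrow> Y \<in> \<C> \<Longrightarrow> X \<subseteq> Y \<or> Y \<subseteq> X"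
   using C(2) by (auto simp: subset_chain_def)
  have "S \<inter> T \<in> \<Union>\<C>" if ST: "S \<in> \<Union>\<C>" "T \<in> \<Union>\<C>" for S T proof -
   obtain X Y where X: "X \<in> \<C>" "S \<in> X" and Y: "Y \<in> \<C>" "T \<in> Y" using ST by blast
   have "X \<subseteq> Y \<or> Y \<subseteq> X" by (rule tot[OF X(1) Y(1)])
   then obtain Z where Z: "Z \<in> \<C>" "S \<in> Z" "T \<in> Z" using X Y by blast
   then have "S \<inter> T \<in> Z" using CA by (auto simp: \<A>_def)
   then show ?thesis using Z(1) by blast
  qed
  moreover have "\<F> \<subseteq> \<Union>\<C>" using C(1) CA by (force simp: \<A>_def)
  moreover have "\<forall>S\<in>\<Union>\<C>. P S" "{} \<notin> \<Union>\<C>" using CA by (auto simp: \<A>_def)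
  ultimately show "\<Union>\<C> \<in> \<A>" by (simp add: \<A>_def)
 qed
 then obtain \<G> where G: "\<G> \<in> \<A>" and max: "\<And>X. X \<in> \<A> \<Longrightarrow> \<G> \<subseteq> X \<Longrightarrow> X = \<G>" by blast
 have g: "\<F> \<subseteq> \<G>" "\<forall>S\<in>\<G>. P S" "{} \<notin> \<G>" "\<forall>S\<in>\<G>. \<forall>T\<in>\<G>. S \<inter> T \<in> \<G>" using G by (simp_all add: \<A>_def)
 have "T \<in> \<G>" if T: "P T" and meet: "\<forall>S\<in>\<G>. S \<inter> T \<noteq> {}" for T proof -
  define X where "X = \<G> \<union> insert T ((\<lambda>S. S \<inter> T) ` \<G>)"
  obtain S0 where S0: "S0 \<in> \<G>" using Fne g(1) by blast
  have "X \<in> \<A>" unfolding \<A>_def proof (intro CollectI conjI ballI)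
   show "\<F> \<subseteq> X" using g(1) by (auto simp: X_def)
   show "P S" if "S \<in> X" for S using that g(2) T Pint by (auto simp: X_def)
   have "T \<noteq> {}" using meet S0 by blast
   then show "{} \<notin> X" using g(3) meet by (auto simp: X_def)
   show "S \<inter> S' \<in> X" if S: "S \<in> X" "S' \<in> X" for S S' proof -
    have aux: "R \<inter> (R' \<inter> T) = (R \<inter> R') \<inter> T" "(R \<inter> T) \<inter> R' = (R \<inter> R') \<inter> T" "T \<inter> R = R \<inter> T"
     "(R \<inter> T) \<inter> (R' \<inter> T) = (R \<inter> R') \<inter> T" "T \<inter> (R \<inter> T) = R \<inter> T" "(R \<inter> T) \<inter> T = R \<inter> T" for R R' by blast+
    have mem: "R \<inter> T \<in> X" if "R \<in> \<G>" for R using that by (simp add: X_def)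
    show ?thesis using S(1)[unfolded X_def] S(2)[unfolded X_def] proof (elim UnE insertE imageE)
     assume "S \<in> \<G>" "S' \<in> \<G>" then show ?thesis using g(4) by (simp add: X_def)
    next
     assume "S \<in> \<G>" "S' = T" then show ?thesis using mem by simp
    next
     fix R assume "S \<in> \<G>" "S' = R \<inter> T" "R \<in> \<G>" then show ?thesis using mem g(4) by (simp add: aux(1))
    next
     assume "S = T" "S' \<in> \<G>" then show ?thesis using mem by (simp add: aux(3))
    next
     assume "S = T" "S' = T" then show ?thesis by (simp add: X_def)
    next
     fix R assume "S = T" "S' = R \<inter> T" "R \<in> \<G>" then show ?thesis using mem by (simp add: aux(5))
    next
     fix R assume "S = R \<inter> T" "R \<in> \<G>" "S' \<in> \<G>" then show ?thesis using mem g(4) by (simp add: aux(2))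
    next
     fix R assume "S = R \<inter> T" "R \<in> \<G>" "S' = T" then show ?thesis using mem by (simp add: aux(6))
    next
     fix R R' assume "S = R \<inter> T" "R \<in> \<G>" "S' = R' \<inter> T" "R' \<in> \<G>"
     then show ?thesis using mem g(4) by (simp add: aux(4))
    qed
   qed
  qed
  from max[OF this] have "X = \<G>" by (auto simp: X_def)
  then show ?thesis by (auto simp: X_def)
 qed
 then show ?thesis using g by (intro exI[of _ \<G>]) simp
qed

context cond_space
begin

lemma AE_nonpos_from_epsilon:
 assumes le: "\<And>\<delta>. 0 < \<delta> \<Longrightarrow> AE w\<in>a in M. t w \<le> (k :: real) * \<delta>"
 shows "AE w\<in>a in M. t w \<le> 0" proof -
 have "AE w\<in>a in M. t w \<le> k * inverse (real (Suc n))" for n by (rule le) simp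
 then have "AE w in M. \<forall>n. w \<in> a \<longrightarrow> t w \<le> k * inverse (real (Suc n))" by (subst AE_all_countable) blast
 then show ?thesis proof eventually_elim
  case (elim w)
  show ?case proof
   assume w: "w \<in> a"
   have "(\<lambda>n. k * inverse (real (Suc n))) \<longlonglongrightarrow> k * 0" by (intro tendsto_mult tendsto_const LIMSEQ_inverse_real_of_nat)
   then have "t w \<le> k * 0" by (rule LIMSEQ_le_const) (use elim w in blast)
   then show "t w \<le> 0" by simp
  qed
 qed
qed

definition cat_closed :: "('w \<Rightarrow> real) set \<Rightarrow> bool" where
 "cat_closed S \<longleftrightarrow> (\<forall>N s. N \<in> rnat \<longrightarrow> (\<forall>k. s k \<in> S) \<longrightarrow> cat N s \<in> S)"

text \<open>A maximal filter base among the sets that are closed under countable gluing plays the part of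
 an ultrafilter: ordinary ultrafilters need not contain the sets that decide a random dichotomy.\<close>

definition stable_ultrafilter :: "('w \<Rightarrow> real) set \<Rightarrow> ('w \<Rightarrow> real) set set \<Rightarrow> bool" where
 "stable_ultrafilter Y \<G> \<longleftrightarrow> \<G> \<noteq> {} \<and> (\<forall>S\<in>\<G>. cat_closed S \<and> S \<subseteq> Y) \<and> {} \<notin> \<G> \<and> (\<forall>S\<in>\<G>. \<forall>T\<in>\<G>. S \<inter> T \<in> \<G>) \<and>
  (\<forall>T. cat_closed T \<and> T \<subseteq> Y \<longrightarrow> (\<forall>S\<in>\<G>. S \<inter> T \<noteq> {}) \<longrightarrow> T \<in> \<G>)"

lemma cat_closedD: "cat_closed S \<Longrightarrow> N \<in> rnat \<Longrightarrow> (\<And>k. s k \<in> S) \<Longrightarrow> cat N s \<in> S"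
 by (simp add: cat_closed_def)

lemma stable_ultrafilterD:
 assumes G: "stable_ultrafilter Y \<G>"
 shows "\<G> \<noteq> {}" and "{} \<notin> \<G>" and "\<And>S. S \<in> \<G> \<Longrightarrow> cat_closed S" and "\<And>S. S \<in> \<G> \<Longrightarrow> S \<subseteq> Y"
  and "\<And>S T. S \<in> \<G> \<Longrightarrow> T \<in> \<G> \<Longrightarrow> S \<inter> T \<in> \<G>"
  and "\<And>T. cat_closed T \<Longrightarrow> T \<subseteq> Y \<Longrightarrow> (\<And>S. S \<in> \<G> \<Longrightarrow> S \<inter> T \<noteq> {}) \<Longrightarrow> T \<in> \<G>"
proof -
 note g = G[unfolded stable_ultrafilter_def]
 show "\<G> \<noteq> {}" by (rule conjunct1[OF g])
 note g = conjunct2[OF g]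
 show "\<And>S. S \<in> \<G> \<Longrightarrow> cat_closed S" "\<And>S. S \<in> \<G> \<Longrightarrow> S \<subseteq> Y" using conjunct1[OF g] by simp_all
 note g = conjunct2[OF g]
 show "{} \<notin> \<G>" by (rule conjunct1[OF g])
 note g = conjunct2[OF g]
 show "\<And>S T. S \<in> \<G> \<Longrightarrow> T \<in> \<G> \<Longrightarrow> S \<inter> T \<in> \<G>" using conjunct1[OF g] by simp
 note g = conjunct2[OF g]
 show "T \<in> \<G>" if "cat_closed T" "T \<subseteq> Y" "\<And>S. S \<in> \<G> \<Longrightarrow> S \<inter> T \<noteq> {}" for T
  using g[THEN spec, of T, THEN mp, OF conjI[OF that(1,2)], THEN mp] that(3) by simp
qed

lemma stable_ultrafilter_upward:
 assumes G: "stable_ultrafilter Y \<G>" and S: "S \<in> \<G>" "S \<subseteq> T" and T: "cat_closed T" "T \<subseteq> Y"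
 shows "T \<in> \<G>" proof (rule stable_ultrafilterD(6)[OF G T])
 fix R assume "R \<in> \<G>"
 then have "R \<inter> S \<in> \<G>" by (rule stable_ultrafilterD(5)[OF G _ S(1)])
 then have "R \<inter> S \<noteq> {}" using stable_ultrafilterD(2)[OF G] by metis
 then show "R \<inter> T \<noteq> {}" using S(2) by blast
qed

lemma stable_ultrafilter_top:
 assumes G: "stable_ultrafilter Y \<G>" and Y: "cat_closed Y"
 shows "Y \<in> \<G>" proof (rule stable_ultrafilterD(6)[OF G Y subset_refl])
 fix S assume S: "S \<in> \<G>"
 then have "S \<noteq> {}" using stable_ultrafilterD(2)[OF G] by metis
 then show "S \<inter> Y \<noteq> {}" using stable_ultrafilterD(4)[OF G S] by blast
qed

text \<open>The limit is the essential supremum of all \<open>h\<close> for which some member lies in \<open>{y. h \<le> E[x y|F]}\<close>.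
  No member exceeds it by \<open>\<epsilon>\<close> throughout on a set of positive measure, so gluing finds in every
  member an element that stays below, and maximality applies.\<close>

lemma stable_ultrafilter_limit:
 assumes G: "stable_ultrafilter Y \<G>" and Y: "Y \<subseteq> X1" "cat_closed Y" and a: "a \<in> sets F" and x: "x \<in> Linf M"
  and Yb: "\<And>y. y \<in> Y \<Longrightarrow> AE w\<in>a in M. \<bar>cpair x y w\<bar> \<le> C"
 shows "\<exists>\<phi>\<in>L0 F. \<forall>\<epsilon>\<in>L0pos M F. {y \<in> Y. AE w\<in>a in M. \<bar>cpair x y w - \<phi> w\<bar> \<le> \<epsilon> w} \<in> \<G>"
proof -
 note Gem = stable_ultrafilterD(2)[OF G] and Gcc = stable_ultrafilterD(3)[OF G] and GY = stable_ultrafilterD(4)[OF G]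
  and Gint = stable_ultrafilterD(5)[OF G] and Gmax = stable_ultrafilterD(6)[OF G]
  and Gup = stable_ultrafilter_upward[OF G]
 have YG: "Y \<in> \<G>" by (rule stable_ultrafilter_top[OF G Y(2)])
 have xc: "x \<in> Xinf" by (rule Linf_in_Xinf[OF x])
 define e where "e y = cpair x y" for y
 have eF: "e y \<in> L0 F" if "y \<in> Y" for y unfolding e_def by (rule cexp_L0[OF X1_mult[OF xc]]) (use that Y in blast)
 have eb: "AE w\<in>a in M. \<bar>e y w\<bar> \<le> C" if "y \<in> Y" for y unfolding e_def by (rule Yb[OF that])
 have ecat: "AE w in M. e (cat N s) w = e (s (N w)) w" if N: "N \<in> rnat" and s: "\<And>k. s k \<in> Y" for N s proof -
  have sX: "s k \<in> X1" for k using s Y(1) by blast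
  have "cat N (\<lambda>k v. x v * s k v) = (\<lambda>v. x v * cat N s v)" by (auto simp: cat_def)
  then show ?thesis using cexp_cat[OF N, of "\<lambda>k v. x v * s k v"] X1_mult[OF xc sX] by (simp add: e_def)
 qed
 have cc: "cat_closed {y \<in> Y. AE w\<in>a in M. R (e y w) w}" for R :: "real \<Rightarrow> 'w \<Rightarrow> bool" unfolding cat_closed_def
 proof (intro allI impI)
  fix N :: "'w \<Rightarrow> nat" and s :: "nat \<Rightarrow> 'w \<Rightarrow> real" assume N: "N \<in> rnat" and s: "\<forall>k. s k \<in> {y \<in> Y. AE w\<in>a in M. R (e y w) w}"
  have sY: "s k \<in> Y" for k using s by blast
  have "AE w in M. \<forall>k. w \<in> a \<longrightarrow> R (e (s k) w) w" by (subst AE_all_countable) (use s in blast)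
  then have "AE w\<in>a in M. R (e (cat N s) w) w" using ecat[of N s, OF N sY] by eventually_elim simp
  then show "cat N s \<in> {y \<in> Y. AE w\<in>a in M. R (e y w) w}" using cat_closedD[OF Y(2) N sY] by simp
 qed
 define H where "H h = {y \<in> Y. AE w\<in>a in M. h w \<le> e y w}" for h
 have Hcc: "cat_closed (H h)" and HY: "H h \<subseteq> Y" for h unfolding H_def using cc[of "\<lambda>t w. h w \<le> t"] by auto
 define D where "D = \<bar>C\<bar>"
 have ebD: "AE w\<in>a in M. \<bar>e y w\<bar> \<le> D" if "y \<in> Y" for y using eb[OF that] by eventually_elim (auto simp: D_def)
 define \<Phi> where "\<Phi> = {h \<in> L0 F. H h \<in> \<G> \<and> (\<forall>w. \<bar>h w\<bar> \<le> D)}"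
 have "H (\<lambda>_. - D) = Y" unfolding H_def proof (intro equalityI subsetI CollectI conjI)
  fix y assume y: "y \<in> Y"
  show "AE w\<in>a in M. - D \<le> e y w" using ebD[OF y] by eventually_elim (auto simp: abs_le_iff)
 qed auto
 then have mD: "(\<lambda>_. - D) \<in> \<Phi>" using YG by (simp add: \<Phi>_def D_def)
 define \<Phi>' where "\<Phi>' = (\<lambda>h w. ereal (h w)) ` \<Phi>"
 have "\<Phi>' \<subseteq> L0bar F" by (auto simp: \<Phi>'_def \<Phi>_def)
 moreover have "\<Phi>' \<noteq> {}" using mD by (auto simp: \<Phi>'_def)
 ultimately obtain s' where s': "\<And>n::nat. s' n \<in> \<Phi>'" "\<And>t. t \<in> \<Phi>' \<Longrightarrow> AE w in M. t w \<le> (SUP n. s' n w)"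
  using ess_sup_sequence by blast
 have "\<forall>n. \<exists>h. h \<in> \<Phi> \<and> s' n = (\<lambda>w. ereal (h w))" using s'(1) by (auto simp: \<Phi>'_def)
 from choice[OF this] obtain s where s: "\<forall>n. s n \<in> \<Phi> \<and> s' n = (\<lambda>w. ereal (s n w))" by (rule exE)
 have sP: "s n \<in> \<Phi>" and s'e: "s' n w = ereal (s n w)" for n w using s by auto
 have sF: "s n \<in> L0 F" and sH: "H (s n) \<in> \<G>" and sD: "\<bar>s n w\<bar> \<le> D" for n w using sP[of n] by (auto simp: \<Phi>_def)
 define \<phi> where "\<phi> w = (SUP n. s n w)" for w
 have bdd: "bdd_above (range (\<lambda>n. s n w))" for w using sD by (intro bdd_aboveI[of _ D]) (auto simp: abs_le_iff)
 have s\<phi>: "s n w \<le> \<phi> w" for n w unfolding \<phi>_def by (rule cSUP_upper[OF _ bdd]) simp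
 have \<phi>F: "\<phi> \<in> L0 F" unfolding \<phi>_def using bdd sF by (intro borel_measurable_cSUP) auto
 have \<phi>D: "- D \<le> \<phi> w" for w using s\<phi>[of 0 w] sD[of 0 w] by (simp add: abs_le_iff)
 have \<Phi>le: "AE w in M. h w \<le> \<phi> w" if h: "h \<in> \<Phi>" for h proof -
  have "(\<lambda>w. ereal (h w)) \<in> \<Phi>'" using h by (auto simp: \<Phi>'_def)
  from s'(2)[OF this] show ?thesis proof eventually_elim
   case (elim w)
   have "(SUP n. s' n w) \<le> ereal (\<phi> w)" by (rule SUP_least) (simp add: s'e s\<phi>)
   with elim have "ereal (h w) \<le> ereal (\<phi> w)" by (rule order_trans)
   then show ?case by simp
  qed
 qed
 show ?thesis proof (intro bexI[OF _ \<phi>F] ballI)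
  fix \<epsilon> assume eps: "\<epsilon> \<in> L0pos M F"
  then have eF': "\<epsilon> \<in> L0 F" and e0: "AE w in M. 0 < \<epsilon> w" by (auto simp: L0pos_def)
  have low: "H (\<lambda>w. \<phi> w - \<epsilon> w) \<in> \<G>" proof -
   define P where "P k w \<longleftrightarrow> \<phi> w - \<epsilon> w \<le> s (k - 1) w" for k w
   have Pm: "{w \<in> space F. P k w} \<in> sets F" for k unfolding P_def using \<phi>F eF' sF[of "k - 1"] by measurable
   have ex: "AE w in M. \<exists>k\<ge>1. P k w" using e0 proof eventually_elim
    case (elim w)
    have "\<exists>n\<in>UNIV. \<phi> w - \<epsilon> w < s n w"
     by (subst less_cSUP_iff[OF _ bdd, symmetric]) (use elim in \<open>auto simp: \<phi>_def\<close>)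
    then obtain n where "\<phi> w - \<epsilon> w < s n w" by blast
    then show ?case by (intro exI[of _ "Suc n"]) (simp add: P_def)
   qed
   obtain m where m: "m \<in> rnat" "\<And>w. 1 \<le> m w" "AE w in M. P (m w) w" using first_index[OF Pm ex] by blast
   define T where "T = H (cat m (\<lambda>k. s (k - 1)))"
   have "T \<in> \<G>" proof (rule Gmax)
    show "cat_closed T" "T \<subseteq> Y" unfolding T_def by (rule Hcc, rule HY)
    fix S assume S: "S \<in> \<G>"
    have "\<forall>k. \<exists>y. y \<in> S \<inter> H (s (k - 1))" proof
     fix k
     have "S \<inter> H (s (k - 1)) \<noteq> {}" using Gint[OF S sH[of "k - 1"]] Gem by metis
     then show "\<exists>y. y \<in> S \<inter> H (s (k - 1))" by blast
    qed
    from choice[OF this] obtain y where y: "\<forall>k. y k \<in> S \<inter> H (s (k - 1))" by (rule exE)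
    have yS: "y k \<in> S" and yH: "y k \<in> H (s (k - 1))" for k using y by auto
    have yY: "y k \<in> Y" for k using yS GY[OF S] by blast
    have "cat m y \<in> S" by (rule cat_closedD[OF Gcc[OF S] m(1) yS])
    moreover have "cat m y \<in> T" unfolding T_def H_def proof (intro CollectI conjI)
     show "cat m y \<in> Y" by (rule cat_closedD[OF Y(2) m(1) yY])
     have "AE w in M. \<forall>k. w \<in> a \<longrightarrow> s (k - 1) w \<le> e (y k) w"
      by (subst AE_all_countable) (use yH in \<open>simp add: H_def\<close>)
     then show "AE w\<in>a in M. cat m (\<lambda>k. s (k - 1)) w \<le> e (cat m y) w"
      using ecat[of m y, OF m(1) yY] by eventually_elim (simp add: cat_def)
    qed
    ultimately show "S \<inter> T \<noteq> {}" by blast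
   qed
   moreover have "T \<subseteq> H (\<lambda>w. \<phi> w - \<epsilon> w)" proof
    fix y assume y: "y \<in> T"
    then have "AE w\<in>a in M. cat m (\<lambda>k. s (k - 1)) w \<le> e y w" by (simp add: T_def H_def)
    then have "AE w\<in>a in M. \<phi> w - \<epsilon> w \<le> e y w" using m(3) by eventually_elim (auto simp: P_def cat_def)
    then show "y \<in> H (\<lambda>w. \<phi> w - \<epsilon> w)" using y by (simp add: T_def H_def)
   qed
   ultimately show ?thesis by (rule Gup[OF _ _ Hcc HY])
  qed
  define T where "T = {y \<in> Y. AE w\<in>a in M. e y w \<le> \<phi> w + \<epsilon> w}"
  have Tcc: "cat_closed T" unfolding T_def by (rule cc[of "\<lambda>t w. t \<le> \<phi> w + \<epsilon> w"])
  have "T \<in> \<G>" proof (rule Gmax[OF Tcc])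
   show "T \<subseteq> Y" by (auto simp: T_def)
   fix S assume S: "S \<in> \<G>"
   define \<C> where "\<C> = (\<lambda>y. {w \<in> space F. e y w \<le> \<phi> w + \<epsilon> w}) ` S"
   have SY: "y \<in> Y" if "y \<in> S" for y using GY[OF S] that by blast
   have CF: "\<C> \<subseteq> sets F" proof
    fix B assume "B \<in> \<C>"
    then obtain y where y: "y \<in> S" "B = {w \<in> space F. e y w \<le> \<phi> w + \<epsilon> w}" by (auto simp: \<C>_def)
    show "B \<in> sets F" unfolding y(2) using eF[OF SY[OF y(1)]] \<phi>F eF' by measurable
   qed
   have "S \<noteq> {}" using S Gem by blast
   then have "\<C> \<noteq> {}" by (auto simp: \<C>_def)
   from exhaustion[OF CF this] obtain d where d: "\<forall>n::nat. d n \<in> \<C>" "\<forall>B\<in>\<C>. AE w\<in>B in M. w \<in> (\<Union>n. d n)" by blast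
   have dF: "d n \<in> sets F" for n using d(1) CF by blast
   have "\<forall>n. \<exists>y. y \<in> S \<and> d n = {w \<in> space F. e y w \<le> \<phi> w + \<epsilon> w}" using d(1) by (auto simp: \<C>_def)
   from choice[OF this] obtain y where y: "\<forall>n. y n \<in> S \<and> d n = {w \<in> space F. e (y n) w \<le> \<phi> w + \<epsilon> w}" by (rule exE)
   have yS: "y n \<in> S" and dn: "d n = {w \<in> space F. e (y n) w \<le> \<phi> w + \<epsilon> w}" for n using y by auto
   define B where "B = a - (\<Union>n. d n)"
   have BF: "B \<in> sets F" unfolding B_def using a dF by auto
   have "AE w in M. w \<notin> B" proof (rule ccontr)
    assume Bn: "\<not> (AE w in M. w \<notin> B)"
    define h where "h w = (if w \<in> B then \<phi> w + \<epsilon> w else - D)" for w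
    have hF: "h \<in> L0 F" unfolding h_def using BF \<phi>F eF' by (intro measurable_If_set) auto
    define h' where "h' w = max (- D) (min D (h w))" for w
    have h'F: "h' \<in> L0 F" unfolding h'_def using hF by measurable
    have gt: "AE w\<in>B in M. \<phi> w + \<epsilon> w < e u w" if u: "u \<in> S" for u proof -
     have "{w \<in> space F. e u w \<le> \<phi> w + \<epsilon> w} \<in> \<C>" using u by (auto simp: \<C>_def)
     from d(2)[THEN bspec, OF this] show ?thesis using AE_space by eventually_elim (auto simp: B_def space_F)
    qed
    have "S \<subseteq> H h'" proof
     fix u assume u: "u \<in> S"
     have "AE w\<in>a in M. h' w \<le> e u w" using gt[OF u] ebD[OF SY[OF u]]
      by eventually_elim (auto simp: h'_def h_def abs_le_iff)
     then show "u \<in> H h'" using SY[OF u] by (simp add: H_def)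
    qed
    from Gup[OF S this Hcc HY] have "h' \<in> \<Phi>" using h'F by (auto simp: \<Phi>_def h'_def D_def)
    from \<Phi>le[OF this] have hle: "AE w in M. h' w \<le> \<phi> w" .
    obtain u where u: "u \<in> S" using \<open>S \<noteq> {}\<close> by blast
    have "AE w in M. w \<notin> B" using hle gt[OF u] ebD[OF SY[OF u]] e0 proof eventually_elim
     case (elim w)
     show ?case proof
      assume wB: "w \<in> B"
      then have wa: "w \<in> a" by (simp add: B_def)
      have "\<phi> w + \<epsilon> w < D" using elim(2,3) wB wa by (auto simp: abs_le_iff)
      then have "h' w = \<phi> w + \<epsilon> w" using wB \<phi>D[of w] elim(4) by (simp add: h'_def h_def)
      then show False using elim(1,4) by simp
     qed
    qed
    then show False using Bn by blast
   qed
   then have cov: "AE w\<in>a in M. w \<in> d (idx d w)" by eventually_elim (auto simp: B_def intro: idx_in)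
   have im: "idx d \<in> rnat" by (rule idx_measurable[of d, OF dF])
   have "cat (idx d) y \<in> S" by (rule cat_closedD[OF Gcc[OF S] im yS])
   moreover have "cat (idx d) y \<in> T" unfolding T_def proof (intro CollectI conjI)
    show "cat (idx d) y \<in> Y" by (rule cat_closedD[OF Y(2) im SY[OF yS]])
    show "AE w\<in>a in M. e (cat (idx d) y) w \<le> \<phi> w + \<epsilon> w" using cov ecat[of "idx d" y, OF im SY[OF yS]]
    proof eventually_elim
     case (elim w)
     show ?case proof
      assume "w \<in> a"
      then have "w \<in> d (idx d w)" using elim(1) by blast
      then have "e (y (idx d w)) w \<le> \<phi> w + \<epsilon> w" using dn[of "idx d w"] by blast
      then show "e (cat (idx d) y) w \<le> \<phi> w + \<epsilon> w" using elim(2) by simp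
     qed
    qed
   qed
   ultimately show "S \<inter> T \<noteq> {}" by blast
  qed
  then have "H (\<lambda>w. \<phi> w - \<epsilon> w) \<inter> T \<in> \<G>" using low Gint by blast
  moreover have "H (\<lambda>w. \<phi> w - \<epsilon> w) \<inter> T \<subseteq> {y \<in> Y. AE w\<in>a in M. \<bar>e y w - \<phi> w\<bar> \<le> \<epsilon> w}" proof
   fix y assume y: "y \<in> H (\<lambda>w. \<phi> w - \<epsilon> w) \<inter> T"
   then have "AE w\<in>a in M. \<phi> w - \<epsilon> w \<le> e y w" "AE w\<in>a in M. e y w \<le> \<phi> w + \<epsilon> w" by (auto simp: H_def T_def)
   then have "AE w\<in>a in M. \<bar>e y w - \<phi> w\<bar> \<le> \<epsilon> w" by eventually_elim (auto simp: abs_le_iff)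
   then show "y \<in> {y \<in> Y. AE w\<in>a in M. \<bar>e y w - \<phi> w\<bar> \<le> \<epsilon> w}" using y by (simp add: T_def)
  qed
  ultimately have "{y \<in> Y. AE w\<in>a in M. \<bar>e y w - \<phi> w\<bar> \<le> \<epsilon> w} \<in> \<G>"
   by (rule Gup[OF _ _ cc[of "\<lambda>t w. \<bar>t - \<phi> w\<bar> \<le> \<epsilon> w"]]) blast
  then show "{y \<in> Y. AE w\<in>a in M. \<bar>cpair x y w - \<phi> w\<bar> \<le> \<epsilon> w} \<in> \<G>" by (simp add: e_def)
 qed
qed

end

context cond_risk
begin

text \<open>Only bounded test functions matter, and the inequalities they impose are local.\<close>

lemma sublevel_facts:
 assumes c: "c \<in> L0 F"
 shows "gluable (sublevel M F \<rho> c)"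
  and "\<And>y b. y \<in> X1 \<Longrightarrow> b \<in> sets F \<Longrightarrow> cobj M y b \<in> sublevel M F \<rho> c \<longleftrightarrow>
   (\<forall>x\<in>Linf M. AE w\<in>b in M. cpair x y w \<le> \<rho> x w + c w)" proof -
 have z0c: "(\<lambda>_. 0::real) \<in> Xinf" by (rule Xinf_const)
 define Q where "Q y b \<longleftrightarrow> (\<forall>x\<in>Linf M. AE w\<in>b in M. cpair x y w \<le> \<rho> x w + c w)" for y b
 have Qiff: "(AE w\<in>b in M. conj_fun M F (Xinf) \<rho> y w \<le> ereal (c w)) \<longleftrightarrow> Q y b"
  if y: "y \<in> X1" and b: "b \<in> sets F" for y b proof -
  have ne: "Xinf \<noteq> {}" using z0c by blast
  have "Q y b \<longleftrightarrow> (\<forall>x\<in>Xinf. AE w\<in>b in M. cpair x y w \<le> \<rho> x w + c w)" proof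
   assume Q: "Q y b"
   show "\<forall>x\<in>Xinf. AE w\<in>b in M. cpair x y w \<le> \<rho> x w + c w" proof
    fix x assume x: "x \<in> Xinf"
    have "AE w\<in>b in M. cpair x y w \<le> \<rho> (\<lambda>v. 0 + x v) w + c w" proof (rule subgradient_extend[OF z0c y b c _ x])
     fix t assume "t \<in> Linf M"
     with Q show "AE w\<in>b in M. cpair t y w \<le> \<rho> (\<lambda>v. 0 + t v) w + c w" by (simp add: Q_def)
    qed
    then show "AE w\<in>b in M. cpair x y w \<le> \<rho> x w + c w" by simp
   qed
  next
   assume "\<forall>x\<in>Xinf. AE w\<in>b in M. cpair x y w \<le> \<rho> x w + c w"
   then show "Q y b" using Linf_in_Xinf by (simp add: Q_def)
  qed
  then show ?thesis using conj_fun_le_iff[OF subset_refl ne y b c] by simp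
 qed
 have S: "sublevel M F \<rho> c = {cobj M y b | y b. y \<in> X1 \<and> b \<in> sets F \<and> Q y b}"
  unfolding sublevel_def using Qiff by blast
 have "gluable (sublevel M F \<rho> c) \<and> (\<forall>y\<in>X1. \<forall>b\<in>sets F. cobj M y b \<in> sublevel M F \<rho> c \<longleftrightarrow> Q y b)" unfolding S
 proof (rule gluable_predicate[where P = Q])
  show "Q y b'" if "Q y b" "le_alg M b' b" for y b b' unfolding Q_def proof
   fix x assume "x \<in> Linf M"
   then have "AE w\<in>b in M. cpair x y w \<le> \<rho> x w + c w" using that(1) by (simp add: Q_def)
   then show "AE w\<in>b' in M. cpair x y w \<le> \<rho> x w + c w"
    using that(2)[unfolded le_alg_def] by eventually_elim simp
  qed
  show "Q y b" if "AE w\<in>b in M. (\<exists>k. w \<in> d k)" "\<And>k::nat. Q y (d k)" for y b d unfolding Q_def proof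
   fix x assume "x \<in> Linf M"
   then have "AE w in M. \<forall>k. w \<in> d k \<longrightarrow> cpair x y w \<le> \<rho> x w + c w"
    by (subst AE_all_countable) (use that(2) in \<open>simp add: Q_def\<close>)
   then show "AE w\<in>b in M. cpair x y w \<le> \<rho> x w + c w" using that(1) by eventually_elim blast
  qed
  show "Q y' b" if "y \<in> X1" "y' \<in> X1" "b \<in> sets F" "Q y b" "AE w\<in>b in M. y w = y' w" for y y' b unfolding Q_def
  proof
   fix x assume x: "x \<in> Linf M"
   have "AE w\<in>b in M. cpair x y w = cpair x y' w"
    by (rule cexp_local[OF X1_mult[OF Linf_in_Xinf[OF x] that(1)] X1_mult[OF Linf_in_Xinf[OF x] that(2)] that(3)])
     (use that(5) in \<open>auto elim: eventually_mono\<close>)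
   moreover have "AE w\<in>b in M. cpair x y w \<le> \<rho> x w + c w" using that(4) x by (simp add: Q_def)
   ultimately show "AE w\<in>b in M. cpair x y' w \<le> \<rho> x w + c w" by eventually_elim simp
  qed
  show "Q y {}" for y by (simp add: Q_def)
 qed
 then show "gluable (sublevel M F \<rho> c)" "\<And>y b. y \<in> X1 \<Longrightarrow> b \<in> sets F \<Longrightarrow> cobj M y b \<in> sublevel M F \<rho> c \<longleftrightarrow>
   (\<forall>x\<in>Linf M. AE w\<in>b in M. cpair x y w \<le> \<rho> x w + c w)" by (simp_all add: Q_def)
qed

lemma density_bound:
 assumes y: "y \<in> X1" and b: "b \<in> sets F" and y0: "AE w\<in>b in M. y w \<le> 0"
  and y1: "AE w\<in>b in M. cexp M F y w = -1" and x: "x \<in> Linf M" and C: "AE w in M. \<bar>x w\<bar> \<le> C"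
 shows "AE w\<in>b in M. \<bar>cpair x y w\<bar> \<le> C" proof -
 have xc: "x \<in> Xinf" by (rule Linf_in_Xinf[OF x])
 have 1: "AE w\<in>b in M. C * y w \<le> x w * y w" using C y0 by eventually_elim (auto intro: mult_right_mono_neg)
 have 2: "AE w\<in>b in M. x w * y w \<le> (- C) * y w" using C y0 proof eventually_elim
  case (elim w)
  have "y w \<le> 0 \<Longrightarrow> x w * y w \<le> (- C) * y w" using elim(1) by (intro mult_right_mono_neg) auto
  then show ?case using elim(2) by blast
 qed
 from cexp_mono_on[OF X1_mult[OF Xinf_const y] X1_mult[OF xc y] b 1]
  cexp_mono_on[OF X1_mult[OF xc y] X1_mult[OF Xinf_const y] b 2]
  cexp_mult[OF borel_measurable_const y, of C] cexp_mult[OF borel_measurable_const y, of "- C"] y1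
 show ?thesis by eventually_elim (auto simp: abs_le_iff)
qed

lemma sublevel_cat_closed:
 assumes c: "c \<in> L0 F" and a: "a \<in> sets F"
 shows "cat_closed {y \<in> X1. cobj M y a \<in> sublevel M F \<rho> c}" unfolding cat_closed_def
proof (intro allI impI CollectI conjI)
 fix N :: "'w \<Rightarrow> nat" and s :: "nat \<Rightarrow> 'w \<Rightarrow> real" assume N: "N \<in> rnat" and s: "\<forall>k. s k \<in> {y \<in> X1. cobj M y a \<in> sublevel M F \<rho> c}"
 have sX: "s k \<in> X1" and sK: "cobj M (s k) a \<in> sublevel M F \<rho> c" for k using s by simp_all
 show z: "cat N s \<in> X1" by (rule cat_X1[OF N sX])
 show "cobj M (cat N s) a \<in> sublevel M F \<rho> c" unfolding sublevel_facts(2)[OF c z a] proof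
  fix x assume x: "x \<in> Linf M"
  note xc = Linf_in_Xinf[OF x]
  have "cat N (\<lambda>k v. x v * s k v) = (\<lambda>v. x v * cat N s v)" by (auto simp: cat_def)
  then have eq: "AE w in M. cpair x (cat N s) w = cexp M F (\<lambda>v. x v * s (N w) v) w"
   using cexp_cat[OF N, of "\<lambda>k v. x v * s k v"] X1_mult[OF xc sX] by simp
  have "AE w\<in>a in M. cpair x (s k) w \<le> \<rho> x w + c w" for k
   using sK[of k] sublevel_facts(2)[OF c sX a, of k] x by blast
  then have "AE w in M. \<forall>k. w \<in> a \<longrightarrow> cpair x (s k) w \<le> \<rho> x w + c w" by (subst AE_all_countable) blast
  then show "AE w\<in>a in M. cpair x (cat N s) w \<le> \<rho> x w + c w" using eq by eventually_elim simp
 qed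
qed

text \<open>The Lebesgue property enters through the density of the limit functional: homogeneity
 turns the bound by \<open>\<rho>\<close> into continuity along bounded sequences converging almost surely.\<close>

lemma stable_ultrafilter_cluster_point:
 assumes l: "lebesgue_property M \<rho>" and c: "c \<in> L0 F" and a: "a \<in> sets F"
  and Y: "Y = {y \<in> X1. cobj M y a \<in> sublevel M F \<rho> c}" and G: "stable_ultrafilter Y \<G>"
 shows "\<exists>y0. y0 \<in> X1 \<and> cobj M y0 a \<in> sublevel M F \<rho> c \<and> (\<forall>x\<in>Linf M. \<forall>\<epsilon>\<in>L0pos M F.
  {y \<in> Y. AE w\<in>a in M. \<bar>cpair x y w - cpair x y0 w\<bar> \<le> \<epsilon> w} \<in> \<G>)" proof -
 note Lc = Linf_in_Xinf
 have YX: "Y \<subseteq> X1" unfolding Y by blast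
 have Ycc: "cat_closed Y" unfolding Y by (rule sublevel_cat_closed[OF c a])
 define e where "e x y = cpair x y" for x y :: "'w \<Rightarrow> real"
 have yX: "y \<in> X1" if "y \<in> Y" for y using YX that by blast
 have sub: "AE w\<in>a in M. e x y w \<le> \<rho> x w + c w" if y: "y \<in> Y" and x: "x \<in> Linf M" for x y proof -
  have "cobj M y a \<in> sublevel M F \<rho> c" using y by (simp add: Y)
  then show ?thesis unfolding e_def using sublevel_facts(2)[OF c yX[OF y] a] x by blast
 qed
 have yn: "AE w\<in>a in M. y w \<le> 0" and y1: "AE w\<in>a in M. cexp M F y w = -1" if y: "y \<in> Y" for y
  using dominated_functional_density[OF Xinf_const[of 0] yX[OF y] a c] sub[OF y, unfolded e_def] by auto
 have bnd: "AE w\<in>a in M. \<bar>e x y w\<bar> \<le> C"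
  if y: "y \<in> Y" and x: "x \<in> Linf M" and C: "AE w in M. \<bar>x w\<bar> \<le> C" for x y C
  unfolding e_def by (rule density_bound[OF yX[OF y] a yn[OF y] y1[OF y] x C])
 define near where "near x h \<epsilon> = {y \<in> Y. AE w\<in>a in M. \<bar>e x y w - h w\<bar> \<le> \<epsilon> w}" for x h \<epsilon>
 have "\<forall>x\<in>Linf M. \<exists>h. h \<in> L0 F \<and> (\<forall>\<epsilon>\<in>L0pos M F. near x h \<epsilon> \<in> \<G>)" proof
  fix x assume x: "x \<in> Linf M"
  obtain C where C: "AE w in M. \<bar>x w\<bar> \<le> C" using LinfE[OF x] by blast
  from stable_ultrafilter_limit[OF G YX Ycc a x bnd[OF _ x C, unfolded e_def]]
  show "\<exists>h. h \<in> L0 F \<and> (\<forall>\<epsilon>\<in>L0pos M F. near x h \<epsilon> \<in> \<G>)" unfolding near_def e_def Bex_def .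
 qed
 from bchoice[OF this] obtain \<phi> where ph: "\<forall>x\<in>Linf M. \<phi> x \<in> L0 F \<and> (\<forall>\<epsilon>\<in>L0pos M F. near x (\<phi> x) \<epsilon> \<in> \<G>)" by (rule exE)
 have \<phi>F: "\<phi> x \<in> L0 F" if "x \<in> Linf M" for x using ph[THEN bspec, OF that] by (rule conjunct1)
 have \<phi>G: "near x (\<phi> x) \<epsilon> \<in> \<G>" if "x \<in> Linf M" "\<epsilon> \<in> L0pos M F" for x \<epsilon>
  using ph[THEN bspec, OF that(1), THEN conjunct2] that(2) by (rule bspec)
 have pick: "\<exists>y\<in>Y. (AE w\<in>a in M. \<bar>e x1 y w - \<phi> x1 w\<bar> \<le> \<delta>) \<and> (AE w\<in>a in M. \<bar>e x2 y w - \<phi> x2 w\<bar> \<le> \<delta>) \<and>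
   (AE w\<in>a in M. \<bar>e x3 y w - \<phi> x3 w\<bar> \<le> \<delta>)"
  if x: "x1 \<in> Linf M" "x2 \<in> Linf M" "x3 \<in> Linf M" and d: "0 < \<delta>" for x1 x2 x3 \<delta> proof -
  have dp: "(\<lambda>_. \<delta>) \<in> L0pos M F" using d by (simp add: L0pos_def)
  have "near x1 (\<phi> x1) (\<lambda>_. \<delta>) \<inter> near x2 (\<phi> x2) (\<lambda>_. \<delta>) \<inter> near x3 (\<phi> x3) (\<lambda>_. \<delta>) \<in> \<G>"
   by (intro stable_ultrafilterD(5)[OF G] \<phi>G x dp)
  then have "near x1 (\<phi> x1) (\<lambda>_. \<delta>) \<inter> near x2 (\<phi> x2) (\<lambda>_. \<delta>) \<inter> near x3 (\<phi> x3) (\<lambda>_. \<delta>) \<noteq> {}"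
   using stable_ultrafilterD(2)[OF G] by metis
  then obtain y where "y \<in> near x1 (\<phi> x1) (\<lambda>_. \<delta>)" "y \<in> near x2 (\<phi> x2) (\<lambda>_. \<delta>)" "y \<in> near x3 (\<phi> x3) (\<lambda>_. \<delta>)" by blast
  then show ?thesis unfolding near_def by (intro bexI[of _ y]) simp_all
 qed
 have padd: "AE w\<in>a in M. \<phi> (\<lambda>w. x w + x' w) w = \<phi> x w + \<phi> x' w" if x: "x \<in> Linf M" "x' \<in> Linf M" for x x'
 proof -
  have "AE w\<in>a in M. \<bar>\<phi> (\<lambda>w. x w + x' w) w - (\<phi> x w + \<phi> x' w)\<bar> \<le> 0"
  proof (rule AE_nonpos_from_epsilon[where k = 3])
   fix \<delta> :: real assume d: "0 < \<delta>"
   obtain y where y: "y \<in> Y" "AE w\<in>a in M. \<bar>e x y w - \<phi> x w\<bar> \<le> \<delta>" "AE w\<in>a in M. \<bar>e x' y w - \<phi> x' w\<bar> \<le> \<delta>"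
    "AE w\<in>a in M. \<bar>e (\<lambda>w. x w + x' w) y w - \<phi> (\<lambda>w. x w + x' w) w\<bar> \<le> \<delta>"
    using pick[OF x Linf_add[OF x] d] by blast
   have "AE w in M. e (\<lambda>w. x w + x' w) y w = e x y w + e x' y w"
    using cexp_add[OF X1_mult[OF Lc[OF x(1)] yX[OF y(1)]] X1_mult[OF Lc[OF x(2)] yX[OF y(1)]]]
    by (simp add: e_def distrib_right)
   then show "AE w\<in>a in M. \<bar>\<phi> (\<lambda>w. x w + x' w) w - (\<phi> x w + \<phi> x' w)\<bar> \<le> 3 * \<delta>" using y(2-4)
    by eventually_elim linarith
  qed
  then show ?thesis by eventually_elim simp
 qed
 have pmult: "AE w\<in>a in M. \<phi> (\<lambda>w. \<xi> w * x w) w = \<xi> w * \<phi> x w"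
  if x: "x \<in> Linf M" and xi: "\<xi> \<in> L0 F" "\<And>w. \<bar>\<xi> w\<bar> \<le> k" for x \<xi> k proof -
  have xiL: "\<xi> \<in> Linf M" using L0_M[OF xi(1)] by (rule LinfI[of _ k]) (simp add: xi(2))
  have xix: "(\<lambda>w. \<xi> w * x w) \<in> Linf M" by (rule Linf_mult[OF xiL x])
  have "AE w\<in>a in M. \<bar>\<phi> (\<lambda>w. \<xi> w * x w) w - \<xi> w * \<phi> x w\<bar> \<le> 0"
  proof (rule AE_nonpos_from_epsilon[where k = "1 + k"])
   fix \<delta> :: real assume d: "0 < \<delta>"
   obtain y where y: "y \<in> Y" "AE w\<in>a in M. \<bar>e x y w - \<phi> x w\<bar> \<le> \<delta>"
    "AE w\<in>a in M. \<bar>e (\<lambda>w. \<xi> w * x w) y w - \<phi> (\<lambda>w. \<xi> w * x w) w\<bar> \<le> \<delta>" using pick[OF x x xix d] by blast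
   have "AE w in M. e (\<lambda>w. \<xi> w * x w) y w = \<xi> w * e x y w"
    using cexp_mult[OF xi(1) X1_mult[OF Lc[OF x] yX[OF y(1)]]] by (simp add: e_def mult.assoc)
   then show "AE w\<in>a in M. \<bar>\<phi> (\<lambda>w. \<xi> w * x w) w - \<xi> w * \<phi> x w\<bar> \<le> (1 + k) * \<delta>" using y(2,3) proof eventually_elim
    case (elim w)
    show ?case proof
     assume w: "w \<in> a"
     have "\<bar>\<xi> w * (e x y w - \<phi> x w)\<bar> \<le> k * \<delta>" unfolding abs_mult
      using elim(2) w xi(2)[of w] d by (intro mult_mono) auto
     then have "\<bar>\<xi> w * e x y w - \<xi> w * \<phi> x w\<bar> \<le> k * \<delta>" by (simp add: right_diff_distrib)
     moreover have "\<bar>e (\<lambda>w. \<xi> w * x w) y w - \<phi> (\<lambda>w. \<xi> w * x w) w\<bar> \<le> \<delta>" using elim(3) w by blast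
     moreover have "(1 + k) * \<delta> = \<delta> + k * \<delta>" by (simp add: algebra_simps)
     ultimately show "\<bar>\<phi> (\<lambda>w. \<xi> w * x w) w - \<xi> w * \<phi> x w\<bar> \<le> (1 + k) * \<delta>" using elim(1) by linarith
    qed
   qed
  qed
  then show ?thesis by eventually_elim simp
 qed
 have one: "AE w\<in>a in M. \<phi> x w \<le> h w"
  if x: "x \<in> Linf M" and le: "\<And>y. y \<in> Y \<Longrightarrow> AE w\<in>a in M. e x y w \<le> h w" for x h proof -
  have "AE w\<in>a in M. \<phi> x w - h w \<le> 0" proof (rule AE_nonpos_from_epsilon[where k = 1])
   fix \<delta> :: real assume d: "0 < \<delta>"
   obtain y where y: "y \<in> Y" "AE w\<in>a in M. \<bar>e x y w - \<phi> x w\<bar> \<le> \<delta>" using pick[OF x x x d] by blast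
   show "AE w\<in>a in M. \<phi> x w - h w \<le> 1 * \<delta>" using y(2) le[OF y(1)] by eventually_elim linarith
  qed
  then show ?thesis by eventually_elim simp
 qed
 have pup: "AE w\<in>a in M. \<phi> x w \<le> \<rho> x w + c w" if x: "x \<in> Linf M" for x by (rule one[OF x sub[OF _ x]])
 have pconst: "AE w\<in>a in M. \<phi> (\<lambda>w. q * x w) w = q * \<phi> x w" if x: "x \<in> Linf M" for x q
  using pmult[OF x borel_measurable_const, of q "\<bar>q\<bar>"] by simp
 have pbd: "AE w\<in>a in M. \<bar>\<phi> x w\<bar> \<le> C" if x: "x \<in> Linf M" and C: "AE w in M. \<bar>x w\<bar> \<le> C" for x C proof -
  have C': "AE w in M. \<bar>-1 * x w\<bar> \<le> C" using C by simp
  have x': "(\<lambda>w. -1 * x w) \<in> Linf M" by (rule Linf_cmult[OF x])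
  have "AE w\<in>a in M. \<phi> x w \<le> C" proof (rule one[OF x])
   fix y assume "y \<in> Y" from bnd[OF this x C] show "AE w\<in>a in M. e x y w \<le> C" by eventually_elim linarith
  qed
  moreover have "AE w\<in>a in M. \<phi> (\<lambda>w. -1 * x w) w \<le> C" proof (rule one[OF x'])
   fix y assume "y \<in> Y" from bnd[OF this x' C'] show "AE w\<in>a in M. e (\<lambda>w. -1 * x w) y w \<le> C"
    by eventually_elim linarith
  qed
  ultimately show ?thesis using pconst[OF x, of "-1"] by eventually_elim (auto simp: abs_le_iff)
 qed
 have ppos: "AE w\<in>a in M. \<phi> x w \<le> 0" if x: "x \<in> Linf M" and x0: "AE w in M. 0 \<le> x w" for x
 proof (rule one[OF x])
  fix y assume y: "y \<in> Y"
  have "AE w\<in>a in M. x w * y w \<le> 0" using yn[OF y] x0 by eventually_elim (auto intro: mult_nonneg_nonpos)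
  from cexp_mono_on[OF X1_mult[OF Lc[OF x] yX[OF y]] Xinf_in_X1[OF Xinf_const] a this]
   cexp_F[OF borel_measurable_const, of 0]
  show "AE w\<in>a in M. e x y w \<le> 0" unfolding e_def by eventually_elim simp
 qed
 define \<psi> where "\<psi> x w = indicator a w * \<phi> x w" for x w
 have \<psi>F: "\<psi> x \<in> L0 F" if "x \<in> Linf M" for x unfolding \<psi>_def using \<phi>F[OF that] a by measurable
 have \<psi>b: "AE w in M. \<bar>\<psi> x w\<bar> \<le> C" if x: "x \<in> Linf M" and C: "AE w in M. \<bar>x w\<bar> \<le> C" for x C
  using pbd[OF x C] C by eventually_elim (auto simp: \<psi>_def indicator_def)
 have \<psi>i: "integrable M (\<psi> x)" if x: "x \<in> Linf M" for x proof -
  obtain C where C: "AE w in M. \<bar>x w\<bar> \<le> C" using LinfE[OF x] by blast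
  show ?thesis by (rule integrable_const_bound[of _ C]) (use \<psi>b[OF x C] L0_M[OF \<psi>F[OF x]] in auto)
 qed
 define L where "L x = - (\<integral>w. \<psi> x w \<partial>M)" for x
 have "\<exists>y. integrable M y \<and> (AE w in M. 0 \<le> y w) \<and> (\<forall>x\<in>Linf M. L x = (\<integral>w. x w * y w \<partial>M))"
 proof (rule positive_functional_density)
  show "L (\<lambda>w. x w + y w) = L x + L y" if x: "x \<in> Linf M" "y \<in> Linf M" for x y proof -
   have "(\<integral>w. \<psi> (\<lambda>w. x w + y w) w \<partial>M) = (\<integral>w. \<psi> x w + \<psi> y w \<partial>M)" proof (rule integral_cong_AE)
    show "\<psi> (\<lambda>w. x w + y w) \<in> L0 M" by (rule L0_M[OF \<psi>F[OF Linf_add[OF x]]])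
    show "(\<lambda>w. \<psi> x w + \<psi> y w) \<in> L0 M" using L0_M[OF \<psi>F[OF x(1)]] L0_M[OF \<psi>F[OF x(2)]] by measurable
    show "AE w in M. \<psi> (\<lambda>w. x w + y w) w = \<psi> x w + \<psi> y w"
     using padd[OF x] by eventually_elim (simp add: \<psi>_def indicator_def)
   qed
   then show ?thesis unfolding L_def using \<psi>i x by simp
  qed
  show "L (\<lambda>w. q * x w) = q * L x" if x: "x \<in> Linf M" for x q proof -
   have "(\<integral>w. \<psi> (\<lambda>w. q * x w) w \<partial>M) = (\<integral>w. q * \<psi> x w \<partial>M)" proof (rule integral_cong_AE)
    show "\<psi> (\<lambda>w. q * x w) \<in> L0 M" by (rule L0_M[OF \<psi>F[OF Linf_cmult[OF x]]])
    show "(\<lambda>w. q * \<psi> x w) \<in> L0 M" using L0_M[OF \<psi>F[OF x]] by measurable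
    show "AE w in M. \<psi> (\<lambda>w. q * x w) w = q * \<psi> x w"
     using pconst[OF x, of q] by eventually_elim (simp add: \<psi>_def indicator_def)
   qed
   then show ?thesis unfolding L_def by simp
  qed
  show "0 \<le> L x" if x: "x \<in> Linf M" "AE w in M. 0 \<le> x w" for x proof -
   have "0 \<le> (\<integral>w. - \<psi> x w \<partial>M)" proof (rule integral_nonneg_AE)
    show "AE w in M. 0 \<le> - \<psi> x w" using ppos[OF x] by eventually_elim (simp add: \<psi>_def indicator_def)
   qed
   then show ?thesis by (simp add: L_def)
  qed
  show "(\<lambda>n. L (x n)) \<longlonglongrightarrow> 0" if bc: "bounded_as_conv M x (\<lambda>_. 0)" for x proof -
   have xL: "x n \<in> Linf M" for n using bc by (simp add: bounded_as_conv_def)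
   obtain C where C: "AE w in M. \<bar>x n w\<bar> \<le> C" for n using bc unfolding bounded_as_conv_def by blast
   have xlim: "AE w in M. (\<lambda>n. x n w) \<longlonglongrightarrow> 0" using bc by (simp add: bounded_as_conv_def)
   have ev: "AE w\<in>a in M. (\<forall>\<^sub>F n in sequentially. q * \<phi> (x n) w \<le> \<rho> (\<lambda>_. 0) w + c w + 1)" for q proof -
    have "bounded_as_conv M (\<lambda>n w. q * x n w) (\<lambda>_. 0)" unfolding bounded_as_conv_def
    proof (intro conjI allI exI)
     show "(\<lambda>w. q * x n w) \<in> Linf M" for n by (rule Linf_cmult[OF xL])
     show "(\<lambda>_. 0) \<in> Linf M" by (rule Linf_const)
     show "AE w in M. \<bar>q * x n w\<bar> \<le> \<bar>q\<bar> * C" for n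
      using C[of n] by eventually_elim (simp add: abs_mult mult_left_mono)
     show "AE w in M. (\<lambda>n. q * x n w) \<longlonglongrightarrow> 0" using xlim by eventually_elim (rule tendsto_mult_right_zero)
    qed
    then have lim: "AE w in M. (\<lambda>n. \<rho> (\<lambda>w. q * x n w) w) \<longlonglongrightarrow> \<rho> (\<lambda>_. 0) w"
     using l unfolding lebesgue_property_def by blast
    have "AE w\<in>a in M. q * \<phi> (x n) w \<le> \<rho> (\<lambda>w. q * x n w) w + c w" for n
     using pconst[OF xL[of n], of q] pup[OF Linf_cmult[OF xL[of n], of q]] by eventually_elim simp
    then have "AE w in M. \<forall>n. w \<in> a \<longrightarrow> q * \<phi> (x n) w \<le> \<rho> (\<lambda>w. q * x n w) w + c w" by (subst AE_all_countable) blast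
    then show ?thesis using lim proof eventually_elim
     case (elim w)
     show ?case proof
      assume w: "w \<in> a"
      have "\<forall>\<^sub>F n in sequentially. \<rho> (\<lambda>w. q * x n w) w < \<rho> (\<lambda>_. 0) w + 1"
       by (rule order_tendstoD(2)[OF elim(2)]) simp
      then show "\<forall>\<^sub>F n in sequentially. q * \<phi> (x n) w \<le> \<rho> (\<lambda>_. 0) w + c w + 1" proof eventually_elim
       case (elim n)
       then show ?case using \<open>\<forall>n. w \<in> a \<longrightarrow> q * \<phi> (x n) w \<le> \<rho> (\<lambda>w. q * x n w) w + c w\<close>[THEN spec, of n] w by linarith
      qed
     qed
    qed
   qed
   have "AE w in M. \<forall>k::nat. w \<in> a \<longrightarrow> (\<forall>\<^sub>F n in sequentially. real k * \<phi> (x n) w \<le> \<rho> (\<lambda>_. 0) w + c w + 1)"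
    by (subst AE_all_countable) (intro allI ev)
   moreover have "AE w in M. \<forall>k::nat. w \<in> a \<longrightarrow> (\<forall>\<^sub>F n in sequentially. - real k * \<phi> (x n) w \<le> \<rho> (\<lambda>_. 0) w + c w + 1)"
    by (subst AE_all_countable) (intro allI ev)
   ultimately have "AE w in M. (\<lambda>n. \<psi> (x n) w) \<longlonglongrightarrow> 0" proof eventually_elim
    case (elim w)
    show ?case proof (cases "w \<in> a")
     case w: True
     define H where "H = \<rho> (\<lambda>_. 0) w + c w + 1"
     have "(\<lambda>n. \<phi> (x n) w) \<longlonglongrightarrow> 0" proof (rule tendstoI)
      fix \<epsilon> :: real assume eps: "0 < \<epsilon>"
      obtain k :: nat where k: "H < real k * \<epsilon>" using reals_Archimedean3[OF eps] by blast
      have "\<forall>\<^sub>F n in sequentially. real k * \<phi> (x n) w \<le> H" "\<forall>\<^sub>F n in sequentially. - real k * \<phi> (x n) w \<le> H"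
       unfolding H_def using elim(1,2)[THEN spec, of k] w by simp_all
      then show "\<forall>\<^sub>F n in sequentially. dist (\<phi> (x n) w) 0 < \<epsilon>" proof eventually_elim
       case (elim n)
       have "real k * \<bar>\<phi> (x n) w\<bar> \<le> H" using elim by (cases "0 \<le> \<phi> (x n) w") (simp_all add: abs_if)
       then have "real k * \<bar>\<phi> (x n) w\<bar> < real k * \<epsilon>" using k by linarith
       then have "\<bar>\<phi> (x n) w\<bar> < \<epsilon>" by (rule mult_left_less_imp_less) simp
       then show ?case by (simp add: dist_real_def)
      qed
     qed
     then show ?thesis using w by (simp add: \<psi>_def)
    qed (simp add: \<psi>_def)
   qed
   then have "(\<lambda>n. \<integral>w. \<psi> (x n) w \<partial>M) \<longlonglongrightarrow> (\<integral>w. 0 \<partial>M)"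
    by (intro integral_dominated_convergence[where w = "\<lambda>_. C"])
     (use L0_M[OF \<psi>F[OF xL]] \<psi>b[OF xL C] in auto)
   from tendsto_minus[OF this] show ?thesis by (simp add: L_def)
  qed
 qed
 then obtain y' where y': "integrable M y'" "\<forall>x\<in>Linf M. L x = (\<integral>w. x w * y' w \<partial>M)" by blast
 define y0 where "y0 w = - y' w" for w
 have y0i: "integrable M y0" unfolding y0_def using y'(1) by simp
 have y0X: "y0 \<in> X1" by (rule integrable_in_X1[OF y0i])
 have int: "(\<integral>w. x w * y0 w \<partial>M) = (\<integral>w. \<psi> x w \<partial>M)" if "x \<in> Linf M" for x
  using y'(2)[THEN bspec, OF that] by (simp add: y0_def L_def)
 have ident: "AE w in M. e x y0 w = \<psi> x w" if x: "x \<in> Linf M" for x proof -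
  have xyi: "integrable M (\<lambda>w. x w * y0 w)" by (rule integrable_Linf_L1[OF x y0i])
  have eF: "e x y0 \<in> L0 F" unfolding e_def by (rule cexp_L0[OF integrable_in_X1[OF xyi]])
  have ei: "integrable M (e x y0)" unfolding e_def by (rule cexp_integral(1)[OF xyi])
  have bal: "(\<integral>w. indicator A w * e x y0 w \<partial>M) = (\<integral>w. indicator A w * \<psi> x w \<partial>M)" if A: "A \<in> sets F" for A
  proof -
   have iA: "indicator A \<in> Linf M" by (rule Linf_ind[OF sets_M[OF A]])
   have iAF: "indicator A \<in> L0 F" using A by simp
   have ix: "(\<lambda>w. indicator A w * x w) \<in> Linf M" by (rule Linf_mult[OF iA x])
   have "(\<integral>w. indicator A w * e x y0 w \<partial>M) = (\<integral>w. (indicator A w * x w) * y0 w \<partial>M)"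
    unfolding e_def integral_indicator_cexp[OF xyi A] by (simp add: mult.assoc)
   also have "\<dots> = (\<integral>w. \<psi> (\<lambda>w. indicator A w * x w) w \<partial>M)" by (rule int[OF ix])
   also have "\<dots> = (\<integral>w. indicator A w * \<psi> x w \<partial>M)" proof (rule integral_cong_AE)
    show "\<psi> (\<lambda>w. indicator A w * x w) \<in> L0 M" by (rule L0_M[OF \<psi>F[OF ix]])
    show "(\<lambda>w. indicator A w * \<psi> x w) \<in> L0 M"
     by (rule borel_measurable_times[OF L0_M[OF iAF] L0_M[OF \<psi>F[OF x]]])
    show "AE w in M. \<psi> (\<lambda>w. indicator A w * x w) w = indicator A w * \<psi> x w"
     using pmult[OF x iAF, of 1] by (auto simp: \<psi>_def indicator_def elim!: eventually_mono)
   qed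
   finally show ?thesis .
  qed
  have ii: "integrable M (\<lambda>w. indicator A w * e x y0 w)" "integrable M (\<lambda>w. indicator A w * \<psi> x w)"
   if A: "A \<in> sets F" for A
   using integrable_Linf_L1[OF Linf_ind[OF sets_M[OF A]] ei] integrable_Linf_L1[OF Linf_ind[OF sets_M[OF A]] \<psi>i[OF x]] by auto
  have "AE w in M. 0 \<le> e x y0 w - \<psi> x w" proof (rule AE_nonneg_from_integrals)
   show "(\<lambda>w. e x y0 w - \<psi> x w) \<in> L0 F" using eF \<psi>F[OF x] by measurable
   show "integrable M (\<lambda>w. e x y0 w - \<psi> x w)" using ei \<psi>i[OF x] by simp
   show "0 \<le> (\<integral>w. indicator A w * (e x y0 w - \<psi> x w) \<partial>M)" if A: "A \<in> sets F" for A
    using bal[OF A] ii[OF A] by (simp add: right_diff_distrib)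
  qed
  moreover have "AE w in M. 0 \<le> \<psi> x w - e x y0 w" proof (rule AE_nonneg_from_integrals)
   show "(\<lambda>w. \<psi> x w - e x y0 w) \<in> L0 F" using eF \<psi>F[OF x] by measurable
   show "integrable M (\<lambda>w. \<psi> x w - e x y0 w)" using ei \<psi>i[OF x] by simp
   show "0 \<le> (\<integral>w. indicator A w * (\<psi> x w - e x y0 w) \<partial>M)" if A: "A \<in> sets F" for A
    using bal[OF A] ii[OF A] by (simp add: right_diff_distrib)
  qed
  ultimately show ?thesis by eventually_elim simp
 qed
 have on_a: "AE w\<in>a in M. e x y0 w = \<phi> x w" if x: "x \<in> Linf M" for x
  using ident[OF x] by eventually_elim (simp add: \<psi>_def)
 have "cobj M y0 a \<in> sublevel M F \<rho> c" unfolding sublevel_facts(2)[OF c y0X a] proof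
  fix x assume x: "x \<in> Linf M"
  show "AE w\<in>a in M. cpair x y0 w \<le> \<rho> x w + c w"
   using on_a[OF x] pup[OF x] unfolding e_def by eventually_elim simp
 qed
 moreover have "{y \<in> Y. AE w\<in>a in M. \<bar>cpair x y w - cpair x y0 w\<bar> \<le> \<epsilon> w} \<in> \<G>"
  if x: "x \<in> Linf M" and eps: "\<epsilon> \<in> L0pos M F" for x \<epsilon> proof -
  have "(AE w\<in>a in M. \<bar>e x y w - e x y0 w\<bar> \<le> \<epsilon> w) \<longleftrightarrow> (AE w\<in>a in M. \<bar>e x y w - \<phi> x w\<bar> \<le> \<epsilon> w)" for y
   by (rule eventually_cong[OF on_a[OF x]]) auto
  then have "near x (\<phi> x) \<epsilon> = {y \<in> Y. AE w\<in>a in M. \<bar>e x y w - e x y0 w\<bar> \<le> \<epsilon> w}" by (simp add: near_def)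
  then show ?thesis using \<phi>G[OF x eps] by (simp add: e_def)
 qed
 ultimately show ?thesis using y0X by (intro exI[of _ y0]) simp
qed

end

context cond_space
begin

text \<open>Nonempty for all finite \<open>V\<close>, these sets witness that a covering has no finite subcovering.\<close>

definition escaping :: "('w \<Rightarrow> real) set \<Rightarrow> 'w set \<Rightarrow> (('w \<Rightarrow> real) \<times> 'w set) set set set \<Rightarrow> ('w \<Rightarrow> real) set" where
 "escaping Y a V = {y \<in> Y. \<forall>U\<in>V. \<forall>d\<in>sets F. le_alg M d a \<longrightarrow> cobj M y d \<in> U \<longrightarrow> (AE w in M. w \<notin> d)}"

lemma escapingD:
 "y \<in> escaping Y a V \<Longrightarrow> U \<in> V \<Longrightarrow> d \<in> sets F \<Longrightarrow> le_alg M d a \<Longrightarrow> cobj M y d \<in> U \<Longrightarrow> AE w in M. w \<notin> d"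
 by (simp add: escaping_def)

lemma AE_notin_pieces:
 assumes "\<And>k::nat. AE w in M. w \<notin> d \<inter> c k" "AE w\<in>d in M. (\<exists>k. w \<in> c k)"
 shows "AE w in M. w \<notin> d" proof -
 have "AE w in M. \<forall>k. w \<notin> d \<inter> c k" using assms(1) by (subst AE_all_countable) blast
 then show ?thesis using assms(2) by eventually_elim blast
qed

lemma escaping_cat_closed:
 assumes Y: "cat_closed Y" "Y \<subseteq> X1" and V: "\<And>U. U \<in> V \<Longrightarrow> gluable U"
 shows "cat_closed (escaping Y a V)" unfolding cat_closed_def proof (intro allI impI)
 fix N :: "'w \<Rightarrow> nat" and s :: "nat \<Rightarrow> 'w \<Rightarrow> real"
 assume N: "N \<in> rnat" and s: "\<forall>k. s k \<in> escaping Y a V"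
 have sY: "s k \<in> Y" for k using s by (simp add: escaping_def)
 have z: "cat N s \<in> Y" by (rule cat_closedD[OF Y(1) N sY])
 have zX: "cat N s \<in> X1" using z Y(2) by blast
 have "AE w in M. w \<notin> d"
  if U: "U \<in> V" and d: "d \<in> sets F" "le_alg M d a" and m: "cobj M (cat N s) d \<in> U" for U d
 proof (rule AE_notin_pieces[where c = "\<lambda>k. {w \<in> space M. N w = k}"])
  fix k
  have dk: "d \<inter> {w \<in> space M. N w = k} \<in> sets F" using d(1) N_level[OF N] by blast
  have "cobj M (cat N s) (d \<inter> {w \<in> space M. N w = k}) \<in> U"
   by (rule gluableD(2)[OF V[OF U] zX d(1) dk m]) (auto intro: le_algI)
  moreover have "cobj M (cat N s) (d \<inter> {w \<in> space M. N w = k}) = cobj M (s k) (d \<inter> {w \<in> space M. N w = k})"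
   by (rule cobj_cong) (auto simp: cat_def)
  moreover have "le_alg M (d \<inter> {w \<in> space M. N w = k}) a"
   using d(2) unfolding le_alg_def by eventually_elim blast
  ultimately show "AE w in M. w \<notin> d \<inter> {w \<in> space M. N w = k}"
   using escapingD[OF s[THEN spec, of k] U dk] by simp
 next
  show "AE w\<in>d in M. (\<exists>k. w \<in> {w \<in> space M. N w = k})" using AE_space by eventually_elim blast
 qed
 then show "cat N s \<in> escaping Y a V" unfolding escaping_def using z by blast
qed

text \<open>Either some element escapes \<open>V\<close>, or \<open>V\<close> covers the whole of \<open>K\<close> on a set of positive
 measure: if no single element escapes, glue those that escape locally and look where none does.\<close>

lemma escaping_nonempty:
 assumes K: "gluable K" and a: "a \<in> sets F" and Y: "Y = {y \<in> X1. cobj M y a \<in> K}" "Y \<noteq> {}" "cat_closed Y"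
  and V: "\<And>U. U \<in> V \<Longrightarrow> gluable U"
  and none: "\<And>b. b \<in> sets F \<Longrightarrow> le_alg M b a \<Longrightarrow> crestrict M F K b \<subseteq> cjoin M F X1 V \<Longrightarrow> AE w in M. w \<notin> b"
 shows "escaping Y a V \<noteq> {}" proof -
 have YX: "y \<in> X1" if "y \<in> Y" for y using that by (simp add: Y)
 obtain y0 where y0: "y0 \<in> Y" using Y(2) by blast
 define \<D> where "\<D> = {d \<in> sets F. le_alg M d a \<and> (\<exists>y. y \<in> Y \<and> (\<forall>U\<in>V. \<forall>d'\<in>sets F. le_alg M d' d \<longrightarrow> cobj M y d' \<in> U \<longrightarrow> (AE w in M. w \<notin> d')))}"
 have "{} \<in> \<D>" unfolding \<D>_def by (intro CollectI conjI exI[of _ y0] ballI impI) (auto simp: le_alg_def y0)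
 then have Dne: "\<D> \<noteq> {}" by blast
 have "\<D> \<subseteq> sets F" unfolding \<D>_def by blast
 from exhaustion[OF this Dne] obtain D where D0: "(\<forall>n::nat. D n \<in> \<D>) \<and> (\<forall>C\<in>\<D>. AE w\<in>C in M. w \<in> (\<Union>n. D n))" by (rule exE)
 have DD: "D n \<in> \<D>" for n using D0 by simp
 have Dex: "AE w\<in>C in M. w \<in> (\<Union>n. D n)" if "C \<in> \<D>" for C using D0[THEN conjunct2] that by (rule bspec)
 have DF: "D n \<in> sets F" for n using DD[of n] by (simp add: \<D>_def)
 have "\<forall>n. \<exists>y. y \<in> Y \<and> (\<forall>U\<in>V. \<forall>d'\<in>sets F. le_alg M d' (D n) \<longrightarrow> cobj M y d' \<in> U \<longrightarrow> (AE w in M. w \<notin> d'))"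
  using DD by (simp add: \<D>_def)
 from choice[OF this] obtain y where y: "\<forall>n. y n \<in> Y \<and> (\<forall>U\<in>V. \<forall>d'\<in>sets F. le_alg M d' (D n) \<longrightarrow> cobj M (y n) d' \<in> U \<longrightarrow> (AE w in M. w \<notin> d'))"
  by (rule exE)
 have yY: "y n \<in> Y" for n using y by simp
 have yesc: "AE w in M. w \<notin> d'" if "U \<in> V" "d' \<in> sets F" "le_alg M d' (D n)" "cobj M (y n) d' \<in> U" for U d' n
  using y[THEN spec, of n, THEN conjunct2, THEN bspec, OF that(1), THEN bspec, OF that(2)] that(3,4) by simp
 define b where "b = a - (\<Union>n. D n)"
 have bF: "b \<in> sets F" unfolding b_def using a DF by auto
 have "crestrict M F K b \<subseteq> cjoin M F X1 V" proof
  fix s assume s: "s \<in> crestrict M F K b"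
  obtain z e where z: "s = cobj M z e" "z \<in> X1" "e \<in> sets F" using gluableD(1)[OF gluable_crestrict[OF K] s] by blast
  have zK: "cobj M z e \<in> K" and eb: "le_alg M e b" using s cobj_in_crestrict[OF K z(2,3)] by (auto simp: z(1))
  define \<E> where "\<E> = {d \<in> sets F. le_alg M d e \<and> (d = {} \<or> (\<exists>U\<in>V. cobj M z d \<in> U))}"
  have "{} \<in> \<E>" by (auto simp: \<E>_def le_alg_def)
  then have Ene: "\<E> \<noteq> {}" by blast
  have "\<E> \<subseteq> sets F" by (auto simp: \<E>_def)
  from exhaustion[OF this Ene] obtain E where E0: "(\<forall>n::nat. E n \<in> \<E>) \<and> (\<forall>C\<in>\<E>. AE w\<in>C in M. w \<in> (\<Union>n. E n))" by (rule exE)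
  have EE: "E n \<in> \<E>" for n using E0 by simp
  have Eex: "AE w\<in>C in M. w \<in> (\<Union>n. E n)" if "C \<in> \<E>" for C using E0[THEN conjunct2] that by (rule bspec)
  have EF: "E n \<in> sets F" for n using EE[of n] by (simp add: \<E>_def)
  define e' where "e' = e - (\<Union>n. E n)"
  have e'F: "e' \<in> sets F" unfolding e'_def using z(3) EF by auto
  define N where "N w = (if w \<in> e' then 0 else 1 :: nat)" for w
  have N: "N \<in> rnat" unfolding N_def using e'F by measurable
  define y' where "y' = cat N (\<lambda>k. if k = 0 then z else y0)"
  have y'X: "y' \<in> X1" unfolding y'_def by (rule cat_X1[OF N]) (use z(2) YX[OF y0] in auto)
  have ea: "AE w\<in>e in M. w \<in> a - (\<Union>n. D n)" using eb by (simp add: le_alg_def b_def)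
  have "cobj M y' a \<in> K" proof (rule gluableD(3)[OF K y'X a, where c = "\<lambda>k::nat. if k = 0 then e' else a - e'"])
   show "(if k = 0 then e' else a - e') \<in> sets F" for k :: nat using a e'F by auto
   show "AE w\<in>a in M. (\<exists>k::nat. w \<in> (if k = 0 then e' else a - e'))"
    by (rule AE_I2) (auto intro: exI[of _ 0] exI[of _ 1])
   have "cobj M z e' \<in> K" by (rule gluableD(2)[OF K z(2,3) e'F zK]) (auto simp: e'_def intro: le_algI)
   moreover have "cobj M y' e' = cobj M z e'" by (rule cobj_cong) (auto simp: y'_def cat_def N_def)
   moreover have "cobj M y0 (a - e') \<in> K"
    by (rule gluableD(2)[OF K YX[OF y0] a]) (use y0 a e'F in \<open>auto simp: Y intro: le_algI\<close>)
   moreover have "cobj M y' (a - e') = cobj M y0 (a - e')" by (rule cobj_cong) (auto simp: y'_def cat_def N_def)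
   ultimately show "cobj M y' (if k = 0 then e' else a - e') \<in> K" for k :: nat by simp
  qed
  then have y'Y: "y' \<in> Y" using y'X by (simp add: Y)
  have "AE w in M. w \<notin> d" if U: "U \<in> V" and d: "d \<in> sets F" "le_alg M d e'" and m: "cobj M y' d \<in> U" for U d
  proof -
   have de: "AE w\<in>d in M. w \<in> e'" using d(2) by (simp add: le_alg_def)
   have "cobj M y' d = cobj M z d"
    by (rule cobj_cong) (use de in \<open>eventually_elim, auto simp: y'_def cat_def N_def\<close>)
   then have "cobj M z d \<in> U" using m by simp
   moreover have "le_alg M d e" unfolding le_alg_def using de by eventually_elim (auto simp: e'_def)
   ultimately have "d \<in> \<E>" using U d(1) by (auto simp: \<E>_def)
   from Eex[OF this] de show ?thesis by eventually_elim (auto simp: e'_def)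
  qed
  moreover have "le_alg M e' a" unfolding le_alg_def using ea by eventually_elim (auto simp: e'_def)
  ultimately have "e' \<in> \<D>" unfolding \<D>_def using e'F y'Y by blast
  from Dex[OF this] ea have e'0: "AE w in M. w \<notin> e'" by eventually_elim (auto simp: e'_def)
  have "covered V z e" unfolding covered_def proof (intro exI[of _ E] conjI allI)
   show "E k \<in> sets F" for k by (rule EF)
   show "AE w\<in>e in M. (\<exists>k. w \<in> E k)" using e'0 by eventually_elim (auto simp: e'_def)
   show "(AE w in M. w \<notin> E k) \<or> (\<exists>U\<in>V. cobj M z (E k) \<in> U)" for k using EE[of k] by (auto simp: \<E>_def)
  qed
  then show "s \<in> cjoin M F X1 V" unfolding z(1) by (rule covered_imp_cjoin[OF z(2,3)])
 qed
 then have b0: "AE w in M. w \<notin> b" by (rule none[OF bF, rotated]) (auto simp: b_def intro: le_algI)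
 define N where "N = idx D"
 have N: "N \<in> rnat" unfolding N_def by (rule idx_measurable[of D, OF DF])
 have gY: "cat N y \<in> Y" by (rule cat_closedD[OF Y(3) N yY])
 have "AE w in M. w \<notin> d" if U: "U \<in> V" and d: "d \<in> sets F" "le_alg M d a" and m: "cobj M (cat N y) d \<in> U" for U d
 proof (rule AE_notin_pieces[where c = "\<lambda>k. {w \<in> space M. N w = k} \<inter> D k"])
  fix k
  have dk: "d \<inter> ({w \<in> space M. N w = k} \<inter> D k) \<in> sets F" using d(1) N_level[OF N] DF by blast
  have "cobj M (cat N y) (d \<inter> ({w \<in> space M. N w = k} \<inter> D k)) \<in> U"
   by (rule gluableD(2)[OF V[OF U] YX[OF gY] d(1) dk m]) (auto intro: le_algI)
  moreover have "cobj M (cat N y) (d \<inter> ({w \<in> space M. N w = k} \<inter> D k)) = cobj M (y k) (d \<inter> ({w \<in> space M. N w = k} \<inter> D k))"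
   by (rule cobj_cong) (auto simp: cat_def)
  moreover have "le_alg M (d \<inter> ({w \<in> space M. N w = k} \<inter> D k)) (D k)" by (auto intro: le_algI)
  ultimately show "AE w in M. w \<notin> d \<inter> ({w \<in> space M. N w = k} \<inter> D k)" using yesc[OF U dk, of k] by simp
 next
  show "AE w\<in>d in M. (\<exists>k. w \<in> {w \<in> space M. N w = k} \<inter> D k)" using b0 d(2)[unfolded le_alg_def] AE_space
   by eventually_elim (auto simp: b_def N_def intro: idx_in)
 qed
 then have "cat N y \<in> escaping Y a V" unfolding escaping_def using gY by blast
 then show ?thesis by blast
qed

text \<open>A cluster point of the stable ultrafilter cannot lie in an open set that all its members
 escape. A conditionally finite set of test functions is \<open>x\<^sub>1, \<dots>, x\<^sub>n\<close> with a random
 \<open>n\<close>; on \<open>{n = j}\<close> only \<open>j\<close> of them matter, so deterministic finite intersections suffice.\<close>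

lemma cluster_point_not_in_open:
 assumes a: "a \<in> sets F" and YX: "Y \<subseteq> X1" and G: "stable_ultrafilter Y \<G>" and U: "weak_open M F U"
  and esc: "escaping Y a {U} \<in> \<G>" and y0: "y0 \<in> X1"
  and near: "\<And>x \<epsilon>. x \<in> Linf M \<Longrightarrow> \<epsilon> \<in> L0pos M F \<Longrightarrow> {y \<in> Y. AE w in M. w \<in> a \<longrightarrow>
   \<bar>cpair x y w - cpair x y0 w\<bar> \<le> \<epsilon> w} \<in> \<G>" and b: "b \<in> sets F" "b \<subseteq> a" and y0U: "cobj M y0 b \<in> U"
 shows "AE w in M. w \<notin> b" proof -
 note UU = U[unfolded weak_open_def]
 from UU[THEN conjunct2, THEN bspec, OF y0, THEN bspec, OF b(1), THEN mp, OF y0U]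
 obtain r G' where r: "r \<in> L0pos M F" and cf: "cfinite M F (Xinf) G'"
  and sub: "crestrict M F (weak_nbhd M F G' r y0) b \<subseteq> U" by (elim bexE exE conjE)
 obtain n f where n: "n \<in> L0N F" and f: "stable_fun M F {k \<in> L0N F. AE w in M. 1 \<le> k w \<and> k w \<le> n w} (Xinf) f"
  and G': "G' = {cobj M (f k) b | k b. k \<in> {k \<in> L0N F. AE w in M. 1 \<le> k w \<and> k w \<le> n w} \<and> b \<in> sets F}"
  using cf unfolding cfinite_def Let_def by (elim bexE exE conjE)
 define I where "I = {k \<in> L0N F. AE w in M. 1 \<le> k w \<and> k w \<le> n w}"
 have nm: "n \<in> rnat" by (rule L0N_measurable[OF n])
 have n1: "AE w in M. 1 \<le> n w" using L0N_ge[OF n] by (rule AE_I2)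
 define \<kappa> where "\<kappa> i w = max 1 (min i (n w))" for i :: nat and w
 have \<kappa>I: "\<kappa> i \<in> I" for i proof -
  have "\<kappa> i \<in> L0N F" proof (rule L0N_I)
   show "\<kappa> i \<in> rnat" unfolding \<kappa>_def using nm by measurable
  qed (simp add: \<kappa>_def)
  moreover have "AE w in M. 1 \<le> \<kappa> i w \<and> \<kappa> i w \<le> n w" using n1 by eventually_elim (auto simp: \<kappa>_def)
  ultimately show ?thesis by (simp add: I_def)
 qed
 define x where "x i = f (\<kappa> i)" for i
 have fI: "f k \<in> Xinf" if "k \<in> I" for k using f[unfolded stable_fun_def, THEN conjunct1] that by (simp add: I_def)
 have xc: "x i \<in> Xinf" for i unfolding x_def by (rule fI[OF \<kappa>I])
 have rF: "r \<in> L0 F" and r0: "AE w in M. 0 < r w" using r by (auto simp: L0pos_def)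
 define E where "E i = {y \<in> Y. AE w\<in>a in M. \<bar>cexp M F (\<lambda>v. x i v * (y v - y0 v)) w\<bar> \<le> r w}" for i
 have EG: "\<exists>S\<in>\<G>. S \<subseteq> E i" for i proof -
  obtain \<eta> where e: "\<eta> \<in> L0 F" "\<And>w. 1 \<le> \<eta> w" "AE w in M. \<bar>x i w\<bar> \<le> \<eta> w" using XinfE[OF xc[of i]] by blast
  have epos: "0 < \<eta> w" for w using e(2)[of w] by simp
  define x' where "x' w = x i w / \<eta> w" for w
  have x'L: "x' \<in> Linf M" proof (rule LinfI[of _ 1])
   show "x' \<in> L0 M" unfolding x'_def using Xinf_borel[OF xc[of i]] L0_M[OF e(1)] by measurable
   show "AE w in M. \<bar>x' w\<bar> \<le> 1" using e(3) proof eventually_elim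
    case (elim w) then show ?case using epos[of w] by (simp add: x'_def abs_div)
   qed
  qed
  have "AE w in M. 0 < r w / \<eta> w" using r0 by eventually_elim (simp add: epos)
  moreover have "(\<lambda>w. r w / \<eta> w) \<in> L0 F" using rF e(1) by measurable
  ultimately have re: "(\<lambda>w. r w / \<eta> w) \<in> L0pos M F" by (simp add: L0pos_def)
  define S where "S = {y \<in> Y. AE w\<in>a in M. \<bar>cpair x' y w - cpair x' y0 w\<bar> \<le> r w / \<eta> w}"
  have "S \<subseteq> E i" proof
   fix y assume y: "y \<in> S"
   have yX: "y \<in> X1" using y YX by (auto simp: S_def)
   note x'c = Linf_in_Xinf[OF x'L]
   have "(\<lambda>v. \<eta> v * (x' v * (y v - y0 v))) = (\<lambda>v. x i v * (y v - y0 v))" using epos by (auto simp: x'_def less_imp_neq[symmetric])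
   then have "AE w in M. cexp M F (\<lambda>v. x i v * (y v - y0 v)) w = \<eta> w * cexp M F (\<lambda>v. x' v * (y v - y0 v)) w"
    using cexp_mult[OF e(1) X1_mult[OF x'c X1_diff[OF yX y0]]] by simp
   moreover have "AE w in M. cexp M F (\<lambda>v. x' v * (y v - y0 v)) w = cpair x' y w - cpair x' y0 w"
    using cexp_diff[OF X1_mult[OF x'c yX] X1_mult[OF x'c y0]] by (simp add: right_diff_distrib)
   moreover have "AE w\<in>a in M. \<bar>cpair x' y w - cpair x' y0 w\<bar> \<le> r w / \<eta> w" using y by (simp add: S_def)
   ultimately have "AE w\<in>a in M. \<bar>cexp M F (\<lambda>v. x i v * (y v - y0 v)) w\<bar> \<le> r w" proof eventually_elim
    case (elim w) then show ?case using epos[of w] by (simp add: abs_mult pos_le_divide_eq mult.commute)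
   qed
   then show "y \<in> E i" using y by (simp add: E_def S_def)
  qed
  moreover have "S \<in> \<G>" unfolding S_def by (rule near[OF x'L re])
  ultimately show ?thesis by blast
 qed
 have "\<exists>S\<in>\<G>. S \<subseteq> escaping Y a {U} \<and> (\<forall>i\<le>j. S \<subseteq> E i)" for j proof (induction j)
  case 0
  obtain S where S: "S \<in> \<G>" "S \<subseteq> E 0" using EG[of 0] by blast
  show ?case using stable_ultrafilterD(5)[OF G esc S(1)] S(2) by (intro bexI[of _ "escaping Y a {U} \<inter> S"]) auto
 next
  case (Suc j)
  then obtain S where S: "S \<in> \<G>" "S \<subseteq> escaping Y a {U}" "\<forall>i\<le>j. S \<subseteq> E i" by blast
  obtain S' where S': "S' \<in> \<G>" "S' \<subseteq> E (Suc j)" using EG[of "Suc j"] by blast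
  have "S \<inter> S' \<subseteq> E i" if "i \<le> Suc j" for i using S(3) S'(2) that by (auto simp: le_Suc_eq)
  then show ?case using stable_ultrafilterD(5)[OF G S(1) S'(1)] S(2) by (intro bexI[of _ "S \<inter> S'"]) auto
 qed
 then have "\<exists>s. s \<in> escaping Y a {U} \<and> (\<forall>i\<le>j. s \<in> E i)" for j proof -
  obtain S where S: "S \<in> \<G>" "S \<subseteq> escaping Y a {U}" "\<forall>i\<le>j. S \<subseteq> E i"
   using \<open>\<exists>S\<in>\<G>. S \<subseteq> escaping Y a {U} \<and> (\<forall>i\<le>j. S \<subseteq> E i)\<close> by blast
  have "S \<noteq> {}" using S(1) stable_ultrafilterD(2)[OF G] by metis
  then show ?thesis using S(2,3) by blast
 qed
 then have "\<forall>j. \<exists>s. s \<in> escaping Y a {U} \<and> (\<forall>i\<le>j. s \<in> E i)" by blast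
 from choice[OF this] obtain s where s: "\<forall>j. s j \<in> escaping Y a {U} \<and> (\<forall>i\<le>j. s j \<in> E i)" by (rule exE)
 have sC: "s j \<in> escaping Y a {U}" and sE: "i \<le> j \<Longrightarrow> s j \<in> E i" for i j using s by simp_all
 have sX: "s j \<in> X1" for j using sC[of j] YX by (auto simp: escaping_def)
 define z where "z = cat n s"
 have zC: "z \<in> escaping Y a {U}" unfolding z_def by (rule cat_closedD[OF stable_ultrafilterD(3)[OF G esc] nm sC])
 have zX: "z \<in> X1" using zC YX by (auto simp: escaping_def)
 define N where "N w = (if w \<in> a then 0 else 1 :: nat)" for w
 have N: "N \<in> rnat" unfolding N_def using a by measurable
 define z' where "z' = cat N (\<lambda>k. if k = 0 then z else y0)"
 have z'X: "z' \<in> X1" unfolding z'_def by (rule cat_X1[OF N]) (use zX y0 in auto)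
 have "cobj M z' b \<in> crestrict M F (weak_nbhd M F G' r y0) b" proof (rule weak_nbhdI[OF z'X b(1)])
  fix t assume t: "t \<in> Xinf" and tG: "cobj M t (space M) \<in> G'"
  obtain k d where k: "cobj M t (space M) = cobj M (f k) d" "k \<in> I"
   using tG unfolding G' I_def[symmetric] by blast
  have tf: "AE w in M. t w = f k w" using k(1)[unfolded cobj_eq_iff, THEN conjunct2] AE_space by eventually_elim simp
  have kN: "k \<in> L0N F" and kn: "AE w in M. 1 \<le> k w \<and> k w \<le> n w" using k(2) by (auto simp: I_def)
  note km = L0N_measurable[OF kN]
  have off: "AE w\<in>space M - a in M. \<bar>cexp M F (\<lambda>v. t v * (z' v - y0 v)) w\<bar> \<le> r w" proof -
   have "AE w\<in>space M - a in M. cexp M F (\<lambda>v. t v * (z' v - y0 v)) w = cexp M F (\<lambda>_. 0) w"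
   proof (rule cexp_local[OF X1_mult[OF t X1_diff[OF z'X y0]] Xinf_in_X1[OF Xinf_const]])
    show "space M - a \<in> sets F" using a sets.compl_sets[OF a] by (simp add: space_F)
   qed (auto simp: z'_def cat_def N_def)
   then show ?thesis using cexp_F[OF borel_measurable_const, of 0] r0 by eventually_elim simp
  qed
  have on: "AE w in M. w \<in> a \<inter> {w \<in> space M. n w = j} \<inter> {w \<in> space M. k w = i} \<longrightarrow> \<bar>cexp M F (\<lambda>v. t v * (z' v - y0 v)) w\<bar> \<le> r w" for i j
  proof (cases "1 \<le> i \<and> i \<le> j")
   case ij: True
   let ?A = "a \<inter> {w \<in> space M. n w = j} \<inter> {w \<in> space M. k w = i}"
   have AF: "?A \<in> sets F" using a N_level[OF nm] N_level[OF km] by blast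
   have "AE w\<in>?A in M. f k w = f (\<kappa> i) w"
    by (rule stable_fun_local[OF f[folded I_def] k(2) \<kappa>I AF]) (use ij in \<open>auto simp: \<kappa>_def\<close>)
   then have "AE w\<in>?A in M. t w * (z' w - y0 w) = x i w * (s j w - y0 w)"
    using tf by eventually_elim (auto simp: x_def z'_def z_def cat_def N_def)
   from cexp_local[OF X1_mult[OF t X1_diff[OF z'X y0]] X1_mult[OF xc X1_diff[OF sX y0]] AF this]
   have "AE w\<in>?A in M. cexp M F (\<lambda>v. t v * (z' v - y0 v)) w = cexp M F (\<lambda>v. x i v * (s j v - y0 v)) w" .
   moreover have "AE w\<in>a in M. \<bar>cexp M F (\<lambda>v. x i v * (s j v - y0 v)) w\<bar> \<le> r w"
    using sE[of i j] ij by (simp add: E_def)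
   ultimately show ?thesis by eventually_elim auto
  next
   case False
   show ?thesis using kn by eventually_elim (use False in auto)
  qed
  have "AE w in M. \<forall>i j. w \<in> a \<inter> {w \<in> space M. n w = j} \<inter> {w \<in> space M. k w = i} \<longrightarrow> \<bar>cexp M F (\<lambda>v. t v * (z' v - y0 v)) w\<bar> \<le> r w"
   unfolding AE_all_countable by (intro allI on)
  then show "AE w in M. \<bar>cexp M F (\<lambda>v. t v * (z' v - y0 v)) w\<bar> \<le> r w" using off AE_space
   by eventually_elim blast
 qed
 then have "cobj M z' b \<in> U" using sub by blast
 moreover have "cobj M z' b = cobj M z b" by (rule cobj_cong) (use b(2) in \<open>auto simp: z'_def cat_def N_def\<close>)
 ultimately show ?thesis using escapingD[OF zC _ b(1) le_algI[OF b(2)], of U] by simp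
qed

end

context cond_risk
begin

text \<open>Exhaust the sets on which a finite subfamily suffices. Should a non-null set remain, the
  escaping elements generate a stable ultrafilter, whose cluster point lies in some member of the
  covering on a non-null piece.\<close>

lemma lebesgue_imp_compact:
 assumes l: "lebesgue_property M \<rho>" and c: "c \<in> L0 F"
 shows "cond_weakly_compact M F (sublevel M F \<rho> c)" proof -
 define K where "K = sublevel M F \<rho> c"
 have K: "gluable K" unfolding K_def by (rule sublevel_facts(1)[OF c])
 from gluable_imp_csubset[OF K] obtain a0 where Ka0: "csubset_on M F X1 a0 K" by (rule exE)
 have a0F: "a0 \<in> sets F" using Ka0 by (simp add: csubset_on_def)
 obtain Y0 where Y0: "stable M F X1 Y0" "K = csub M F Y0 a0" using Ka0 unfolding csubset_on_def by blast
 show ?thesis unfolding cond_weakly_compact_def K_def[symmetric] proof (intro exI[of _ a0] conjI allI impI Ka0)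
  fix \<U> assume cover: "(\<forall>U\<in>\<U>. weak_open M F U) \<and> concat_closed M F X1 \<U> \<and> K \<subseteq> cjoin M F X1 \<U>"
  have Uop: "weak_open M F U" if "U \<in> \<U>" for U using conjunct1[OF cover] that by (rule bspec)
  have KU: "K \<subseteq> cjoin M F X1 \<U>" using cover by simp
  have Ug: "gluable U" if "U \<in> \<U>" for U
   using Uop[OF that, unfolded weak_open_def, THEN conjunct1] by (simp add: csubset_iff_gluable)
  define \<C> where "\<C> = {b \<in> sets F. le_alg M b a0 \<and> (\<exists>V. finite V \<and> V \<subseteq> \<U> \<and> crestrict M F K b \<subseteq> cjoin M F X1 V)}"
  have "crestrict M F K {} \<subseteq> cjoin M F X1 {}" proof
   fix s assume s: "s \<in> crestrict M F K {}"
   obtain z e where z: "s = cobj M z e" "z \<in> X1" "e \<in> sets F" using gluableD(1)[OF gluable_crestrict[OF K] s] by blast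
   have "le_alg M e {}" using s cobj_in_crestrict[OF K z(2,3)] by (simp add: z(1))
   then have "covered {} z e" unfolding covered_def by (intro exI[of _ "\<lambda>_. e"]) (auto simp: le_alg_def z(3))
   then show "s \<in> cjoin M F X1 {}" unfolding z(1) by (rule covered_imp_cjoin[OF z(2,3)])
  qed
  then have "{} \<in> \<C>" unfolding \<C>_def by (intro CollectI conjI exI[of _ "{}"]) (auto simp: le_alg_def)
  then have Cne: "\<C> \<noteq> {}" by blast
  have "\<C> \<subseteq> sets F" unfolding \<C>_def by blast
  from exhaustion[OF this Cne] obtain b where b0: "(\<forall>n::nat. b n \<in> \<C>) \<and> (\<forall>C\<in>\<C>. AE w\<in>C in M. w \<in> (\<Union>n. b n))" by (rule exE)
  have bC: "b n \<in> \<C>" for n using b0 by simp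
  have bex: "AE w\<in>C in M. w \<in> (\<Union>n. b n)" if "C \<in> \<C>" for C using conjunct2[OF b0] that by (rule bspec)
  have bF: "b n \<in> sets F" and ba: "le_alg M (b n) a0" for n using bC[of n] by (simp_all add: \<C>_def)
  have "\<forall>n. \<exists>V. finite V \<and> V \<subseteq> \<U> \<and> crestrict M F K (b n) \<subseteq> cjoin M F X1 V" using bC by (simp add: \<C>_def)
  from choice[OF this] obtain V where V: "\<forall>n. finite (V n) \<and> V n \<subseteq> \<U> \<and> crestrict M F K (b n) \<subseteq> cjoin M F X1 (V n)" by (rule exE)
  define a where "a = a0 - (\<Union>n. b n)"
  have aF: "a \<in> sets F" unfolding a_def using a0F bF by auto
  have null: "AE w in M. w \<notin> a" proof -
   define Y where "Y = {y \<in> X1. cobj M y a \<in> K}"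
   have YX: "Y \<subseteq> X1" by (auto simp: Y_def)
   have Ycc: "cat_closed Y" unfolding Y_def K_def by (rule sublevel_cat_closed[OF c aF])
   obtain y1 where y1: "y1 \<in> Y0" using Y0(1) unfolding stable_def by blast
   have "y1 \<in> X1" using Y0(1) y1 unfolding stable_def by blast
   moreover have "cobj M y1 a \<in> K" unfolding Y0(2) csub_def using y1 aF by (auto simp: a_def intro!: le_algI)
   ultimately have Yne: "Y \<noteq> {}" by (auto simp: Y_def)
   have esc_ne: "escaping Y a W \<noteq> {}" if W: "finite W" "W \<subseteq> \<U>" for W
   proof (rule escaping_nonempty[OF K aF Y_def Yne Ycc])
    show "gluable U" if "U \<in> W" for U using Ug W(2) that by blast
    fix d assume d: "d \<in> sets F" "le_alg M d a" "crestrict M F K d \<subseteq> cjoin M F X1 W"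
    have "le_alg M d a0" using d(2) unfolding le_alg_def by eventually_elim (simp add: a_def)
    then have "d \<in> \<C>" unfolding \<C>_def using d(1,3) W by blast
    from bex[OF this] d(2)[unfolded le_alg_def] show "AE w in M. w \<notin> d" by eventually_elim (auto simp: a_def)
   qed
   have esc_Int: "escaping Y a W \<inter> escaping Y a W' = escaping Y a (W \<union> W')" for W W'
    by (auto simp: escaping_def)
   define \<F> where "\<F> = escaping Y a ` {W. finite W \<and> W \<subseteq> \<U>}"
   have "\<exists>\<G>. \<F> \<subseteq> \<G> \<and> (\<forall>S\<in>\<G>. cat_closed S \<and> S \<subseteq> Y) \<and> {} \<notin> \<G> \<and> (\<forall>S\<in>\<G>. \<forall>T\<in>\<G>. S \<inter> T \<in> \<G>) \<and>
    (\<forall>T. cat_closed T \<and> T \<subseteq> Y \<longrightarrow> (\<forall>S\<in>\<G>. S \<inter> T \<noteq> {}) \<longrightarrow> T \<in> \<G>)"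
   proof (rule maximal_filter_base[where P = "\<lambda>S. cat_closed S \<and> S \<subseteq> Y"])
    show "cat_closed (S \<inter> T) \<and> S \<inter> T \<subseteq> Y" if "cat_closed S \<and> S \<subseteq> Y" "cat_closed T \<and> T \<subseteq> Y" for S T
     using that by (auto simp: cat_closed_def)
    show "cat_closed S \<and> S \<subseteq> Y" if S: "S \<in> \<F>" for S proof -
     obtain W where W: "W \<subseteq> \<U>" "S = escaping Y a W" using S by (auto simp: \<F>_def)
     have "cat_closed S" unfolding W(2) by (rule escaping_cat_closed[OF Ycc YX]) (use Ug W(1) in blast)
     then show ?thesis unfolding W(2) by (auto simp: escaping_def)
    qed
    show "\<F> \<noteq> {}" unfolding \<F>_def by blast
    show "{} \<notin> \<F>" using esc_ne by (auto simp: \<F>_def)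
    show "S \<inter> T \<in> \<F>" if ST: "S \<in> \<F>" "T \<in> \<F>" for S T proof -
     obtain W W' where "finite W" "W \<subseteq> \<U>" "S = escaping Y a W" "finite W'" "W' \<subseteq> \<U>" "T = escaping Y a W'"
      using ST by (auto simp: \<F>_def)
     then show ?thesis unfolding \<F>_def by (intro image_eqI[of _ _ "W \<union> W'"]) (auto simp: esc_Int)
    qed
   qed
   then obtain \<G> where FG: "\<F> \<subseteq> \<G>" and G0: "(\<forall>S\<in>\<G>. cat_closed S \<and> S \<subseteq> Y) \<and> {} \<notin> \<G> \<and> (\<forall>S\<in>\<G>. \<forall>T\<in>\<G>. S \<inter> T \<in> \<G>) \<and>
    (\<forall>T. cat_closed T \<and> T \<subseteq> Y \<longrightarrow> (\<forall>S\<in>\<G>. S \<inter> T \<noteq> {}) \<longrightarrow> T \<in> \<G>)" by (elim exE conjE[of "\<F> \<subseteq> _"])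
   have escG: "escaping Y a W \<in> \<G>" if "finite W" "W \<subseteq> \<U>" for W using FG that unfolding \<F>_def by blast
   have "escaping Y a {} \<in> \<G>" by (rule escG) auto
   then have Gne: "\<G> \<noteq> {}" by blast
   have G: "stable_ultrafilter Y \<G>" unfolding stable_ultrafilter_def by (rule conjI[OF Gne G0])
   from stable_ultrafilter_cluster_point[OF l c aF Y_def[unfolded K_def] G]
   obtain y0 where y0: "y0 \<in> X1 \<and> cobj M y0 a \<in> sublevel M F \<rho> c \<and> (\<forall>x\<in>Linf M. \<forall>\<epsilon>\<in>L0pos M F.
    {y \<in> Y. AE w\<in>a in M. \<bar>cpair x y w - cpair x y0 w\<bar> \<le> \<epsilon> w} \<in> \<G>)" by (rule exE)
   have y0X: "y0 \<in> X1" and y0K: "cobj M y0 a \<in> K" using y0 by (simp_all add: K_def)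
   have near: "{y \<in> Y. AE w\<in>a in M. \<bar>cpair x y w - cpair x y0 w\<bar> \<le> \<epsilon> w} \<in> \<G>"
    if "x \<in> Linf M" "\<epsilon> \<in> L0pos M F" for x \<epsilon>
    using y0[THEN conjunct2, THEN conjunct2, THEN bspec, OF that(1)] that(2) by (rule bspec)
   have "cobj M y0 a \<in> cjoin M F X1 \<U>" using y0K KU by blast
   from cjoin_imp_covered[OF Ug y0X aF this] obtain d where d: "(\<forall>k::nat. d k \<in> sets F) \<and> (AE w\<in>a in M. (\<exists>k. w \<in> d k)) \<and>
    (\<forall>k. (AE w in M. w \<notin> d k) \<or> (\<exists>U\<in>\<U>. cobj M y0 (d k) \<in> U))" unfolding covered_def by (rule exE)
   have dF: "d k \<in> sets F" for k using d by simp
   show ?thesis proof (rule AE_notin_pieces[where c = d])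
    show "AE w\<in>a in M. (\<exists>k. w \<in> d k)" using d by simp
    fix k
    have ad: "a \<inter> d k \<in> sets F" using aF dF by blast
    have "(AE w in M. w \<notin> d k) \<or> (\<exists>U\<in>\<U>. cobj M y0 (d k) \<in> U)" using d by simp
    then show "AE w in M. w \<notin> a \<inter> d k" proof
     assume "AE w in M. w \<notin> d k" then show ?thesis by eventually_elim simp
    next
     assume "\<exists>U\<in>\<U>. cobj M y0 (d k) \<in> U"
     then obtain U where U: "U \<in> \<U>" "cobj M y0 (d k) \<in> U" by blast
     have "cobj M y0 (a \<inter> d k) \<in> U" by (rule gluableD(2)[OF Ug[OF U(1)] y0X dF ad U(2)]) (auto intro: le_algI)
     moreover have "escaping Y a {U} \<in> \<G>" by (rule escG) (use U(1) in auto)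
     ultimately show ?thesis using cluster_point_not_in_open[OF aF YX G Uop[OF U(1)] _ y0X near ad] by blast
    qed
   qed
  qed
  show "\<exists>A\<in>partitions M F a0. \<exists>\<V>. \<forall>k. finite (\<V> k) \<and> \<V> k \<subseteq> \<U> \<and> crestrict M F K (A k) \<subseteq> cjoin M F X1 (\<V> k)"
  proof (intro bexI[of _ "disjointed b"] exI[of _ V] allI)
   fix k
   have "crestrict M F K (disjointed b k) \<subseteq> crestrict M F K (b k)" proof
    fix s assume s: "s \<in> crestrict M F K (disjointed b k)"
    obtain z e where z: "s = cobj M z e" "z \<in> X1" "e \<in> sets F" using gluableD(1)[OF gluable_crestrict[OF K] s] by blast
    have e: "cobj M z e \<in> K" "le_alg M e (disjointed b k)" using s cobj_in_crestrict[OF K z(2,3)] by (auto simp: z(1))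
    have "le_alg M e (b k)" using e(2) disjointed_subset[of b k] unfolding le_alg_def by (auto elim!: eventually_mono)
    then show "s \<in> crestrict M F K (b k)" using e(1) cobj_in_crestrict[OF K z(2,3)] by (simp add: z(1))
   qed
   then show "finite (V k) \<and> V k \<subseteq> \<U> \<and> crestrict M F K (disjointed b k) \<subseteq> cjoin M F X1 (V k)" using V by blast
  next
   have dF: "disjointed b k \<in> sets F" for k using sets.range_disjointed_sets[of b F] bF by blast
   have "AE w in M. \<forall>k. w \<in> b k \<longrightarrow> w \<in> a0" using ba unfolding le_alg_def by (subst AE_all_countable) blast
   then have "AE w in M. w \<in> a0 \<longleftrightarrow> w \<in> (\<Union>k. disjointed b k)" unfolding UN_disjointed_eq using null
    by eventually_elim (auto simp: a_def)
   moreover have "AE w in M. w \<notin> disjointed b i \<inter> disjointed b j" if "i \<noteq> j" for i j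
    using disjoint_family_disjointed[of b] that by (auto simp: disjoint_family_on_def)
   ultimately show "disjointed b \<in> partitions M F a0" using dF by (simp add: partitions_def)
  qed
 qed
qed

end

theorem theorem2p7:
  fixes M F :: "'w measure" and \<rho> :: "('w \<Rightarrow> real) \<Rightarrow> 'w \<Rightarrow> real"
  assumes "prob_space M" and "subalgebra M F"
    and "convex_risk_measure M F \<rho>"
    and "fatou_property M \<rho>"
  shows "(lebesgue_property M \<rho> \<longleftrightarrow>
            (\<forall>c\<in>L0 F. cond_weakly_compact M F (sublevel M F \<rho> c))) \<and>
         (lebesgue_property M \<rho> \<longleftrightarrow> cond_lebesgue_property M F \<rho>) \<and>
         (lebesgue_property M \<rho> \<longleftrightarrow>
            (\<forall>x\<in>Linf M. \<exists>y\<in>L1 M. (AE w in M. y w \<le> 0) \<and> (AE w in M. cexp M F y w = -1) \<and>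
               (AE w in M. ereal (\<rho> x w) =
                  ereal (cexp M F (\<lambda>v. x v * y v) w) - conj_fun M F (Linf M) \<rho> y w))) \<and>
         (lebesgue_property M \<rho> \<longleftrightarrow>
            (\<forall>x\<in>Linf_cond M F. \<exists>y\<in>L1_cond M F.
               (AE w in M. y w \<le> 0) \<and> (AE w in M. cexp M F y w = -1) \<and>
               (AE w in M. ereal (\<rho> x w) =
                  ereal (cexp M F (\<lambda>v. x v * y v) w) - conj_fun M F (Linf_cond M F) \<rho> y w)))"
proof -
  interpret prob_space M by (rule assms(1))
  interpret finite_measure_subalgebra M F by unfold_locales (rule assms(2))
  interpret cond_risk M F \<rho> by unfold_locales (rule assms(3))
  note f = assms(4)
  have Linf: "Linf M \<subseteq> Linf_cond M F" using Linf_in_Xinf by blast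
  have "lebesgue_property M \<rho> \<longleftrightarrow> (\<forall>c\<in>L0 F. cond_weakly_compact M F (sublevel M F \<rho> c))"
    using lebesgue_imp_compact compact_imp_lebesgue[OF f] by blast
  moreover have "lebesgue_property M \<rho> \<longleftrightarrow> cond_lebesgue_property M F \<rho>"
    using lebesgue_imp_cond_lebesgue cond_lebesgue_imp_lebesgue by blast
  moreover have "lebesgue_property M \<rho> \<longleftrightarrow>
      (\<forall>x\<in>Linf M. \<exists>y\<in>L1 M. (AE w in M. y w \<le> 0) \<and> (AE w in M. cexp M F y w = -1) \<and>
        (AE w in M. ereal (\<rho> x w) = ereal (cpair x y w) - conj_fun M F (Linf M) \<rho> y w))" (is "_ \<longleftrightarrow> ?att")
  proof
    assume l: "lebesgue_property M \<rho>"
    show ?att by (intro ballI lebesgue_imp_attained[OF l Linf])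
  next
    assume att: ?att
    show "lebesgue_property M \<rho>"
    proof (rule attained_imp_lebesgue[OF subset_refl Linf])
      fix x assume "x \<in> Linf M"
      with att obtain y where "y \<in> L1 M" "(AE w in M. y w \<le> 0) \<and> (AE w in M. cexp M F y w = -1) \<and>
        (AE w in M. ereal (\<rho> x w) = ereal (cpair x y w) - conj_fun M F (Linf M) \<rho> y w)" by blast
      then show "\<exists>y\<in>X1. (AE w in M. y w \<le> 0) \<and> (AE w in M. cexp M F y w = -1) \<and>
        (AE w in M. ereal (\<rho> x w) = ereal (cpair x y w) - conj_fun M F (Linf M) \<rho> y w)"
        by (intro bexI[of _ y]) (auto intro: L1_in_X1)
    qed
  qed
  moreover have "lebesgue_property M \<rho> \<longleftrightarrow>
      (\<forall>x\<in>Xinf. \<exists>y\<in>X1. (AE w in M. y w \<le> 0) \<and> (AE w in M. cexp M F y w = -1) \<and>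
        (AE w in M. ereal (\<rho> x w) = ereal (cpair x y w) - conj_fun M F Xinf \<rho> y w))" (is "_ \<longleftrightarrow> ?att")
  proof
    assume l: "lebesgue_property M \<rho>"
    show ?att
    proof
      fix x assume "x \<in> Xinf"
      from lebesgue_imp_attained[OF l subset_refl this]
      obtain y where "y \<in> L1 M" "(AE w in M. y w \<le> 0) \<and> (AE w in M. cexp M F y w = -1) \<and>
        (AE w in M. ereal (\<rho> x w) = ereal (cpair x y w) - conj_fun M F Xinf \<rho> y w)" by (rule bexE)
      then show "\<exists>y\<in>X1. (AE w in M. y w \<le> 0) \<and> (AE w in M. cexp M F y w = -1) \<and>
        (AE w in M. ereal (\<rho> x w) = ereal (cpair x y w) - conj_fun M F Xinf \<rho> y w)"
        by (intro bexI[of _ y]) (auto intro: L1_in_X1)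
    qed
  next
    assume att: ?att
    show "lebesgue_property M \<rho>"
      by (rule attained_imp_lebesgue[OF Linf subset_refl]) (use att Linf in blast)
  qed
  ultimately show ?thesis by (intro conjI)
qed

end
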